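(* Let $A$ be a local ring with residue field $k$. Then $A$ is regular if and only if some syzygy module $\Omega_n^A(k)$ ($n\ge0$) of $k$ has a non-zero direct summand of finite injective dimension.
   Context: All rings are commutative Noetherian with identity. For $n\ge0$, $\Omega_n^A(k)$ denotes the $n$th syzygy module of $k$ in a minimal free resolution of $k$ over $A$, with $\Omega_0^A(k)=k$. Injective dimension is taken over $A$. *)

theory Defs
  imports "HOL-Algebra.Algebra" "HOL-Library.Extended_Nat"
begin

section \<open>Local rings and regularity\<close>

definition local_ring :: "('a, 'c) ring_scheme \<Rightarrow> bool" where
  "local_ring R \<longleftrightarrow> cring R \<and> (\<exists>!I. maximalideal I R)"

definition max_ideal :: "('a, 'c) ring_scheme \<Rightarrow> 'a set" where
  "max_ideal R = (THE I. maximalideal I R)"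

definition krull_dim :: "('a, 'c) ring_scheme \<Rightarrow> enat" where
  "krull_dim R =
     Sup {enat n | n. \<exists>P :: nat \<Rightarrow> 'a set.
            (\<forall>i\<le>n. primeideal (P i) R) \<and> (\<forall>i<n. P i \<subset> P (Suc i))}"

definition embedding_dim :: "('a, 'c) ring_scheme \<Rightarrow> nat" where
  "embedding_dim R =
     (LEAST n. \<exists>S \<subseteq> carrier R. finite S \<and> card S = n \<and> genideal R S = max_ideal R)"

definition regular_local_ring :: "('a, 'c) ring_scheme \<Rightarrow> bool" where
  "regular_local_ring R \<longleftrightarrow>
     noetherian_ring R \<and> local_ring R \<and> krull_dim R = enat (embedding_dim R)"


section \<open>Modules\<close>

text \<open>The fields \<open>mult\<close> and \<open>one\<close> of a module record carry no information.\<close>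

definition module_homs ::
    "('a, 'c) ring_scheme \<Rightarrow> ('a, 'm) module \<Rightarrow> ('a, 'n) module \<Rightarrow> ('m \<Rightarrow> 'n) set" where
  "module_homs R M N =
     {f \<in> carrier M \<rightarrow> carrier N.
        (\<forall>x\<in>carrier M. \<forall>y\<in>carrier M. f (x \<oplus>\<^bsub>M\<^esub> y) = f x \<oplus>\<^bsub>N\<^esub> f y) \<and>
        (\<forall>a\<in>carrier R. \<forall>x\<in>carrier M. f (a \<odot>\<^bsub>M\<^esub> x) = a \<odot>\<^bsub>N\<^esub> f x)}"

definition module_isomorphic ::
    "('a, 'c) ring_scheme \<Rightarrow> ('a, 'm) module \<Rightarrow> ('a, 'n) module \<Rightarrow> bool" where
  "module_isomorphic R M N \<longleftrightarrow>
     (\<exists>f\<in>module_homs R M N. bij_betw f (carrier M) (carrier N))"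

definition module_ker :: "('a, 'm) module \<Rightarrow> ('a, 'n) module \<Rightarrow> ('m \<Rightarrow> 'n) \<Rightarrow> 'm set" where
  "module_ker M N f = {x \<in> carrier M. f x = \<zero>\<^bsub>N\<^esub>}"

definition residue_field_module :: "('a, 'c) ring_scheme \<Rightarrow> ('a, 'a set) module" where
  "residue_field_module R =
     ring.extend (R Quot max_ideal R)
       (module.fields (\<lambda>a u. (max_ideal R +>\<^bsub>R\<^esub> a) \<otimes>\<^bsub>R Quot max_ideal R\<^esub> u))"

definition direct_summand :: "('a, 'c) ring_scheme \<Rightarrow> ('a, 'm) module \<Rightarrow> 'm set \<Rightarrow> bool" where
  "direct_summand R M N \<longleftrightarrow>
     submodule N R M \<and>
     (\<exists>C. submodule C R M \<and> N \<inter> C = {\<zero>\<^bsub>M\<^esub>} \<and> N <+>\<^bsub>M\<^esub> C = carrier M)"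

definition ideal_times :: "('a, 'c) ring_scheme \<Rightarrow> 'a set \<Rightarrow> ('a, 'm) module \<Rightarrow> 'm set" where
  "ideal_times R I M =
     \<Inter>{H. submodule H R M \<and> (\<forall>a\<in>I. \<forall>x\<in>carrier M. a \<odot>\<^bsub>M\<^esub> x \<in> H)}"

definition finite_free_module :: "('a, 'c) ring_scheme \<Rightarrow> ('a, 'm) module \<Rightarrow> bool" where
  "finite_free_module R F \<longleftrightarrow>
     module R F \<and>
     (\<exists>B \<subseteq> carrier F. finite B \<and>
        (\<forall>x\<in>carrier F. \<exists>!c. c \<in> B \<rightarrow>\<^sub>E carrier R \<and> x = (\<Oplus>\<^bsub>F\<^esub>b\<in>B. c b \<odot>\<^bsub>F\<^esub> b)))"


section \<open>Minimal free resolutions and syzygies\<close>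

text \<open>
  The resolution is \<open>\<cdots> \<rightarrow> F 2 \<rightarrow> F 1 \<rightarrow> F 0 \<rightarrow> M \<rightarrow> 0\<close>, with differentials
  \<open>d i : F (Suc i) \<rightarrow> F i\<close> and augmentation \<open>e : F 0 \<rightarrow> M\<close>. The finitely generated modules over
  a Noetherian local ring have minimal free resolutions by free modules of finite rank.
\<close>

definition minimal_free_resolution ::
    "('a, 'c) ring_scheme \<Rightarrow> ('a, 'm) module \<Rightarrow> (nat \<Rightarrow> ('a, 'm) module) \<Rightarrow>
     ('m \<Rightarrow> 'm) \<Rightarrow> (nat \<Rightarrow> 'm \<Rightarrow> 'm) \<Rightarrow> bool" where
  "minimal_free_resolution R M F e d \<longleftrightarrow>
     module R M \<and>
     (\<forall>i. finite_free_module R (F i)) \<and>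
     e \<in> module_homs R (F 0) M \<and>
     (\<forall>i. d i \<in> module_homs R (F (Suc i)) (F i)) \<and>
     e ` carrier (F 0) = carrier M \<and>
     d 0 ` carrier (F 1) = module_ker (F 0) M e \<and>
     (\<forall>i. d (Suc i) ` carrier (F (Suc (Suc i))) = module_ker (F (Suc i)) (F i) (d i)) \<and>
     (\<forall>i. d i ` carrier (F (Suc i)) \<subseteq> ideal_times R (max_ideal R) (F i))"

fun syzygy ::
    "('a, 'm) module \<Rightarrow> (nat \<Rightarrow> ('a, 'm) module) \<Rightarrow> (nat \<Rightarrow> 'm \<Rightarrow> 'm) \<Rightarrow> nat \<Rightarrow> ('a, 'm) module" where
  "syzygy M F d 0 = M"
| "syzygy M F d (Suc n) = (F n)\<lparr>carrier := d n ` carrier (F (Suc n))\<rparr>"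


section \<open>Injective modules and injective dimension\<close>

text \<open>
  A definition cannot quantify over the types of the test modules. Test modules with elements in
  the type of the ring suffice: the extension property for them implies the extension property
  for test modules of all types, which is \<open>injective_module_extends\<close> below (Baer).
\<close>

definition injective_module :: "('a, 'c) ring_scheme \<Rightarrow> ('a, 'e) module \<Rightarrow> bool" where
  "injective_module R E \<longleftrightarrow>
     module R E \<and>
     (\<forall>(N' :: ('a, 'a) module) (N :: ('a, 'a) module). module R N' \<longrightarrow> module R N \<longrightarrow>
        (\<forall>i\<in>module_homs R N' N. \<forall>f\<in>module_homs R N' E. inj_on i (carrier N') \<longrightarrow>
           (\<exists>g\<in>module_homs R N E. \<forall>x\<in>carrier N'. g (i x) = f x)))"

lemma module_homsD:
  assumes "f \<in> module_homs R M N"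
  shows "x \<in> carrier M \<Longrightarrow> f x \<in> carrier N"
    and "x \<in> carrier M \<Longrightarrow> y \<in> carrier M \<Longrightarrow> f (x \<oplus>\<^bsub>M\<^esub> y) = f x \<oplus>\<^bsub>N\<^esub> f y"
    and "a \<in> carrier R \<Longrightarrow> x \<in> carrier M \<Longrightarrow> f (a \<odot>\<^bsub>M\<^esub> x) = a \<odot>\<^bsub>N\<^esub> f x"
  using assms by (auto simp: module_homs_def)

lemma module_homs_zero:
  assumes "module R M" "module R N" "f \<in> module_homs R M N"
  shows "f \<zero>\<^bsub>M\<^esub> = \<zero>\<^bsub>N\<^esub>"
proof -
  interpret M: module R M by fact
  interpret N: module R N by fact
  have "f (\<zero>\<^bsub>R\<^esub> \<odot>\<^bsub>M\<^esub> \<zero>\<^bsub>M\<^esub>) = \<zero>\<^bsub>R\<^esub> \<odot>\<^bsub>N\<^esub> f \<zero>\<^bsub>M\<^esub>"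
    using module_homsD(3)[OF assms(3)] by blast
  then show ?thesis
    using module_homsD(1)[OF assms(3), of "\<zero>\<^bsub>M\<^esub>"] by simp
qed

definition ring_as_module :: "('a, 'c) ring_scheme \<Rightarrow> ('a, 'a) module" where
  "ring_as_module R = ring.extend (ring.truncate R) (module.fields (monoid.mult R))"

lemma ring_as_module_simps [simp]:
  "carrier (ring_as_module R) = carrier R"
  "ring.zero (ring_as_module R) = ring.zero R"
  "ring.add (ring_as_module R) = ring.add R"
  "module.smult (ring_as_module R) = monoid.mult R"
  by (simp_all add: ring_as_module_def ring.defs module.defs)

lemma module_ring_as_module:
  assumes "cring R"
  shows "module R (ring_as_module R)"
proof -
  interpret cring R by fact
  have "abelian_group (ring_as_module R)"
    by (intro abelian_groupI) (auto simp: a_ac intro: l_neg bexI[of _ "\<ominus>\<^bsub>R\<^esub> _"])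
  then show ?thesis
    by (intro moduleI) (auto simp: assms l_distr r_distr m_assoc)
qed

text \<open>An extension of \<open>f\<close> to a submodule is encoded by its graph.\<close>

theorem injective_module_extends:
  fixes E :: "('a, 'e) module" and N' :: "('a, 'p) module" and N :: "('a, 'q) module"
  assumes inj: "injective_module R E"
    and N': "module R N'" and N: "module R N"
    and i: "i \<in> module_homs R N' N" and f: "f \<in> module_homs R N' E"
    and inj_i: "inj_on i (carrier N')"
  shows "\<exists>g\<in>module_homs R N E. \<forall>x\<in>carrier N'. g (i x) = f x"
proof -
  have E: "module R E" using inj by (simp add: injective_module_def)
  interpret R: cring R using N by (rule module.axioms(1))
  interpret N': module R N' by fact
  interpret N: module R N by fact
  interpret E: module R E by fact
  note iD = module_homsD[OF i] and fD = module_homsD[OF f]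
  define closed where "closed G \<longleftrightarrow>
     (\<forall>x y x' y'. (x, y) \<in> G \<longrightarrow> (x', y') \<in> G \<longrightarrow> (x \<oplus>\<^bsub>N\<^esub> x', y \<oplus>\<^bsub>E\<^esub> y') \<in> G) \<and>
     (\<forall>a x y. a \<in> carrier R \<longrightarrow> (x, y) \<in> G \<longrightarrow> (a \<odot>\<^bsub>N\<^esub> x, a \<odot>\<^bsub>E\<^esub> y) \<in> G)"
    for G :: "('q \<times> 'e) set"
  define G0 where "G0 = (\<lambda>x. (i x, f x)) ` carrier N'"
  define P where "P = {G. G0 \<subseteq> G \<and> G \<subseteq> carrier N \<times> carrier E \<and> closed G \<and>
     (\<forall>y. (\<zero>\<^bsub>N\<^esub>, y) \<in> G \<longrightarrow> y = \<zero>\<^bsub>E\<^esub>)}"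
  have G0P: "G0 \<in> P"
  proof -
    have "closed G0"
      unfolding closed_def G0_def
    proof (intro conjI allI impI; elim imageE)
      fix x y x' y' u v
      assume "(x, y) = (i u, f u)" "u \<in> carrier N'" "(x', y') = (i v, f v)" "v \<in> carrier N'"
      then show "(x \<oplus>\<^bsub>N\<^esub> x', y \<oplus>\<^bsub>E\<^esub> y') \<in> (\<lambda>x. (i x, f x)) ` carrier N'"
        by (intro image_eqI[of _ _ "u \<oplus>\<^bsub>N'\<^esub> v"]) (auto simp: iD fD)
    next
      fix a x y u
      assume "a \<in> carrier R" "(x, y) = (i u, f u)" "u \<in> carrier N'"
      then show "(a \<odot>\<^bsub>N\<^esub> x, a \<odot>\<^bsub>E\<^esub> y) \<in> (\<lambda>x. (i x, f x)) ` carrier N'"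
        by (intro image_eqI[of _ _ "a \<odot>\<^bsub>N'\<^esub> u"]) (auto simp: iD fD)
    qed
    moreover have "y = \<zero>\<^bsub>E\<^esub>" if "(\<zero>\<^bsub>N\<^esub>, y) \<in> G0" for y
    proof -
      from that obtain u where u: "u \<in> carrier N'" "\<zero>\<^bsub>N\<^esub> = i u" "y = f u"
        by (auto simp: G0_def)
      then have "u = \<zero>\<^bsub>N'\<^esub>"
        using inj_i module_homs_zero[OF N' N i] by (auto simp: inj_on_def)
      then show ?thesis using u module_homs_zero[OF N' E f] by simp
    qed
    ultimately show ?thesis
      by (auto simp: P_def G0_def iD fD)
  qed
  have "\<exists>M\<in>P. \<forall>G\<in>P. M \<subseteq> G \<longrightarrow> G = M"
  proof (rule subset_Zorn_nonempty)
    show "P \<noteq> {}" using G0P by blast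
    fix C assume C: "C \<noteq> {}" "subset.chain P C"
    then have CP: "\<And>G. G \<in> C \<Longrightarrow> G \<in> P" and
      tot: "\<And>G H. G \<in> C \<Longrightarrow> H \<in> C \<Longrightarrow> G \<subseteq> H \<or> H \<subseteq> G"
      by (auto simp: subset_chain_def)
    have "closed (\<Union>C)"
      unfolding closed_def
    proof (intro conjI allI impI; elim UnionE)
      fix x y x' y' G H
      assume *: "(x, y) \<in> G" "G \<in> C" "(x', y') \<in> H" "H \<in> C"
      then obtain K where "K \<in> C" "(x, y) \<in> K" "(x', y') \<in> K" using tot by blast
      moreover from this have "closed K" using CP by (simp add: P_def)
      ultimately show "(x \<oplus>\<^bsub>N\<^esub> x', y \<oplus>\<^bsub>E\<^esub> y') \<in> \<Union>C"
        unfolding closed_def by blast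
    next
      fix a x y G
      assume *: "a \<in> carrier R" "(x, y) \<in> G" "G \<in> C"
      then have "closed G" using CP by (simp add: P_def)
      then show "(a \<odot>\<^bsub>N\<^esub> x, a \<odot>\<^bsub>E\<^esub> y) \<in> \<Union>C"
        using * unfolding closed_def by blast
    qed
    then show "\<Union>C \<in> P"
      using CP C(1) unfolding P_def by blast
  qed
  then obtain G where GP: "G \<in> P" and max: "\<And>H. H \<in> P \<Longrightarrow> G \<subseteq> H \<Longrightarrow> H = G" by blast
  have G0: "G0 \<subseteq> G" and Gsub: "G \<subseteq> carrier N \<times> carrier E" and Gcl: "closed G"
    and G_zero: "\<And>y. (\<zero>\<^bsub>N\<^esub>, y) \<in> G \<Longrightarrow> y = \<zero>\<^bsub>E\<^esub>"
    using GP by (auto simp: P_def)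
  have G_add: "(x \<oplus>\<^bsub>N\<^esub> x', y \<oplus>\<^bsub>E\<^esub> y') \<in> G" if "(x, y) \<in> G" "(x', y') \<in> G" for x y x' y'
    using Gcl that unfolding closed_def by blast
  have G_smult: "(a \<odot>\<^bsub>N\<^esub> x, a \<odot>\<^bsub>E\<^esub> y) \<in> G" if "a \<in> carrier R" "(x, y) \<in> G" for a x y
    using Gcl that unfolding closed_def by blast
  have G_carr: "x \<in> carrier N" "y \<in> carrier E" if "(x, y) \<in> G" for x y
    using Gsub that by auto
  have minus_N: "(\<ominus>\<^bsub>R\<^esub> \<one>\<^bsub>R\<^esub>) \<odot>\<^bsub>N\<^esub> x = \<ominus>\<^bsub>N\<^esub> x" if "x \<in> carrier N" for x
    using that N.smult_l_minus[of "\<one>\<^bsub>R\<^esub>" x] by simp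
  have minus_E: "(\<ominus>\<^bsub>R\<^esub> \<one>\<^bsub>R\<^esub>) \<odot>\<^bsub>E\<^esub> x = \<ominus>\<^bsub>E\<^esub> x" if "x \<in> carrier E" for x
    using that E.smult_l_minus[of "\<one>\<^bsub>R\<^esub>" x] by simp
  have G_minus: "(\<ominus>\<^bsub>N\<^esub> x, \<ominus>\<^bsub>E\<^esub> y) \<in> G" if "(x, y) \<in> G" for x y
    using G_smult[OF _ that, of "\<ominus>\<^bsub>R\<^esub> \<one>\<^bsub>R\<^esub>"] G_carr[OF that] by (simp add: minus_N minus_E)
  have G_fun: "y = y'" if "(x, y) \<in> G" "(x, y') \<in> G" for x y y'
  proof -
    have "(x \<oplus>\<^bsub>N\<^esub> \<ominus>\<^bsub>N\<^esub> x, y \<oplus>\<^bsub>E\<^esub> \<ominus>\<^bsub>E\<^esub> y') \<in> G"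
      using that by (intro G_add G_minus)
    then have "y \<oplus>\<^bsub>E\<^esub> \<ominus>\<^bsub>E\<^esub> y' = \<zero>\<^bsub>E\<^esub>"
      using G_zero G_carr[OF that(1)] by (simp add: N.M.r_neg)
    then show ?thesis
      using G_carr[OF that(1)] G_carr[OF that(2)] E.M.minus_equality[of y "\<ominus>\<^bsub>E\<^esub> y'"] by simp
  qed
  have G00: "(\<zero>\<^bsub>N\<^esub>, \<zero>\<^bsub>E\<^esub>) \<in> G"
    using G0 module_homs_zero[OF N' N i] module_homs_zero[OF N' E f]
    by (force simp: G0_def)
  have dom: "\<exists>y. (x, y) \<in> G" if x: "x \<in> carrier N" for x
  proof -
    define J where "J = {a \<in> carrier R. \<exists>y. (a \<odot>\<^bsub>N\<^esub> x, y) \<in> G}"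
    define p where "p a = (THE y. (a \<odot>\<^bsub>N\<^esub> x, y) \<in> G)" for a
    have p: "p a = y" if "(a \<odot>\<^bsub>N\<^esub> x, y) \<in> G" for a y
      unfolding p_def using that G_fun by blast
    have pG: "(a \<odot>\<^bsub>N\<^esub> x, p a) \<in> G" if "a \<in> J" for a
      using that p by (auto simp: J_def)
    let ?A = "ring_as_module R" and ?J = "(ring_as_module R)\<lparr>carrier := J\<rparr>"
    have A: "module R ?A"
      by (rule module_ring_as_module) (rule module.axioms(1)[OF N])
    interpret A: module R ?A by fact
    have addJ: "((a \<oplus>\<^bsub>R\<^esub> b) \<odot>\<^bsub>N\<^esub> x, p a \<oplus>\<^bsub>E\<^esub> p b) \<in> G" if "a \<in> J" "b \<in> J" for a b
      using G_add[OF pG[OF that(1)] pG[OF that(2)]] that x by (simp add: J_def N.smult_l_distr)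
    have mulJ: "((a \<otimes>\<^bsub>R\<^esub> b) \<odot>\<^bsub>N\<^esub> x, a \<odot>\<^bsub>E\<^esub> p b) \<in> G" if "a \<in> carrier R" "b \<in> J" for a b
      using G_smult[OF that(1) pG[OF that(2)]] that x by (simp add: J_def N.smult_assoc1)
    have "submodule J R ?A"
    proof (rule A.submoduleI)
      show "J \<subseteq> carrier ?A" by (auto simp: J_def)
      show "\<zero>\<^bsub>?A\<^esub> \<in> J" using G00 x by (auto simp: J_def)
      show sm: "a \<odot>\<^bsub>?A\<^esub> b \<in> J" if "a \<in> carrier R" "b \<in> J" for a b
        using mulJ[OF that] that by (auto simp: J_def)
      show "\<ominus>\<^bsub>?A\<^esub> a \<in> J" if "a \<in> J" for a
        using sm[OF _ that, of "\<ominus>\<^bsub>R\<^esub> \<one>\<^bsub>R\<^esub>"] that A.smult_l_minus[of "\<one>\<^bsub>R\<^esub>" a]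
        by (simp add: J_def)
      show "a \<oplus>\<^bsub>?A\<^esub> b \<in> J" if "a \<in> J" "b \<in> J" for a b
        using addJ[OF that] that by (auto simp: J_def)
    qed
    then have J: "module R ?J"
      using A by (rule submodule.submodule_is_module)
    have "id \<in> module_homs R ?J ?A" by (auto simp: module_homs_def J_def)
    moreover have "p \<in> module_homs R ?J E"
      using p[OF addJ] p[OF mulJ] G_carr(2)[OF pG] by (auto simp: module_homs_def)
    moreover have carrier_J: "carrier ?J = J" by simp
    ultimately obtain q where q: "q \<in> module_homs R ?A E" and qp: "\<And>a. a \<in> J \<Longrightarrow> q a = p a"
      using inj J A unfolding injective_module_def by (metis id_apply inj_on_id carrier_J)
    note qD = module_homsD[OF q, simplified]
    define z where "z = q \<one>\<^bsub>R\<^esub>"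
    have z: "z \<in> carrier E" by (simp add: z_def qD)
    have qz: "q a = a \<odot>\<^bsub>E\<^esub> z" if "a \<in> carrier R" for a
      using qD(3)[OF that R.one_closed] that by (simp add: z_def)
    define H where "H = {(u \<oplus>\<^bsub>N\<^esub> a \<odot>\<^bsub>N\<^esub> x, v \<oplus>\<^bsub>E\<^esub> a \<odot>\<^bsub>E\<^esub> z) | u v a. (u, v) \<in> G \<and> a \<in> carrier R}"
    have HI: "(s, t) \<in> H"
      if "(u, v) \<in> G" "a \<in> carrier R" "s = u \<oplus>\<^bsub>N\<^esub> a \<odot>\<^bsub>N\<^esub> x" "t = v \<oplus>\<^bsub>E\<^esub> a \<odot>\<^bsub>E\<^esub> z" for u v a s t
      using that unfolding H_def by blast
    have GH: "G \<subseteq> H"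
    proof clarify
      fix u v assume "(u, v) \<in> G"
      then show "(u, v) \<in> H"
        by (rule HI[OF _ R.zero_closed]) (use G_carr[OF \<open>(u, v) \<in> G\<close>] x z in simp_all)
    qed
    have "closed H"
      unfolding closed_def
    proof (intro conjI allI impI)
      fix s t s' t' assume "(s, t) \<in> H" "(s', t') \<in> H"
      then obtain u v a u' v' a' where *: "(u, v) \<in> G" "a \<in> carrier R" "(u', v') \<in> G" "a' \<in> carrier R"
        "s = u \<oplus>\<^bsub>N\<^esub> a \<odot>\<^bsub>N\<^esub> x" "t = v \<oplus>\<^bsub>E\<^esub> a \<odot>\<^bsub>E\<^esub> z"
        "s' = u' \<oplus>\<^bsub>N\<^esub> a' \<odot>\<^bsub>N\<^esub> x" "t' = v' \<oplus>\<^bsub>E\<^esub> a' \<odot>\<^bsub>E\<^esub> z"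
        unfolding H_def by blast
      note c = G_carr[OF *(1)] G_carr[OF *(3)]
      show "(s \<oplus>\<^bsub>N\<^esub> s', t \<oplus>\<^bsub>E\<^esub> t') \<in> H"
        by (rule HI[OF G_add[OF *(1,3)], of "a \<oplus>\<^bsub>R\<^esub> a'"])
          (use * c x z in \<open>simp_all add: N.smult_l_distr E.smult_l_distr N.M.a_ac E.M.a_ac\<close>)
    next
      fix b s t assume b: "b \<in> carrier R" and "(s, t) \<in> H"
      then obtain u v a where *: "(u, v) \<in> G" "a \<in> carrier R"
        "s = u \<oplus>\<^bsub>N\<^esub> a \<odot>\<^bsub>N\<^esub> x" "t = v \<oplus>\<^bsub>E\<^esub> a \<odot>\<^bsub>E\<^esub> z"
        unfolding H_def by blast
      note c = G_carr[OF *(1)]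
      show "(b \<odot>\<^bsub>N\<^esub> s, b \<odot>\<^bsub>E\<^esub> t) \<in> H"
        by (rule HI[OF G_smult[OF b *(1)], of "b \<otimes>\<^bsub>R\<^esub> a"])
          (use * b c x z in \<open>simp_all add: N.smult_r_distr E.smult_r_distr N.smult_assoc1 E.smult_assoc1\<close>)
    qed
    moreover have "t = \<zero>\<^bsub>E\<^esub>" if t: "(\<zero>\<^bsub>N\<^esub>, t) \<in> H" for t
    proof -
      obtain u v a where *: "(u, v) \<in> G" "a \<in> carrier R"
        "\<zero>\<^bsub>N\<^esub> = u \<oplus>\<^bsub>N\<^esub> a \<odot>\<^bsub>N\<^esub> x" "t = v \<oplus>\<^bsub>E\<^esub> a \<odot>\<^bsub>E\<^esub> z"
        using t unfolding H_def by blast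
      note c = G_carr[OF *(1)]
      have "\<ominus>\<^bsub>N\<^esub> u = a \<odot>\<^bsub>N\<^esub> x"
        using *(2,3) c(1) x N.M.minus_equality[of "a \<odot>\<^bsub>N\<^esub> x" u] by (simp add: N.M.a_comm)
      then have G': "(a \<odot>\<^bsub>N\<^esub> x, \<ominus>\<^bsub>E\<^esub> v) \<in> G" using G_minus[OF *(1)] by simp
      then have "a \<in> J" using * by (auto simp: J_def)
      then have "a \<odot>\<^bsub>E\<^esub> z = \<ominus>\<^bsub>E\<^esub> v"
        using qp qz[OF *(2)] p[OF G'] by simp
      then show ?thesis using * c by (simp add: E.M.r_neg)
    qed
    moreover have "H \<subseteq> carrier N \<times> carrier E"
      using x z by (auto simp: H_def dest: G_carr)
    ultimately have "H \<in> P" using G0 GH by (simp add: P_def)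
    then have "H = G" using max GH by blast
    moreover have "(x, z) \<in> H"
      by (rule HI[OF G00 R.one_closed]) (use x z in simp_all)
    ultimately show ?thesis by blast
  qed
  define g where "g x = (THE y. (x, y) \<in> G)" for x
  have g: "g x = y" if "(x, y) \<in> G" for x y
    unfolding g_def using that G_fun by blast
  have gG: "(x, g x) \<in> G" if "x \<in> carrier N" for x
    using dom[OF that] g by auto
  have "g \<in> module_homs R N E"
    unfolding module_homs_def
    using g[OF G_add[OF gG gG]] g[OF G_smult[OF _ gG]] G_carr(2)[OF gG] by auto
  moreover have "\<forall>x\<in>carrier N'. g (i x) = f x"
    using G0 g by (auto simp: G0_def)
  ultimately show ?thesis by blast
qed

text \<open>
  The resolution is \<open>0 \<rightarrow> M \<rightarrow> I 0 \<rightarrow> I 1 \<rightarrow> \<cdots>\<close>, with \<open>h : M \<rightarrow> I 0\<close> and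
  \<open>d j : I j \<rightarrow> I (Suc j)\<close>.
\<close>

definition injective_resolution ::
    "('a, 'c) ring_scheme \<Rightarrow> ('a, 'm) module \<Rightarrow> (nat \<Rightarrow> ('a, 'e) module) \<Rightarrow>
     ('m \<Rightarrow> 'e) \<Rightarrow> (nat \<Rightarrow> 'e \<Rightarrow> 'e) \<Rightarrow> bool" where
  "injective_resolution R M I h d \<longleftrightarrow>
     module R M \<and>
     (\<forall>j. injective_module R (I j)) \<and>
     h \<in> module_homs R M (I 0) \<and>
     (\<forall>j. d j \<in> module_homs R (I j) (I (Suc j))) \<and>
     inj_on h (carrier M) \<and>
     h ` carrier M = module_ker (I 0) (I 1) (d 0) \<and>
     (\<forall>j. d j ` carrier (I j) = module_ker (I (Suc j)) (I (Suc (Suc j))) (d (Suc j)))"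

text \<open>
  The element type of the modules \<open>I j\<close> has to be fixed. The type \<open>('a \<times> 'm \<times> nat) set\<close> is large
  enough to contain an isomorphic copy of some injective resolution of minimal length. Let \<open>\<kappa>\<close> be
  its cardinality. Then \<open>\<kappa> ^ |R| = \<kappa>\<close>. A module of cardinality at most \<open>\<kappa>\<close> lies in a divisible
  abelian group \<open>D\<close> of cardinality at most \<open>\<kappa>\<close>, hence it embeds into the injective module
  \<open>Hom\<^sub>\<int>(R, D)\<close>, of cardinality at most \<open>\<kappa>\<close>, and so does every cokernel that arises. By
  Schanuel's lemma such a resolution can be cut off at the injective dimension.
\<close>

type_synonym ('a, 'm) inj_carrier = "('a \<times> 'm \<times> nat) set"

definition inj_dim :: "('a, 'c) ring_scheme \<Rightarrow> ('a, 'm) module \<Rightarrow> enat" where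
  "inj_dim R M =
     Inf {enat n | n. \<exists>(I :: nat \<Rightarrow> ('a, ('a, 'm) inj_carrier) module) h d.
            injective_resolution R M I h d \<and> (\<forall>j>n. carrier (I j) = {\<zero>\<^bsub>I j\<^esub>})}"

end

theory Submission
  imports Defs "HOL-Library.Countable"
begin

text \<open>
  Let \<open>r\<close> be the embedding dimension of \<open>A\<close> and \<open>F\<close> the minimal resolution of \<open>k\<close>.

  If \<open>A\<close> is regular, then \<open>\<mm>\<close> is generated by a regular sequence of length \<open>r\<close>, so
  \<open>Tor\<^sub>i(k, k) = 0\<close> and \<open>F i = 0\<close> for \<open>i > r\<close>. With \<open>E\<close> the injective hull of \<open>k\<close>, which is found
  inside \<open>Hom\<^sub>\<int>(A, \<rat>/\<int>)\<close>, the complex \<open>Hom(F, E)\<close> is a finite injective resolution of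
  \<open>Hom(k, E) \<cong> k\<close>, so \<open>k\<close> itself is a summand as required.

  Conversely, let \<open>N \<noteq> 0\<close> be a summand of \<open>\<Omega>\<^sub>n(k)\<close>. The projection onto \<open>N\<close> is a cocycle
  \<open>F n \<rightarrow> N\<close> that is nonzero modulo \<open>\<mm> N\<close>. Homotopies for the multiplication by the generators of
  \<open>\<mm>\<close> and chain maps that represent \<open>Ext\<^sup>1(k, k)\<close> satisfy commutation relations modulo \<open>\<mm>\<close>, by
  which such a cocycle in a degree below \<open>r\<close> is carried to one in the next degree. Hence
  \<open>Ext\<^sup>i(k, N) \<noteq> 0\<close> for some \<open>i \<ge> r\<close>. If \<open>N\<close> has finite injective dimension, there is a largest such
  \<open>s\<close>. The cohomology of the complex \<open>Hom(F, A)\<close> is annihilated by \<open>\<mm>\<close>, and mapping this complex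
  into an injective resolution of \<open>N\<close> shows that it is exact in degrees below \<open>s\<close>. So
  \<open>Ext\<^sup>q(k, A) = 0\<close> for \<open>q < r\<close>, therefore \<open>\<mm>\<close> contains a regular sequence of length \<open>r\<close>, and
  the dimension of \<open>A\<close> is at least \<open>r\<close>.
\<close>

section \<open>Ideals of Noetherian rings\<close>

text \<open>Ext and Tor are never formed as objects: a vanishing statement is a lifting or extension
  property of homomorphisms, and each long exact sequence becomes one diagram chase. Images stand in
  for quotient modules, saturated submodules for localisations. The obstacle in the converse is to
  push non-vanishing up from degree n to degree r. A nonzero class is too weak a property to carry
  along; being nonzero modulo \<mm> N is stronger, since coboundaries lie in \<mm> N by minimality.
  If all r operators made a cocycle vanish modulo \<mm> N, the homotopies would show that it
  vanished before. That argument uses up one generator per degree, which is why it reaches degree r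
  and no further. Only the top degree of Ext(k, N) matters afterwards: paired with the lowest
  cohomology of Hom(F, A), a vector space over k, it leaves a class that nothing cancels. In the
  forward direction Q/Z is also chosen for its size: it is countable, so functions with values in it
  can be coded in the element type that \<open>inj_dim\<close> prescribes.\<close>

locale noetherian_cring = cring R + noetherian_ring R for R (structure)

text \<open>The annihilator of the class of \<open>g\<close> in R/J. Associated primes of R/J are
  handled through it, without the quotient ring.\<close>

definition colon :: "('a, 'c) ring_scheme \<Rightarrow> 'a set \<Rightarrow> 'a \<Rightarrow> 'a set" where
  "colon R J g = {a \<in> carrier R. a \<otimes>\<^bsub>R\<^esub> g \<in> J}"

lemma (in ring) ideal_closed:
  assumes "ideal J R"
  shows "a \<in> J \<Longrightarrow> a \<in> carrier R" "\<zero> \<in> J"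
    "a \<in> J \<Longrightarrow> b \<in> J \<Longrightarrow> a \<oplus> b \<in> J"
    "a \<in> J \<Longrightarrow> \<ominus> a \<in> J"
    "a \<in> J \<Longrightarrow> b \<in> J \<Longrightarrow> a \<ominus> b \<in> J"
    "a \<in> J \<Longrightarrow> x \<in> carrier R \<Longrightarrow> x \<otimes> a \<in> J"
    "a \<in> J \<Longrightarrow> x \<in> carrier R \<Longrightarrow> a \<otimes> x \<in> J"
proof -
  interpret ideal J R by fact
  show "a \<in> J \<Longrightarrow> a \<in> carrier R" "\<zero> \<in> J"
    "a \<in> J \<Longrightarrow> b \<in> J \<Longrightarrow> a \<oplus> b \<in> J"
    "a \<in> J \<Longrightarrow> \<ominus> a \<in> J"
    "a \<in> J \<Longrightarrow> x \<in> carrier R \<Longrightarrow> x \<otimes> a \<in> J"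
    "a \<in> J \<Longrightarrow> x \<in> carrier R \<Longrightarrow> a \<otimes> x \<in> J"
    by (auto simp: I_l_closed I_r_closed)
  then show "a \<in> J \<Longrightarrow> b \<in> J \<Longrightarrow> a \<ominus> b \<in> J"
    using a_closed a_inv_closed by (simp add: a_minus_def)
qed

lemma (in cring) ideal_intro:
  assumes "J \<subseteq> carrier R" "\<zero> \<in> J" "\<And>a b. a \<in> J \<Longrightarrow> b \<in> J \<Longrightarrow> a \<oplus> b \<in> J"
    and "\<And>a x. a \<in> J \<Longrightarrow> x \<in> carrier R \<Longrightarrow> x \<otimes> a \<in> J"
  shows "ideal J R"
proof (rule idealI[OF ring_axioms])
  have neg: "\<ominus> a \<in> J" if "a \<in> J" for a
  proof -
    have "\<ominus> a = (\<ominus> \<one>) \<otimes> a" using that assms(1) by (simp add: l_minus subset_iff)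
    then show ?thesis using assms(4)[OF that, of "\<ominus> \<one>"] by simp
  qed
  show "subgroup J (add_monoid R)"
    by (rule subgroup.intro) (use assms neg in \<open>auto simp: a_inv_def\<close>)
  show "x \<otimes> a \<in> J" "a \<otimes> x \<in> J" if "a \<in> J" "x \<in> carrier R" for a x
    using assms(1) assms(4)[OF that] that m_comm[of a x] by auto
qed

lemma (in ring) diff_mem_cancel:
  assumes "ideal J R" "a \<in> carrier R" "b \<in> J" "a \<ominus> b \<in> J"
  shows "a \<in> J"
proof -
  have "b \<in> carrier R" using ideal_closed(1)[OF assms(1,3)] .
  then have "(a \<ominus> b) \<oplus> b = a" using assms(2) by algebra
  then show ?thesis using ideal_closed(3)[OF assms(1,4,3)] by simp
qed

lemma (in ring) sum_mem_cancel:
  assumes "ideal J R" "a \<in> carrier R" "b \<in> J" "a \<oplus> b \<in> J"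
  shows "a \<in> J"
proof -
  have "b \<in> carrier R" using ideal_closed(1)[OF assms(1,3)] .
  then have "(a \<oplus> b) \<ominus> b = a" using assms(2) by algebra
  then show ?thesis using ideal_closed(5)[OF assms(1,4,3)] by simp
qed

lemma (in cring) ideal_colon:
  assumes J: "ideal J R" and g: "g \<in> carrier R"
  shows "ideal (colon R J g) R" "J \<subseteq> colon R J g"
  by (auto intro!: ideal_intro simp: colon_def g l_distr m_assoc ideal_closed[OF J])

lemma (in cring) ideal_add_gen:
  assumes J: "ideal J R" and g: "g \<in> carrier R"
  shows "ideal {b \<oplus> c \<otimes> g | b c. b \<in> J \<and> c \<in> carrier R} R" (is "ideal ?K R")
    and "J \<subseteq> {b \<oplus> c \<otimes> g | b c. b \<in> J \<and> c \<in> carrier R}"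
    and "g \<in> {b \<oplus> c \<otimes> g | b c. b \<in> J \<and> c \<in> carrier R}"
proof -
  note [simp] = ideal_closed[OF J] g
  show "ideal ?K R"
  proof (rule ideal_intro)
    show "\<zero> \<in> ?K" by (rule CollectI, rule exI[of _ \<zero>], rule exI[of _ \<zero>]) simp
    fix a assume "a \<in> ?K"
    then obtain u c where a: "a = u \<oplus> c \<otimes> g" "u \<in> J" "c \<in> carrier R" by blast
    { fix b assume "b \<in> ?K"
      then obtain v d where b: "b = v \<oplus> d \<otimes> g" "v \<in> J" "d \<in> carrier R" by blast
      have "u \<in> carrier R" "v \<in> carrier R" using a b by auto
      then have "a \<oplus> b = (u \<oplus> v) \<oplus> (c \<oplus> d) \<otimes> g"
        using a b g by algebra
      then show "a \<oplus> b \<in> ?K" using a b by (blast intro: ideal_closed(3)[OF J]) }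
    fix x assume x: "x \<in> carrier R"
    have "u \<in> carrier R" using a by auto
    then have "x \<otimes> a = x \<otimes> u \<oplus> (x \<otimes> c) \<otimes> g" using a x g by algebra
    then show "x \<otimes> a \<in> ?K" using a x by (blast intro: ideal_closed(6)[OF J])
  qed auto
  show "J \<subseteq> ?K"
  proof
    fix u assume "u \<in> J"
    then show "u \<in> ?K" by (intro CollectI exI[of _ u] exI[of _ \<zero>]) simp
  qed
  show "g \<in> ?K" by (intro CollectI exI[of _ \<zero>] exI[of _ \<one>]) simp
qed

text \<open>The union of a non-empty chain of ideals is a member of the chain, which gives Zorn's
  lemma its upper bounds inside an arbitrary family \<open>S\<close>.\<close>

lemma (in noetherian_cring) ideal_max:
  assumes "S \<noteq> {}" "\<And>I. I \<in> S \<Longrightarrow> ideal I R"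
  shows "\<exists>M\<in>S. \<forall>J\<in>S. M \<subseteq> J \<longrightarrow> J = M"
proof (rule subset_Zorn_nonempty[OF assms(1)])
  fix C assume "C \<noteq> {}" "subset.chain S C"
  moreover from this have "subset.chain {I. ideal I R} C"
    using assms(2) by (auto simp: pred_on.chain_def)
  ultimately show "\<Union> C \<in> S"
    using ideal_chain_is_trivial[of C] by (auto simp: pred_on.chain_def)
qed

lemma (in noetherian_cring) maximal_colon:
  assumes J: "ideal J R" and S: "S \<subseteq> carrier R - J" "S \<noteq> {}"
  shows "\<exists>g\<in>S. \<forall>h\<in>S. colon R J g \<subseteq> colon R J h \<longrightarrow> colon R J h = colon R J g"
proof -
  have "\<exists>M\<in>colon R J ` S. \<forall>K\<in>colon R J ` S. M \<subseteq> K \<longrightarrow> K = M"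
    by (rule ideal_max) (use S ideal_colon(1)[OF J] in auto)
  then show ?thesis by auto
qed

text \<open>If \<open>b\<close> does not kill \<open>g\<close> modulo \<open>J\<close>, the
  annihilator of \<open>b \<otimes> g\<close> is proper and at least as large as that of
  \<open>g\<close>, so by maximality they are equal. Whatever kills \<open>b \<otimes> g\<close>
  therefore kills \<open>g\<close>.\<close>

lemma (in cring) maximal_colon_prime:
  assumes J: "ideal J R" and g: "g \<in> carrier R - J"
    and max: "\<And>h. h \<in> carrier R - J \<Longrightarrow> colon R J g \<subseteq> colon R J h \<Longrightarrow> colon R J h = colon R J g"
  shows "primeideal (colon R J g) R"
proof (rule primeidealI)
  show "ideal (colon R J g) R" using ideal_colon(1)[OF J] g by auto
  show "carrier R \<noteq> colon R J g"
  proof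
    assume "carrier R = colon R J g"
    then have "\<one> \<in> colon R J g" using one_closed by blast
    then show False using g by (auto simp: colon_def)
  qed
  fix a b assume ab: "a \<in> carrier R" "b \<in> carrier R" "a \<otimes> b \<in> colon R J g"
  show "a \<in> colon R J g \<or> b \<in> colon R J g"
  proof (cases "b \<otimes> g \<in> J")
    case False
    have "colon R J g \<subseteq> colon R J (b \<otimes> g)"
    proof
      fix c assume c: "c \<in> colon R J g"
      then have "c \<otimes> (b \<otimes> g) = b \<otimes> (c \<otimes> g)" using ab g by (auto simp: colon_def m_ac)
      then show "c \<in> colon R J (b \<otimes> g)" using c ab ideal_closed[OF J] by (auto simp: colon_def)
    qed
    then have "colon R J (b \<otimes> g) = colon R J g" using max False ab g by auto
    moreover have "a \<in> colon R J (b \<otimes> g)" using ab g by (auto simp: colon_def m_assoc)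
    ultimately show ?thesis by simp
  qed (use ab in \<open>auto simp: colon_def\<close>)
qed (rule is_cring)

text \<open>The witness is maximal among the ideals above \<open>K\<close> that miss
  \<open>S\<close>. Adding an outside element makes it meet \<open>S\<close>; if two such elements
  had their product in the ideal, the product of the two meetings would lie in \<open>S\<close> and
  in the ideal.\<close>

lemma (in noetherian_cring) prime_avoiding:
  assumes K: "ideal K R" and S: "S \<subseteq> carrier R" "\<one> \<in> S" "\<And>s t. s \<in> S \<Longrightarrow> t \<in> S \<Longrightarrow> s \<otimes> t \<in> S"
    and disj: "K \<inter> S = {}"
  shows "\<exists>P. primeideal P R \<and> K \<subseteq> P \<and> P \<inter> S = {}"
proof -
  define \<I> where "\<I> = {I. ideal I R \<and> K \<subseteq> I \<and> I \<inter> S = {}}"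
  have "K \<in> \<I>" using K disj by (simp add: \<I>_def)
  then have "\<exists>P\<in>\<I>. \<forall>J\<in>\<I>. P \<subseteq> J \<longrightarrow> J = P"
    by (intro ideal_max) (auto simp: \<I>_def)
  then obtain P where P: "ideal P R" "K \<subseteq> P" "P \<inter> S = {}"
    and max: "\<And>J. ideal J R \<Longrightarrow> J \<inter> S = {} \<Longrightarrow> P \<subseteq> J \<Longrightarrow> J = P"
    unfolding \<I>_def by (smt (verit) mem_Collect_eq order.trans)
  have meet: "\<exists>u\<in>P. \<exists>c\<in>carrier R. u \<oplus> c \<otimes> a \<in> S" if "a \<in> carrier R" "a \<notin> P" for a
  proof -
    let ?K = "{u \<oplus> c \<otimes> a | u c. u \<in> P \<and> c \<in> carrier R}"
    have "?K \<noteq> P" using ideal_add_gen(3)[OF P(1) that(1)] that(2) by blast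
    then have "?K \<inter> S \<noteq> {}" using max[OF ideal_add_gen(1)[OF P(1) that(1)]] ideal_add_gen(2)[OF P(1) that(1)] by blast
    then show ?thesis by blast
  qed
  have "primeideal P R"
  proof (rule primeidealI[OF P(1) is_cring])
    show "carrier R \<noteq> P" using P(3) S(2) by auto
    fix a b assume ab: "a \<in> carrier R" "b \<in> carrier R" "a \<otimes> b \<in> P"
    show "a \<in> P \<or> b \<in> P"
    proof (rule ccontr)
      assume "\<not> ?thesis"
      then obtain u c v d where *: "u \<in> P" "c \<in> carrier R" "u \<oplus> c \<otimes> a \<in> S" "v \<in> P" "d \<in> carrier R" "v \<oplus> d \<otimes> b \<in> S"
        using meet ab by meson
      have uv: "u \<in> carrier R" "v \<in> carrier R" using * ideal_closed[OF P(1)] by auto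
      have "(u \<oplus> c \<otimes> a) \<otimes> (v \<oplus> d \<otimes> b) = (v \<oplus> d \<otimes> b) \<otimes> u \<oplus> ((c \<otimes> a) \<otimes> v \<oplus> (c \<otimes> d) \<otimes> (a \<otimes> b))"
        using uv ab * by algebra
      also have "\<dots> \<in> P" using uv ab * by (simp add: ideal_closed[OF P(1)])
      finally show False using S(3) * P(3) by blast
    qed
  qed
  then show ?thesis using P by blast
qed

lemma (in primeideal) prime_compl_mult:
  assumes "s \<in> carrier R - I" "t \<in> carrier R - I"
  shows "s \<otimes> t \<in> carrier R - I"
  using assms I_prime by auto

lemma (in primeideal) one_notin: "\<one> \<notin> I"
  using one_imp_carrier I_notcarr by blast

text \<open>The products of elements outside \<open>P\<close> with powers of \<open>x\<close> form a
  multiplicative set, and cancelling \<open>x\<close> modulo \<open>K\<close> shows that it misses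
  \<open>K\<close>. In this way each entry of a regular sequence yields one strict inclusion of
  primes.\<close>

lemma (in noetherian_cring) prime_below_avoiding:
  assumes K: "ideal K R" and P: "primeideal P R" and x: "x \<in> carrier R"
    and nzd: "\<And>a. a \<in> carrier R \<Longrightarrow> x \<otimes> a \<in> K \<Longrightarrow> a \<in> K" and KP: "K \<subseteq> P"
  shows "\<exists>Q. primeideal Q R \<and> K \<subseteq> Q \<and> Q \<subseteq> P \<and> x \<notin> Q"
proof -
  interpret P: primeideal P R by fact
  define S where "S = {s \<otimes> x [^] n | s (n::nat). s \<in> carrier R - P}"
  have pow: "a \<in> K" if "a \<in> carrier R" "a \<otimes> x [^] n \<in> K" for a and n::nat
    using that
  proof (induction n arbitrary: a)
    case (Suc n)
    have "x \<otimes> (a \<otimes> x [^] n) = a \<otimes> x [^] Suc n" using Suc.prems x by (simp add: m_ac)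
    then have "a \<otimes> x [^] n \<in> K" using nzd[of "a \<otimes> x [^] n"] Suc.prems x by simp
    then show ?case by (rule Suc.IH[OF Suc.prems(1)])
  qed simp
  have "\<exists>Q. primeideal Q R \<and> K \<subseteq> Q \<and> Q \<inter> S = {}"
  proof (rule prime_avoiding[OF K])
    show "S \<subseteq> carrier R" using x by (auto simp: S_def)
    have "\<one> = \<one> \<otimes> x [^] (0::nat)" by simp
    then show "\<one> \<in> S" unfolding S_def using P.one_notin by blast
    show "s \<otimes> t \<in> S" if st: "s \<in> S" "t \<in> S" for s t
    proof -
      obtain u n v m where *: "s = u \<otimes> x [^] (n::nat)" "u \<in> carrier R - P" "t = v \<otimes> x [^] (m::nat)" "v \<in> carrier R - P"
        using st unfolding S_def by blast
      have "s \<otimes> t = (u \<otimes> v) \<otimes> x [^] (n + m)"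
        using * x by (simp add: nat_pow_mult[symmetric] m_ac)
      then show ?thesis unfolding S_def using P.prime_compl_mult[OF *(2,4)] by blast
    qed
    show "K \<inter> S = {}"
    proof (rule ccontr)
      assume "K \<inter> S \<noteq> {}"
      then obtain s n where "s \<in> carrier R - P" "s \<otimes> x [^] (n::nat) \<in> K" unfolding S_def by blast
      then show False using pow KP by blast
    qed
  qed
  then obtain Q where Q: "primeideal Q R" "K \<subseteq> Q" "Q \<inter> S = {}" by blast
  interpret Q: primeideal Q R by fact
  have "Q \<subseteq> P"
  proof
    fix s assume "s \<in> Q"
    then have "s \<in> carrier R" "s = s \<otimes> x [^] (0::nat)" by auto
    then show "s \<in> P" using Q(3) \<open>s \<in> Q\<close> unfolding S_def by blast
  qed
  moreover have "x \<notin> Q"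
  proof -
    have "x = \<one> \<otimes> x [^] (1::nat)" using x by simp
    then have "x \<in> S" unfolding S_def using P.one_notin by blast
    then show ?thesis using Q(3) by blast
  qed
  ultimately show ?thesis using Q by blast
qed

section \<open>Local Nakayama lemma and Krull's principal ideal theorem\<close>

text \<open>For an ideal \<open>P\<close> and a submodule \<open>L\<close> this is L + P T,
  generated one summand at a time so that rule induction takes the place of finite sums. The usual
  span of \<open>T\<close> is the case of all scalars and the zero submodule.\<close>

inductive_set lspan :: "('a, 'm, 'z) module_scheme \<Rightarrow> 'a set \<Rightarrow> 'm set \<Rightarrow> 'm set \<Rightarrow> 'm set"
  for M P L T where
  base: "l \<in> L \<Longrightarrow> l \<in> lspan M P L T"
| step: "v \<in> lspan M P L T \<Longrightarrow> a \<in> P \<Longrightarrow> t \<in> T \<Longrightarrow> v \<oplus>\<^bsub>M\<^esub> a \<odot>\<^bsub>M\<^esub> t \<in> lspan M P L T"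

lemma lspan_mono:
  assumes "L \<subseteq> L'" "P \<subseteq> P'" "T \<subseteq> T'"
  shows "lspan M P L T \<subseteq> lspan M P' L' T'"
proof
  fix v assume "v \<in> lspan M P L T"
  then show "v \<in> lspan M P' L' T'"
    by induction (use assms in \<open>auto intro: lspan.intros\<close>)
qed

context module
begin

lemma submodule_mem:
  assumes "submodule L R M"
  shows "v \<in> L \<Longrightarrow> v \<in> carrier M" "\<zero>\<^bsub>M\<^esub> \<in> L"
    "v \<in> L \<Longrightarrow> w \<in> L \<Longrightarrow> v \<oplus>\<^bsub>M\<^esub> w \<in> L" "v \<in> L \<Longrightarrow> \<ominus>\<^bsub>M\<^esub> v \<in> L"
    "v \<in> L \<Longrightarrow> w \<in> L \<Longrightarrow> v \<ominus>\<^bsub>M\<^esub> w \<in> L"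
    "a \<in> carrier R \<Longrightarrow> v \<in> L \<Longrightarrow> a \<odot>\<^bsub>M\<^esub> v \<in> L"
proof -
  note E = submoduleE[OF assms]
  show "v \<in> L \<Longrightarrow> v \<in> carrier M" "v \<in> L \<Longrightarrow> w \<in> L \<Longrightarrow> v \<oplus>\<^bsub>M\<^esub> w \<in> L" "v \<in> L \<Longrightarrow> \<ominus>\<^bsub>M\<^esub> v \<in> L"
    "a \<in> carrier R \<Longrightarrow> v \<in> L \<Longrightarrow> a \<odot>\<^bsub>M\<^esub> v \<in> L"
    using E by auto
  then show "v \<in> L \<Longrightarrow> w \<in> L \<Longrightarrow> v \<ominus>\<^bsub>M\<^esub> w \<in> L" using E(3,5) by (simp add: a_minus_def)
  obtain u where "u \<in> L" using E(2) by auto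
  then show "\<zero>\<^bsub>M\<^esub> \<in> L" using E(4)[of \<zero> u] E(1) by auto
qed

lemma submodule_intro:
  assumes "H \<subseteq> carrier M" "\<zero>\<^bsub>M\<^esub> \<in> H" "\<And>a b. a \<in> H \<Longrightarrow> b \<in> H \<Longrightarrow> a \<oplus>\<^bsub>M\<^esub> b \<in> H"
    and "\<And>a x. a \<in> carrier R \<Longrightarrow> x \<in> H \<Longrightarrow> a \<odot>\<^bsub>M\<^esub> x \<in> H"
  shows "submodule H R M"
proof (rule submoduleI[OF assms(1,2) _ assms(3,4)])
  fix a assume a: "a \<in> H"
  then have "\<ominus>\<^bsub>M\<^esub> a = (\<ominus> \<one>) \<odot>\<^bsub>M\<^esub> a" using assms(1) smult_l_minus[of \<one> a] by auto
  then show "\<ominus>\<^bsub>M\<^esub> a \<in> H" using assms(4)[OF _ a, of "\<ominus> \<one>"] by simp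
qed

lemma diff_submodule_cancel:
  assumes "submodule L R M" "v \<in> carrier M" "w \<in> L" "v \<oplus>\<^bsub>M\<^esub> w \<in> L"
  shows "v \<in> L"
proof -
  have "v = (v \<oplus>\<^bsub>M\<^esub> w) \<ominus>\<^bsub>M\<^esub> w"
    using assms submodule_mem(1)[OF assms(1)] by (simp add: a_minus_def M.a_assoc M.r_neg)
  then show ?thesis using submodule_mem(5)[OF assms(1,4,3)] by simp
qed

lemma smult_diff_l:
  assumes "a \<in> carrier R" "b \<in> carrier R" "v \<in> carrier M"
  shows "(a \<ominus> b) \<odot>\<^bsub>M\<^esub> v = a \<odot>\<^bsub>M\<^esub> v \<ominus>\<^bsub>M\<^esub> b \<odot>\<^bsub>M\<^esub> v"
  using assms by (simp add: a_minus_def smult_l_distr smult_l_minus)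

lemma smult_diff_r:
  assumes "a \<in> carrier R" "v \<in> carrier M" "w \<in> carrier M"
  shows "a \<odot>\<^bsub>M\<^esub> (v \<ominus>\<^bsub>M\<^esub> w) = a \<odot>\<^bsub>M\<^esub> v \<ominus>\<^bsub>M\<^esub> a \<odot>\<^bsub>M\<^esub> w"
  using assms by (simp add: a_minus_def smult_r_distr smult_r_minus)

context
  fixes P L T
  assumes P: "ideal P R" and L: "submodule L R M" and T: "T \<subseteq> carrier M"
begin

lemma lspan_carrier: "v \<in> lspan M P L T \<Longrightarrow> v \<in> carrier M"
  by (induction rule: lspan.induct) (use T submodule_mem[OF L] R.ideal_closed[OF P] in auto)

lemma lspan_add:
  assumes "w \<in> lspan M P L T" "v \<in> lspan M P L T"
  shows "v \<oplus>\<^bsub>M\<^esub> w \<in> lspan M P L T"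
  using assms
proof (induction w arbitrary: v rule: lspan.induct)
  case (base l)
  from base(2) show ?case
  proof (induction v rule: lspan.induct)
    case (base l')
    then show ?case using \<open>l \<in> L\<close> by (auto intro!: lspan.base submodule_mem[OF L])
  next
    case (step v a t)
    have "v \<oplus>\<^bsub>M\<^esub> a \<odot>\<^bsub>M\<^esub> t \<oplus>\<^bsub>M\<^esub> l = v \<oplus>\<^bsub>M\<^esub> l \<oplus>\<^bsub>M\<^esub> a \<odot>\<^bsub>M\<^esub> t"
      using lspan_carrier[OF step(1)] step T submodule_mem(1)[OF L \<open>l \<in> L\<close>] R.ideal_closed[OF P]
      by (simp add: subset_iff M.a_ac)
    then show ?case using lspan.step[OF step(4,2,3)] by simp
  qed
next
  case (step w a t)
  have "v \<oplus>\<^bsub>M\<^esub> (w \<oplus>\<^bsub>M\<^esub> a \<odot>\<^bsub>M\<^esub> t) = v \<oplus>\<^bsub>M\<^esub> w \<oplus>\<^bsub>M\<^esub> a \<odot>\<^bsub>M\<^esub> t"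
    using lspan_carrier[OF step(1)] lspan_carrier[OF step(5)] step T R.ideal_closed[OF P]
    by (simp add: subset_iff M.a_ac)
  then show ?case using lspan.step[OF step(4)[OF step(5)] step(2,3)] by simp
qed

lemma lspan_smult:
  assumes "w \<in> lspan M P L T" "r \<in> carrier R"
  shows "r \<odot>\<^bsub>M\<^esub> w \<in> lspan M P L T"
  using assms
proof (induction w rule: lspan.induct)
  case (base l)
  then show ?case by (auto intro!: lspan.base submodule_mem[OF L])
next
  case (step w a t)
  have "r \<odot>\<^bsub>M\<^esub> (w \<oplus>\<^bsub>M\<^esub> a \<odot>\<^bsub>M\<^esub> t) = r \<odot>\<^bsub>M\<^esub> w \<oplus>\<^bsub>M\<^esub> (r \<otimes> a) \<odot>\<^bsub>M\<^esub> t"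
    using lspan_carrier[OF step(1)] step T R.ideal_closed[OF P]
    by (simp add: subset_iff smult_r_distr smult_assoc1)
  then show ?case using lspan.step[OF step(4)[OF step(5)] _ step(3)] R.ideal_closed(6)[OF P step(2,5)] by simp
qed

lemma lspan_submodule: "submodule (lspan M P L T) R M"
  by (rule submodule_intro) (auto intro: lspan_carrier lspan_add lspan_smult lspan.base submodule_mem[OF L])

lemma lspan_gen:
  assumes "a \<in> P" "t \<in> T"
  shows "a \<odot>\<^bsub>M\<^esub> t \<in> lspan M P L T"
proof -
  have "\<zero>\<^bsub>M\<^esub> \<oplus>\<^bsub>M\<^esub> a \<odot>\<^bsub>M\<^esub> t \<in> lspan M P L T"
    by (rule lspan.step[OF lspan.base]) (use assms submodule_mem[OF L] in auto)
  then show ?thesis using assms T R.ideal_closed(1)[OF P] by (simp add: subset_iff)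
qed

text \<open>All multiples of \<open>t\<close> are collected in a single coefficient. This is what
  lets Nakayama's lemma remove one generator at a time.\<close>

lemma lspan_insert:
  assumes t: "t \<in> carrier M" and v: "v \<in> lspan M P L (insert t T)"
  shows "\<exists>c\<in>P. \<exists>w\<in>lspan M P L T. v = w \<oplus>\<^bsub>M\<^esub> c \<odot>\<^bsub>M\<^esub> t"
  using v
proof (induction v rule: lspan.induct)
  case (base l)
  then show ?case
    using t submodule_mem(1)[OF L] by (intro bexI[of _ \<zero>] bexI[of _ l]) (auto intro: lspan.base R.ideal_closed[OF P])
next
  case (step v a u)
  then obtain c w where cw: "c \<in> P" "w \<in> lspan M P L T" "v = w \<oplus>\<^bsub>M\<^esub> c \<odot>\<^bsub>M\<^esub> t" by blast
  have carr: "c \<in> carrier R" "a \<in> carrier R" "w \<in> carrier M"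
    using cw step R.ideal_closed[OF P] lspan_carrier by auto
  show ?case
  proof (cases "u = t")
    case True
    then have "v \<oplus>\<^bsub>M\<^esub> a \<odot>\<^bsub>M\<^esub> u = w \<oplus>\<^bsub>M\<^esub> (c \<oplus> a) \<odot>\<^bsub>M\<^esub> t"
      using carr t cw by (simp add: smult_l_distr M.a_ac)
    then show ?thesis using cw step R.ideal_closed(3)[OF P] by blast
  next
    case False
    then have u: "u \<in> T" using step by simp
    then have "v \<oplus>\<^bsub>M\<^esub> a \<odot>\<^bsub>M\<^esub> u = (w \<oplus>\<^bsub>M\<^esub> a \<odot>\<^bsub>M\<^esub> u) \<oplus>\<^bsub>M\<^esub> c \<odot>\<^bsub>M\<^esub> t"
      using carr t cw T by (simp add: subset_iff M.a_ac)
    then show ?thesis using cw lspan.step[OF cw(2) step(2) u] by blast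
  qed
qed

end

lemma lspan_minimal:
  assumes "submodule H R M" "L \<subseteq> H" "T \<subseteq> H" "P \<subseteq> carrier R"
  shows "lspan M P L T \<subseteq> H"
proof
  fix v assume "v \<in> lspan M P L T"
  then show "v \<in> H"
    by induction (use assms submodule_mem[OF assms(1)] in \<open>auto simp: subset_iff\<close>)
qed

lemma zero_submodule: "submodule {\<zero>\<^bsub>M\<^esub>} R M"
  by (rule submodule_intro) auto

text \<open>Multiplication by an element of \<open>P\<close> moves every coefficient into
  \<open>P\<close>. It converts "x times an element of the span" into the form that Nakayama's lemma
  asks for.\<close>

lemma lspan_scale:
  assumes P: "ideal P R" and T: "T \<subseteq> carrier M" and x: "x \<in> P"
    and v: "v \<in> lspan M (carrier R) {\<zero>\<^bsub>M\<^esub>} T"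
  shows "x \<odot>\<^bsub>M\<^esub> v \<in> lspan M P {\<zero>\<^bsub>M\<^esub>} T"
  using v
proof (induction v rule: lspan.induct)
  case (base l)
  then show ?case using x R.ideal_closed[OF P] by (auto intro: lspan.base)
next
  case (step v a t)
  have xc: "x \<in> carrier R" using x R.ideal_closed[OF P] by simp
  have "x \<odot>\<^bsub>M\<^esub> (v \<oplus>\<^bsub>M\<^esub> a \<odot>\<^bsub>M\<^esub> t) = x \<odot>\<^bsub>M\<^esub> v \<oplus>\<^bsub>M\<^esub> (x \<otimes> a) \<odot>\<^bsub>M\<^esub> t"
    using lspan_carrier[OF R.oneideal zero_submodule T step(1)] step T xc
    by (simp add: subset_iff smult_r_distr smult_assoc1)
  then show ?case using lspan.step[OF step(4) _ step(3)] R.ideal_closed(7)[OF P x step(2)] by simp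
qed

text \<open>Localising at \<open>P\<close> is avoided by working with submodules that are saturated with respect to
  the complement of \<open>P\<close>.\<close>

lemma local_nakayama:
  assumes P: "primeideal P R" and L: "submodule L R M"
    and sat: "\<And>s v. s \<in> carrier R - P \<Longrightarrow> v \<in> carrier M \<Longrightarrow> s \<odot>\<^bsub>M\<^esub> v \<in> L \<Longrightarrow> v \<in> L"
    and T: "finite T" "T \<subseteq> carrier M"
    and gen: "\<And>t. t \<in> T \<Longrightarrow> \<exists>s\<in>carrier R - P. s \<odot>\<^bsub>M\<^esub> t \<in> lspan M P L T"
  shows "T \<subseteq> L"
  using T gen
proof (induction T rule: finite_induct)
  case (insert t T)
  interpret P: primeideal P R by fact
  have Pi: "ideal P R" by (rule P.is_ideal)
  have t: "t \<in> carrier M" and T: "T \<subseteq> carrier M" using insert.prems by auto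
  obtain s where s: "s \<in> carrier R - P" "s \<odot>\<^bsub>M\<^esub> t \<in> lspan M P L (insert t T)"
    using insert.prems(2)[of t] by auto
  obtain c w where cw: "c \<in> P" "w \<in> lspan M P L T" "s \<odot>\<^bsub>M\<^esub> t = w \<oplus>\<^bsub>M\<^esub> c \<odot>\<^bsub>M\<^esub> t"
    using lspan_insert[OF Pi L T t s(2)] by blast
  have cR: "c \<in> carrier R" and wM: "w \<in> carrier M"
    using cw R.ideal_closed(1)[OF Pi] lspan_carrier[OF Pi L T] by auto
  \<comment> \<open>Moving the \<open>t\<close>-term to the left leaves the coefficient
    \<open>s - c\<close>, which is outside \<open>P\<close> because \<open>c\<close> is inside and
    \<open>s\<close> is not.\<close>
  define s' where "s' = s \<ominus> c"
  have s'R: "s' \<in> carrier R" using s cR by (simp add: s'_def)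
  have s': "s' \<in> carrier R - P"
    using s s'R cw R.diff_mem_cancel[OF Pi, of s c] by (auto simp: s'_def)
  have s't: "s' \<odot>\<^bsub>M\<^esub> t = w"
  proof -
    have "s' \<odot>\<^bsub>M\<^esub> t = s \<odot>\<^bsub>M\<^esub> t \<ominus>\<^bsub>M\<^esub> c \<odot>\<^bsub>M\<^esub> t"
      unfolding s'_def using s cR t by (intro smult_diff_l) auto
    then show ?thesis using cR wM t by (simp add: cw(3) a_minus_def M.a_assoc M.r_neg)
  qed
  have "T \<subseteq> L"
  proof (rule insert.IH[OF T])
    fix u assume u: "u \<in> T"
    then obtain r where r: "r \<in> carrier R - P" "r \<odot>\<^bsub>M\<^esub> u \<in> lspan M P L (insert t T)"
      using insert.prems(2)[of u] by auto
    obtain c' w' where cw': "c' \<in> P" "w' \<in> lspan M P L T" "r \<odot>\<^bsub>M\<^esub> u = w' \<oplus>\<^bsub>M\<^esub> c' \<odot>\<^bsub>M\<^esub> t"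
      using lspan_insert[OF Pi L T t r(2)] by blast
    have carr: "c' \<in> carrier R" "w' \<in> carrier M" "u \<in> carrier M" "r \<in> carrier R"
      using cw' R.ideal_closed(1)[OF Pi] lspan_carrier[OF Pi L T] u T r by auto
    \<comment> \<open>Multiplying the relation for \<open>u\<close> by \<open>s'\<close> replaces
      the multiple of \<open>t\<close> by a multiple of \<open>w\<close>, which no longer involves
      \<open>t\<close>. The product of the two denominators stays outside the prime
      \<open>P\<close>.\<close>
    have "(s' \<otimes> r) \<odot>\<^bsub>M\<^esub> u = s' \<odot>\<^bsub>M\<^esub> w' \<oplus>\<^bsub>M\<^esub> (c' \<otimes> s') \<odot>\<^bsub>M\<^esub> t"
      using carr s'R t cw'(3) by (simp add: smult_assoc1 smult_r_distr R.m_comm[of c'])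
    also have "\<dots> = s' \<odot>\<^bsub>M\<^esub> w' \<oplus>\<^bsub>M\<^esub> c' \<odot>\<^bsub>M\<^esub> w"
      using carr s'R t s't by (simp add: smult_assoc1)
    also have "\<dots> \<in> lspan M P L T"
      by (intro lspan_add[OF Pi L T] lspan_smult[OF Pi L T] cw cw' s'R carr)
    finally show "\<exists>s\<in>carrier R - P. s \<odot>\<^bsub>M\<^esub> u \<in> lspan M P L T"
      using P.prime_compl_mult[OF s' r(1)] by blast
  qed
  moreover from this have "lspan M P L T \<subseteq> L"
    by (intro lspan_minimal[OF L]) (use R.ideal_closed(1)[OF Pi] in auto)
  then have "t \<in> L" using sat[OF s' t] s't cw by auto
  ultimately show ?case by simp
qed simp

end

lemma (in cring) genideal_lspan:
  assumes S: "S \<subseteq> carrier R"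
  shows "Idl S = lspan (ring_as_module R) (carrier R) {\<zero>} S"
proof -
  interpret A: module R "ring_as_module R" by (rule module_ring_as_module) (rule is_cring)
  let ?L = "lspan (ring_as_module R) (carrier R) {\<zero>} S"
  have z: "submodule {\<zero>} R (ring_as_module R)" using A.zero_submodule by simp
  have L: "submodule ?L R (ring_as_module R)"
    by (rule A.lspan_submodule[OF oneideal z]) (use S in simp)
  note m = A.submodule_mem[OF L, simplified]
  have "ideal ?L R" by (rule ideal_intro) (use m in auto)
  moreover have "S \<subseteq> ?L"
  proof
    fix t assume t: "t \<in> S"
    then show "t \<in> ?L" using A.lspan_gen[OF oneideal z, of S \<one> t] subsetD[OF S t] S by simp
  qed
  ultimately have "Idl S \<subseteq> ?L" by (rule genideal_minimal)
  moreover have "?L \<subseteq> Idl S"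
  proof
    fix v assume "v \<in> ?L"
    then show "v \<in> Idl S"
      by induction (use ideal_closed[OF genideal_ideal[OF S]] genideal_self[OF S] in auto)
  qed
  ultimately show ?thesis by blast
qed

section \<open>Saturated ideals and Krull's principal ideal theorem\<close>

definition add_gen :: "('a, 'c) ring_scheme \<Rightarrow> 'a set \<Rightarrow> 'a \<Rightarrow> 'a set" where
  "add_gen R J g = {b \<oplus>\<^bsub>R\<^esub> c \<otimes>\<^bsub>R\<^esub> g | b c. b \<in> J \<and> c \<in> carrier R}"

text \<open>The preimage in \<open>R\<close> of the extension of \<open>J\<close> to the
  localisation at \<open>P\<close>.\<close>

definition saturation :: "('a, 'c) ring_scheme \<Rightarrow> 'a set \<Rightarrow> 'a set \<Rightarrow> 'a set" where
  "saturation R P J = {a \<in> carrier R. \<exists>s\<in>carrier R - P. s \<otimes>\<^bsub>R\<^esub> a \<in> J}"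

lemma (in cring) add_gen:
  assumes "ideal J R" "g \<in> carrier R"
  shows "ideal (add_gen R J g) R" "J \<subseteq> add_gen R J g" "g \<in> add_gen R J g"
  unfolding add_gen_def by (rule ideal_add_gen[OF assms])+

lemma (in cring) add_gen_minimal:
  assumes "ideal I R" "J \<subseteq> I" "g \<in> I"
  shows "add_gen R J g \<subseteq> I"
  unfolding add_gen_def using assms(2,3) ideal_closed[OF assms(1)] by auto

lemma (in cring) saturation:
  assumes P: "primeideal P R" and J: "ideal J R"
  shows "ideal (saturation R P J) R" "J \<subseteq> saturation R P J"
    "s \<in> carrier R - P \<Longrightarrow> a \<in> carrier R \<Longrightarrow> s \<otimes> a \<in> saturation R P J \<Longrightarrow> a \<in> saturation R P J"
proof -
  interpret P: primeideal P R by fact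
  note j = ideal_closed[OF J]
  show "ideal (saturation R P J) R"
  proof (rule ideal_intro)
    show "\<zero> \<in> saturation R P J" using j P.one_notin by (auto simp: saturation_def intro!: bexI[of _ \<one>])
    fix a assume "a \<in> saturation R P J"
    then obtain s where s: "a \<in> carrier R" "s \<in> carrier R - P" "s \<otimes> a \<in> J" by (auto simp: saturation_def)
    { fix b assume "b \<in> saturation R P J"
      then obtain t where t: "b \<in> carrier R" "t \<in> carrier R - P" "t \<otimes> b \<in> J" by (auto simp: saturation_def)
      have "(s \<otimes> t) \<otimes> (a \<oplus> b) = t \<otimes> (s \<otimes> a) \<oplus> s \<otimes> (t \<otimes> b)"
        using s t by (simp add: r_distr m_ac)
      also have "\<dots> \<in> J" using s t by (simp add: j)
      finally show "a \<oplus> b \<in> saturation R P J"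
        using P.prime_compl_mult[OF s(2) t(2)] s t by (auto simp: saturation_def) }
    fix x assume x: "x \<in> carrier R"
    have "s \<otimes> (x \<otimes> a) = x \<otimes> (s \<otimes> a)" using s x by (simp add: m_ac)
    then have "s \<otimes> (x \<otimes> a) \<in> J" using s x by (simp add: j)
    then show "x \<otimes> a \<in> saturation R P J" using s x by (auto simp: saturation_def)
  qed (auto simp: saturation_def)
  show "J \<subseteq> saturation R P J"
    using j P.one_notin by (auto simp: saturation_def intro!: bexI[of _ \<one>])
  assume s: "s \<in> carrier R - P" "a \<in> carrier R" "s \<otimes> a \<in> saturation R P J"
  then obtain t where t: "t \<in> carrier R - P" "t \<otimes> (s \<otimes> a) \<in> J" by (auto simp: saturation_def)
  then have "(t \<otimes> s) \<otimes> a \<in> J" using s by (simp add: m_assoc)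
  then show "a \<in> saturation R P J"
    using P.prime_compl_mult[OF t(1) s(1)] s(2) by (auto simp: saturation_def)
qed

lemma saturation_mono: "J \<subseteq> J' \<Longrightarrow> saturation R P J \<subseteq> saturation R P J'"
  by (auto simp: saturation_def)

lemma add_gen_mono: "J \<subseteq> J' \<Longrightarrow> add_gen R J g \<subseteq> add_gen R J' g"
  by (auto simp: add_gen_def)

text \<open>The localisation of \<open>R/K\<close> at \<open>P\<close> has only one prime ideal, so it is Artinian.\<close>

lemma (in noetherian_cring) saturated_chain_stops:
  assumes P: "primeideal P R" and K: "ideal K R"
    and only: "\<And>P'. primeideal P' R \<Longrightarrow> K \<subseteq> P' \<Longrightarrow> P' \<subseteq> P \<Longrightarrow> P' = P"
    and I: "\<And>n::nat. ideal (I n) R" "\<And>n. K \<subseteq> I n" "\<And>n. I (Suc n) \<subseteq> I n"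
    and sat: "\<And>n s a. s \<in> carrier R - P \<Longrightarrow> a \<in> carrier R \<Longrightarrow> s \<otimes> a \<in> I n \<Longrightarrow> a \<in> I n"
  shows "\<exists>n. I n \<subseteq> I (Suc n)"
proof -
  interpret P: primeideal P R by fact
  note i = ideal_closed[OF I(1)]
  have dec: "I n \<subseteq> I m" if "m \<le> n" for m n
    using lift_Suc_antimono_le[of I m n] I(3) that by auto
  \<comment> \<open>Noetherian induction: the chain becomes stationary inside \<open>K\<close>,
    which lies in all its members. A largest ideal inside which it becomes stationary is shown to be
    the unit ideal.\<close>
  define stab where "stab J \<longleftrightarrow> (\<exists>m. \<forall>n\<ge>m. I m \<inter> J \<subseteq> I n)" for J
  define \<J> where "\<J> = {J. ideal J R \<and> K \<subseteq> J \<and> stab J}"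
  have "K \<in> \<J>" using K I(2) by (auto simp: \<J>_def stab_def)
  then have "\<exists>J\<in>\<J>. \<forall>J'\<in>\<J>. J \<subseteq> J' \<longrightarrow> J' = J"
    by (intro ideal_max) (auto simp: \<J>_def)
  then obtain J where "J \<in> \<J>" and max': "\<forall>J'\<in>\<J>. J \<subseteq> J' \<longrightarrow> J' = J" by blast
  then have J: "ideal J R" "K \<subseteq> J" and "stab J"
    and max: "\<And>J'. ideal J' R \<Longrightarrow> stab J' \<Longrightarrow> J \<subseteq> J' \<Longrightarrow> J' = J"
    unfolding \<J>_def by auto
  then obtain m where m: "\<And>n. n \<ge> m \<Longrightarrow> I m \<inter> J \<subseteq> I n" by (auto simp: stab_def)
  note j = ideal_closed[OF J(1)]
  \<comment> \<open>The members of the chain are themselves saturated, so an element enters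
    \<open>I n\<close> as soon as a multiple by a denominator does.\<close>
  have "stab (saturation R P J)"
    unfolding stab_def
  proof (intro exI[of _ m] allI impI subsetI)
    fix n u assume n: "n \<ge> m" and u: "u \<in> I m \<inter> saturation R P J"
    then obtain s where s: "u \<in> carrier R" "s \<in> carrier R - P" "s \<otimes> u \<in> J" by (auto simp: saturation_def)
    then have "s \<otimes> u \<in> I m \<inter> J" using u i by auto
    then show "u \<in> I n" using m[OF n] sat[OF s(2,1)] by auto
  qed
  then have satJ: "saturation R P J = J"
    using max saturation[OF P J(1)] by blast
  have "\<one> \<in> J"
  proof (rule ccontr)
    assume one: "\<one> \<notin> J"
    then obtain g where g: "g \<in> carrier R - J"
      and gmax: "\<And>h. h \<in> carrier R - J \<Longrightarrow> colon R J g \<subseteq> colon R J h \<Longrightarrow> colon R J h = colon R J g"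
      using maximal_colon[OF J(1), of "carrier R - J"] by blast
    have gR: "g \<in> carrier R" using g by simp
    \<comment> \<open>As \<open>J\<close> is saturated, no element outside \<open>P\<close> can
      carry \<open>g\<close> into \<open>J\<close>. The annihilator is then a prime between
      \<open>K\<close> and \<open>P\<close>, and only \<open>P\<close> is left.\<close>
    have "colon R J g \<subseteq> P"
      using g saturation(3)[OF P J(1), of _ g] satJ saturation(2)[OF P J(1)]
      by (auto simp: colon_def)
    moreover have "K \<subseteq> colon R J g" using ideal_colon(2)[OF J(1) gR] J(2) by blast
    ultimately have colP: "colon R J g = P"
      using only[OF maximal_colon_prime[OF J(1) g gmax]] by blast
    \<comment> \<open>Modulo \<open>J\<close> the new ideal is, locally at \<open>P\<close>, a line
      over the residue field of \<open>P\<close>. Either some member of the chain meets this line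
      only in zero, or every member contains an element whose coefficient at \<open>g\<close> is
      outside \<open>P\<close>; subtracting a multiple of the latter reduces to
      \<open>J\<close>.\<close>
    have "stab (add_gen R J g)"
    proof (cases "\<exists>l\<ge>m. I l \<inter> add_gen R J g \<subseteq> J")
      case True
      then obtain l where l: "l \<ge> m" "I l \<inter> add_gen R J g \<subseteq> J" by blast
      show ?thesis unfolding stab_def
      proof (intro exI[of _ l] allI impI subsetI)
        fix n u assume "n \<ge> l" "u \<in> I l \<inter> add_gen R J g"
        then show "u \<in> I n" using l m[of n] dec[of m l] by auto
      qed
    next
      case False
      show ?thesis unfolding stab_def
      proof (intro exI[of _ m] allI impI subsetI)
        fix n u assume n: "n \<ge> m" and u: "u \<in> I m \<inter> add_gen R J g"
        then obtain j1 b where u': "u = j1 \<oplus> b \<otimes> g" "j1 \<in> J" "b \<in> carrier R" by (auto simp: add_gen_def)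
        obtain v where v: "v \<in> I n" "v \<in> add_gen R J g" "v \<notin> J" using False n by blast
        then obtain j2 b' where v': "v = j2 \<oplus> b' \<otimes> g" "j2 \<in> J" "b' \<in> carrier R" by (auto simp: add_gen_def)
        have b': "b' \<in> carrier R - P"
        proof -
          have "b' \<otimes> g \<notin> J" using v(3) v' j(3) by blast
          then show ?thesis using colP v'(3) by (auto simp: colon_def)
        qed
        have carr: "j1 \<in> carrier R" "j2 \<in> carrier R" "u \<in> carrier R" "v \<in> carrier R"
          using u u' v v' i j by auto
        have "b' \<otimes> u \<ominus> b \<otimes> v = b' \<otimes> j1 \<ominus> b \<otimes> j2"
          unfolding u'(1) v'(1) using carr u' v' gR by algebra
        also have "\<dots> \<in> J" using u' v' by (simp add: j)
        finally have wJ: "b' \<otimes> u \<ominus> b \<otimes> v \<in> J" .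
        have "v \<in> I m" using v(1) dec[OF n] by blast
        then have "b' \<otimes> u \<ominus> b \<otimes> v \<in> I m" using u u'(3) v'(3) by (simp add: i)
        then have "b' \<otimes> u \<ominus> b \<otimes> v \<in> I n" using wJ m[OF n] by blast
        then have "b' \<otimes> u \<in> I n"
          using diff_mem_cancel[OF I(1), of "b' \<otimes> u" "b \<otimes> v" n] v(1) carr u'(3) v'(3) by (simp add: i)
        then show "u \<in> I n" using sat[OF b' carr(3)] by simp
      qed
    qed
    then have "add_gen R J g = J" using max add_gen[OF J(1) gR] by blast
    then show False using add_gen(3)[OF J(1) gR] g by simp
  qed
  then have "J = carrier R" using ideal.one_imp_carrier[OF J(1)] by simp
  then have "I m \<subseteq> I (Suc m)" using m[of "Suc m"] i(1) by auto
  then show ?thesis by blast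
qed

text \<open>If the exchange of the middle prime failed, \<open>P\<close> would be the only prime
  below itself that contains \<open>P0\<close> and \<open>x\<close>, and Krull's argument with
  symbolic powers, taken modulo \<open>P0\<close> and locally at \<open>P\<close>, gives a
  contradiction. As an exchange the theorem can be iterated along a chain.\<close>

theorem (in noetherian_cring) krull_principal_ideal:
  assumes P0: "primeideal P0 R" and Q: "primeideal Q R" and P: "primeideal P R"
    and sub: "P0 \<subset> Q" "Q \<subset> P" and x: "x \<in> P"
  shows "\<exists>P'. primeideal P' R \<and> P0 \<subset> P' \<and> P' \<subset> P \<and> x \<in> P'"
proof (rule ccontr)
  assume no: "\<not> ?thesis"
  interpret P0: primeideal P0 R by fact
  interpret Q: primeideal Q R by fact
  interpret P: primeideal P R by fact
  have xR: "x \<in> carrier R" using x by simp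
  have xQ: "x \<notin> Q" using no Q sub by blast
  then have x0: "x \<notin> P0" using sub by blast
  obtain y where y: "y \<in> Q" "y \<notin> P0" using sub by blast
  then have yR: "y \<in> carrier R" by simp
  have yn: "y [^] (n::nat) \<in> carrier R" for n using yR by simp
  \<comment> \<open>Contractions of the ideals generated by \<open>P0\<close> and a power of
    \<open>y\<close> from the localisation at \<open>Q\<close>. They stand in for the symbolic
    powers of \<open>Q\<close>; one element \<open>y\<close> outside \<open>P0\<close> suffices,
    since its powers can be cancelled modulo the prime \<open>P0\<close> at the end.\<close>
  define Y where "Y n = saturation R Q (add_gen R P0 (y [^] (n::nat)))" for n
  define I where "I n = saturation R P (add_gen R (Y n) x)" for n
  note gP0 = add_gen[OF P0.is_ideal yn]
  have Y: "ideal (Y n) R" "P0 \<subseteq> Y n" "y [^] n \<in> Y n" for n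
    unfolding Y_def using saturation(1,2)[OF Q gP0(1)] gP0(2,3) by blast+
  have Ysat: "a \<in> Y n" if "s \<in> carrier R - Q" "a \<in> carrier R" "s \<otimes> a \<in> Y n" for s a n
    using saturation(3)[OF Q gP0(1)] that unfolding Y_def by blast
  have Ydec: "Y (Suc n) \<subseteq> Y n" for n
    unfolding Y_def
  proof (rule saturation_mono, rule add_gen_minimal[OF gP0(1) gP0(2)])
    show "y [^] Suc n \<in> add_gen R P0 (y [^] n)"
      using ideal_closed(7)[OF gP0(1) gP0(3) yR] by simp
  qed
  note gY = add_gen[OF Y(1) xR]
  have I: "ideal (I n) R" "add_gen R P0 x \<subseteq> I n" "Y n \<subseteq> I n" "I (Suc n) \<subseteq> I n" for n
  proof -
    show "ideal (I n) R" unfolding I_def by (rule saturation(1)[OF P gY(1)])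
    have "add_gen R (Y n) x \<subseteq> I n" unfolding I_def by (rule saturation(2)[OF P gY(1)])
    then show "Y n \<subseteq> I n" "add_gen R P0 x \<subseteq> I n"
      using gY(2)[of n] add_gen_mono[OF Y(2), of R x n] by blast+
    show "I (Suc n) \<subseteq> I n"
      unfolding I_def by (intro saturation_mono add_gen_mono Ydec)
  qed
  have "\<exists>n. I n \<subseteq> I (Suc n)"
  proof (rule saturated_chain_stops[OF P add_gen(1)[OF P0.is_ideal xR]])
    fix P' assume "primeideal P' R" "add_gen R P0 x \<subseteq> P'" "P' \<subseteq> P"
    moreover from this have "P0 \<subseteq> P'" "x \<in> P'" using add_gen(2,3)[OF P0.is_ideal xR] by auto
    ultimately show "P' = P" using no x0 by blast
  next
    show "s \<in> carrier R - P \<Longrightarrow> a \<in> carrier R \<Longrightarrow> s \<otimes> a \<in> I n \<Longrightarrow> a \<in> I n" for n s a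
      unfolding I_def by (rule saturation(3)[OF P gY(1)])
  qed (use I in auto)
  then obtain n where n: "I n \<subseteq> I (Suc n)" by blast
  interpret A: module R "ring_as_module R" by (rule module_ring_as_module) (rule is_cring)
  obtain T where T: "T \<subseteq> carrier R" "finite T" "Y n = Idl T" using finetely_gen[OF Y(1)] by blast
  note y' = ideal_closed[OF Y(1)]
  have subY: "submodule (Y (Suc n)) R (ring_as_module R)"
    by (rule A.submodule_intro) (auto simp: y')
  have "T \<subseteq> Y (Suc n)"
  proof (rule A.local_nakayama[OF P subY])
    fix t assume "t \<in> T"
    then have t: "t \<in> Y n" using genideal_self[OF T(1)] T(3) by blast
    then have "t \<in> I (Suc n)" using I(3) n by blast
    then obtain s b c where s: "s \<in> carrier R - P" "s \<otimes> t = b \<oplus> c \<otimes> x" "b \<in> Y (Suc n)" "c \<in> carrier R"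
      unfolding I_def saturation_def add_gen_def by blast
    have carr: "t \<in> carrier R" "b \<in> carrier R" using t s y' by auto
    \<comment> \<open>\<open>x \<otimes> c\<close> lies in \<open>Y n\<close> and \<open>x\<close>
      is outside \<open>Q\<close>, so \<open>c\<close> lies in \<open>Y n\<close> by saturation.
      Locally at \<open>P\<close>, therefore, \<open>Y n\<close> is contained in
      \<open>Y (Suc n)\<close> plus x times \<open>Y n\<close>, and Nakayama's lemma removes the
      last term.\<close>
    have "x \<otimes> c = s \<otimes> t \<ominus> b"
      using s carr xR by (simp add: a_minus_def m_comm[of c] a_comm[of b] a_assoc r_neg)
    also have "\<dots> \<in> Y n"
      using t s(1,3) Ydec by (intro y'(5) y'(6)) auto
    finally have "c \<in> Y n" using Ysat[of x c n] xQ xR s(4) by simp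
    then have "x \<odot>\<^bsub>ring_as_module R\<^esub> c \<in> lspan (ring_as_module R) P {\<zero>\<^bsub>ring_as_module R\<^esub>} T"
      using A.lspan_scale[OF P.is_ideal, of T x c] T x genideal_lspan[OF T(1)] by simp
    also have "\<dots> \<subseteq> lspan (ring_as_module R) P (Y (Suc n)) T"
      by (rule lspan_mono) (auto simp: y')
    finally have "x \<otimes> c \<in> lspan (ring_as_module R) P (Y (Suc n)) T" by simp
    then have "b \<oplus> x \<otimes> c \<in> lspan (ring_as_module R) P (Y (Suc n)) T"
      using A.lspan_add[OF P.is_ideal subY, of T "x \<otimes> c" b] T(1) s(3) by (simp add: lspan.base)
    then show "\<exists>s\<in>carrier R - P. s \<odot>\<^bsub>ring_as_module R\<^esub> t \<in> lspan (ring_as_module R) P (Y (Suc n)) T"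
      using s xR by (auto simp: m_comm[of c] intro!: bexI[of _ s])
  next
    show "v \<in> Y (Suc n)" if "s \<in> carrier R - P" "v \<in> carrier (ring_as_module R)"
      "s \<odot>\<^bsub>ring_as_module R\<^esub> v \<in> Y (Suc n)" for s v
      using Ysat[of s v "Suc n"] that sub by auto
  qed (use T in auto)
  then have "Y n \<subseteq> Y (Suc n)" using T(3) genideal_minimal[OF Y(1)] by simp
  then have "y [^] n \<in> Y (Suc n)" using Y(3) by blast
  then obtain s b c where s: "s \<in> carrier R - Q" "s \<otimes> y [^] n = b \<oplus> c \<otimes> y [^] Suc n" "b \<in> P0" "c \<in> carrier R"
    unfolding Y_def saturation_def add_gen_def by blast
  have bR: "b \<in> carrier R" using s by simp
  \<comment> \<open>Cancelling the power of \<open>y\<close> modulo \<open>P0\<close> leaves s - c y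
    in \<open>P0\<close>. Since \<open>y\<close> is in \<open>Q\<close>, this forces the denominator
    \<open>s\<close> into \<open>Q\<close>.\<close>
  have "y [^] n \<otimes> (s \<ominus> c \<otimes> y) = s \<otimes> y [^] n \<ominus> c \<otimes> y [^] Suc n"
  proof -
    have "s \<in> carrier R" using s(1) by simp
    then show ?thesis unfolding nat_pow_Suc using yn[of n] s(4) yR by algebra
  qed
  also have "\<dots> = b" using s(2,4) yn[of "Suc n"] bR by (simp add: a_minus_def a_assoc r_neg)
  finally have "y [^] n \<otimes> (s \<ominus> c \<otimes> y) \<in> P0" using s(3) by simp
  moreover have "y [^] k \<notin> P0" for k :: nat
  proof (induction k)
    case (Suc k)
    then show ?case using P0.I_prime[of "y [^] k" y] y yR by auto
  qed (use P0.one_notin in simp)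
  ultimately have "s \<ominus> c \<otimes> y \<in> P0" using P0.I_prime[of "y [^] n" "s \<ominus> c \<otimes> y"] yn s(1,4) yR by auto
  then have "s \<ominus> c \<otimes> y \<in> Q" using sub by blast
  then have "s \<in> Q"
    using diff_mem_cancel[OF Q.is_ideal, of s "c \<otimes> y"] s(1,4) ideal_closed(6)[OF Q.is_ideal y(1)] by simp
  then show False using s(1) by simp
qed

section \<open>Chains of primes and regular sequences\<close>

definition prime_chain :: "('a, 'c) ring_scheme \<Rightarrow> (nat \<Rightarrow> 'a set) \<Rightarrow> nat \<Rightarrow> bool" where
  "prime_chain R P n \<longleftrightarrow> (\<forall>i\<le>n. primeideal (P i) R) \<and> (\<forall>i<n. P i \<subset> P (Suc i))"

text \<open>Weakly regular sequences: the quotient may be zero. Properness comes from the places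
  that put the entries into a prime ideal.\<close>

definition regular_seq :: "('a, 'c) ring_scheme \<Rightarrow> 'a list \<Rightarrow> bool" where
  "regular_seq R xs \<longleftrightarrow> set xs \<subseteq> carrier R \<and>
     (\<forall>j<length xs. \<forall>a\<in>carrier R.
        xs ! j \<otimes>\<^bsub>R\<^esub> a \<in> Idl\<^bsub>R\<^esub> (set (take j xs)) \<longrightarrow> a \<in> Idl\<^bsub>R\<^esub> (set (take j xs)))"

lemma prime_chain_mono:
  assumes "prime_chain R P n" "i \<le> j" "j \<le> n"
  shows "P i \<subseteq> P j"
  using assms(2,3)
proof (induction j rule: dec_induct)
  case (step k)
  then have "P k \<subset> P (Suc k)" using assms(1) by (simp add: prime_chain_def)
  then show ?case using step by auto
qed simp

lemma prime_chain_snoc: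
  assumes "prime_chain R P n" "primeideal Q R" "P n \<subset> Q"
  shows "prime_chain R (P(Suc n := Q)) (Suc n)"
  unfolding prime_chain_def
proof (intro conjI allI impI)
  show "primeideal ((P(Suc n := Q)) i) R" if "i \<le> Suc n" for i
    using assms(1,2) that by (cases "i = Suc n") (simp_all add: prime_chain_def)
  show "(P(Suc n := Q)) i \<subset> (P(Suc n := Q)) (Suc i)" if "i < Suc n" for i
    using assms(1,3) that by (cases "i = n") (simp_all add: prime_chain_def)
qed

text \<open>Trading the next-to-top prime for one through \<open>x\<close> leaves a shorter chain
  whose top contains \<open>x\<close>. Repeating this carries \<open>x\<close> down to index 1 while
  both ends stay fixed.\<close>

lemma (in noetherian_cring) prime_chain_through:
  assumes "prime_chain R P (Suc n)" "x \<in> P (Suc n)"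
  shows "\<exists>Q. prime_chain R Q (Suc n) \<and> Q 0 = P 0 \<and> Q (Suc n) = P (Suc n) \<and> x \<in> Q 1"
  using assms
proof (induction n arbitrary: P)
  case (Suc n)
  have ch: "prime_chain R P (Suc n)" using Suc.prems(1) by (auto simp: prime_chain_def)
  have "\<exists>P'. primeideal P' R \<and> P n \<subset> P' \<and> P' \<subset> P (Suc (Suc n)) \<and> x \<in> P'"
    by (rule krull_principal_ideal[of "P n" "P (Suc n)" "P (Suc (Suc n))"])
      (use Suc.prems in \<open>auto simp: prime_chain_def\<close>)
  then obtain P' where P': "primeideal P' R" "P n \<subset> P'" "P' \<subset> P (Suc (Suc n))" "x \<in> P'" by blast
  have "prime_chain R (P(Suc n := P')) (Suc n)"
    by (rule prime_chain_snoc) (use ch P' in \<open>auto simp: prime_chain_def\<close>)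
  from Suc.IH[OF this] P'(4)
  obtain Q where Q: "prime_chain R Q (Suc n)" "Q 0 = P 0" "Q (Suc n) = P'" "x \<in> Q 1"
    by auto
  have "prime_chain R (Q(Suc (Suc n) := P (Suc (Suc n)))) (Suc (Suc n))"
    by (rule prime_chain_snoc[OF Q(1)]) (use Suc.prems P' Q in \<open>auto simp: prime_chain_def\<close>)
  moreover have "(Q(Suc (Suc n) := P (Suc (Suc n)))) 0 = P 0" "x \<in> (Q(Suc (Suc n) := P (Suc (Suc n)))) 1"
    using Q by simp_all
  ultimately show ?case by (meson fun_upd_same)
qed auto

text \<open>The first entry is moved into the prime at index 1; the remaining entries are treated in
  the chain that starts there.\<close>

lemma (in noetherian_cring) prime_chain_through_list:
  assumes "prime_chain R P n" "length xs \<le> n" "set xs \<subseteq> P n"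
  shows "\<exists>Q. prime_chain R Q n \<and> Q 0 = P 0 \<and> Q n = P n \<and> (\<forall>i<length xs. xs ! i \<in> Q (Suc i))"
  using assms
proof (induction xs arbitrary: P n)
  case (Cons x xs)
  then obtain m where n: "n = Suc m" by (cases n) auto
  obtain P' where P': "prime_chain R P' (Suc m)" "P' 0 = P 0" "P' (Suc m) = P (Suc m)" "x \<in> P' 1"
    using prime_chain_through[of P m x] Cons.prems n by auto
  have "prime_chain R (\<lambda>i. P' (Suc i)) m" using P'(1) by (auto simp: prime_chain_def)
  then obtain Q where Q: "prime_chain R Q m" "Q 0 = P' 1" "Q m = P (Suc m)" "\<forall>i<length xs. xs ! i \<in> Q (Suc i)"
    using Cons.IH[of "\<lambda>i. P' (Suc i)" m] Cons.prems n P'(3) by auto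
  define Q' where "Q' i = (case i of 0 \<Rightarrow> P 0 | Suc j \<Rightarrow> Q j)" for i
  have P01: "P 0 \<subset> P' 1" using P'(1,2) by (auto simp: prime_chain_def)
  have "prime_chain R Q' (Suc m)"
    unfolding prime_chain_def
  proof (intro conjI allI impI)
    fix i assume "i \<le> Suc m"
    then show "primeideal (Q' i) R"
      using Q(1) P' by (cases i) (auto simp: Q'_def prime_chain_def)
  next
    fix i assume "i < Suc m"
    then show "Q' i \<subset> Q' (Suc i)"
      using Q(1,2) P01 by (cases i) (simp_all add: Q'_def prime_chain_def)
  qed
  moreover have "(x # xs) ! i \<in> Q' (Suc i)" if "i < length (x # xs)" for i
    using that Q P'(4) by (cases i) (auto simp: Q'_def)
  moreover have "Q' 0 = P 0" "Q' (Suc m) = P (Suc m)" using Q(3) by (simp_all add: Q'_def)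
  ultimately show ?case unfolding n by blast
qed auto

lemma (in cring) genideal_insert:
  assumes "S \<subseteq> carrier R" "x \<in> carrier R"
  shows "Idl (insert x S) = add_gen R (Idl S) x"
proof
  note a = add_gen[OF genideal_ideal[OF assms(1)] assms(2)]
  show "Idl (insert x S) \<subseteq> add_gen R (Idl S) x"
    by (rule genideal_minimal[OF a(1)]) (use a genideal_self[OF assms(1)] in auto)
  have i: "insert x S \<subseteq> carrier R" using assms by simp
  show "add_gen R (Idl S) x \<subseteq> Idl (insert x S)"
    by (rule add_gen_minimal[OF genideal_ideal[OF i]])
      (use genideal_self[OF i] subset_Idl_subset[OF i, of S] in auto)
qed

text \<open>The chain is built from the top: the last entry cancels modulo the others, so some prime
  strictly below \<open>P\<close> contains the others but not this entry, and it serves as the top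
  for the shorter sequence.\<close>

lemma (in noetherian_cring) prime_chain_of_regular_seq:
  assumes "regular_seq R xs" "primeideal P R" "set xs \<subseteq> P"
  shows "\<exists>Q. prime_chain R Q (length xs) \<and> Q (length xs) = P"
  using assms
proof (induction xs arbitrary: P rule: rev_induct)
  case Nil
  then show ?case by (intro exI[of _ "\<lambda>_. P"]) (auto simp: prime_chain_def)
next
  case (snoc x xs)
  interpret P: primeideal P R by fact
  have xs: "set xs \<subseteq> carrier R" "x \<in> carrier R" using snoc.prems(1) by (auto simp: regular_seq_def)
  have reg: "regular_seq R xs"
    unfolding regular_seq_def
  proof (intro conjI allI impI ballI)
    fix j a assume "j < length xs" "a \<in> carrier R" "xs ! j \<otimes> a \<in> Idl (set (take j xs))"
    then show "a \<in> Idl (set (take j xs))"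
      using snoc.prems(1)[unfolded regular_seq_def, THEN conjunct2, rule_format, of j a]
      by (auto simp: nth_append)
  qed (use xs in simp)
  have "\<exists>Q. primeideal Q R \<and> Idl (set xs) \<subseteq> Q \<and> Q \<subseteq> P \<and> x \<notin> Q"
  proof (rule prime_below_avoiding[OF genideal_ideal[OF xs(1)] snoc.prems(2) xs(2)])
    show "a \<in> Idl (set xs)" if "a \<in> carrier R" "x \<otimes> a \<in> Idl (set xs)" for a
      using snoc.prems(1)[unfolded regular_seq_def, THEN conjunct2, rule_format, of "length xs" a] that by auto
    show "Idl (set xs) \<subseteq> P" using snoc.prems(3) by (intro genideal_minimal P.is_ideal) auto
  qed
  then obtain P' where P': "primeideal P' R" "Idl (set xs) \<subseteq> P'" "P' \<subseteq> P" "x \<notin> P'" by blast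
  have "P' \<subset> P" using P' snoc.prems(3) by auto
  obtain Q where Q: "prime_chain R Q (length xs)" "Q (length xs) = P'"
    using snoc.IH[OF reg P'(1)] genideal_self[OF xs(1)] P'(2) by blast
  have "prime_chain R (Q(Suc (length xs) := P)) (Suc (length xs))"
    by (rule prime_chain_snoc) (use Q \<open>P' \<subset> P\<close> snoc.prems in auto)
  then show ?case
    by (intro exI[of _ "Q(Suc (length xs) := P)"] conjI) (simp_all only: length_append_singleton fun_upd_same)
qed

section \<open>Prime avoidance and the existence of nonzerodivisors\<close>

lemma (in cring) prime_prod_avoid:
  assumes P: "primeideal P R" and S: "finite S"
    and I: "\<And>s. s \<in> S \<Longrightarrow> ideal (I s) R" "\<And>s. s \<in> S \<Longrightarrow> \<not> I s \<subseteq> P"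
  shows "\<exists>a\<in>carrier R - P. \<forall>s\<in>S. a \<in> I s"
  using S I
proof (induction S rule: finite_induct)
  case empty
  then show ?case using primeideal.one_notin[OF P] by blast
next
  case (insert s S)
  obtain a where a: "a \<in> carrier R - P" "\<forall>s\<in>S. a \<in> I s" using insert.IH insert.prems by auto
  obtain b where b: "b \<in> I s" "b \<notin> P" using insert.prems(2)[of s] by auto
  note i = ideal_closed[OF insert.prems(1)]
  have bR: "b \<in> carrier R" using b i by auto
  have "a \<otimes> b \<in> carrier R - P" using primeideal.prime_compl_mult[OF P a(1), of b] b bR by simp
  moreover have "\<forall>t\<in>insert s S. a \<otimes> b \<in> I t" using a b bR i(6)[of s b a] i(7)[of _ a b] by auto
  ultimately show ?case by blast
qed

text \<open>Incomparability makes a correction possible when \<open>y\<close> falls into the newly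
  added prime: some element of \<open>M\<close> lies in all the older primes but not in the new one,
  and adding it repairs \<open>y\<close> there without spoiling the rest. Maximal annihilators are
  incomparable for free.\<close>

lemma (in cring) prime_avoidance:
  assumes fin: "finite \<P>" and prime: "\<And>P. P \<in> \<P> \<Longrightarrow> primeideal P R"
    and inc: "\<And>P P'. P \<in> \<P> \<Longrightarrow> P' \<in> \<P> \<Longrightarrow> P \<subseteq> P' \<Longrightarrow> P = P'"
    and M: "ideal M R" "\<And>P. P \<in> \<P> \<Longrightarrow> \<not> M \<subseteq> P"
  shows "\<exists>y\<in>M. \<forall>P\<in>\<P>. y \<notin> P"
  using fin prime inc M(2)
proof (induction \<P> rule: finite_induct)
  case empty
  then show ?case using ideal_closed(2)[OF M(1)] by blast
next
  case (insert P \<P>)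
  have "\<exists>y\<in>M. \<forall>Q\<in>\<P>. y \<notin> Q"
    by (rule insert.IH) (use insert.prems in \<open>meson insertCI\<close>)+
  then obtain y where y: "y \<in> M" "\<And>Q. Q \<in> \<P> \<Longrightarrow> y \<notin> Q" by auto
  have Pp: "primeideal P R" using insert.prems(1) by simp
  show ?case
  proof (cases "y \<in> P")
    case True
    have "\<exists>w\<in>carrier R - P. \<forall>Q\<in>insert M \<P>. w \<in> Q"
    proof (rule prime_prod_avoid[OF Pp])
      show "\<not> Q \<subseteq> P" if "Q \<in> insert M \<P>" for Q
        using insert.prems(2)[of Q P] insert.prems(3)[of P] insert.hyps(2) that by auto
      show "ideal Q R" if "Q \<in> insert M \<P>" for Q
        using insert.prems(1)[of Q] M(1) that primeideal.axioms(1) by auto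
    qed (use insert.hyps in simp)
    then obtain w where w: "w \<in> carrier R" "w \<notin> P" "w \<in> M" "\<And>Q. Q \<in> \<P> \<Longrightarrow> w \<in> Q" by auto
    have yR: "y \<in> carrier R" using ideal_closed(1)[OF M(1) y(1)] .
    have "y \<oplus> w \<notin> P"
      using sum_mem_cancel[of P w y] True w(1,2) a_comm[OF yR w(1)] primeideal.axioms(1)[OF Pp] by auto
    moreover have "y \<oplus> w \<notin> Q" if "Q \<in> \<P>" for Q
      using sum_mem_cancel[of Q y w] w(4)[OF that] y(2)[OF that] yR
        primeideal.axioms(1)[OF insert.prems(1)[of Q]] that by auto
    moreover have "y \<oplus> w \<in> M" using ideal_closed(3)[OF M(1) y(1) w(3)] .
    ultimately show ?thesis by blast
  qed (use y in blast)
qed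

text \<open>The maximal annihilators \<open>(J : g)\<close> of elements of \<open>R/J\<close> are finite in number because the
  ideal generated by all the \<open>g\<close> is generated by finitely many of them.\<close>

lemma (in noetherian_cring) exists_nonzerodivisor:
  assumes J: "ideal J R" and M: "ideal M R"
    and soc: "\<And>c. c \<in> carrier R \<Longrightarrow> (\<And>a. a \<in> M \<Longrightarrow> a \<otimes> c \<in> J) \<Longrightarrow> c \<in> J"
  shows "\<exists>y\<in>M. \<forall>a\<in>carrier R. y \<otimes> a \<in> J \<longrightarrow> a \<in> J"
proof -
  note j = ideal_closed[OF J]
  define G where "G = {g \<in> carrier R - J. \<forall>h\<in>carrier R - J. colon R J g \<subseteq> colon R J h \<longrightarrow> colon R J h = colon R J g}"
  have G: "G \<subseteq> carrier R" by (auto simp: G_def)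
  have prime: "primeideal (colon R J g) R" if "g \<in> G" for g
    by (rule maximal_colon_prime[OF J]) (use that in \<open>auto simp: G_def\<close>)
  define \<F> where "\<F> = {S. finite S \<and> S \<subseteq> G}"
  have "\<exists>K\<in>genideal R ` \<F>. \<forall>K'\<in>genideal R ` \<F>. K \<subseteq> K' \<longrightarrow> K' = K"
  proof (rule ideal_max)
    have "{} \<in> \<F>" by (simp add: \<F>_def)
    then show "genideal R ` \<F> \<noteq> {}" by blast
    show "ideal K R" if "K \<in> genideal R ` \<F>" for K
      using that G genideal_ideal by (auto simp: \<F>_def)
  qed
  then obtain S where "S \<in> \<F>" and Smax': "\<And>S'. S' \<in> \<F> \<Longrightarrow> Idl S \<subseteq> Idl S' \<Longrightarrow> Idl S' = Idl S"
    by auto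
  then have S: "finite S" "S \<subseteq> G"
    and Smax: "\<And>S'. finite S' \<Longrightarrow> S' \<subseteq> G \<Longrightarrow> Idl S \<subseteq> Idl S' \<Longrightarrow> Idl S' = Idl S"
    by (simp_all add: \<F>_def)
  have "colon R J g \<in> colon R J ` S" if g: "g \<in> G" for g
  proof (rule ccontr)
    assume no: "colon R J g \<notin> colon R J ` S"
    \<comment> \<open>Maximality of \<open>Idl S\<close> puts \<open>g\<close> into it, so an
      element that kills all of \<open>S\<close> modulo \<open>J\<close> would kill \<open>g\<close>
      as well, against its choice outside the prime (J : g).\<close>
    have "\<exists>a\<in>carrier R - colon R J g. \<forall>s\<in>S. a \<in> colon R J s"
    proof (rule prime_prod_avoid[OF prime[OF g] S(1)])
      show "\<not> colon R J s \<subseteq> colon R J g" if "s \<in> S" for s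
        using no that S(2) g by (auto simp: G_def)
      show "ideal (colon R J s) R" if "s \<in> S" for s using ideal_colon(1)[OF J] that S(2) G by blast
    qed
    then obtain a where a: "a \<in> carrier R" "a \<notin> colon R J g" "\<And>s. s \<in> S \<Longrightarrow> a \<in> colon R J s" by blast
    have SR: "S \<subseteq> carrier R" "insert g S \<subseteq> carrier R" using S G g by auto
    have "Idl S \<subseteq> Idl (insert g S)" using subset_Idl_subset[OF SR(2)] by auto
    then have "Idl (insert g S) = Idl S" using Smax[of "insert g S"] S g by simp
    then have "g \<in> Idl S" using genideal_self[OF SR(2)] by auto
    moreover have "Idl S \<subseteq> colon R J a"
    proof (rule genideal_minimal[OF ideal_colon(1)[OF J a(1)]], rule subsetI)
      fix s assume s: "s \<in> S"
      then show "s \<in> colon R J a" using a(3)[OF s] a(1) SR(1) m_comm[of a s] by (auto simp: colon_def)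
    qed
    ultimately have "g \<otimes> a \<in> J" by (auto simp: colon_def)
    then show False using a G g m_comm[of g a] by (auto simp: colon_def)
  qed
  then have "colon R J ` G \<subseteq> colon R J ` S" by auto
  then have fin: "finite (colon R J ` G)" using S(1) finite_surj by blast
  have "\<exists>y\<in>M. \<forall>P\<in>colon R J ` G. y \<notin> P"
  proof (rule prime_avoidance[OF fin _ _ M])
    fix P P' assume "P \<in> colon R J ` G" "P' \<in> colon R J ` G" "P \<subseteq> P'"
    then show "P = P'" unfolding G_def by auto
  next
    fix P assume "P \<in> colon R J ` G"
    then obtain g where g: "g \<in> G" "P = colon R J g" by blast
    then show "\<not> M \<subseteq> P" using soc[of g] by (auto simp: G_def colon_def)
  qed (use prime in auto)
  then obtain y where y: "y \<in> M" "\<And>g. g \<in> G \<Longrightarrow> y \<notin> colon R J g" by blast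
  have yR: "y \<in> carrier R" using ideal_closed(1)[OF M y(1)] .
  have "a \<in> J" if a: "a \<in> carrier R" "y \<otimes> a \<in> J" for a
  proof (rule ccontr)
    assume na: "a \<notin> J"
    \<comment> \<open>The annihilator of \<open>a\<close> is contained in a maximal one, hence in (J
      : g) for some \<open>g\<close> in \<open>G\<close>, and \<open>y\<close> avoids all of
      these.\<close>
    obtain g where g: "g \<in> carrier R - J" "colon R J a \<subseteq> colon R J g"
      and gmax: "\<And>h. h \<in> carrier R - J \<Longrightarrow> colon R J a \<subseteq> colon R J h \<Longrightarrow> colon R J g \<subseteq> colon R J h \<Longrightarrow> colon R J h = colon R J g"
      using maximal_colon[OF J, of "{h \<in> carrier R - J. colon R J a \<subseteq> colon R J h}"] a(1) na by blast
    have "g \<in> G" unfolding G_def using g gmax by blast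
    moreover have "y \<in> colon R J a" using a yR by (auto simp: colon_def)
    ultimately show False using y(2) g(2) by blast
  qed
  then show ?thesis using y(1) by blast
qed

section \<open>Local rings: Nakayama's lemma and the height theorem\<close>

locale noetherian_local = noetherian_cring R for R (structure) +
  fixes \<mm>
  assumes maximal_m: "maximalideal \<mm> R" and unique_m: "\<And>I. maximalideal I R \<Longrightarrow> I = \<mm>"
begin

sublocale m: maximalideal \<mm> R by (rule maximal_m)

lemma m_prime: "primeideal \<mm> R"
  by (rule maximalideal_prime[OF maximal_m])

lemma proper_in_m:
  assumes "ideal I R" "\<one> \<notin> I"
  shows "I \<subseteq> \<mm>"
proof -
  define \<I> where "\<I> = {J. ideal J R \<and> I \<subseteq> J \<and> \<one> \<notin> J}"
  have "I \<in> \<I>" using assms by (simp add: \<I>_def)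
  then have "\<exists>M\<in>\<I>. \<forall>J\<in>\<I>. M \<subseteq> J \<longrightarrow> J = M"
    by (intro ideal_max) (auto simp: \<I>_def)
  then obtain M where "M \<in> \<I>" and max': "\<forall>J\<in>\<I>. M \<subseteq> J \<longrightarrow> J = M" by blast
  then have M: "ideal M R" "I \<subseteq> M" "\<one> \<notin> M"
    and max: "\<And>J. ideal J R \<Longrightarrow> M \<subseteq> J \<Longrightarrow> \<one> \<notin> J \<Longrightarrow> J = M"
    unfolding \<I>_def by auto
  have "maximalideal M R"
  proof (rule maximalidealI[OF M(1)])
    show "carrier R \<noteq> M" using M(3) by auto
    show "J = M \<or> J = carrier R" if "ideal J R" "M \<subseteq> J" for J
      using max[OF that] ideal.one_imp_carrier[OF that(1)] by blast
  qed
  then show ?thesis using unique_m M(2) by blast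
qed

lemma unit_of_notin_m:
  assumes "a \<in> carrier R" "a \<notin> \<mm>"
  shows "\<exists>b\<in>carrier R. b \<otimes> a = \<one>"
proof -
  have "\<not> PIdl a \<subseteq> \<mm>" using cgenideal_self[OF assms(1)] assms(2) by blast
  then have "\<one> \<in> PIdl a" using proper_in_m[OF cgenideal_ideal[OF assms(1)]] by blast
  then show ?thesis by (auto simp: cgenideal_def)
qed

lemma one_notin_m: "\<one> \<notin> \<mm>"
  using primeideal.one_notin[OF m_prime] .

lemma prime_in_m:
  assumes "primeideal P R" shows "P \<subseteq> \<mm>"
  using proper_in_m[of P] assms primeideal.one_notin primeideal.axioms(1) by blast

text \<open>Elements outside \<open>\<mm>\<close> are units. Read backwards, a scalar that takes
  \<open>v\<close> into a submodule not containing \<open>v\<close> must lie in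
  \<open>\<mm>\<close>.\<close>

lemma module_saturated:
  assumes "module R M" "submodule L R M" "s \<in> carrier R - \<mm>" "v \<in> carrier M" "s \<odot>\<^bsub>M\<^esub> v \<in> L"
  shows "v \<in> L"
proof -
  interpret M: module R M by fact
  obtain b where b: "b \<in> carrier R" "b \<otimes> s = \<one>" using unit_of_notin_m assms(3) by auto
  then have "b \<odot>\<^bsub>M\<^esub> (s \<odot>\<^bsub>M\<^esub> v) = v" using assms(3,4) M.smult_assoc1[of b s v] by simp
  then show ?thesis using M.submodule_mem(6)[OF assms(2) b(1) assms(5)] by simp
qed

lemma nakayama:
  assumes M: "module R M" and L: "submodule L R M" and T: "finite T" "T \<subseteq> carrier M"
    and gen: "\<And>t. t \<in> T \<Longrightarrow> t \<in> lspan M \<mm> L T"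
  shows "T \<subseteq> L"
proof -
  interpret M: module R M by fact
  show ?thesis
  proof (rule M.local_nakayama[OF m_prime L _ T])
    show "\<exists>s\<in>carrier R - \<mm>. s \<odot>\<^bsub>M\<^esub> t \<in> lspan M \<mm> L T" if "t \<in> T" for t
      using gen[OF that] that T(2) one_notin_m by (intro bexI[of _ \<one>]) auto
  qed (rule module_saturated[OF M L])
qed

lemma nakayama_ideal:
  assumes I: "ideal I R" and L: "ideal L R" and x: "x \<in> \<mm>"
    and dec: "\<And>t. t \<in> I \<Longrightarrow> \<exists>l\<in>L. \<exists>c\<in>I. t = l \<oplus> c \<otimes> x"
  shows "I \<subseteq> L"
proof -
  interpret A: module R "ring_as_module R" by (rule module_ring_as_module) (rule is_cring)
  obtain T where T: "T \<subseteq> carrier R" "finite T" "I = Idl T" using finetely_gen[OF I] by blast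
  note l = ideal_closed[OF L]
  have subL: "submodule L R (ring_as_module R)"
    by (rule A.submodule_intro) (auto simp: l)
  have "T \<subseteq> L"
  proof (rule nakayama[OF A.module_axioms subL])
    fix t assume "t \<in> T"
    then have "t \<in> I" using genideal_self[OF T(1)] T(3) by blast
    then obtain b c where bc: "b \<in> L" "c \<in> I" "t = b \<oplus> c \<otimes> x" using dec by blast
    have "x \<odot>\<^bsub>ring_as_module R\<^esub> c \<in> lspan (ring_as_module R) \<mm> {\<zero>\<^bsub>ring_as_module R\<^esub>} T"
      using A.lspan_scale[OF m.is_ideal, of T x c] T x bc genideal_lspan[OF T(1)] by simp
    also have "\<dots> \<subseteq> lspan (ring_as_module R) \<mm> L T"
      by (rule lspan_mono) (auto simp: l)
    finally have "x \<otimes> c \<in> lspan (ring_as_module R) \<mm> L T" by simp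
    then have "b \<oplus> x \<otimes> c \<in> lspan (ring_as_module R) \<mm> L T"
      using A.lspan_add[OF m.is_ideal subL, of T "x \<otimes> c" b] T(1) bc(1) by (simp add: lspan.base)
    then show "t \<in> lspan (ring_as_module R) \<mm> L T"
      using bc x ideal_closed(1)[OF I bc(2)] m_comm[of c x] by simp
  qed (use T in auto)
  then show ?thesis using T(3) genideal_minimal[OF L] by simp
qed

lemma prime_chain_to_m:
  assumes "prime_chain R P n"
  shows "\<exists>Q. prime_chain R Q n \<and> Q n = \<mm>"
proof -
  have "prime_chain R (P(n := \<mm>)) n"
    unfolding prime_chain_def
  proof (intro conjI allI impI)
    show "primeideal ((P(n := \<mm>)) i) R" if "i \<le> n" for i
      using assms that m_prime by (auto simp: prime_chain_def)
    show "(P(n := \<mm>)) i \<subset> (P(n := \<mm>)) (Suc i)" if "i < n" for i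
      using assms that prime_in_m[of "P n"] by (auto simp: prime_chain_def)
  qed
  then show ?thesis by (intro exI[of _ "P(n := \<mm>)"]) simp
qed

lemma prime_chain_through_gens:
  assumes "prime_chain R P n" "length xs \<le> n" "set xs \<subseteq> \<mm>"
  shows "\<exists>Q. prime_chain R Q n \<and> Q n = \<mm> \<and> (\<forall>j\<le>n. set (take j xs) \<subseteq> Q j)"
proof -
  obtain P' where "prime_chain R P' n" "P' n = \<mm>" using prime_chain_to_m[OF assms(1)] by blast
  then obtain Q where Q: "prime_chain R Q n" "Q n = \<mm>" "\<forall>i<length xs. xs ! i \<in> Q (Suc i)"
    using prime_chain_through_list[of P' n xs] assms by auto
  have "set (take j xs) \<subseteq> Q j" if "j \<le> n" for j
  proof
    fix x assume "x \<in> set (take j xs)"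
    then obtain i where i: "i < j" "i < length xs" "x = xs ! i" by (auto simp: in_set_conv_nth)
    then show "x \<in> Q j" using Q(3) prime_chain_mono[OF Q(1), of "Suc i" j] that by auto
  qed
  then show ?thesis using Q by blast
qed

text \<open>In a longer chain the generators could be distributed so that the prime at index
  \<open>length xs\<close> contains them all. It would then contain \<open>\<mm>\<close>, although
  another prime of the chain lies strictly above it.\<close>

theorem krull_height:
  assumes "prime_chain R P n" "set xs \<subseteq> carrier R" "Idl (set xs) = \<mm>"
  shows "n \<le> length xs"
proof (rule ccontr)
  assume "\<not> ?thesis"
  then have n: "length xs < n" by simp
  have "set xs \<subseteq> \<mm>" using genideal_self[OF assms(2)] assms(3) by simp
  then obtain Q where Q: "prime_chain R Q n" "Q n = \<mm>" "\<forall>j\<le>n. set (take j xs) \<subseteq> Q j"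
    using prime_chain_through_gens[OF assms(1) _ \<open>set xs \<subseteq> \<mm>\<close>] n by auto
  have "primeideal (Q (length xs)) R" using Q(1) n by (simp add: prime_chain_def)
  moreover have "set xs \<subseteq> Q (length xs)" using Q(3)[rule_format, of "length xs"] n by simp
  ultimately have "\<mm> \<subseteq> Q (length xs)"
    using genideal_minimal[OF primeideal.axioms(1)] assms(3) by blast
  moreover have "Q (length xs) \<subset> Q (Suc (length xs))" using Q(1) n by (auto simp: prime_chain_def)
  moreover have "Q (Suc (length xs)) \<subseteq> Q n" using prime_chain_mono[OF Q(1)] n by simp
  ultimately show False using Q(2) by blast
qed

text \<open>Choose the chain so that its \<open>j\<close>-th prime contains the first
  \<open>j\<close> entries. Its length leaves no room: these entries generate the prime. The partial
  ideals are thus prime, and each next entry only has to lie outside.\<close>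

theorem regular_seq_of_prime_chain:
  assumes "prime_chain R P (length xs)" "set xs \<subseteq> carrier R" "Idl (set xs) = \<mm>"
  shows "regular_seq R xs"
proof -
  let ?n = "length xs"
  let ?J = "\<lambda>j. Idl (set (take j xs))"
  have m: "set xs \<subseteq> \<mm>" using genideal_self[OF assms(2)] assms(3) by simp
  obtain Q where Q: "prime_chain R Q ?n" "Q ?n = \<mm>" "\<forall>j\<le>?n. set (take j xs) \<subseteq> Q j"
    using prime_chain_through_gens[OF assms(1) _ m] by auto
  have tR: "set (take j xs) \<subseteq> carrier R" for j using assms(2) set_take_subset by fastforce
  have step: "?J (Suc j) = add_gen R (?J j) (xs ! j)" if "j < ?n" for j
  proof -
    have "set (take (Suc j) xs) = insert (xs ! j) (set (take j xs))"
      using that by (simp add: take_Suc_conv_app_nth)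
    moreover have "xs ! j \<in> carrier R" using assms(2) that by auto
    ultimately show ?thesis using genideal_insert[OF tR] by simp
  qed
  have prime: "primeideal (Q j) R" if "j \<le> ?n" for j using Q(1) that by (auto simp: prime_chain_def)
  have sub: "?J j \<subseteq> Q j" if "j \<le> ?n" for j
    using that Q(3) primeideal.axioms(1)[OF prime] by (intro genideal_minimal) auto
  \<comment> \<open>Otherwise all generators of \<open>Q (Suc j)\<close> would lie in
    \<open>Q j\<close>, against the strict inclusion.\<close>
  have notin: "xs ! j \<notin> Q j" if "j < ?n" "Q (Suc j) = ?J (Suc j)" for j
  proof
    assume a: "xs ! j \<in> Q j"
    have "Q (Suc j) \<subseteq> Q j" unfolding that(2) step[OF that(1)]
      by (rule add_gen_minimal) (use a sub[of j] that(1) primeideal.axioms(1)[OF prime[of j]] in auto)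
    then show False using Q(1) that(1) by (auto simp: prime_chain_def)
  qed
  \<comment> \<open>Descending induction from \<open>\<mm>\<close>. An element of \<open>Q j\<close>
    is l + c x with \<open>l\<close> in the partial ideal and \<open>x\<close> the next entry; as
    \<open>x\<close> is outside the prime \<open>Q j\<close>, the coefficient \<open>c\<close> is in
    \<open>Q j\<close> too, and Nakayama's lemma finishes.\<close>
  have eq: "Q j = ?J j" if "j \<le> ?n" for j
    using that
  proof (induction j rule: inc_induct)
    case base
    then show ?case using Q(2) assms(3) by simp
  next
    case (step j)
    note st = \<open>\<And>j. j < ?n \<Longrightarrow> ?J (Suc j) = _\<close>
    interpret q: primeideal "Q j" R using prime[of j] step by simp
    have xR: "xs ! j \<in> carrier R" using assms(2) step by auto
    have "Q j \<subseteq> ?J j"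
    proof (rule nakayama_ideal[OF q.is_ideal genideal_ideal[OF tR]])
      show "xs ! j \<in> \<mm>" using m step by auto
      fix t assume t: "t \<in> Q j"
      then have "t \<in> Q (Suc j)" using Q(1) step by (auto simp: prime_chain_def)
      then have "t \<in> add_gen R (?J j) (xs ! j)" using step st by simp
      then obtain l c where lc: "l \<in> ?J j" "c \<in> carrier R" "t = l \<oplus> c \<otimes> xs ! j" by (auto simp: add_gen_def)
      have "l \<in> Q j" using lc sub[of j] step by auto
      then have "c \<otimes> xs ! j \<in> Q j"
        using sum_mem_cancel[OF q.is_ideal, of "c \<otimes> xs ! j" l] t lc xR by (simp add: a_comm)
      then have "c \<in> Q j" using q.I_prime[OF lc(2) xR] notin[of j] step by auto
      then show "\<exists>l\<in>?J j. \<exists>c\<in>Q j. t = l \<oplus> c \<otimes> xs ! j" using lc by blast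
    qed
    then show ?case using sub[of j] step by auto
  qed
  show ?thesis
    unfolding regular_seq_def
  proof (intro conjI allI impI ballI assms(2))
    fix j a assume j: "j < ?n" "a \<in> carrier R" "xs ! j \<otimes> a \<in> ?J j"
    interpret q: primeideal "Q j" R using prime[of j] j by simp
    have "xs ! j \<notin> Q j" using notin[OF j(1)] eq[of "Suc j"] j by simp
    then show "a \<in> ?J j"
      using q.I_prime[of "xs ! j" a] j eq[of j] assms(2) by (auto simp: subset_iff)
  qed
qed

end

section \<open>Regularity as the existence of a long chain of primes\<close>

lemma noetherian_local_max_ideal:
  assumes "noetherian_ring R" "local_ring R"
  shows "noetherian_local R (max_ideal R)"
proof -
  interpret noetherian_ring R by fact
  interpret cring R using assms(2) by (simp add: local_ring_def)
  have ex1: "\<exists>!I. maximalideal I R" using assms(2) by (simp add: local_ring_def)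
  have m: "maximalideal (max_ideal R) R" unfolding max_ideal_def by (rule theI'[OF ex1])
  have "I = max_ideal R" if "maximalideal I R" for I using that m ex1 by blast
  then show ?thesis
    by (intro noetherian_local.intro noetherian_local_axioms.intro noetherian_cring.intro m
      noetherian_ring_axioms is_cring)
qed

lemma embedding_dim_gens:
  assumes "noetherian_ring R" "local_ring R"
  shows "\<exists>xs. length xs = embedding_dim R \<and> set xs \<subseteq> carrier R \<and> Idl\<^bsub>R\<^esub> (set xs) = max_ideal R"
    and "set ys \<subseteq> carrier R \<Longrightarrow> Idl\<^bsub>R\<^esub> (set ys) = max_ideal R \<Longrightarrow> embedding_dim R \<le> length ys"
proof -
  interpret noetherian_local R "max_ideal R" by (rule noetherian_local_max_ideal[OF assms])
  let ?P = "\<lambda>n. \<exists>S \<subseteq> carrier R. finite S \<and> card S = n \<and> Idl\<^bsub>R\<^esub> S = max_ideal R"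
  obtain S where "S \<subseteq> carrier R" "finite S" "max_ideal R = Idl\<^bsub>R\<^esub> S"
    using finetely_gen[OF m.is_ideal] by blast
  then have "?P (card S)" by blast
  then have "?P (embedding_dim R)" unfolding embedding_dim_def by (rule LeastI)
  then obtain S where S: "S \<subseteq> carrier R" "finite S" "card S = embedding_dim R" "Idl\<^bsub>R\<^esub> S = max_ideal R"
    by blast
  obtain xs where "set xs = S" "distinct xs" using finite_distinct_list[OF S(2)] by blast
  then show "\<exists>xs. length xs = embedding_dim R \<and> set xs \<subseteq> carrier R \<and> Idl\<^bsub>R\<^esub> (set xs) = max_ideal R"
    using S distinct_card[of xs] by (intro exI[of _ xs]) auto
  assume ys: "set ys \<subseteq> carrier R" "Idl\<^bsub>R\<^esub> (set ys) = max_ideal R"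
  have "embedding_dim R \<le> card (set ys)" unfolding embedding_dim_def
    by (rule Least_le) (use ys in auto)
  then show "embedding_dim R \<le> length ys" using card_length[of ys] by linarith
qed

text \<open>The height theorem bounds all lengths of chains by the embedding dimension, so the
  supremum in \<open>krull_dim\<close> runs over a finite set and is a maximum.\<close>

theorem regular_local_ring_iff_prime_chain:
  assumes "noetherian_ring R" "local_ring R"
  shows "regular_local_ring R \<longleftrightarrow> (\<exists>P. prime_chain R P (embedding_dim R))"
proof -
  interpret noetherian_local R "max_ideal R" by (rule noetherian_local_max_ideal[OF assms])
  let ?d = "embedding_dim R"
  let ?D = "{enat n | n. \<exists>P. prime_chain R P n}"
  have D: "krull_dim R = Sup ?D" by (simp add: krull_dim_def prime_chain_def)
  obtain xs where xs: "length xs = ?d" "set xs \<subseteq> carrier R" "Idl\<^bsub>R\<^esub> (set xs) = max_ideal R"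
    using embedding_dim_gens(1)[OF assms] by blast
  have le: "n \<le> ?d" if "prime_chain R P n" for P n
    using krull_height[OF that xs(2,3)] xs(1) by simp
  have "prime_chain R (\<lambda>_. max_ideal R) 0" using m_prime by (simp add: prime_chain_def)
  then have ne: "?D \<noteq> {}" by blast
  have fin: "finite ?D"
    by (rule finite_subset[of _ "enat ` {..?d}"]) (use le in auto)
  have "Sup ?D = enat ?d \<longleftrightarrow> enat ?d \<in> ?D"
  proof
    assume "Sup ?D = enat ?d"
    moreover have "Sup ?D = Max ?D" unfolding Sup_enat_def using ne fin by (simp only: if_False if_True)
    ultimately show "enat ?d \<in> ?D" using Max_in[OF fin ne] by simp
  next
    assume *: "enat ?d \<in> ?D"
    show "Sup ?D = enat ?d"
      by (rule antisym[OF Sup_least Sup_upper[OF *]]) (use le in auto)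
  qed
  then show ?thesis using assms D by (auto simp: regular_local_ring_def)
qed

section \<open>Homomorphisms and projective modules\<close>

abbreviation restr :: "('a, 'm) module \<Rightarrow> 'm set \<Rightarrow> ('a, 'm) module" where
  "restr N U \<equiv> N\<lparr>carrier := U\<rparr>"

lemma module_homsI:
  assumes "\<And>x. x \<in> carrier M \<Longrightarrow> f x \<in> carrier N"
    and "\<And>x y. x \<in> carrier M \<Longrightarrow> y \<in> carrier M \<Longrightarrow> f (x \<oplus>\<^bsub>M\<^esub> y) = f x \<oplus>\<^bsub>N\<^esub> f y"
    and "\<And>a x. a \<in> carrier R \<Longrightarrow> x \<in> carrier M \<Longrightarrow> f (a \<odot>\<^bsub>M\<^esub> x) = a \<odot>\<^bsub>N\<^esub> f x"
  shows "f \<in> module_homs R M N"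
  using assms by (auto simp: module_homs_def)

lemma module_restr:
  assumes "module R M" "submodule U R M"
  shows "module R (restr M U)"
  using submodule.submodule_is_module[OF assms(2,1)] .

lemma module_homs_comp:
  assumes "f \<in> module_homs R M N" "g \<in> module_homs R N P"
  shows "(\<lambda>x. g (f x)) \<in> module_homs R M P"
  using module_homsD[OF assms(1)] module_homsD[OF assms(2)] by (auto intro!: module_homsI)

lemma module_homs_restr:
  assumes "f \<in> module_homs R M N" "U \<subseteq> carrier M"
  shows "f \<in> module_homs R (restr M U) N"
  using module_homsD[OF assms(1)] assms(2) by (auto intro!: module_homsI simp: subset_iff)

lemma module_homs_corestr:
  assumes "f \<in> module_homs R M N" "\<And>x. x \<in> carrier M \<Longrightarrow> f x \<in> Y"
  shows "f \<in> module_homs R M (restr N Y)"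
  using module_homsD[OF assms(1)] assms(2) by (auto intro!: module_homsI)

lemma module_homs_corestrD:
  assumes "f \<in> module_homs R M (restr N Y)" "Y \<subseteq> carrier N"
  shows "f \<in> module_homs R M N"
  using module_homsD[OF assms(1)] assms(2) by (auto intro!: module_homsI simp: subset_iff)

lemma module_homs_cong:
  assumes "f \<in> module_homs R M N" "module R M" "\<And>x. x \<in> carrier M \<Longrightarrow> g x = f x"
  shows "g \<in> module_homs R M N"
proof -
  interpret M: module R M by fact
  show ?thesis using module_homsD[OF assms(1)] assms(3) by (auto intro!: module_homsI)
qed

context
  fixes R :: "('a, 'c) ring_scheme" (structure) and M :: "('a, 'm) module"
  assumes M: "module R M"
begin

interpretation module R M by (rule M)

lemma homs_zero: "(\<lambda>x. \<zero>\<^bsub>M\<^esub>) \<in> module_homs R N M"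
  by (rule module_homsI) auto

lemma homs_add:
  assumes "f \<in> module_homs R N M" "g \<in> module_homs R N M"
  shows "(\<lambda>x. f x \<oplus>\<^bsub>M\<^esub> g x) \<in> module_homs R N M"
  using module_homsD[OF assms(1)] module_homsD[OF assms(2)]
  by (auto intro!: module_homsI simp: M.a_ac smult_r_distr)

lemma homs_smult:
  assumes "f \<in> module_homs R N M" "r \<in> carrier R"
  shows "(\<lambda>x. r \<odot>\<^bsub>M\<^esub> f x) \<in> module_homs R N M"
  using module_homsD[OF assms(1)] assms(2)
  by (auto intro!: module_homsI simp: smult_r_distr smult_assoc1[symmetric] R.m_comm)

lemma homs_neg:
  assumes "f \<in> module_homs R N M"
  shows "(\<lambda>x. \<ominus>\<^bsub>M\<^esub> f x) \<in> module_homs R N M"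
  using module_homsD[OF assms(1)]
  by (auto intro!: module_homsI simp: smult_r_minus M.minus_add)

lemma homs_diff:
  assumes "f \<in> module_homs R N M" "g \<in> module_homs R N M"
  shows "(\<lambda>x. f x \<ominus>\<^bsub>M\<^esub> g x) \<in> module_homs R N M"
  using homs_add[OF assms(1) homs_neg[OF assms(2)]] by (simp add: a_minus_def)

lemma homs_finsum:
  assumes "finite T" "\<And>t. t \<in> T \<Longrightarrow> f t \<in> module_homs R N M"
  shows "(\<lambda>x. \<Oplus>\<^bsub>M\<^esub>t\<in>T. f t x) \<in> module_homs R N M"
proof (rule module_homsI)
  note D = module_homsD[OF assms(2)]
  show "(\<Oplus>\<^bsub>M\<^esub>t\<in>T. f t x) \<in> carrier M" if "x \<in> carrier N" for x
    by (rule M.finsum_closed) (use that D in auto)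
  fix x assume x: "x \<in> carrier N"
  show "(\<Oplus>\<^bsub>M\<^esub>t\<in>T. f t (x \<oplus>\<^bsub>N\<^esub> y)) = (\<Oplus>\<^bsub>M\<^esub>t\<in>T. f t x) \<oplus>\<^bsub>M\<^esub> (\<Oplus>\<^bsub>M\<^esub>t\<in>T. f t y)"
    if y: "y \<in> carrier N" for y
  proof -
    have "(\<Oplus>\<^bsub>M\<^esub>t\<in>T. f t (x \<oplus>\<^bsub>N\<^esub> y)) = (\<Oplus>\<^bsub>M\<^esub>t\<in>T. f t x \<oplus>\<^bsub>M\<^esub> f t y)"
      by (rule M.finsum_cong') (use D x y in auto)
    also have "\<dots> = (\<Oplus>\<^bsub>M\<^esub>t\<in>T. f t x) \<oplus>\<^bsub>M\<^esub> (\<Oplus>\<^bsub>M\<^esub>t\<in>T. f t y)"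
      by (rule M.finsum_addf) (use D x y in auto)
    finally show ?thesis .
  qed
  show "(\<Oplus>\<^bsub>M\<^esub>t\<in>T. f t (a \<odot>\<^bsub>N\<^esub> x)) = a \<odot>\<^bsub>M\<^esub> (\<Oplus>\<^bsub>M\<^esub>t\<in>T. f t x)" if a: "a \<in> carrier R" for a
  proof -
    have "(\<Oplus>\<^bsub>M\<^esub>t\<in>T. f t (a \<odot>\<^bsub>N\<^esub> x)) = (\<Oplus>\<^bsub>M\<^esub>t\<in>T. a \<odot>\<^bsub>M\<^esub> f t x)"
      by (rule M.finsum_cong') (use D x a in auto)
    then show ?thesis using finsum_smult_ldistr[of T a "\<lambda>t. f t x"] assms(1) a D x by auto
  qed
qed

end

lemma (in module) finsum_in_submodule:
  assumes H: "submodule H R M" and "finite T" "\<And>t. t \<in> T \<Longrightarrow> f t \<in> H"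
  shows "(\<Oplus>\<^bsub>M\<^esub>t\<in>T. f t) \<in> H"
  using assms(2,3)
proof (induction T rule: finite_induct)
  case empty
  then show ?case using submodule_mem(2)[OF H] by simp
next
  case (insert t T)
  then have "(\<Oplus>\<^bsub>M\<^esub>t\<in>insert t T. f t) = f t \<oplus>\<^bsub>M\<^esub> (\<Oplus>\<^bsub>M\<^esub>t\<in>T. f t)"
    using submodule_mem(1)[OF H] by (intro M.finsum_insert) auto
  then show ?case using insert submodule_mem(3)[OF H] by auto
qed

context
  fixes R :: "('a, 'c) ring_scheme" and M :: "('a, 'm) module" and N :: "('a, 'n) module" and f
  assumes M: "module R M" and N: "module R N" and f: "f \<in> module_homs R M N"
begin

interpretation M: module R M by (rule M)
interpretation N: module R N by (rule N)

lemma module_homs_neg: "x \<in> carrier M \<Longrightarrow> f (\<ominus>\<^bsub>M\<^esub> x) = \<ominus>\<^bsub>N\<^esub> f x"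
  using module_homsD(3)[OF f, of "\<ominus>\<^bsub>R\<^esub> \<one>\<^bsub>R\<^esub>" x] module_homsD(1)[OF f, of x]
    M.smult_l_minus[of "\<one>\<^bsub>R\<^esub>" x] N.smult_l_minus[of "\<one>\<^bsub>R\<^esub>" "f x"] by simp

lemma module_homs_minus:
  "x \<in> carrier M \<Longrightarrow> y \<in> carrier M \<Longrightarrow> f (x \<ominus>\<^bsub>M\<^esub> y) = f x \<ominus>\<^bsub>N\<^esub> f y"
  using module_homsD(2)[OF f, of x "\<ominus>\<^bsub>M\<^esub> y"] module_homs_neg[of y] by (simp add: a_minus_def)

lemma module_homs_finsum_apply:
  assumes "finite T" "\<And>t. t \<in> T \<Longrightarrow> u t \<in> carrier M"
  shows "f (\<Oplus>\<^bsub>M\<^esub>t\<in>T. u t) = (\<Oplus>\<^bsub>N\<^esub>t\<in>T. f (u t))"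
  using assms
proof (induction T rule: finite_induct)
  case empty
  then show ?case using module_homs_zero[OF M N f] by simp
next
  case (insert t T)
  then have "u \<in> T \<rightarrow> carrier M" "(\<lambda>t. f (u t)) \<in> T \<rightarrow> carrier N" using module_homsD(1)[OF f] by auto
  then show ?case using insert module_homsD[OF f] by simp
qed

lemma submodule_image:
  assumes "submodule U R M" shows "submodule (f ` U) R N"
proof (rule N.submodule_intro)
  note x = M.submodule_mem[OF assms]
  show "f ` U \<subseteq> carrier N" using x module_homsD(1)[OF f] by auto
  show "\<zero>\<^bsub>N\<^esub> \<in> f ` U" using module_homs_zero[OF M N f] x(2) by (metis imageI)
  show "a \<oplus>\<^bsub>N\<^esub> b \<in> f ` U" if ab: "a \<in> f ` U" "b \<in> f ` U" for a b
  proof -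
    obtain u v where "u \<in> U" "v \<in> U" "a = f u" "b = f v" using ab by auto
    then show ?thesis using x module_homsD(2)[OF f, of u v] by (auto intro!: image_eqI[of _ _ "u \<oplus>\<^bsub>M\<^esub> v"])
  qed
  show "a \<odot>\<^bsub>N\<^esub> b \<in> f ` U" if ab: "a \<in> carrier R" "b \<in> f ` U" for a b
  proof -
    obtain u where "u \<in> U" "b = f u" using ab by auto
    then show ?thesis using x ab module_homsD(3)[OF f, of a u] by (auto intro!: image_eqI[of _ _ "a \<odot>\<^bsub>M\<^esub> u"])
  qed
qed

lemma submodule_vimage:
  assumes "submodule Y R N" shows "submodule {x \<in> carrier M. f x \<in> Y} R M"
  by (rule M.submodule_intro)
    (use N.submodule_mem[OF assms] module_homsD[OF f] module_homs_zero[OF M N f] in auto)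

lemma submodule_ker: "submodule (module_ker M N f) R M"
  using submodule_vimage[OF N.zero_submodule] by (simp add: module_ker_def)

text \<open>The universal property of the quotient by the kernel of \<open>f\<close>, with the image
  of \<open>f\<close> in the role of the quotient. It takes the place of quotient modules
  throughout.\<close>

lemma factor_through_image:
  assumes g: "g \<in> module_homs R M E" and E: "module R E"
    and ker: "\<And>x. x \<in> carrier M \<Longrightarrow> f x = \<zero>\<^bsub>N\<^esub> \<Longrightarrow> g x = \<zero>\<^bsub>E\<^esub>"
  shows "\<exists>h\<in>module_homs R (restr N (f ` carrier M)) E. \<forall>x\<in>carrier M. h (f x) = g x"
proof -
  interpret E: module R E by (rule E)
  note fD = module_homsD[OF f] and gD = module_homsD[OF g]
  define h where "h y = g (SOME x. x \<in> carrier M \<and> f x = y)" for y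
  have h: "h (f x) = g x" if x: "x \<in> carrier M" for x
  proof -
    define x' where "x' = (SOME x'. x' \<in> carrier M \<and> f x' = f x)"
    have x': "x' \<in> carrier M \<and> f x' = f x" unfolding x'_def by (rule someI[of _ x]) (use x in simp)
    have "f (x' \<ominus>\<^bsub>M\<^esub> x) = \<zero>\<^bsub>N\<^esub>" using module_homs_minus x x' fD(1) by (simp add: a_minus_def N.M.r_neg)
    then have "g (x' \<ominus>\<^bsub>M\<^esub> x) = \<zero>\<^bsub>E\<^esub>" using ker x x' by simp
    moreover have "g ((x' \<ominus>\<^bsub>M\<^esub> x) \<oplus>\<^bsub>M\<^esub> x) = g (x' \<ominus>\<^bsub>M\<^esub> x) \<oplus>\<^bsub>E\<^esub> g x" using gD(2) x x' by simp
    moreover have "(x' \<ominus>\<^bsub>M\<^esub> x) \<oplus>\<^bsub>M\<^esub> x = x'"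
      using x x' by (simp add: a_minus_def M.M.a_assoc M.M.l_neg)
    ultimately have "g x' = g x" using gD(1) x by simp
    then show ?thesis unfolding h_def x'_def .
  qed
  have "h \<in> module_homs R (restr N (f ` carrier M)) E"
  proof (rule module_homsI)
    fix y assume "y \<in> carrier (restr N (f ` carrier M))"
    then obtain x where x: "x \<in> carrier M" "y = f x" by auto
    show "h y \<in> carrier E" using x h gD by simp
    show "h (y \<oplus>\<^bsub>restr N (f ` carrier M)\<^esub> y') = h y \<oplus>\<^bsub>E\<^esub> h y'"
      if y': "y' \<in> carrier (restr N (f ` carrier M))" for y'
    proof -
      obtain x' where x': "x' \<in> carrier M" "y' = f x'" using y' by auto
      have "h (f (x \<oplus>\<^bsub>M\<^esub> x')) = h (f x) \<oplus>\<^bsub>E\<^esub> h (f x')" using x x' by (simp add: h gD)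
      then show ?thesis using x x' by (simp add: fD)
    qed
    show "h (a \<odot>\<^bsub>restr N (f ` carrier M)\<^esub> y) = a \<odot>\<^bsub>E\<^esub> h y" if a: "a \<in> carrier R" for a
    proof -
      have "h (f (a \<odot>\<^bsub>M\<^esub> x)) = a \<odot>\<^bsub>E\<^esub> h (f x)" using x a by (simp add: h gD)
      then show ?thesis using x a by (simp add: fD)
    qed
  qed
  then show ?thesis using h by blast
qed

end

lemma injective_extend:
  assumes "injective_module R E" "module R N" "submodule U R N" "f \<in> module_homs R (restr N U) E"
  shows "\<exists>g\<in>module_homs R N E. \<forall>x\<in>U. g x = f x"
proof -
  interpret N: module R N by fact
  have "id \<in> module_homs R (restr N U) N"
    using N.submodule_mem(1)[OF assms(3)] by (auto simp: module_homs_def)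
  then show ?thesis
    using injective_module_extends[OF assms(1) module_restr[OF assms(2,3)] assms(2) _ assms(4), of id] by auto
qed

text \<open>Both finitely generated free modules and their duals have a dual basis, and it suffices for
  lifting homomorphisms.\<close>

definition dual_basis ::
    "('a, 'c) ring_scheme \<Rightarrow> ('a, 'm) module \<Rightarrow> 'i set \<Rightarrow> ('i \<Rightarrow> 'm) \<Rightarrow> ('i \<Rightarrow> 'm \<Rightarrow> 'a) \<Rightarrow> bool" where
  "dual_basis R P T p \<pi> \<longleftrightarrow> finite T \<and> p \<in> T \<rightarrow> carrier P \<and>
     (\<forall>t\<in>T. \<pi> t \<in> module_homs R P (ring_as_module R)) \<and>
     (\<forall>x\<in>carrier P. x = (\<Oplus>\<^bsub>P\<^esub>t\<in>T. \<pi> t x \<odot>\<^bsub>P\<^esub> p t))"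

lemma dual_basis_coord:
  assumes "dual_basis R P T p \<pi>" "t \<in> T"
  shows "x \<in> carrier P \<Longrightarrow> \<pi> t x \<in> carrier R"
    and "x \<in> carrier P \<Longrightarrow> y \<in> carrier P \<Longrightarrow> \<pi> t (x \<oplus>\<^bsub>P\<^esub> y) = \<pi> t x \<oplus>\<^bsub>R\<^esub> \<pi> t y"
    and "a \<in> carrier R \<Longrightarrow> x \<in> carrier P \<Longrightarrow> \<pi> t (a \<odot>\<^bsub>P\<^esub> x) = a \<otimes>\<^bsub>R\<^esub> \<pi> t x"
    and "p t \<in> carrier P"
proof -
  have "\<pi> t \<in> module_homs R P (ring_as_module R)" using assms by (auto simp: dual_basis_def)
  note D = module_homsD[OF this]
  show "x \<in> carrier P \<Longrightarrow> \<pi> t x \<in> carrier R"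
    "x \<in> carrier P \<Longrightarrow> y \<in> carrier P \<Longrightarrow> \<pi> t (x \<oplus>\<^bsub>P\<^esub> y) = \<pi> t x \<oplus>\<^bsub>R\<^esub> \<pi> t y"
    "a \<in> carrier R \<Longrightarrow> x \<in> carrier P \<Longrightarrow> \<pi> t (a \<odot>\<^bsub>P\<^esub> x) = a \<otimes>\<^bsub>R\<^esub> \<pi> t x"
    using D by simp_all
  show "p t \<in> carrier P" using assms by (auto simp: dual_basis_def)
qed

lemma dual_basis_hom:
  assumes P: "dual_basis R P T p \<pi>" and M: "module R M" and u: "\<And>t. t \<in> T \<Longrightarrow> u t \<in> carrier M"
  shows "(\<lambda>x. \<Oplus>\<^bsub>M\<^esub>t\<in>T. \<pi> t x \<odot>\<^bsub>M\<^esub> u t) \<in> module_homs R P M"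
proof -
  interpret M: module R M by fact
  show ?thesis
  proof (rule homs_finsum[OF M])
    show "finite T" using P by (simp add: dual_basis_def)
    fix t assume t: "t \<in> T"
    note c = dual_basis_coord[OF P t]
    show "(\<lambda>x. \<pi> t x \<odot>\<^bsub>M\<^esub> u t) \<in> module_homs R P M"
      by (rule module_homsI) (use c u[OF t] in \<open>auto simp: M.smult_l_distr M.smult_assoc1\<close>)
  qed
qed

lemma dual_basis_expand:
  assumes P: "dual_basis R P T p \<pi>" "module R P" and M: "module R M" and f: "f \<in> module_homs R P M"
    and x: "x \<in> carrier P"
  shows "f x = (\<Oplus>\<^bsub>M\<^esub>t\<in>T. \<pi> t x \<odot>\<^bsub>M\<^esub> f (p t))"
proof -
  interpret P: module R P by fact
  interpret M: module R M by fact
  note c = dual_basis_coord[OF P(1)]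
  have T: "finite T" using P by (simp add: dual_basis_def)
  have "x = (\<Oplus>\<^bsub>P\<^esub>t\<in>T. \<pi> t x \<odot>\<^bsub>P\<^esub> p t)" using P(1) x unfolding dual_basis_def by blast
  then have "f x = f (\<Oplus>\<^bsub>P\<^esub>t\<in>T. \<pi> t x \<odot>\<^bsub>P\<^esub> p t)" by simp
  also have "\<dots> = (\<Oplus>\<^bsub>M\<^esub>t\<in>T. f (\<pi> t x \<odot>\<^bsub>P\<^esub> p t))"
    by (rule module_homs_finsum_apply[OF P(2) M f T]) (use c x in auto)
  also have "\<dots> = (\<Oplus>\<^bsub>M\<^esub>t\<in>T. \<pi> t x \<odot>\<^bsub>M\<^esub> f (p t))"
    by (rule M.finsum_cong') (use c x module_homsD[OF f] in auto)
  finally show ?thesis .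
qed

text \<open>Projectivity: preimages are chosen for the finitely many elements \<open>f (p t)\<close>
  and combined by the coordinates.\<close>

lemma dual_basis_lift:
  assumes P: "dual_basis R P T p \<pi>" "module R P" and M: "module R M" and N: "module R N"
    and q: "q \<in> module_homs R M N" and f: "f \<in> module_homs R P N"
    and onto: "\<And>x. x \<in> carrier P \<Longrightarrow> f x \<in> q ` carrier M"
  shows "\<exists>g\<in>module_homs R P M. \<forall>x\<in>carrier P. q (g x) = f x"
proof -
  interpret M: module R M by fact
  interpret N: module R N by fact
  note c = dual_basis_coord[OF P(1)]
  have T: "finite T" using P by (simp add: dual_basis_def)
  have "\<forall>t\<in>T. \<exists>m\<in>carrier M. q m = f (p t)" using onto c(4) by force
  then obtain u where u: "\<And>t. t \<in> T \<Longrightarrow> u t \<in> carrier M" "\<And>t. t \<in> T \<Longrightarrow> q (u t) = f (p t)" by metis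
  let ?g = "\<lambda>x. \<Oplus>\<^bsub>M\<^esub>t\<in>T. \<pi> t x \<odot>\<^bsub>M\<^esub> u t"
  have "q (?g x) = f x" if x: "x \<in> carrier P" for x
  proof -
    have "q (?g x) = (\<Oplus>\<^bsub>N\<^esub>t\<in>T. q (\<pi> t x \<odot>\<^bsub>M\<^esub> u t))"
      by (rule module_homs_finsum_apply[OF M N q T]) (use c x u in auto)
    also have "\<dots> = (\<Oplus>\<^bsub>N\<^esub>t\<in>T. \<pi> t x \<odot>\<^bsub>N\<^esub> f (p t))"
      by (rule N.finsum_cong') (use c x u module_homsD[OF q] module_homsD[OF f] in auto)
    also have "\<dots> = f x" using dual_basis_expand[OF P N f x] by simp
    finally show ?thesis .
  qed
  moreover have "?g \<in> module_homs R P M" by (rule dual_basis_hom[OF P(1) M u(1)])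
  ultimately show ?thesis by (intro bexI[of _ ?g] ballI)
qed

text \<open>The coordinates come from unique existence, and uniqueness again makes them linear and
  gives the Kronecker relations on the basis.\<close>

lemma finite_free_dual_basis:
  assumes "finite_free_module R F"
  shows "\<exists>B \<pi>. dual_basis R F B (\<lambda>b. b) \<pi> \<and>
    (\<forall>b\<in>B. \<forall>b'\<in>B. \<pi> b b' = (if b = b' then \<one>\<^bsub>R\<^esub> else \<zero>\<^bsub>R\<^esub>))"
proof -
  have F: "module R F" using assms by (simp add: finite_free_module_def)
  interpret F: module R F by fact
  obtain B where B: "B \<subseteq> carrier F" "finite B"
    and ex1: "\<And>x. x \<in> carrier F \<Longrightarrow> \<exists>!c. c \<in> B \<rightarrow>\<^sub>E carrier R \<and> x = (\<Oplus>\<^bsub>F\<^esub>b\<in>B. c b \<odot>\<^bsub>F\<^esub> b)"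
    using assms unfolding finite_free_module_def by auto
  define \<pi>' where "\<pi>' x = (THE c. c \<in> B \<rightarrow>\<^sub>E carrier R \<and> x = (\<Oplus>\<^bsub>F\<^esub>b\<in>B. c b \<odot>\<^bsub>F\<^esub> b))" for x
  have \<pi>': "\<pi>' x \<in> B \<rightarrow>\<^sub>E carrier R" "x = (\<Oplus>\<^bsub>F\<^esub>b\<in>B. \<pi>' x b \<odot>\<^bsub>F\<^esub> b)" if "x \<in> carrier F" for x
    using theI'[OF ex1[OF that]] unfolding \<pi>'_def by blast+
  have uniq: "\<pi>' x b = c b" if "x \<in> carrier F" "\<And>b. b \<in> B \<Longrightarrow> c b \<in> carrier R" "x = (\<Oplus>\<^bsub>F\<^esub>b\<in>B. c b \<odot>\<^bsub>F\<^esub> b)" "b \<in> B"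
    for x c b
  proof -
    have "(\<Oplus>\<^bsub>F\<^esub>b\<in>B. c b \<odot>\<^bsub>F\<^esub> b) = (\<Oplus>\<^bsub>F\<^esub>b\<in>B. restrict c B b \<odot>\<^bsub>F\<^esub> b)"
      by (rule F.finsum_cong') (use that(2) B in auto)
    then have "restrict c B \<in> B \<rightarrow>\<^sub>E carrier R \<and> x = (\<Oplus>\<^bsub>F\<^esub>b\<in>B. restrict c B b \<odot>\<^bsub>F\<^esub> b)"
      using that by auto
    then have "\<pi>' x = restrict c B" using \<pi>'[OF that(1)] ex1[OF that(1)] by blast
    then show ?thesis using that(4) by simp
  qed
  have cl: "\<pi>' x b \<in> carrier R" if "x \<in> carrier F" "b \<in> B" for x b
    using \<pi>'(1)[OF that(1)] that(2) by auto
  have Bc: "b \<in> carrier F" if "b \<in> B" for b using B that by auto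
  have hom: "(\<lambda>x. \<pi>' x b) \<in> module_homs R F (ring_as_module R)" if b: "b \<in> B" for b
  proof (rule module_homsI)
    fix x assume x: "x \<in> carrier F"
    show "\<pi>' x b \<in> carrier (ring_as_module R)" using cl x b by simp
    show "\<pi>' (x \<oplus>\<^bsub>F\<^esub> y) b = \<pi>' x b \<oplus>\<^bsub>ring_as_module R\<^esub> \<pi>' y b" if y: "y \<in> carrier F" for y
    proof -
      have "x \<oplus>\<^bsub>F\<^esub> y = (\<Oplus>\<^bsub>F\<^esub>b\<in>B. \<pi>' x b \<odot>\<^bsub>F\<^esub> b) \<oplus>\<^bsub>F\<^esub> (\<Oplus>\<^bsub>F\<^esub>b\<in>B. \<pi>' y b \<odot>\<^bsub>F\<^esub> b)"
        using \<pi>'(2)[OF x] \<pi>'(2)[OF y] by simp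
      also have "\<dots> = (\<Oplus>\<^bsub>F\<^esub>b\<in>B. \<pi>' x b \<odot>\<^bsub>F\<^esub> b \<oplus>\<^bsub>F\<^esub> \<pi>' y b \<odot>\<^bsub>F\<^esub> b)"
        by (rule F.finsum_addf[symmetric]) (use cl Bc x y in auto)
      also have "\<dots> = (\<Oplus>\<^bsub>F\<^esub>b\<in>B. (\<pi>' x b \<oplus>\<^bsub>R\<^esub> \<pi>' y b) \<odot>\<^bsub>F\<^esub> b)"
        by (rule F.finsum_cong') (use cl Bc x y in \<open>auto simp: F.smult_l_distr\<close>)
      finally have eq: "x \<oplus>\<^bsub>F\<^esub> y = (\<Oplus>\<^bsub>F\<^esub>b\<in>B. (\<pi>' x b \<oplus>\<^bsub>R\<^esub> \<pi>' y b) \<odot>\<^bsub>F\<^esub> b)" .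
      have "\<pi>' (x \<oplus>\<^bsub>F\<^esub> y) b = \<pi>' x b \<oplus>\<^bsub>R\<^esub> \<pi>' y b"
        by (rule uniq[OF _ _ eq b]) (use cl x y in auto)
      then show ?thesis by simp
    qed
    show "\<pi>' (a \<odot>\<^bsub>F\<^esub> x) b = a \<odot>\<^bsub>ring_as_module R\<^esub> \<pi>' x b" if a: "a \<in> carrier R" for a
    proof -
      have "a \<odot>\<^bsub>F\<^esub> x = a \<odot>\<^bsub>F\<^esub> (\<Oplus>\<^bsub>F\<^esub>b\<in>B. \<pi>' x b \<odot>\<^bsub>F\<^esub> b)" using \<pi>'(2)[OF x] by simp
      also have "\<dots> = (\<Oplus>\<^bsub>F\<^esub>b\<in>B. a \<odot>\<^bsub>F\<^esub> (\<pi>' x b \<odot>\<^bsub>F\<^esub> b))"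
        by (rule F.finsum_smult_ldistr) (use cl Bc x a B in auto)
      also have "\<dots> = (\<Oplus>\<^bsub>F\<^esub>b\<in>B. (a \<otimes>\<^bsub>R\<^esub> \<pi>' x b) \<odot>\<^bsub>F\<^esub> b)"
        by (rule F.finsum_cong') (use cl Bc x a in \<open>auto simp: F.smult_assoc1\<close>)
      finally have eq: "a \<odot>\<^bsub>F\<^esub> x = (\<Oplus>\<^bsub>F\<^esub>b\<in>B. (a \<otimes>\<^bsub>R\<^esub> \<pi>' x b) \<odot>\<^bsub>F\<^esub> b)" .
      have "\<pi>' (a \<odot>\<^bsub>F\<^esub> x) b = a \<otimes>\<^bsub>R\<^esub> \<pi>' x b"
        by (rule uniq[OF _ _ eq b]) (use cl x a in auto)
      then show ?thesis by simp
    qed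
  qed
  have delta: "\<pi>' b' b = (if b = b' then \<one>\<^bsub>R\<^esub> else \<zero>\<^bsub>R\<^esub>)" if b: "b \<in> B" "b' \<in> B" for b b'
  proof (rule uniq)
    have "(\<Oplus>\<^bsub>F\<^esub>b\<in>B. (if b = b' then \<one>\<^bsub>R\<^esub> else \<zero>\<^bsub>R\<^esub>) \<odot>\<^bsub>F\<^esub> b) = (\<Oplus>\<^bsub>F\<^esub>b\<in>B. if b' = b then b else \<zero>\<^bsub>F\<^esub>)"
      by (rule F.finsum_cong') (use Bc in auto)
    also have "\<dots> = b'" by (rule F.add.finprod_singleton[OF b(2) B(2)]) (use Bc in auto)
    finally show "b' = (\<Oplus>\<^bsub>F\<^esub>b\<in>B. (if b = b' then \<one>\<^bsub>R\<^esub> else \<zero>\<^bsub>R\<^esub>) \<odot>\<^bsub>F\<^esub> b)" by simp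
  qed (use b Bc in auto)
  have "dual_basis R F B (\<lambda>b. b) (\<lambda>b x. \<pi>' x b)"
    unfolding dual_basis_def using B hom \<pi>'(2) by auto
  then show ?thesis using delta by (intro exI[of _ B] exI[of _ "\<lambda>b x. \<pi>' x b"]) auto
qed

section \<open>Extending homomorphisms one element at a time\<close>

text \<open>Zorn's lemma for partial homomorphisms, which are encoded by their graphs.\<close>

theorem extension_by_steps:
  fixes R :: "('a, 'c) ring_scheme" and N :: "('a, 'm) module" and E :: "('a, 'n) module"
  assumes N: "module R N" and E: "module R E" and X0: "submodule X0 R N"
    and f: "f \<in> module_homs R (restr N X0) E"
    and step: "\<And>Y g z. submodule Y R N \<Longrightarrow> X0 \<subseteq> Y \<Longrightarrow> g \<in> module_homs R (restr N Y) E \<Longrightarrow>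
      (\<And>x. x \<in> X0 \<Longrightarrow> g x = f x) \<Longrightarrow> z \<in> carrier N \<Longrightarrow>
      \<exists>w\<in>carrier E. \<forall>a\<in>carrier R. a \<odot>\<^bsub>N\<^esub> z \<in> Y \<longrightarrow> g (a \<odot>\<^bsub>N\<^esub> z) = a \<odot>\<^bsub>E\<^esub> w"
  shows "\<exists>g\<in>module_homs R N E. \<forall>x\<in>X0. g x = f x"
proof -
  interpret N: module R N by fact
  interpret E: module R E by fact
  note fD = module_homsD[OF f, simplified]
  note x0 = N.submodule_mem[OF X0]
  define closed where "closed G \<longleftrightarrow>
     (\<forall>x y x' y'. (x, y) \<in> G \<longrightarrow> (x', y') \<in> G \<longrightarrow> (x \<oplus>\<^bsub>N\<^esub> x', y \<oplus>\<^bsub>E\<^esub> y') \<in> G) \<and>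
     (\<forall>a x y. a \<in> carrier R \<longrightarrow> (x, y) \<in> G \<longrightarrow> (a \<odot>\<^bsub>N\<^esub> x, a \<odot>\<^bsub>E\<^esub> y) \<in> G)"
    for G :: "('m \<times> 'n) set"
  have closedD: "(x \<oplus>\<^bsub>N\<^esub> x', y \<oplus>\<^bsub>E\<^esub> y') \<in> G" "a \<in> carrier R \<Longrightarrow> (a \<odot>\<^bsub>N\<^esub> x, a \<odot>\<^bsub>E\<^esub> y) \<in> G"
    if "closed G" "(x, y) \<in> G" "(x', y') \<in> G" for G x x' y y' a
    using that unfolding closed_def by blast+
  define G0 where "G0 = (\<lambda>x. (x, f x)) ` X0"
  define \<P> where "\<P> = {G. G0 \<subseteq> G \<and> G \<subseteq> carrier N \<times> carrier E \<and> closed G \<and>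
     (\<forall>y. (\<zero>\<^bsub>N\<^esub>, y) \<in> G \<longrightarrow> y = \<zero>\<^bsub>E\<^esub>)}"
  have f0: "f \<zero>\<^bsub>N\<^esub> = \<zero>\<^bsub>E\<^esub>"
    using module_homs_zero[OF module_restr[OF N X0] E f] by simp
  have "closed G0"
    unfolding closed_def
  proof (intro conjI allI impI)
    fix x y x' y' assume "(x, y) \<in> G0" "(x', y') \<in> G0"
    then show "(x \<oplus>\<^bsub>N\<^esub> x', y \<oplus>\<^bsub>E\<^esub> y') \<in> G0"
      unfolding G0_def using x0(3) fD(2) by fastforce
  next
    fix a x y assume "a \<in> carrier R" "(x, y) \<in> G0"
    then show "(a \<odot>\<^bsub>N\<^esub> x, a \<odot>\<^bsub>E\<^esub> y) \<in> G0"
      unfolding G0_def using x0(6) fD(3) by fastforce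
  qed
  then have G0P: "G0 \<in> \<P>"
    using f0 x0(1) fD(1) by (auto simp: \<P>_def G0_def)
  have "\<exists>M\<in>\<P>. \<forall>G\<in>\<P>. M \<subseteq> G \<longrightarrow> G = M"
  proof (rule subset_Zorn_nonempty)
    show "\<P> \<noteq> {}" using G0P by blast
    fix C assume C: "C \<noteq> {}" "subset.chain \<P> C"
    then have CP: "\<And>G. G \<in> C \<Longrightarrow> G \<in> \<P>" and
      tot: "\<And>G H. G \<in> C \<Longrightarrow> H \<in> C \<Longrightarrow> G \<subseteq> H \<or> H \<subseteq> G"
      by (auto simp: subset_chain_def)
    have "closed (\<Union>C)"
      unfolding closed_def
    proof (intro conjI allI impI; elim UnionE)
      fix x y x' y' G H
      assume *: "(x, y) \<in> G" "G \<in> C" "(x', y') \<in> H" "H \<in> C"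
      then obtain K where K: "K \<in> C" "(x, y) \<in> K" "(x', y') \<in> K" using tot by blast
      then show "(x \<oplus>\<^bsub>N\<^esub> x', y \<oplus>\<^bsub>E\<^esub> y') \<in> \<Union>C"
        using closedD(1)[of K x y x' y'] CP[of K] by (auto simp: \<P>_def)
    next
      fix a x y G
      assume *: "a \<in> carrier R" "(x, y) \<in> G" "G \<in> C"
      then show "(a \<odot>\<^bsub>N\<^esub> x, a \<odot>\<^bsub>E\<^esub> y) \<in> \<Union>C"
        using closedD(2)[of G x y x y a] CP[of G] by (auto simp: \<P>_def)
    qed
    then show "\<Union>C \<in> \<P>"
      using CP C(1) unfolding \<P>_def by blast
  qed
  then obtain G where GP: "G \<in> \<P>" and max: "\<And>H. H \<in> \<P> \<Longrightarrow> G \<subseteq> H \<Longrightarrow> H = G" by blast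
  have G0: "G0 \<subseteq> G" and Gsub: "G \<subseteq> carrier N \<times> carrier E" and Gcl: "closed G"
    and G_zero: "\<And>y. (\<zero>\<^bsub>N\<^esub>, y) \<in> G \<Longrightarrow> y = \<zero>\<^bsub>E\<^esub>"
    using GP by (auto simp: \<P>_def)
  have G_add: "(x \<oplus>\<^bsub>N\<^esub> x', y \<oplus>\<^bsub>E\<^esub> y') \<in> G" if "(x, y) \<in> G" "(x', y') \<in> G" for x y x' y'
    using closedD(1)[OF Gcl that] .
  have G_smult: "(a \<odot>\<^bsub>N\<^esub> x, a \<odot>\<^bsub>E\<^esub> y) \<in> G" if "a \<in> carrier R" "(x, y) \<in> G" for a x y
    using closedD(2)[OF Gcl that(2,2,1)] .
  have G_carr: "x \<in> carrier N" "y \<in> carrier E" if "(x, y) \<in> G" for x y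
    using Gsub that by auto
  have G_minus: "(\<ominus>\<^bsub>N\<^esub> x, \<ominus>\<^bsub>E\<^esub> y) \<in> G" if "(x, y) \<in> G" for x y
    using G_smult[OF _ that, of "\<ominus>\<^bsub>R\<^esub> \<one>\<^bsub>R\<^esub>"] G_carr[OF that]
      N.smult_l_minus[of "\<one>\<^bsub>R\<^esub>" x] E.smult_l_minus[of "\<one>\<^bsub>R\<^esub>" y] by simp
  have G_fun: "y = y'" if "(x, y) \<in> G" "(x, y') \<in> G" for x y y'
  proof -
    have "(x \<oplus>\<^bsub>N\<^esub> \<ominus>\<^bsub>N\<^esub> x, y \<oplus>\<^bsub>E\<^esub> \<ominus>\<^bsub>E\<^esub> y') \<in> G"
      using that by (intro G_add G_minus)
    then have "y \<oplus>\<^bsub>E\<^esub> \<ominus>\<^bsub>E\<^esub> y' = \<zero>\<^bsub>E\<^esub>"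
      using G_zero G_carr[OF that(1)] by (simp add: N.M.r_neg)
    then show ?thesis
      using G_carr[OF that(1)] G_carr[OF that(2)] E.M.minus_equality[of y "\<ominus>\<^bsub>E\<^esub> y'"] by simp
  qed
  define Y where "Y = fst ` G"
  define g where "g x = (THE y. (x, y) \<in> G)" for x
  have g: "g x = y" if "(x, y) \<in> G" for x y
    unfolding g_def using that G_fun by blast
  have gG: "(x, g x) \<in> G" if "x \<in> Y" for x
    using that g by (auto simp: Y_def)
  have YI: "x \<in> Y" if "(x, y) \<in> G" for x y using that by (force simp: Y_def)
  have gf: "g x = f x" if "x \<in> X0" for x
    using G0 YI g that by (auto simp: G0_def)
  have X0Y: "X0 \<subseteq> Y" using G0 YI by (auto simp: G0_def)
  have Y: "submodule Y R N"
  proof (rule N.submodule_intro)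
    show "Y \<subseteq> carrier N" using G_carr by (auto simp: Y_def)
    show "\<zero>\<^bsub>N\<^esub> \<in> Y" using X0Y x0 by blast
    show "a \<oplus>\<^bsub>N\<^esub> b \<in> Y" if "a \<in> Y" "b \<in> Y" for a b
      using YI[OF G_add[OF gG[OF that(1)] gG[OF that(2)]]] .
    show "a \<odot>\<^bsub>N\<^esub> b \<in> Y" if "a \<in> carrier R" "b \<in> Y" for a b
      using YI[OF G_smult[OF that(1) gG[OF that(2)]]] .
  qed
  have ghom: "g \<in> module_homs R (restr N Y) E"
    using g[OF G_add[OF gG gG]] g[OF G_smult[OF _ gG]] G_carr(2)[OF gG] by (auto simp: module_homs_def)
  have G00: "(\<zero>\<^bsub>N\<^esub>, \<zero>\<^bsub>E\<^esub>) \<in> G"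
    using G0 f0 x0(2) by (force simp: G0_def)
  have dom: "x \<in> Y" if x: "x \<in> carrier N" for x
  proof -
    obtain z where z: "z \<in> carrier E"
      and gz: "\<And>a. a \<in> carrier R \<Longrightarrow> a \<odot>\<^bsub>N\<^esub> x \<in> Y \<Longrightarrow> g (a \<odot>\<^bsub>N\<^esub> x) = a \<odot>\<^bsub>E\<^esub> z"
      using step[OF Y X0Y ghom gf x] by blast
    define H where "H = {(u \<oplus>\<^bsub>N\<^esub> a \<odot>\<^bsub>N\<^esub> x, v \<oplus>\<^bsub>E\<^esub> a \<odot>\<^bsub>E\<^esub> z) | u v a. (u, v) \<in> G \<and> a \<in> carrier R}"
    have HI: "(s, t) \<in> H"
      if "(u, v) \<in> G" "a \<in> carrier R" "s = u \<oplus>\<^bsub>N\<^esub> a \<odot>\<^bsub>N\<^esub> x" "t = v \<oplus>\<^bsub>E\<^esub> a \<odot>\<^bsub>E\<^esub> z" for u v a s t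
      using that unfolding H_def by blast
    have GH: "G \<subseteq> H"
    proof clarify
      fix u v assume "(u, v) \<in> G"
      then show "(u, v) \<in> H"
        by (rule HI[OF _ N.R.zero_closed]) (use G_carr[OF \<open>(u, v) \<in> G\<close>] x z in simp_all)
    qed
    have "closed H"
      unfolding closed_def
    proof (intro conjI allI impI)
      fix s t s' t' assume "(s, t) \<in> H" "(s', t') \<in> H"
      then obtain u v a u' v' a' where *: "(u, v) \<in> G" "a \<in> carrier R" "(u', v') \<in> G" "a' \<in> carrier R"
        "s = u \<oplus>\<^bsub>N\<^esub> a \<odot>\<^bsub>N\<^esub> x" "t = v \<oplus>\<^bsub>E\<^esub> a \<odot>\<^bsub>E\<^esub> z"
        "s' = u' \<oplus>\<^bsub>N\<^esub> a' \<odot>\<^bsub>N\<^esub> x" "t' = v' \<oplus>\<^bsub>E\<^esub> a' \<odot>\<^bsub>E\<^esub> z"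
        unfolding H_def by blast
      note c = G_carr[OF *(1)] G_carr[OF *(3)]
      show "(s \<oplus>\<^bsub>N\<^esub> s', t \<oplus>\<^bsub>E\<^esub> t') \<in> H"
        by (rule HI[OF G_add[OF *(1,3)], of "a \<oplus>\<^bsub>R\<^esub> a'"])
          (use * c x z in \<open>simp_all add: N.smult_l_distr E.smult_l_distr N.M.a_ac E.M.a_ac\<close>)
    next
      fix b s t assume b: "b \<in> carrier R" and "(s, t) \<in> H"
      then obtain u v a where *: "(u, v) \<in> G" "a \<in> carrier R"
        "s = u \<oplus>\<^bsub>N\<^esub> a \<odot>\<^bsub>N\<^esub> x" "t = v \<oplus>\<^bsub>E\<^esub> a \<odot>\<^bsub>E\<^esub> z"
        unfolding H_def by blast
      note c = G_carr[OF *(1)]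
      show "(b \<odot>\<^bsub>N\<^esub> s, b \<odot>\<^bsub>E\<^esub> t) \<in> H"
        by (rule HI[OF G_smult[OF b *(1)], of "b \<otimes>\<^bsub>R\<^esub> a"])
          (use * b c x z in \<open>simp_all add: N.smult_r_distr E.smult_r_distr N.smult_assoc1 E.smult_assoc1\<close>)
    qed
    moreover have "t = \<zero>\<^bsub>E\<^esub>" if t: "(\<zero>\<^bsub>N\<^esub>, t) \<in> H" for t
    proof -
      obtain u v a where *: "(u, v) \<in> G" "a \<in> carrier R"
        "\<zero>\<^bsub>N\<^esub> = u \<oplus>\<^bsub>N\<^esub> a \<odot>\<^bsub>N\<^esub> x" "t = v \<oplus>\<^bsub>E\<^esub> a \<odot>\<^bsub>E\<^esub> z"
        using t unfolding H_def by blast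
      note c = G_carr[OF *(1)]
      have "\<ominus>\<^bsub>N\<^esub> u = a \<odot>\<^bsub>N\<^esub> x"
        using *(2,3) c(1) x N.M.minus_equality[of "a \<odot>\<^bsub>N\<^esub> x" u] by (simp add: N.M.a_comm)
      then have G': "(a \<odot>\<^bsub>N\<^esub> x, \<ominus>\<^bsub>E\<^esub> v) \<in> G" using G_minus[OF *(1)] by simp
      then have "a \<odot>\<^bsub>E\<^esub> z = \<ominus>\<^bsub>E\<^esub> v"
        using gz[OF *(2) YI[OF G']] g[OF G'] by simp
      then show ?thesis using * c by (simp add: E.M.r_neg)
    qed
    moreover have "H \<subseteq> carrier N \<times> carrier E"
      using x z by (auto simp: H_def dest: G_carr)
    ultimately have "H \<in> \<P>" using G0 GH by (simp add: \<P>_def)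
    then have "H = G" using max GH by blast
    moreover have "(x, z) \<in> H"
      by (rule HI[OF G00 N.R.one_closed]) (use x z in simp_all)
    ultimately show ?thesis using YI by blast
  qed
  then have "Y = carrier N" using N.submodule_mem(1)[OF Y] by blast
  then have "g \<in> module_homs R N E" using ghom by (simp add: module_homs_def)
  then show ?thesis using gf by blast
qed

text \<open>For \<open>z\<close> outside \<open>Y\<close>, the scalars that take \<open>z\<close>
  into \<open>Y\<close> are exactly those of \<open>\<mm>\<close>: these send \<open>z\<close> into
  \<open>X0\<close>, and all others are units. The condition for adjoining \<open>z\<close>
  therefore concerns \<open>\<mm>\<close> only.\<close>

lemma (in noetherian_local) extension_over_residue:
  fixes N :: "('a, 'm) module" and E :: "('a, 'n) module"
  assumes N: "module R N" and E: "module R E" and X0: "submodule X0 R N"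
    and f: "f \<in> module_homs R (restr N X0) E"
    and kill: "\<And>a z. a \<in> \<mm> \<Longrightarrow> z \<in> carrier N \<Longrightarrow> a \<odot>\<^bsub>N\<^esub> z \<in> X0"
    and step: "\<And>Y g z. submodule Y R N \<Longrightarrow> X0 \<subseteq> Y \<Longrightarrow> g \<in> module_homs R (restr N Y) E \<Longrightarrow>
      (\<And>x. x \<in> X0 \<Longrightarrow> g x = f x) \<Longrightarrow> z \<in> carrier N \<Longrightarrow> z \<notin> Y \<Longrightarrow>
      \<exists>w\<in>carrier E. \<forall>a\<in>\<mm>. g (a \<odot>\<^bsub>N\<^esub> z) = a \<odot>\<^bsub>E\<^esub> w"
  shows "\<exists>g\<in>module_homs R N E. \<forall>x\<in>X0. g x = f x"
proof (rule extension_by_steps[OF N E X0 f])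
  fix Y g z
  assume *: "submodule Y R N" "X0 \<subseteq> Y" "g \<in> module_homs R (restr N Y) E"
    "\<And>x. x \<in> X0 \<Longrightarrow> g x = f x" "z \<in> carrier N"
  note gD = module_homsD[OF *(3), simplified]
  show "\<exists>w\<in>carrier E. \<forall>a\<in>carrier R. a \<odot>\<^bsub>N\<^esub> z \<in> Y \<longrightarrow> g (a \<odot>\<^bsub>N\<^esub> z) = a \<odot>\<^bsub>E\<^esub> w"
  proof (cases "z \<in> Y")
    case True
    then show ?thesis using gD by blast
  next
    case False
    have "a \<in> \<mm>" if "a \<in> carrier R" "a \<odot>\<^bsub>N\<^esub> z \<in> Y" for a
      using module_saturated[OF N *(1), of a z] that *(5) False by blast
    then show ?thesis using step[OF * False] by blast
  qed
qed

section \<open>Vanishing of Ext along an injective resolution\<close>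

context module
begin

lemma diff_zero: "v \<in> carrier M \<Longrightarrow> v \<ominus>\<^bsub>M\<^esub> \<zero>\<^bsub>M\<^esub> = v"
  by (simp add: a_minus_def)

lemma diff_self: "v \<in> carrier M \<Longrightarrow> v \<ominus>\<^bsub>M\<^esub> v = \<zero>\<^bsub>M\<^esub>"
  by (simp add: a_minus_def M.r_neg)

lemma diff_add_cancel: "v \<in> carrier M \<Longrightarrow> w \<in> carrier M \<Longrightarrow> (v \<ominus>\<^bsub>M\<^esub> w) \<oplus>\<^bsub>M\<^esub> w = v"
  by (simp add: a_minus_def M.a_assoc M.l_neg)

lemma diff_closed: "v \<in> carrier M \<Longrightarrow> w \<in> carrier M \<Longrightarrow> v \<ominus>\<^bsub>M\<^esub> w \<in> carrier M"
  by simp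

lemma diff_eq_zero: "v \<in> carrier M \<Longrightarrow> w \<in> carrier M \<Longrightarrow> v \<ominus>\<^bsub>M\<^esub> w = \<zero>\<^bsub>M\<^esub> \<longleftrightarrow> v = w"
  using diff_add_cancel[of v w] diff_self by fastforce

end

text \<open>The zero map on \<open>B\<close> and the value \<open>c\<close> at \<open>z\<close> are
  compatible because every scalar that takes \<open>z\<close> into \<open>B\<close> kills
  \<open>c\<close>. It serves for socle elements of cosyzygies and, over the integers, to start a
  character of \<open>R\<close>.\<close>

lemma extend_by_element:
  fixes R (structure) and Z :: "('a, 'm) module" and E :: "('a, 'n) module"
  assumes Z: "module R Z" and E: "module R E" and B: "submodule B R Z" and z: "z \<in> carrier Z"
    and c: "c \<in> carrier E" "\<And>a. a \<in> carrier R \<Longrightarrow> a \<odot>\<^bsub>Z\<^esub> z \<in> B \<Longrightarrow> a \<odot>\<^bsub>E\<^esub> c = \<zero>\<^bsub>E\<^esub>"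
  shows "\<exists>Y f. submodule Y R Z \<and> B \<subseteq> Y \<and> z \<in> Y \<and> f \<in> module_homs R (restr Z Y) E \<and> f z = c \<and>
    (\<forall>b\<in>B. f b = \<zero>\<^bsub>E\<^esub>)"
proof -
  interpret Z: module R Z by fact
  interpret E: module R E by fact
  note b = Z.submodule_mem[OF B]
  define Y where "Y = {b \<oplus>\<^bsub>Z\<^esub> a \<odot>\<^bsub>Z\<^esub> z | b a. b \<in> B \<and> a \<in> carrier R}"
  define f where "f y = (SOME a. a \<in> carrier R \<and> (\<exists>b\<in>B. y = b \<oplus>\<^bsub>Z\<^esub> a \<odot>\<^bsub>Z\<^esub> z)) \<odot>\<^bsub>E\<^esub> c" for y
  have f: "f (b \<oplus>\<^bsub>Z\<^esub> a \<odot>\<^bsub>Z\<^esub> z) = a \<odot>\<^bsub>E\<^esub> c" if ba: "b \<in> B" "a \<in> carrier R" for a b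
  proof -
    let ?P = "\<lambda>a'. a' \<in> carrier R \<and> (\<exists>b'\<in>B. b \<oplus>\<^bsub>Z\<^esub> a \<odot>\<^bsub>Z\<^esub> z = b' \<oplus>\<^bsub>Z\<^esub> a' \<odot>\<^bsub>Z\<^esub> z)"
    define a' where "a' = Eps ?P"
    have "?P a" using ba by blast
    then have "?P a'" unfolding a'_def by (rule someI)
    then obtain b' where a': "a' \<in> carrier R" "b' \<in> B" "b \<oplus>\<^bsub>Z\<^esub> a \<odot>\<^bsub>Z\<^esub> z = b' \<oplus>\<^bsub>Z\<^esub> a' \<odot>\<^bsub>Z\<^esub> z" by blast
    have carr: "b \<in> carrier Z" "b' \<in> carrier Z" "a \<odot>\<^bsub>Z\<^esub> z \<in> carrier Z" "a' \<odot>\<^bsub>Z\<^esub> z \<in> carrier Z"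
      using ba a' b z by auto
    have diff: "(a \<ominus> a') \<odot>\<^bsub>Z\<^esub> z = a \<odot>\<^bsub>Z\<^esub> z \<ominus>\<^bsub>Z\<^esub> a' \<odot>\<^bsub>Z\<^esub> z"
      by (rule Z.smult_diff_l) (use ba a' z in auto)
    have "(a \<ominus> a') \<odot>\<^bsub>Z\<^esub> z \<oplus>\<^bsub>Z\<^esub> b = b \<oplus>\<^bsub>Z\<^esub> a \<odot>\<^bsub>Z\<^esub> z \<oplus>\<^bsub>Z\<^esub> (\<ominus>\<^bsub>Z\<^esub> (a' \<odot>\<^bsub>Z\<^esub> z))"
      unfolding diff using carr by (simp add: a_minus_def Z.M.a_ac)
    also have "\<dots> = b'" unfolding a'(3) using carr by (simp add: Z.M.a_assoc Z.M.r_neg)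
    finally have "(a \<ominus> a') \<odot>\<^bsub>Z\<^esub> z \<oplus>\<^bsub>Z\<^esub> b \<in> B" using a' by simp
    then have "(a \<ominus> a') \<odot>\<^bsub>Z\<^esub> z \<in> B"
      using Z.diff_submodule_cancel[OF B, of "(a \<ominus> a') \<odot>\<^bsub>Z\<^esub> z" b] ba a' z by simp
    then have "(a \<ominus> a') \<odot>\<^bsub>E\<^esub> c = \<zero>\<^bsub>E\<^esub>" using c(2)[of "a \<ominus> a'"] ba a' by simp
    then have "a \<odot>\<^bsub>E\<^esub> c \<ominus>\<^bsub>E\<^esub> a' \<odot>\<^bsub>E\<^esub> c = \<zero>\<^bsub>E\<^esub>"
      using E.smult_diff_l[of a a' c] ba a' c(1) by simp
    then have "a \<odot>\<^bsub>E\<^esub> c = a' \<odot>\<^bsub>E\<^esub> c" using ba a' c(1) by (simp add: E.diff_eq_zero)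
    then show ?thesis unfolding f_def a'_def by simp
  qed
  have YI: "b \<oplus>\<^bsub>Z\<^esub> a \<odot>\<^bsub>Z\<^esub> z \<in> Y" if "b \<in> B" "a \<in> carrier R" for a b using that by (auto simp: Y_def)
  have add: "(b \<oplus>\<^bsub>Z\<^esub> a \<odot>\<^bsub>Z\<^esub> z) \<oplus>\<^bsub>Z\<^esub> (b' \<oplus>\<^bsub>Z\<^esub> a' \<odot>\<^bsub>Z\<^esub> z) = (b \<oplus>\<^bsub>Z\<^esub> b') \<oplus>\<^bsub>Z\<^esub> (a \<oplus> a') \<odot>\<^bsub>Z\<^esub> z"
    if "b \<in> B" "a \<in> carrier R" "b' \<in> B" "a' \<in> carrier R" for a b a' b'
    using that b z by (simp add: Z.smult_l_distr Z.M.a_ac)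
  have mul: "r \<odot>\<^bsub>Z\<^esub> (b \<oplus>\<^bsub>Z\<^esub> a \<odot>\<^bsub>Z\<^esub> z) = r \<odot>\<^bsub>Z\<^esub> b \<oplus>\<^bsub>Z\<^esub> (r \<otimes> a) \<odot>\<^bsub>Z\<^esub> z"
    if "b \<in> B" "a \<in> carrier R" "r \<in> carrier R" for a b r
    using that b z by (simp add: Z.smult_r_distr Z.smult_assoc1)
  have BY: "y \<in> Y \<and> f y = \<zero>\<^bsub>E\<^esub>" if "y \<in> B" for y
    using YI[OF that Z.R.zero_closed] f[OF that Z.R.zero_closed] b(1)[OF that] z c by simp
  have zY: "z \<in> Y" "f z = c"
    using YI[OF b(2) Z.R.one_closed] f[OF b(2) Z.R.one_closed] z c by simp_all
  have "submodule Y R Z"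
  proof (rule Z.submodule_intro)
    show "Y \<subseteq> carrier Z" using b z by (auto simp: Y_def)
    show "\<zero>\<^bsub>Z\<^esub> \<in> Y" using BY b by blast
    show "y \<oplus>\<^bsub>Z\<^esub> y' \<in> Y" if yy: "y \<in> Y" "y' \<in> Y" for y y'
    proof -
      obtain u a u' a' where *: "u \<in> B" "a \<in> carrier R" "u' \<in> B" "a' \<in> carrier R"
        "y = u \<oplus>\<^bsub>Z\<^esub> a \<odot>\<^bsub>Z\<^esub> z" "y' = u' \<oplus>\<^bsub>Z\<^esub> a' \<odot>\<^bsub>Z\<^esub> z" using yy unfolding Y_def by blast
      show ?thesis unfolding *(5,6) add[OF *(1-4)] by (rule YI) (use * b in auto)
    qed
    show "r \<odot>\<^bsub>Z\<^esub> y \<in> Y" if yy: "r \<in> carrier R" "y \<in> Y" for r y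
    proof -
      obtain u a where *: "u \<in> B" "a \<in> carrier R" "y = u \<oplus>\<^bsub>Z\<^esub> a \<odot>\<^bsub>Z\<^esub> z" using yy unfolding Y_def by blast
      show ?thesis unfolding *(3) mul[OF *(1,2) yy(1)] by (rule YI) (use * b yy in auto)
    qed
  qed
  moreover have "f \<in> module_homs R (restr Z Y) E"
  proof (rule module_homsI)
    fix y assume "y \<in> carrier (restr Z Y)"
    then obtain u a where y: "u \<in> B" "a \<in> carrier R" "y = u \<oplus>\<^bsub>Z\<^esub> a \<odot>\<^bsub>Z\<^esub> z" unfolding Y_def by auto
    show "f y \<in> carrier E" unfolding y(3) f[OF y(1,2)] using y c by simp
    show "f (y \<oplus>\<^bsub>restr Z Y\<^esub> y') = f y \<oplus>\<^bsub>E\<^esub> f y'" if yc: "y' \<in> carrier (restr Z Y)" for y'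
    proof -
      obtain u' a' where y': "u' \<in> B" "a' \<in> carrier R" "y' = u' \<oplus>\<^bsub>Z\<^esub> a' \<odot>\<^bsub>Z\<^esub> z"
        using yc unfolding Y_def by auto
      have "f (y \<oplus>\<^bsub>Z\<^esub> y') = (a \<oplus> a') \<odot>\<^bsub>E\<^esub> c"
        unfolding y(3) y'(3) add[OF y(1,2) y'(1,2)] by (rule f) (use y y' b in auto)
      then show ?thesis unfolding y(3) y'(3) f[OF y(1,2)] f[OF y'(1,2)]
        using y(2) y'(2) c(1) by (simp add: E.smult_l_distr)
    qed
    show "f (r \<odot>\<^bsub>restr Z Y\<^esub> y) = r \<odot>\<^bsub>E\<^esub> f y" if r: "r \<in> carrier R" for r
    proof -
      have "f (r \<odot>\<^bsub>Z\<^esub> y) = (r \<otimes> a) \<odot>\<^bsub>E\<^esub> c"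
        unfolding y(3) mul[OF y(1,2) r] by (rule f) (use y b r in auto)
      then show ?thesis unfolding y(3) f[OF y(1,2)] using y(2) r c(1) by (simp add: E.smult_assoc1)
    qed
  qed
  ultimately show ?thesis using BY zY by blast
qed

locale injective_res = noetherian_local R \<mm> for R :: "('a, 'c) ring_scheme" (structure) and \<mm> +
  fixes N :: "('a, 'n) module" and I :: "nat \<Rightarrow> ('a, 'e) module"
    and h :: "'n \<Rightarrow> 'e" and \<delta> :: "nat \<Rightarrow> 'e \<Rightarrow> 'e"
  assumes resolution: "injective_resolution R N I h \<delta>"
begin

text \<open>\<open>cosyz 0\<close> is the copy of \<open>N\<close> in \<open>I 0\<close>, and
  \<open>cosyz (Suc j)\<close> is the image of \<open>\<delta> j\<close>. Maps into
  \<open>C (Suc j)\<close>, modulo those that lift along \<open>\<delta> j\<close>, represent Ext in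
  degree j+1.\<close>

definition cosyz :: "nat \<Rightarrow> 'e set" where
  "cosyz j = module_ker (I j) (I (Suc j)) (\<delta> j)"

abbreviation C :: "nat \<Rightarrow> ('a, 'e) module" where
  "C j \<equiv> restr (I j) (cosyz j)"

text \<open>\<open>Ext_vanish L j\<close> expresses \<open>Ext\<^sup>j(L, N) = 0\<close>, and \<open>Ext_k_vanish j\<close> is the case \<open>L = k\<close>
  in degree \<open>j + 1\<close>.\<close>

definition Ext_vanish :: "('a, 'm) module \<Rightarrow> nat \<Rightarrow> bool" where
  "Ext_vanish L j = (case j of
     0 \<Rightarrow> \<forall>f\<in>module_homs R L (C 0). \<forall>x\<in>carrier L. f x = \<zero>\<^bsub>I 0\<^esub>
   | Suc i \<Rightarrow> \<forall>f\<in>module_homs R L (C (Suc i)). \<exists>l\<in>module_homs R L (I i). \<forall>x\<in>carrier L. \<delta> i (l x) = f x)"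

definition Ext_k_vanish :: "nat \<Rightarrow> bool" where
  "Ext_k_vanish j \<longleftrightarrow> (\<forall>c\<in>cosyz (Suc j). (\<forall>a\<in>\<mm>. a \<odot>\<^bsub>I (Suc j)\<^esub> c = \<zero>\<^bsub>I (Suc j)\<^esub>) \<longrightarrow>
     (\<exists>w\<in>carrier (I j). (\<forall>a\<in>\<mm>. a \<odot>\<^bsub>I j\<^esub> w = \<zero>\<^bsub>I j\<^esub>) \<and> \<delta> j w = c))"

lemma injI: "injective_module R (I j)" and modI: "module R (I j)" and modN: "module R N"
  and h: "h \<in> module_homs R N (I 0)" "inj_on h (carrier N)" "h ` carrier N = cosyz 0"
  and \<delta>: "\<delta> j \<in> module_homs R (I j) (I (Suc j))"
  and \<delta>_image: "\<delta> j ` carrier (I j) = cosyz (Suc j)"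
  using resolution unfolding injective_resolution_def injective_module_def cosyz_def by auto

lemma cosyz_sub: "submodule (cosyz j) R (I j)"
  unfolding cosyz_def by (rule submodule_ker[OF modI modI \<delta>])

lemma cosyzD: "c \<in> cosyz j \<Longrightarrow> c \<in> carrier (I j)" "c \<in> cosyz j \<Longrightarrow> \<delta> j c = \<zero>\<^bsub>I (Suc j)\<^esub>"
  by (auto simp: cosyz_def module_ker_def)

lemma cosyzI: "c \<in> carrier (I j) \<Longrightarrow> \<delta> j c = \<zero>\<^bsub>I (Suc j)\<^esub> \<Longrightarrow> c \<in> cosyz j"
  by (auto simp: cosyz_def module_ker_def)

lemma modC: "module R (C j)"
  by (rule module_restr[OF modI cosyz_sub])

lemma \<delta>_cosyz: "w \<in> carrier (I j) \<Longrightarrow> \<delta> j w \<in> cosyz (Suc j)"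
  using \<delta>_image by blast

lemma \<delta>\<delta>: "w \<in> carrier (I j) \<Longrightarrow> \<delta> (Suc j) (\<delta> j w) = \<zero>\<^bsub>I (Suc (Suc j))\<^esub>"
  using cosyzD(2)[OF \<delta>_cosyz] .

lemma \<delta>_homC: "\<delta> j \<in> module_homs R (I j) (C (Suc j))"
  by (rule module_homs_corestr[OF \<delta> \<delta>_cosyz])

lemma homCD:
  assumes "f \<in> module_homs R L (C j)"
  shows "f \<in> module_homs R L (I j)" "x \<in> carrier L \<Longrightarrow> f x \<in> cosyz j"
proof -
  show "f \<in> module_homs R L (I j)"
    by (rule module_homs_corestrD[OF assms]) (use cosyzD in auto)
  show "x \<in> carrier L \<Longrightarrow> f x \<in> cosyz j" using module_homsD(1)[OF assms] by simp
qed

lemma homCI: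
  assumes "f \<in> module_homs R L (I j)" "\<And>x. x \<in> carrier L \<Longrightarrow> \<delta> j (f x) = \<zero>\<^bsub>I (Suc j)\<^esub>"
  shows "f \<in> module_homs R L (C j)"
  by (rule module_homs_corestr[OF assms(1)]) (use assms module_homsD(1)[OF assms(1)] in \<open>auto intro!: cosyzI\<close>)

lemma lift_projective:
  assumes "dual_basis R P T p \<pi>" "module R P" "f \<in> module_homs R P (C (Suc j))"
  shows "\<exists>l\<in>module_homs R P (I j). \<forall>x\<in>carrier P. \<delta> j (l x) = f x"
  by (rule dual_basis_lift[OF assms(1,2) modI modC \<delta>_homC assms(3)])
    (use homCD(2)[OF assms(3)] \<delta>_image in auto)

text \<open>Z/B is a vector space over the residue field, so the obstruction lies in copies of
  Ext^{j+1}(k, N). Concretely, \<open>f\<close> extends into the injective module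
  \<open>I j\<close>, and the values of the extension are then corrected back into
  \<open>cosyz j\<close>.\<close>

lemma extend_over_residue:
  fixes Z :: "('a, 'm) module"
  assumes van: "Ext_k_vanish j" and Z: "module R Z" and B: "submodule B R Z"
    and kill: "\<And>a z. a \<in> \<mm> \<Longrightarrow> z \<in> carrier Z \<Longrightarrow> a \<odot>\<^bsub>Z\<^esub> z \<in> B"
    and f: "f \<in> module_homs R (restr Z B) (C j)"
  shows "\<exists>g\<in>module_homs R Z (C j). \<forall>x\<in>B. g x = f x"
proof (rule extension_over_residue[OF Z modC B f kill])
  fix Y g z assume Y: "submodule Y R Z" "B \<subseteq> Y" and g: "g \<in> module_homs R (restr Z Y) (C j)"
    and z: "z \<in> carrier Z"
  interpret Z: module R Z by fact
  interpret I: module R "I j" by (rule modI)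
  interpret I': module R "I (Suc j)" by (rule modI)
  obtain g' where g': "g' \<in> module_homs R Z (I j)" "\<And>x. x \<in> Y \<Longrightarrow> g' x = g x"
    using injective_extend[OF injI Z Y(1) homCD(1)[OF g]] by blast
  note g'D = module_homsD[OF g'(1)] and dD = module_homsD[OF \<delta>[of j]]
  have mR: "a \<in> carrier R" if "a \<in> \<mm>" for a using that by simp
  have az: "a \<odot>\<^bsub>I j\<^esub> g' z = g (a \<odot>\<^bsub>Z\<^esub> z)" if a: "a \<in> \<mm>" for a
    using g'(2)[of "a \<odot>\<^bsub>Z\<^esub> z"] kill[OF a z] Y g'D(3)[OF mR[OF a] z] by auto
  have "a \<odot>\<^bsub>I (Suc j)\<^esub> \<delta> j (g' z) = \<zero>\<^bsub>I (Suc j)\<^esub>" if a: "a \<in> \<mm>" for a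
  proof -
    have "a \<odot>\<^bsub>I (Suc j)\<^esub> \<delta> j (g' z) = \<delta> j (g (a \<odot>\<^bsub>Z\<^esub> z))"
      using az[OF a] dD(3)[OF mR[OF a] g'D(1)[OF z]] by simp
    then show ?thesis using cosyzD(2)[OF homCD(2)[OF g]] kill[OF a z] Y by auto
  qed
  \<comment> \<open>The defect \<open>\<delta> j (g' z)\<close> is killed by \<open>\<mm>\<close>,
    so it comes from a socle element \<open>w\<close>. Subtracting \<open>w\<close> leaves all
    products with \<open>\<mm>\<close> unchanged and moves the value into
    \<open>cosyz j\<close>.\<close>
  then obtain w where w: "w \<in> carrier (I j)" "\<And>a. a \<in> \<mm> \<Longrightarrow> a \<odot>\<^bsub>I j\<^esub> w = \<zero>\<^bsub>I j\<^esub>" "\<delta> j w = \<delta> j (g' z)"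
    using van[unfolded Ext_k_vanish_def, rule_format, OF \<delta>_cosyz[OF g'D(1)[OF z]]] by auto
  show "\<exists>w\<in>carrier (C j). \<forall>a\<in>\<mm>. g (a \<odot>\<^bsub>Z\<^esub> z) = a \<odot>\<^bsub>C j\<^esub> w"
  proof (intro bexI[of _ "g' z \<ominus>\<^bsub>I j\<^esub> w"] ballI)
    have "\<delta> j (g' z \<ominus>\<^bsub>I j\<^esub> w) = \<zero>\<^bsub>I (Suc j)\<^esub>"
      using module_homs_minus[OF modI modI \<delta> g'D(1)[OF z] w(1)] w(3) dD(1)[OF g'D(1)[OF z]]
      by (simp add: a_minus_def I'.M.r_neg)
    then show "g' z \<ominus>\<^bsub>I j\<^esub> w \<in> carrier (C j)" using g'D(1)[OF z] w(1) by (simp add: cosyzI)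
    fix a assume a: "a \<in> \<mm>"
    show "g (a \<odot>\<^bsub>Z\<^esub> z) = a \<odot>\<^bsub>C j\<^esub> (g' z \<ominus>\<^bsub>I j\<^esub> w)"
    proof -
      have "a \<odot>\<^bsub>I j\<^esub> (g' z \<ominus>\<^bsub>I j\<^esub> w) = a \<odot>\<^bsub>I j\<^esub> g' z \<ominus>\<^bsub>I j\<^esub> a \<odot>\<^bsub>I j\<^esub> w"
        by (rule I.smult_diff_r[OF mR[OF a] g'D(1)[OF z] w(1)])
      also have "\<dots> = a \<odot>\<^bsub>I j\<^esub> g' z"
        unfolding w(2)[OF a] using g'D(1)[OF z] mR[OF a] by (intro I.diff_zero) simp
      finally show ?thesis using az[OF a] by simp
    qed
  qed
qed

text \<open>In the long exact sequence Ext^{j+1}(B, N) lies between Ext^{j+1}(Z, N) and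
  Ext^{j+2}(Z/B, N); the latter vanishes with Ext^{j+2}(k, N) because \<open>\<mm>\<close> kills
  Z/B.\<close>

lemma Ext_vanish_restrict:
  fixes Z :: "('a, 'm) module"
  assumes "Ext_k_vanish (Suc j)" "module R Z" "submodule B R Z"
    and "\<And>a z. a \<in> \<mm> \<Longrightarrow> z \<in> carrier Z \<Longrightarrow> a \<odot>\<^bsub>Z\<^esub> z \<in> B"
    and "Ext_vanish Z (Suc j)"
  shows "Ext_vanish (restr Z B) (Suc j)"
  unfolding Ext_vanish_def nat.case
proof
  interpret Z: module R Z by fact
  note b = Z.submodule_mem[OF assms(3)]
  fix f assume f: "f \<in> module_homs R (restr Z B) (C (Suc j))"
  obtain g where g: "g \<in> module_homs R Z (C (Suc j))" "\<forall>x\<in>B. g x = f x"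
    using extend_over_residue[OF assms(1-4) f] by blast
  then obtain l where "l \<in> module_homs R Z (I j)" "\<forall>x\<in>carrier Z. \<delta> j (l x) = g x"
    using assms(5) unfolding Ext_vanish_def by auto
  then show "\<exists>l\<in>module_homs R (restr Z B) (I j). \<forall>x\<in>carrier (restr Z B). \<delta> j (l x) = f x"
    using g(2) b(1) by (intro bexI[of _ l]) (auto intro!: module_homs_restr)
qed

context
  fixes G G' :: "('a, 'm) module" and q T p \<pi>
  assumes G: "module R G" and G': "module R G'" and q: "q \<in> module_homs R G G'"
    and basis: "dual_basis R G T p \<pi>"
begin

interpretation G: module R G by (rule G)
interpretation G': module R G' by (rule G')

text \<open>Dimension shift for 0 -> ker q -> G -> im q -> 0: as \<open>G\<close> is projective,
  Ext^{j+1} of the kernel embeds into Ext^{j+2} of the image. The final lift from \<open>G\<close>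
  is where projectivity enters.\<close>

lemma Ext_vanish_kernel:
  assumes "Ext_vanish (restr G' (q ` carrier G)) (Suc (Suc j))"
  shows "Ext_vanish (restr G (module_ker G G' q)) (Suc j)"
  unfolding Ext_vanish_def nat.case
proof
  let ?Z = "module_ker G G' q"
  note ker = submodule_ker[OF G G' q]
  interpret I: module R "I (Suc j)" by (rule modI)
  interpret I': module R "I (Suc (Suc j))" by (rule modI)
  fix f assume f: "f \<in> module_homs R (restr G ?Z) (C (Suc j))"
  obtain g where g: "g \<in> module_homs R G (I (Suc j))" "\<And>x. x \<in> ?Z \<Longrightarrow> g x = f x"
    using injective_extend[OF injI G ker homCD(1)[OF f]] by blast
  note gD = module_homsD[OF g(1)]
  have dg: "(\<lambda>x. \<delta> (Suc j) (g x)) \<in> module_homs R G (C (Suc (Suc j)))"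
    by (rule module_homs_comp[OF g(1) \<delta>_homC])
  have "\<delta> (Suc j) (g x) = \<zero>\<^bsub>C (Suc (Suc j))\<^esub>" if "x \<in> carrier G" "q x = \<zero>\<^bsub>G'\<^esub>" for x
  proof -
    have x: "x \<in> ?Z" using that by (simp add: module_ker_def)
    then show ?thesis using cosyzD(2)[OF homCD(2)[OF f, of x]] g(2)[OF x] by simp
  qed
  then obtain g' where g': "g' \<in> module_homs R (restr G' (q ` carrier G)) (C (Suc (Suc j)))"
    "\<forall>x\<in>carrier G. g' (q x) = \<delta> (Suc j) (g x)"
    using factor_through_image[OF G G' q dg modC] by blast
  obtain l where l: "l \<in> module_homs R (restr G' (q ` carrier G)) (I (Suc j))"
    "\<And>x. x \<in> carrier G \<Longrightarrow> \<delta> (Suc j) (l (q x)) = g' (q x)"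
    using assms g'(1) unfolding Ext_vanish_def by auto
  have lq: "(\<lambda>x. l (q x)) \<in> module_homs R G (I (Suc j))"
    by (rule module_homs_comp[OF module_homs_corestr[OF q] l(1)]) auto
  have diff: "(\<lambda>x. g x \<ominus>\<^bsub>I (Suc j)\<^esub> l (q x)) \<in> module_homs R G (C (Suc j))"
  proof (rule homCI[OF homs_diff[OF modI g(1) lq]])
    fix x assume x: "x \<in> carrier G"
    have "\<delta> (Suc j) (g x) \<in> carrier (I (Suc (Suc j)))" using module_homsD(1)[OF \<delta> gD(1)[OF x]] .
    then show "\<delta> (Suc j) (g x \<ominus>\<^bsub>I (Suc j)\<^esub> l (q x)) = \<zero>\<^bsub>I (Suc (Suc j))\<^esub>"
      using module_homs_minus[OF modI modI \<delta> gD(1)[OF x] module_homsD(1)[OF lq x]] l(2)[OF x] g'(2) x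
      by (simp add: a_minus_def I'.M.r_neg)
  qed
  obtain l' where l': "l' \<in> module_homs R G (I j)" "\<forall>x\<in>carrier G. \<delta> j (l' x) = g x \<ominus>\<^bsub>I (Suc j)\<^esub> l (q x)"
    using lift_projective[OF basis G diff] by blast
  show "\<exists>l\<in>module_homs R (restr G ?Z) (I j). \<forall>x\<in>carrier (restr G ?Z). \<delta> j (l x) = f x"
  proof (intro bexI[of _ l'] ballI)
    show "l' \<in> module_homs R (restr G ?Z) (I j)"
      by (rule module_homs_restr[OF l'(1)]) (auto simp: module_ker_def)
    fix x assume "x \<in> carrier (restr G ?Z)"
    then have x: "x \<in> carrier G" "q x = \<zero>\<^bsub>G'\<^esub>" "x \<in> ?Z" by (auto simp: module_ker_def)
    have im: "submodule (q ` carrier G) R G'" by (rule submodule_image[OF G G' q G.carrier_is_submodule])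
    have "l (q x) = \<zero>\<^bsub>I (Suc j)\<^esub>"
      using module_homs_zero[OF module_restr[OF G' im] modI l(1)] x(2) by simp
    then show "\<delta> j (l' x) = f x" using l'(2) x g(2)[OF x(3)] gD(1)[OF x(1)] by (simp add: a_minus_def)
  qed
qed

text \<open>The shift in the other direction: a class on the image becomes trivial on
  \<open>G\<close>, and the trivialisation restricts to a class on the kernel one degree lower. For
  \<open>j = 0\<close> this restriction is a homomorphism that must vanish outright.\<close>

lemma Ext_vanish_image:
  assumes van: "Ext_vanish (restr G (module_ker G G' q)) j"
  shows "Ext_vanish (restr G' (q ` carrier G)) (Suc j)"
  unfolding Ext_vanish_def nat.case
proof
  let ?Z = "module_ker G G' q"
  note ker = submodule_ker[OF G G' q]
  have im: "submodule (q ` carrier G) R G'" by (rule submodule_image[OF G G' q G.carrier_is_submodule])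
  interpret I: module R "I j" by (rule modI)
  fix f assume f: "f \<in> module_homs R (restr G' (q ` carrier G)) (C (Suc j))"
  have fq: "(\<lambda>x. f (q x)) \<in> module_homs R G (C (Suc j))"
    by (rule module_homs_comp[OF module_homs_corestr[OF q] f]) auto
  obtain l where l: "l \<in> module_homs R G (I j)" "\<And>x. x \<in> carrier G \<Longrightarrow> \<delta> j (l x) = f (q x)"
    using lift_projective[OF basis G fq] by blast
  note lD = module_homsD[OF l(1)]
  have Zc: "x \<in> carrier G" "q x = \<zero>\<^bsub>G'\<^esub>" if "x \<in> ?Z" for x using that by (auto simp: module_ker_def)
  have "f \<zero>\<^bsub>G'\<^esub> = \<zero>\<^bsub>I (Suc j)\<^esub>"
    using module_homs_zero[OF module_restr[OF G' im] modC f] by simp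
  then have lZ: "l \<in> module_homs R (restr G ?Z) (C j)"
    by (intro homCI module_homs_restr[OF l(1)]) (use l(2) Zc in auto)
  \<comment> \<open>\<open>m\<close> agrees with \<open>l\<close> on the kernel and is killed by
    \<open>\<delta> j\<close>, so \<open>l\<close> minus \<open>m\<close> descends to the image with
    the same \<open>\<delta> j\<close>. In degree 0 it is zero; above, it is
    \<open>\<delta> i\<close> of an extension to \<open>G\<close>.\<close>
  have "\<exists>m\<in>module_homs R G (I j). (\<forall>x\<in>?Z. m x = l x) \<and> (\<forall>x\<in>carrier G. \<delta> j (m x) = \<zero>\<^bsub>I (Suc j)\<^esub>)"
  proof (cases j)
    case 0
    then have "\<forall>x\<in>?Z. l x = \<zero>\<^bsub>I j\<^esub>" using van lZ unfolding Ext_vanish_def by simp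
    then show ?thesis using homs_zero[OF modI] module_homs_zero[OF modI modI \<delta>]
      by (intro bexI[of _ "\<lambda>_. \<zero>\<^bsub>I j\<^esub>"]) auto
  next
    case (Suc i)
    then obtain l' where l': "l' \<in> module_homs R (restr G ?Z) (I i)" "\<And>x. x \<in> ?Z \<Longrightarrow> \<delta> i (l' x) = l x"
      using van lZ unfolding Ext_vanish_def by auto
    obtain l'' where l'': "l'' \<in> module_homs R G (I i)" "\<And>x. x \<in> ?Z \<Longrightarrow> l'' x = l' x"
      using injective_extend[OF injI G ker l'(1)] by blast
    have "(\<lambda>x. \<delta> i (l'' x)) \<in> module_homs R G (I j)" unfolding Suc by (rule module_homs_comp[OF l''(1) \<delta>])
    moreover have "\<forall>x\<in>carrier G. \<delta> j (\<delta> i (l'' x)) = \<zero>\<^bsub>I (Suc j)\<^esub>"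
      unfolding Suc using \<delta>\<delta> module_homsD(1)[OF l''(1)] by blast
    moreover have "\<forall>x\<in>?Z. \<delta> i (l'' x) = l x" using l' l'' by simp
    ultimately show ?thesis by (intro bexI[of _ "\<lambda>x. \<delta> i (l'' x)"] conjI)
  qed
  then obtain m where m: "m \<in> module_homs R G (I j)" "\<And>x. x \<in> ?Z \<Longrightarrow> m x = l x"
    "\<And>x. x \<in> carrier G \<Longrightarrow> \<delta> j (m x) = \<zero>\<^bsub>I (Suc j)\<^esub>" by blast
  note mD = module_homsD[OF m(1)]
  have "l x \<ominus>\<^bsub>I j\<^esub> m x = \<zero>\<^bsub>I j\<^esub>" if "x \<in> carrier G" "q x = \<zero>\<^bsub>G'\<^esub>" for x
    using m(2)[of x] that lD(1) by (simp add: module_ker_def a_minus_def I.M.r_neg)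
  then obtain t where t: "t \<in> module_homs R (restr G' (q ` carrier G)) (I j)"
    "\<And>x. x \<in> carrier G \<Longrightarrow> t (q x) = l x \<ominus>\<^bsub>I j\<^esub> m x"
    using factor_through_image[OF G G' q homs_diff[OF modI l(1) m(1)] modI] by blast
  show "\<exists>l\<in>module_homs R (restr G' (q ` carrier G)) (I j). \<forall>x\<in>carrier (restr G' (q ` carrier G)). \<delta> j (l x) = f x"
  proof (intro bexI[OF _ t(1)] ballI)
    fix y assume "y \<in> carrier (restr G' (q ` carrier G))"
    then obtain x where x: "x \<in> carrier G" "y = q x" by auto
    have "\<delta> j (l x) \<in> carrier (I (Suc j))" using module_homsD(1)[OF \<delta> lD(1)[OF x(1)]] .
    then show "\<delta> j (t y) = f y"
      using module_homs_minus[OF modI modI \<delta> lD(1)[OF x(1)] mD(1)[OF x(1)]] t(2)[OF x(1)] m(3)[OF x(1)] l(2)[OF x(1)] x(2)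
        module.diff_zero[OF modI, of "f (q x)" "Suc j"] by simp
  qed
qed

end

text \<open>Ext^j(B, N) and Ext^{j+1}(Z, N) vanish, hence also the term Ext^{j+1}(Z/B, N) between
  them, and Z/B is a vector space over \<open>k\<close> that is nonzero because of \<open>z\<close>.
  A socle element \<open>c\<close> becomes a map on B + R z with value \<open>c\<close> at
  \<open>z\<close>; vanishing one degree higher extends it to \<open>Z\<close>.\<close>

lemma Ext_k_vanish_of_socle:
  fixes Z :: "('a, 'm) module"
  assumes Z: "module R Z" and B: "submodule B R Z"
    and kill: "\<And>a z. a \<in> \<mm> \<Longrightarrow> z \<in> carrier Z \<Longrightarrow> a \<odot>\<^bsub>Z\<^esub> z \<in> B"
    and z: "z \<in> carrier Z" "z \<notin> B"
    and van: "Ext_k_vanish (Suc j)" "Ext_vanish Z (Suc j)" "Ext_vanish (restr Z B) j"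
  shows "Ext_k_vanish j"
  unfolding Ext_k_vanish_def
proof (intro ballI impI)
  interpret Z: module R Z by fact
  interpret I: module R "I j" by (rule modI)
  interpret I': module R "I (Suc j)" by (rule modI)
  note b = Z.submodule_mem[OF B]
  fix c assume c: "c \<in> cosyz (Suc j)" "\<forall>a\<in>\<mm>. a \<odot>\<^bsub>I (Suc j)\<^esub> c = \<zero>\<^bsub>I (Suc j)\<^esub>"
  have "\<exists>Y f. submodule Y R Z \<and> B \<subseteq> Y \<and> z \<in> Y \<and> f \<in> module_homs R (restr Z Y) (C (Suc j)) \<and> f z = c \<and>
    (\<forall>b\<in>B. f b = \<zero>\<^bsub>C (Suc j)\<^esub>)"
  proof (rule extend_by_element[OF Z modC B z(1)])
    show "a \<odot>\<^bsub>C (Suc j)\<^esub> c = \<zero>\<^bsub>C (Suc j)\<^esub>" if "a \<in> carrier R" "a \<odot>\<^bsub>Z\<^esub> z \<in> B" for a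
      using module_saturated[OF Z B, of a z] that z(1,2) c(2) by auto
  qed (use c in auto)
  then obtain Y f where Y: "submodule Y R Z" "B \<subseteq> Y" "z \<in> Y"
    and f: "f \<in> module_homs R (restr Z Y) (C (Suc j))" "f z = c" "\<And>b. b \<in> B \<Longrightarrow> f b = \<zero>\<^bsub>I (Suc j)\<^esub>"
    by auto
  have "\<exists>g\<in>module_homs R Z (C (Suc j)). \<forall>x\<in>Y. g x = f x"
    by (rule extend_over_residue[OF van(1) Z Y(1) _ f(1)]) (use kill Y in blast)
  then obtain g where g: "g \<in> module_homs R Z (C (Suc j))" "\<And>x. x \<in> Y \<Longrightarrow> g x = f x" by blast
  obtain l where l: "l \<in> module_homs R Z (I j)" "\<And>x. x \<in> carrier Z \<Longrightarrow> \<delta> j (l x) = g x"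
    using van(2) g(1) unfolding Ext_vanish_def by auto
  note lD = module_homsD[OF l(1)]
  have lB: "l \<in> module_homs R (restr Z B) (C j)"
    by (intro homCI module_homs_restr[OF l(1)]) (use l(2) b Y(2) g(2) f(3) in auto)
  \<comment> \<open>\<open>w\<close> is killed by \<open>\<delta> j\<close> and has the same
    products with \<open>\<mm>\<close> as \<open>l z\<close>, so the difference is a socle element
    that still maps to \<open>c\<close>.\<close>
  have "\<exists>w\<in>carrier (I j). \<delta> j w = \<zero>\<^bsub>I (Suc j)\<^esub> \<and> (\<forall>a\<in>\<mm>. a \<odot>\<^bsub>I j\<^esub> w = l (a \<odot>\<^bsub>Z\<^esub> z))"
  proof (cases j)
    case 0
    then have "\<forall>x\<in>B. l x = \<zero>\<^bsub>I j\<^esub>" using van(3) lB unfolding Ext_vanish_def by simp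
    then show ?thesis using kill z module_homs_zero[OF modI modI \<delta>]
      by (intro bexI[of _ "\<zero>\<^bsub>I j\<^esub>"]) auto
  next
    case (Suc i)
    then obtain l' where l': "l' \<in> module_homs R (restr Z B) (I i)" "\<And>x. x \<in> B \<Longrightarrow> \<delta> i (l' x) = l x"
      using van(3) lB unfolding Ext_vanish_def by auto
    obtain l'' where l'': "l'' \<in> module_homs R Z (I i)" "\<And>x. x \<in> B \<Longrightarrow> l'' x = l' x"
      using injective_extend[OF injI Z B l'(1)] by blast
    have c: "(\<lambda>x. \<delta> i (l'' x)) \<in> module_homs R Z (I j)" unfolding Suc by (rule module_homs_comp[OF l''(1) \<delta>])
    note cD = module_homsD[OF c]
    have "a \<odot>\<^bsub>I j\<^esub> \<delta> i (l'' z) = l (a \<odot>\<^bsub>Z\<^esub> z)" if "a \<in> \<mm>" for a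
      using cD(3)[of a z] kill[OF that z(1)] l''(2) l'(2) that z(1) by simp
    moreover have "\<delta> j (\<delta> i (l'' z)) = \<zero>\<^bsub>I (Suc j)\<^esub>"
      unfolding Suc using \<delta>\<delta> module_homsD(1)[OF l''(1) z(1)] by blast
    ultimately show ?thesis using cD(1)[OF z(1)] by blast
  qed
  then obtain w where w: "w \<in> carrier (I j)" "\<delta> j w = \<zero>\<^bsub>I (Suc j)\<^esub>" "\<And>a. a \<in> \<mm> \<Longrightarrow> a \<odot>\<^bsub>I j\<^esub> w = l (a \<odot>\<^bsub>Z\<^esub> z)"
    by blast
  have lz: "l z \<in> carrier (I j)" using lD(1)[OF z(1)] .
  show "\<exists>w\<in>carrier (I j). (\<forall>a\<in>\<mm>. a \<odot>\<^bsub>I j\<^esub> w = \<zero>\<^bsub>I j\<^esub>) \<and> \<delta> j w = c"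
  proof (intro bexI[of _ "l z \<ominus>\<^bsub>I j\<^esub> w"] conjI ballI)
    fix a assume a: "a \<in> \<mm>"
    show "a \<odot>\<^bsub>I j\<^esub> (l z \<ominus>\<^bsub>I j\<^esub> w) = \<zero>\<^bsub>I j\<^esub>"
      using w(3)[OF a] lD(3)[of a z] z(1) a I.smult_diff_r[of a "l z" w] lz w(1)
        I.diff_self[of "a \<odot>\<^bsub>I j\<^esub> l z"] by simp
  next
    have "\<delta> j (l z) = c" using l(2)[OF z(1)] g(2)[OF Y(3)] f(2) by simp
    then show "\<delta> j (l z \<ominus>\<^bsub>I j\<^esub> w) = c"
      using module_homs_minus[OF modI modI \<delta> lz w(1)] w(2) cosyzD(1)[OF c(1)] by (simp add: a_minus_def)
  qed (use lz w in auto)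
qed

text \<open>A cochain complex of finitely generated projective modules whose cohomology is annihilated by
  \<open>\<mm>\<close>. The lowest cohomology, in degree \<open>t\<close>, contributes to \<open>Ext\<close> into \<open>N\<close> together with the
  top degree \<open>s\<close> of \<open>Ext(k, N)\<close>, and nothing can cancel this contribution unless \<open>s \<le> t\<close>.\<close>

theorem cochain_exact_below_top:
  fixes G :: "nat \<Rightarrow> ('a, 'm) module"
  assumes G: "\<And>q. module R (G q)" and dG: "\<And>q. dG q \<in> module_homs R (G q) (G (Suc q))"
    and dd: "\<And>q x. x \<in> carrier (G q) \<Longrightarrow> dG (Suc q) (dG q x) = \<zero>\<^bsub>G (Suc (Suc q))\<^esub>"
    and basis: "\<And>q. \<exists>T p \<pi>. dual_basis R (G q) (T :: 'i set) p \<pi>"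
    and kill0: "\<And>a x. a \<in> \<mm> \<Longrightarrow> x \<in> module_ker (G 0) (G 1) (dG 0) \<Longrightarrow> a \<odot>\<^bsub>G 0\<^esub> x = \<zero>\<^bsub>G 0\<^esub>"
    and kill: "\<And>a q x. a \<in> \<mm> \<Longrightarrow> x \<in> module_ker (G (Suc q)) (G (Suc (Suc q))) (dG (Suc q)) \<Longrightarrow>
      a \<odot>\<^bsub>G (Suc q)\<^esub> x \<in> dG q ` carrier (G q)"
    and fin: "\<And>j. j > D \<Longrightarrow> carrier (I j) = {\<zero>\<^bsub>I j\<^esub>}"
    and top: "\<not> Ext_k_vanish s" "\<And>j. j > s \<Longrightarrow> Ext_k_vanish j"
  shows "module_ker (G 0) (G 1) (dG 0) = {\<zero>\<^bsub>G 0\<^esub>}"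
    and "q < s \<Longrightarrow> module_ker (G (Suc q)) (G (Suc (Suc q))) (dG (Suc q)) = dG q ` carrier (G q)"
proof -
  define Z where "Z q = module_ker (G q) (G (Suc q)) (dG q)" for q
  define B where "B q = (case q of 0 \<Rightarrow> {\<zero>\<^bsub>G 0\<^esub>} | Suc i \<Rightarrow> dG i ` carrier (G i))" for q
  have Zs: "submodule (Z q) R (G q)" for q unfolding Z_def by (rule submodule_ker[OF G G dG])
  have Bs: "submodule (B q) R (G q)" for q
  proof (cases q)
    case 0
    then show ?thesis using module.zero_submodule[OF G] by (simp add: B_def)
  next
    case (Suc i)
    then show ?thesis using submodule_image[OF G G dG module.carrier_is_submodule[OF G]] by (simp add: B_def)
  qed
  have BZ: "B q \<subseteq> Z q" for q
  proof (cases q)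
    case 0
    then show ?thesis using module.submodule_mem(2)[OF G Zs] by (simp add: B_def)
  next
    case (Suc i)
    then show ?thesis using dd module_homsD(1)[OF dG] by (auto simp: B_def Z_def module_ker_def)
  qed
  have mZ: "module R (restr (G q) (Z q))" for q by (rule module_restr[OF G Zs])
  have BZs: "submodule (B q) R (restr (G q) (Z q))" for q
  proof (rule module.submodule_intro[OF mZ])
    note b = module.submodule_mem[OF G Bs]
    show "B q \<subseteq> carrier (restr (G q) (Z q))" using BZ by simp
  qed (use module.submodule_mem[OF G Bs] in auto)
  have killZ: "a \<odot>\<^bsub>G q\<^esub> z \<in> B q" if "a \<in> \<mm>" "z \<in> Z q" for a z q
    using kill0[of a z] kill[of a z] that by (cases q) (auto simp: B_def Z_def)
  have image: "Ext_vanish (restr (G (Suc q)) (B (Suc q))) (Suc j)" if "Ext_vanish (restr (G q) (Z q)) j" for q j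
  proof -
    obtain T :: "'i set" and p \<pi> where "dual_basis R (G q) T p \<pi>" using basis by blast
    from Ext_vanish_image[OF G G dG this] that show ?thesis by (simp add: B_def Z_def)
  qed
  have kernel: "Ext_vanish (restr (G q) (Z q)) (Suc j)" if "Ext_vanish (restr (G (Suc q)) (B (Suc q))) (Suc (Suc j))" for q j
  proof -
    obtain T :: "'i set" and p \<pi> where "dual_basis R (G q) T p \<pi>" using basis by blast
    from Ext_vanish_kernel[OF G G dG this] that show ?thesis by (simp add: B_def Z_def)
  qed
  \<comment> \<open>Descending induction on the degree, which starts where the injective modules are
    zero. Vanishing passes from the cocycles in degree q+1 to the coboundaries there, and by the
    shift to the cocycles in degree \<open>q\<close>, one Ext degree lower.\<close>
  have high: "Ext_vanish (restr (G q) (Z q)) (Suc j)" if "j \<ge> s" for q j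
    using that
  proof (induction "D - j" arbitrary: j q)
    case 0
    then have "cosyz (Suc j) \<subseteq> {\<zero>\<^bsub>I (Suc j)\<^esub>}" using fin[of "Suc j"] cosyzD(1) by auto
    then show ?case unfolding Ext_vanish_def nat.case
      using homs_zero[OF modI] module_homs_zero[OF modI modI \<delta>] homCD(2)
      by (intro ballI bexI[of _ "\<lambda>_. \<zero>\<^bsub>I j\<^esub>"]) fastforce+
  next
    case (Suc n)
    have "Ext_vanish (restr (restr (G (Suc q)) (Z (Suc q))) (B (Suc q))) (Suc (Suc j))"
    proof (rule Ext_vanish_restrict[OF _ mZ BZs])
      show "Ext_k_vanish (Suc (Suc j))" using top(2) Suc.prems by simp
      show "Ext_vanish (restr (G (Suc q)) (Z (Suc q))) (Suc (Suc j))"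
        by (rule Suc.hyps(1)) (use Suc in auto)
    qed (use killZ in auto)
    then show ?case by (intro kernel) simp
  qed
  have main: "Z q = B q" if "q \<le> s" for q
  proof (rule ccontr)
    assume "Z q \<noteq> B q"
    define t where "t = (LEAST q. Z q \<noteq> B q)"
    have t: "Z t \<noteq> B t" unfolding t_def by (rule LeastI) (rule \<open>Z q \<noteq> B q\<close>)
    have below: "Z i = B i" if "i < t" for i using not_less_Least that unfolding t_def by blast
    have "t \<le> q" unfolding t_def by (rule Least_le) fact
    then have ts: "t \<le> s" using that by simp
    \<comment> \<open>Below \<open>t\<close> cocycles and coboundaries agree, so vanishing
      propagates upwards from \<open>B 0\<close>, which is zero. Each shift raises the Ext degree by
      one, hence the condition \<open>i \<le> j\<close>.\<close>
    have low: "Ext_vanish (restr (G i) (B i)) j" if "i \<le> t" "i \<le> j" for i j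
      using that
    proof (induction i arbitrary: j)
      case 0
      have "f x = \<zero>\<^bsub>I j\<^esub>" if "f \<in> module_homs R (restr (G 0) (B 0)) (C j)" "x \<in> B 0" for f x
        using module_homs_zero[OF module_restr[OF G Bs] modC that(1)] that(2) by (simp add: B_def)
      then show ?case unfolding Ext_vanish_def
        using homs_zero[OF modI] module_homs_zero[OF modI modI \<delta>]
        by (cases j) (auto intro!: bexI[of _ "\<lambda>_. \<zero>\<^bsub>I (j - 1)\<^esub>"])
    next
      case (Suc i)
      then obtain j' where j: "j = Suc j'" "i \<le> j'" by (cases j) auto
      have "Ext_vanish (restr (G i) (B i)) j'" using Suc j by simp
      then show ?case unfolding j(1) using image below[of i] Suc.prems by simp
    qed
    obtain z where z: "z \<in> Z t" "z \<notin> B t" using t BZ by blast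
    \<comment> \<open>Since \<open>t \<le> s\<close>, the low range reaches Ext degree
      \<open>s\<close>. The nonzero cohomology in degree \<open>t\<close> then forces Ext^{s+1}(k,
      N) to vanish, against the choice of \<open>s\<close>.\<close>
    have "Ext_k_vanish s"
    proof (rule Ext_k_vanish_of_socle[OF mZ BZs])
      show "Ext_k_vanish (Suc s)" using top(2) by simp
      show "Ext_vanish (restr (G t) (Z t)) (Suc s)" by (rule high) simp
      show "Ext_vanish (restr (restr (G t) (Z t)) (B t)) s" using low[of t s] ts by simp
      show "z \<in> carrier (restr (G t) (Z t))" "z \<notin> B t" using z by simp_all
    qed (use killZ in auto)
    then show False using top(1) by simp
  qed
  show "module_ker (G 0) (G 1) (dG 0) = {\<zero>\<^bsub>G 0\<^esub>}" using main[of 0] by (simp add: Z_def B_def)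
  show "module_ker (G (Suc q)) (G (Suc (Suc q))) (dG (Suc q)) = dG q ` carrier (G q)" if "q < s" for q
    using main[of "Suc q"] that by (simp add: Z_def B_def)
qed

end

section \<open>Minimal free resolutions of the residue field\<close>

text \<open>The given module is only isomorphic to the residue field; a generator whose annihilator
  is the maximal ideal is all that is used of the isomorphism afterwards.\<close>

lemma residue_field_generator:
  assumes R: "noetherian_ring R" "local_ring R" and k: "module R k"
    and iso: "module_isomorphic R k (residue_field_module R)"
  shows "\<exists>u\<in>carrier k. (\<forall>a\<in>carrier R. a \<odot>\<^bsub>k\<^esub> u = \<zero>\<^bsub>k\<^esub> \<longleftrightarrow> a \<in> max_ideal R) \<and>
    (\<forall>y\<in>carrier k. \<exists>a\<in>carrier R. y = a \<odot>\<^bsub>k\<^esub> u)"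
proof -
  interpret noetherian_local R "max_ideal R" by (rule noetherian_local_max_ideal[OF R])
  interpret k: module R k by fact
  let ?m = "max_ideal R" and ?K = "residue_field_module R"
  define c where "c a = ?m +>\<^bsub>R\<^esub> a" for a
  obtain \<phi> where \<phi>: "\<phi> \<in> module_homs R k ?K" and bij: "bij_betw \<phi> (carrier k) (carrier ?K)"
    using iso by (auto simp: module_isomorphic_def)
  note D = module_homsD[OF \<phi>]
  have K: "carrier ?K = c ` carrier R" "\<And>a v. a \<odot>\<^bsub>?K\<^esub> v = c a \<otimes>\<^bsub>R Quot ?m\<^esub> v"
    by (auto simp: residue_field_module_def ring.defs module.defs c_def FactRing_simps)
  have c1: "c \<one>\<^bsub>R\<^esub> \<in> carrier ?K" using K(1) by simp
  then obtain u where u: "u \<in> carrier k" "\<phi> u = c \<one>\<^bsub>R\<^esub>" using bij by (metis bij_betw_imp_surj_on imageE)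
  have \<phi>a: "\<phi> (a \<odot>\<^bsub>k\<^esub> u) = c a" if "a \<in> carrier R" for a
    using D(3)[OF that u(1)] u(2) K(2) ring_hom_mult[OF m.rcos_ring_hom that one_closed] that
    by (simp add: c_def)
  have inj: "x = y" if "x \<in> carrier k" "y \<in> carrier k" "\<phi> x = \<phi> y" for x y
    using bij that by (auto simp: bij_betw_def inj_on_def)
  have "a \<odot>\<^bsub>k\<^esub> u = \<zero>\<^bsub>k\<^esub> \<longleftrightarrow> a \<in> ?m" if a: "a \<in> carrier R" for a
  proof -
    have "a \<odot>\<^bsub>k\<^esub> u = \<zero>\<^bsub>k\<^esub> \<longleftrightarrow> c a = c \<zero>\<^bsub>R\<^esub>"
      using inj[of "a \<odot>\<^bsub>k\<^esub> u" "\<zero>\<^bsub>R\<^esub> \<odot>\<^bsub>k\<^esub> u"] \<phi>a[OF a] \<phi>a[OF zero_closed] a u(1) by auto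
    also have "\<dots> \<longleftrightarrow> a \<in> ?m"
      using quotient_eq_iff_same_a_r_cos[OF m.is_ideal a zero_closed] a by (simp add: c_def a_minus_def)
    finally show ?thesis .
  qed
  moreover have "\<exists>a\<in>carrier R. y = a \<odot>\<^bsub>k\<^esub> u" if y: "y \<in> carrier k" for y
  proof -
    obtain a where "a \<in> carrier R" "\<phi> y = c a" using D(1)[OF y] K(1) by auto
    then show ?thesis using inj[OF y, of "a \<odot>\<^bsub>k\<^esub> u"] \<phi>a u(1) by auto
  qed
  ultimately show ?thesis using u(1) by blast
qed

text \<open>For an ideal \<open>P\<close> this is the submodule that \<open>ideal_times\<close>
  obtains as an intersection, here built from below so that rule induction applies.\<close>

definition ideal_mult :: "('a, 'm) module \<Rightarrow> 'a set \<Rightarrow> 'm set" where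
  "ideal_mult M P = lspan M P {\<zero>\<^bsub>M\<^esub>} (carrier M)"

context
  fixes R :: "('a, 'c) ring_scheme" (structure) and M :: "('a, 'm) module" and P
  assumes M: "module R M" and P: "ideal P R"
begin

interpretation module R M by (rule M)

lemma ideal_mult_submodule: "submodule (ideal_mult M P) R M"
  unfolding ideal_mult_def by (rule lspan_submodule[OF P zero_submodule]) simp

lemma ideal_mult_gen: "a \<in> P \<Longrightarrow> x \<in> carrier M \<Longrightarrow> a \<odot>\<^bsub>M\<^esub> x \<in> ideal_mult M P"
  unfolding ideal_mult_def by (rule lspan_gen[OF P zero_submodule]) auto

lemma ideal_mult_minimal:
  assumes "submodule H R M" "\<And>a x. a \<in> P \<Longrightarrow> x \<in> carrier M \<Longrightarrow> a \<odot>\<^bsub>M\<^esub> x \<in> H"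
  shows "ideal_mult M P \<subseteq> H"
proof
  fix v assume "v \<in> ideal_mult M P"
  then show "v \<in> H"
    unfolding ideal_mult_def
    by induction (use assms submodule_mem[OF assms(1)] in auto)
qed

end

text \<open>\<open>W q\<close> and \<open>\<partial> q : F q \<rightarrow> W q\<close> treat the augmentation and the differentials uniformly.\<close>

locale min_resolution = noetherian_local R \<mm>
  for R :: "('a, 'c) ring_scheme" (structure) and \<mm> +
  fixes k :: "('a, 'm) module" and F :: "nat \<Rightarrow> ('a, 'm) module"
    and e :: "'m \<Rightarrow> 'm" and d :: "nat \<Rightarrow> 'm \<Rightarrow> 'm" and u :: 'm
  assumes m_eq: "\<mm> = max_ideal R"
    and min_res: "minimal_free_resolution R k F e d"
    and u: "u \<in> carrier k" "\<And>a. a \<in> carrier R \<Longrightarrow> a \<odot>\<^bsub>k\<^esub> u = \<zero>\<^bsub>k\<^esub> \<longleftrightarrow> a \<in> \<mm>"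
      "\<And>y. y \<in> carrier k \<Longrightarrow> \<exists>a\<in>carrier R. y = a \<odot>\<^bsub>k\<^esub> u"
begin

definition W :: "nat \<Rightarrow> ('a, 'm) module" where
  "W q = (case q of 0 \<Rightarrow> k | Suc i \<Rightarrow> F i)"

definition bdry :: "nat \<Rightarrow> 'm \<Rightarrow> 'm" ("\<partial>") where
  "bdry q = (case q of 0 \<Rightarrow> e | Suc i \<Rightarrow> d i)"

lemma modk: "module R k" and free: "finite_free_module R (F q)" and modF: "module R (F q)"
  and d_hom: "d q \<in> module_homs R (F (Suc q)) (F q)"
  using min_res by (auto simp: minimal_free_resolution_def finite_free_module_def)

lemma W_simps [simp]: "W 0 = k" "W (Suc q) = F q"
  by (simp_all add: W_def)

lemma bdry_simps [simp]: "\<partial> 0 = e" "\<partial> (Suc q) = d q"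
  by (simp_all add: bdry_def)

lemma bdry_hom: "\<partial> q \<in> module_homs R (F q) (W q)"
  using min_res by (cases q) (auto simp: minimal_free_resolution_def)

lemma d_image: "d q ` carrier (F (Suc q)) = module_ker (F q) (W q) (\<partial> q)"
  using min_res by (cases q) (auto simp: minimal_free_resolution_def)

lemma e_onto: "e ` carrier (F 0) = carrier k"
  using min_res by (auto simp: minimal_free_resolution_def)

lemma bdry_d: "y \<in> carrier (F (Suc q)) \<Longrightarrow> \<partial> q (d q y) = \<zero>\<^bsub>W q\<^esub>"
  using d_image[of q] by (auto simp: module_ker_def)

lemma dd: "y \<in> carrier (F (Suc (Suc q))) \<Longrightarrow> d q (d (Suc q) y) = \<zero>\<^bsub>F q\<^esub>"
  using bdry_d[of y "Suc q"] by simp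

lemma exact:
  assumes "x \<in> carrier (F q)" "\<partial> q x = \<zero>\<^bsub>W q\<^esub>"
  shows "\<exists>y\<in>carrier (F (Suc q)). x = d q y"
proof -
  have "x \<in> d q ` carrier (F (Suc q))" unfolding d_image using assms by (simp add: module_ker_def)
  then show ?thesis by blast
qed

lemma k_killed: "a \<in> \<mm> \<Longrightarrow> y \<in> carrier k \<Longrightarrow> a \<odot>\<^bsub>k\<^esub> y = \<zero>\<^bsub>k\<^esub>"
proof -
  interpret k: module R k by (rule modk)
  assume a: "a \<in> \<mm>" and "y \<in> carrier k"
  then obtain b where b: "b \<in> carrier R" "y = b \<odot>\<^bsub>k\<^esub> u" using u(3) by blast
  have "a \<odot>\<^bsub>k\<^esub> y = b \<odot>\<^bsub>k\<^esub> (a \<odot>\<^bsub>k\<^esub> u)"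
    using a b u(1) k.smult_assoc1[of a b u] k.smult_assoc1[of b a u] by (simp add: m_comm)
  also have "\<dots> = \<zero>\<^bsub>k\<^esub>" using u(2)[of a] a b by simp
  finally show ?thesis .
qed

definition coords :: "nat \<Rightarrow> 'm set \<times> ('m \<Rightarrow> 'm \<Rightarrow> 'a)" where
  "coords q = (SOME Bp. dual_basis R (F q) (fst Bp) (\<lambda>b. b) (snd Bp) \<and>
    (\<forall>b\<in>fst Bp. \<forall>b'\<in>fst Bp. snd Bp b b' = (if b = b' then \<one> else \<zero>)))"

abbreviation "bas q \<equiv> fst (coords q)"
abbreviation "crd q \<equiv> snd (coords q)"

lemma basis: "dual_basis R (F q) (bas q) (\<lambda>b. b) (crd q)"
  and crd_delta: "b \<in> bas q \<Longrightarrow> b' \<in> bas q \<Longrightarrow> crd q b b' = (if b = b' then \<one> else \<zero>)"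
proof -
  have "\<exists>Bp. dual_basis R (F q) (fst Bp) (\<lambda>b. b) (snd Bp) \<and>
    (\<forall>b\<in>fst Bp. \<forall>b'\<in>fst Bp. snd Bp b b' = (if b = b' then \<one> else \<zero>))"
    using finite_free_dual_basis[OF free, of q] by auto
  from someI_ex[OF this, folded coords_def]
  show "dual_basis R (F q) (bas q) (\<lambda>b. b) (crd q)"
    "b \<in> bas q \<Longrightarrow> b' \<in> bas q \<Longrightarrow> crd q b b' = (if b = b' then \<one> else \<zero>)"
    by auto
qed

lemma bas: "finite (bas q)" "b \<in> bas q \<Longrightarrow> b \<in> carrier (F q)"
  using basis[of q] by (auto simp: dual_basis_def)

lemmas crd = dual_basis_coord[OF basis]

lemma crd_hom: "b \<in> bas q \<Longrightarrow> crd q b \<in> module_homs R (F q) (ring_as_module R)"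
  using basis[of q] by (auto simp: dual_basis_def)

lemma expand: "x \<in> carrier (F q) \<Longrightarrow> x = (\<Oplus>\<^bsub>F q\<^esub>b\<in>bas q. crd q b x \<odot>\<^bsub>F q\<^esub> b)"
  using basis[of q] unfolding dual_basis_def by blast

lemma lift_F:
  assumes "dual_basis R P T p \<pi>" "module R P" "f \<in> module_homs R P (F q)"
    and "\<And>x. x \<in> carrier P \<Longrightarrow> \<partial> q (f x) = \<zero>\<^bsub>W q\<^esub>"
  shows "\<exists>g\<in>module_homs R P (F (Suc q)). \<forall>x\<in>carrier P. d q (g x) = f x"
  by (rule dual_basis_lift[OF assms(1,2) modF modF d_hom assms(3)])
    (use assms(4) module_homsD(1)[OF assms(3)] in \<open>auto simp: d_image module_ker_def\<close>)

definition mF :: "nat \<Rightarrow> 'm set" where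
  "mF q = ideal_mult (F q) \<mm>"

lemma mF_sub: "submodule (mF q) R (F q)"
  unfolding mF_def by (rule ideal_mult_submodule[OF modF m.is_ideal])

lemmas mF_mem = module.submodule_mem[OF modF mF_sub]

lemma mF_iff:
  assumes "x \<in> carrier (F q)"
  shows "x \<in> mF q \<longleftrightarrow> (\<forall>b\<in>bas q. crd q b x \<in> \<mm>)"
proof
  interpret F: module R "F q" by (rule modF)
  assume "x \<in> mF q"
  then show "\<forall>b\<in>bas q. crd q b x \<in> \<mm>"
    unfolding mF_def ideal_mult_def
  proof (induction x rule: lspan.induct)
    case (base l)
    then show ?case
      using module_homs_zero[OF modF module_ring_as_module[OF is_cring] crd_hom] by auto
  next
    case (step v a t)
    have v: "v \<in> carrier (F q)"
      by (rule F.lspan_carrier[OF m.is_ideal F.zero_submodule _ step(1)]) simp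
    show ?case
      using step v crd ideal_closed[OF m.is_ideal] by auto
  qed
next
  interpret F: module R "F q" by (rule modF)
  assume "\<forall>b\<in>bas q. crd q b x \<in> \<mm>"
  then have "crd q b x \<odot>\<^bsub>F q\<^esub> b \<in> mF q" if "b \<in> bas q" for b
    using ideal_mult_gen[OF modF m.is_ideal] bas(2) that by (simp add: mF_def)
  then have "(\<Oplus>\<^bsub>F q\<^esub>b\<in>bas q. crd q b x \<odot>\<^bsub>F q\<^esub> b) \<in> mF q"
    by (rule F.finsum_in_submodule[OF mF_sub bas(1)])
  then show "x \<in> mF q" using expand[OF assms] by simp
qed

lemma hom_mF:
  assumes M: "module R M" and f: "f \<in> module_homs R (F q) M" and x: "x \<in> mF q"
  shows "f x \<in> ideal_mult M \<mm>"
proof -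
  note s = submodule_vimage[OF modF M f ideal_mult_submodule[OF M m.is_ideal]]
  have "mF q \<subseteq> {x \<in> carrier (F q). f x \<in> ideal_mult M \<mm>}"
    unfolding mF_def
  proof (rule ideal_mult_minimal[OF modF m.is_ideal s])
    interpret F: module R "F q" by (rule modF)
    show "a \<odot>\<^bsub>F q\<^esub> y \<in> {x \<in> carrier (F q). f x \<in> ideal_mult M \<mm>}" if "a \<in> \<mm>" "y \<in> carrier (F q)" for a y
      using that module_homsD[OF f] ideal_mult_gen[OF M m.is_ideal] by simp
  qed
  then show ?thesis using x by blast
qed

lemma hom_F_mF:
  assumes f: "f \<in> module_homs R (F q) (F p)" and x: "x \<in> mF q"
  shows "f x \<in> mF p"
  using hom_mF[OF modF f x] by (simp add: mF_def)

lemma d_mF: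
  assumes y: "y \<in> carrier (F (Suc q))"
  shows "d q y \<in> mF q"
proof -
  have "d q ` carrier (F (Suc q)) \<subseteq> ideal_times R \<mm> (F q)"
    using min_res m_eq by (simp add: minimal_free_resolution_def)
  then have "d q y \<in> ideal_times R \<mm> (F q)" using y by blast
  moreover have "mF q \<in> {H. submodule H R (F q) \<and> (\<forall>a\<in>\<mm>. \<forall>x\<in>carrier (F q). a \<odot>\<^bsub>F q\<^esub> x \<in> H)}"
    using mF_sub ideal_mult_gen[OF modF m.is_ideal] by (simp add: mF_def)
  ultimately show ?thesis unfolding ideal_times_def by blast
qed

lemma mF0_iff:
  assumes x: "x \<in> carrier (F 0)"
  shows "x \<in> mF 0 \<longleftrightarrow> e x = \<zero>\<^bsub>k\<^esub>"
proof
  interpret k: module R k by (rule modk)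
  have ek: "e \<in> module_homs R (F 0) k" using bdry_hom[of 0] by simp
  assume "x \<in> mF 0"
  then have "e x \<in> ideal_mult k \<mm>" by (rule hom_mF[OF modk ek])
  also have "ideal_mult k \<mm> \<subseteq> {\<zero>\<^bsub>k\<^esub>}"
    by (rule ideal_mult_minimal[OF modk m.is_ideal k.zero_submodule]) (simp add: k_killed)
  finally show "e x = \<zero>\<^bsub>k\<^esub>" by simp
next
  assume "e x = \<zero>\<^bsub>k\<^esub>"
  then obtain y where "y \<in> carrier (F 1)" "x = d 0 y" using exact[of x 0] x by auto
  then show "x \<in> mF 0" using d_mF[of y 0] by simp
qed

text \<open>By minimality the kernel of \<open>e\<close> is \<mm> \<open>F 0\<close>. Since
  \<open>k\<close> has one generator, every basis element differs from a multiple of a fixed one by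
  an element of the kernel; a second basis element would then have its own coordinate 1 in
  \<open>\<mm>\<close>.\<close>

lemma F0_rank_one: "\<exists>b. bas 0 = {b}"
proof -
  interpret F: module R "F 0" by (rule modF)
  interpret k: module R k by (rule modk)
  have ek: "e \<in> module_homs R (F 0) k" using bdry_hom[of 0] by simp
  note eD = module_homsD[OF ek]
  have u0: "u \<noteq> \<zero>\<^bsub>k\<^esub>" using u(1) u(2)[OF one_closed] one_notin_m by simp
  have "\<exists>b\<in>bas 0. e b \<noteq> \<zero>\<^bsub>k\<^esub>"
  proof (rule ccontr)
    assume no: "\<not> ?thesis"
    obtain x where x: "x \<in> carrier (F 0)" "e x = u" using e_onto u(1) by (metis imageE)
    have "b \<in> mF 0" if "b \<in> bas 0" for b using no mF0_iff bas(2) that by simp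
    then have "(\<Oplus>\<^bsub>F 0\<^esub>b\<in>bas 0. crd 0 b x \<odot>\<^bsub>F 0\<^esub> b) \<in> mF 0"
      using crd(1) x(1) by (intro F.finsum_in_submodule[OF mF_sub bas(1)] mF_mem(6)) auto
    then have "x \<in> mF 0" using expand[OF x(1)] by simp
    then show False using mF0_iff x u0 by simp
  qed
  then obtain b0 where b0: "b0 \<in> bas 0" "e b0 \<noteq> \<zero>\<^bsub>k\<^esub>" by blast
  have b0F: "b0 \<in> carrier (F 0)" using bas(2)[OF b0(1)] .
  obtain c where c: "c \<in> carrier R" "e b0 = c \<odot>\<^bsub>k\<^esub> u" using u(3) eD(1)[OF b0F] by blast
  have "c \<notin> \<mm>" using b0(2) c u(2) by auto
  then obtain c' where c': "c' \<in> carrier R" "c' \<otimes> c = \<one>" using unit_of_notin_m c(1) by blast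
  have "b = b0" if b: "b \<in> bas 0" for b
  proof (rule ccontr)
    assume ne: "b \<noteq> b0"
    have bF: "b \<in> carrier (F 0)" using bas(2)[OF b] .
    obtain a where a: "a \<in> carrier R" "e b = a \<odot>\<^bsub>k\<^esub> u" using u(3) eD(1)[OF bF] by blast
    \<comment> \<open>\<open>c'\<close> inverts the coefficient of \<open>e b0\<close>, so this
      multiple of \<open>b0\<close> has the same image in \<open>k\<close> as
      \<open>b\<close>.\<close>
    let ?r = "a \<otimes> c'"
    have r: "?r \<in> carrier R" using a c' by simp
    have "c' \<odot>\<^bsub>k\<^esub> e b0 = u" using c c' u(1) k.smult_assoc1[of c' c u] by simp
    then have eb: "?r \<odot>\<^bsub>k\<^esub> e b0 = e b" using a c'(1) k.smult_assoc1[of a c' "e b0"] eD(1)[OF b0F] by simp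
    have "e (b \<ominus>\<^bsub>F 0\<^esub> ?r \<odot>\<^bsub>F 0\<^esub> b0) = e b \<ominus>\<^bsub>k\<^esub> e (?r \<odot>\<^bsub>F 0\<^esub> b0)"
      by (rule module_homs_minus[OF modF modk ek bF]) (use r b0F in simp)
    also have "\<dots> = \<zero>\<^bsub>k\<^esub>" using eD(3)[OF r b0F] eb k.diff_self[OF eD(1)[OF bF]] by simp
    finally have mem: "b \<ominus>\<^bsub>F 0\<^esub> ?r \<odot>\<^bsub>F 0\<^esub> b0 \<in> mF 0" using mF0_iff bF b0F r by simp
    have crb: "crd 0 b \<in> module_homs R (F 0) (ring_as_module R)" by (rule crd_hom[OF b])
    have "crd 0 b (b \<ominus>\<^bsub>F 0\<^esub> ?r \<odot>\<^bsub>F 0\<^esub> b0) \<in> \<mm>" using mem mF_iff mF_mem(1)[OF mem] b by blast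
    moreover have "crd 0 b (b \<ominus>\<^bsub>F 0\<^esub> ?r \<odot>\<^bsub>F 0\<^esub> b0) = \<one>"
    proof -
      have nb: "\<ominus>\<^bsub>F 0\<^esub> (?r \<odot>\<^bsub>F 0\<^esub> b0) = (\<ominus> ?r) \<odot>\<^bsub>F 0\<^esub> b0" using F.smult_l_minus[OF r b0F] by simp
      show ?thesis
        unfolding a_minus_def[of "F 0"] nb
        using crd(2)[OF b bF, of "(\<ominus> ?r) \<odot>\<^bsub>F 0\<^esub> b0"] crd(3)[OF b _ b0F, of "\<ominus> ?r"] r b0F
          crd_delta[OF b b] crd_delta[OF b b0(1)] ne by simp
    qed
    ultimately show False using one_notin_m by simp
  qed
  then have "bas 0 = {b0}" using b0(1) by blast
  then show ?thesis by blast
qed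

definition b0 :: 'm where "b0 = (SOME b. bas 0 = {b})"

lemma bas0: "bas 0 = {b0}"
  unfolding b0_def by (rule someI_ex[OF F0_rank_one])

abbreviation "crd0 \<equiv> crd 0 b0"

lemma b0: "b0 \<in> carrier (F 0)" "crd0 b0 = \<one>" "x \<in> carrier (F 0) \<Longrightarrow> x = crd0 x \<odot>\<^bsub>F 0\<^esub> b0"
  "x \<in> carrier (F 0) \<Longrightarrow> crd0 x \<in> carrier R" "a \<in> carrier R \<Longrightarrow> crd0 (a \<odot>\<^bsub>F 0\<^esub> b0) = a"
proof -
  interpret F: module R "F 0" by (rule modF)
  have b: "b0 \<in> bas 0" using bas0 by simp
  show b0: "b0 \<in> carrier (F 0)" using bas(2)[OF b] .
  show one: "crd0 b0 = \<one>" using crd_delta[OF b b] by simp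
  show cr: "x \<in> carrier (F 0) \<Longrightarrow> crd0 x \<in> carrier R" for x using crd(1)[OF b] .
  show "x \<in> carrier (F 0) \<Longrightarrow> x = crd0 x \<odot>\<^bsub>F 0\<^esub> b0"
    using expand[of x 0] cr[of x] b0 unfolding bas0 by simp
  show "a \<in> carrier R \<Longrightarrow> crd0 (a \<odot>\<^bsub>F 0\<^esub> b0) = a" using crd(3)[OF b _ b0] one by simp
qed

lemma crd0_hom: "crd0 \<in> module_homs R (F 0) (ring_as_module R)"
  using crd_hom bas0 by simp

lemma mF0_crd: "x \<in> carrier (F 0) \<Longrightarrow> x \<in> mF 0 \<longleftrightarrow> crd0 x \<in> \<mm>"
  using mF_iff[of x 0] bas0 by simp

lemma mF0_image:
  assumes "x \<in> mF 0" shows "\<exists>y\<in>carrier (F 1). x = d 0 y"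
  using exact[of x 0] mF0_iff mF_mem(1)[OF assms] assms by simp

text \<open>Up to the scalar \<open>\<rho>\<close>, \<open>T\<close> is a chain map that induces zero on \<open>k\<close>. It is null-homotopic,
  and the differentials vanish modulo \<open>\<mm>\<close>.\<close>

lemma chain_map_mF:
  assumes T: "\<And>q. T q \<in> module_homs R (F q) (F q)" and r: "\<rho> \<in> carrier R"
    and chain: "\<And>q y. y \<in> carrier (F (Suc q)) \<Longrightarrow> d q (T (Suc q) y) = \<rho> \<odot>\<^bsub>F q\<^esub> T q (d q y)"
    and T0: "T 0 b0 \<in> mF 0"
  shows "x \<in> carrier (F q) \<Longrightarrow> T q x \<in> mF q"
proof -
  have T0': "T 0 x \<in> mF 0" if "x \<in> carrier (F 0)" for x
  proof -
    have "T 0 x = crd0 x \<odot>\<^bsub>F 0\<^esub> T 0 b0"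
      using module_homsD(3)[OF T b0(4)[OF that] b0(1)] b0(3)[OF that] by simp
    then show ?thesis using mF_mem(6)[OF b0(4)[OF that] T0] by simp
  qed
  \<comment> \<open>The induction carries a partial homotopy: T - \<rho> s d has values in cycles,
    so it lifts along the next differential. Then \<open>T\<close> is a boundary plus \<rho> s d,
    and both terms lie in \<mm> F by minimality.\<close>
  have "(\<exists>s\<in>module_homs R (F q) (F (Suc q)).
      \<forall>y\<in>carrier (F (Suc q)). d q (T (Suc q) y \<ominus>\<^bsub>F (Suc q)\<^esub> \<rho> \<odot>\<^bsub>F (Suc q)\<^esub> s (d q y)) = \<zero>\<^bsub>F q\<^esub>) \<and>
      (\<forall>x\<in>carrier (F q). T q x \<in> mF q)" for q
  proof (induction q)
    case 0
    interpret F0: module R "F 0" by (rule modF)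
    interpret F1: module R "F (Suc 0)" by (rule modF)
    have "\<exists>s\<in>module_homs R (F 0) (F (Suc 0)). \<forall>x\<in>carrier (F 0). d 0 (s x) = T 0 x"
      by (rule lift_F[OF basis modF T]) (use T0' mF0_iff mF_mem(1) in auto)
    then obtain s where s: "s \<in> module_homs R (F 0) (F (Suc 0))" "\<And>x. x \<in> carrier (F 0) \<Longrightarrow> d 0 (s x) = T 0 x"
      by blast
    have "d 0 (T (Suc 0) y \<ominus>\<^bsub>F (Suc 0)\<^esub> \<rho> \<odot>\<^bsub>F (Suc 0)\<^esub> s (d 0 y)) = \<zero>\<^bsub>F 0\<^esub>" if y: "y \<in> carrier (F (Suc 0))" for y
    proof -
      have dy: "d 0 y \<in> carrier (F 0)" using module_homsD(1)[OF d_hom y] .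
      have sy: "s (d 0 y) \<in> carrier (F (Suc 0))" using module_homsD(1)[OF s(1) dy] .
      have "d 0 (T (Suc 0) y \<ominus>\<^bsub>F (Suc 0)\<^esub> \<rho> \<odot>\<^bsub>F (Suc 0)\<^esub> s (d 0 y))
        = d 0 (T (Suc 0) y) \<ominus>\<^bsub>F 0\<^esub> d 0 (\<rho> \<odot>\<^bsub>F (Suc 0)\<^esub> s (d 0 y))"
        by (rule module_homs_minus[OF modF modF d_hom module_homsD(1)[OF T y]]) (use r sy in simp)
      also have "\<dots> = \<zero>\<^bsub>F 0\<^esub>"
        unfolding chain[OF y] module_homsD(3)[OF d_hom r sy] s(2)[OF dy]
        by (rule F0.diff_self) (use r module_homsD(1)[OF T dy] in simp)
      finally show ?thesis .
    qed
    then show ?case using s(1) T0' by blast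
  next
    case (Suc q)
    interpret Fq: module R "F q" by (rule modF)
    interpret F1: module R "F (Suc q)" by (rule modF)
    interpret F2: module R "F (Suc (Suc q))" by (rule modF)
    obtain s where s: "s \<in> module_homs R (F q) (F (Suc q))"
      "\<And>y. y \<in> carrier (F (Suc q)) \<Longrightarrow> d q (T (Suc q) y \<ominus>\<^bsub>F (Suc q)\<^esub> \<rho> \<odot>\<^bsub>F (Suc q)\<^esub> s (d q y)) = \<zero>\<^bsub>F q\<^esub>"
      using Suc by blast
    have sd: "(\<lambda>y. \<rho> \<odot>\<^bsub>F (Suc q)\<^esub> s (d q y)) \<in> module_homs R (F (Suc q)) (F (Suc q))"
      by (rule homs_smult[OF modF module_homs_comp[OF d_hom s(1)] r])
    have "\<exists>s'\<in>module_homs R (F (Suc q)) (F (Suc (Suc q))).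
      \<forall>x\<in>carrier (F (Suc q)). d (Suc q) (s' x) = T (Suc q) x \<ominus>\<^bsub>F (Suc q)\<^esub> \<rho> \<odot>\<^bsub>F (Suc q)\<^esub> s (d q x)"
      by (rule lift_F[OF basis modF homs_diff[OF modF T sd]]) (use s(2) in simp)
    then obtain s' where s': "s' \<in> module_homs R (F (Suc q)) (F (Suc (Suc q)))"
      "\<And>x. x \<in> carrier (F (Suc q)) \<Longrightarrow> d (Suc q) (s' x) = T (Suc q) x \<ominus>\<^bsub>F (Suc q)\<^esub> \<rho> \<odot>\<^bsub>F (Suc q)\<^esub> s (d q x)"
      by blast
    have "T (Suc q) x \<in> mF (Suc q)" if x: "x \<in> carrier (F (Suc q))" for x
    proof -
      have "T (Suc q) x = d (Suc q) (s' x) \<oplus>\<^bsub>F (Suc q)\<^esub> \<rho> \<odot>\<^bsub>F (Suc q)\<^esub> s (d q x)"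
        unfolding s'(2)[OF x]
        by (rule F1.diff_add_cancel[symmetric]) (use module_homsD(1)[OF T x] module_homsD(1)[OF sd x] in auto)
      also have "\<dots> \<in> mF (Suc q)"
        by (intro mF_mem(3,6) d_mF hom_F_mF[OF s(1)] module_homsD(1)[OF s'(1)] x r)
      finally show ?thesis .
    qed
    moreover have "d (Suc q) (T (Suc (Suc q)) y \<ominus>\<^bsub>F (Suc (Suc q))\<^esub> \<rho> \<odot>\<^bsub>F (Suc (Suc q))\<^esub> s' (d (Suc q) y)) = \<zero>\<^bsub>F (Suc q)\<^esub>"
      if y: "y \<in> carrier (F (Suc (Suc q)))" for y
    proof -
      have dy: "d (Suc q) y \<in> carrier (F (Suc q))" using module_homsD(1)[OF d_hom y] .
      have sy: "s' (d (Suc q) y) \<in> carrier (F (Suc (Suc q)))" using module_homsD(1)[OF s'(1) dy] .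
      have Tdy: "T (Suc q) (d (Suc q) y) \<in> carrier (F (Suc q))" using module_homsD(1)[OF T dy] .
      have "s (d q (d (Suc q) y)) = \<zero>\<^bsub>F (Suc q)\<^esub>" using dd[OF y] module_homs_zero[OF modF modF s(1)] by simp
      then have eq: "d (Suc q) (s' (d (Suc q) y)) = T (Suc q) (d (Suc q) y)"
        using s'(2)[OF dy] r F1.diff_zero[OF Tdy] by simp
      have "d (Suc q) (T (Suc (Suc q)) y \<ominus>\<^bsub>F (Suc (Suc q))\<^esub> \<rho> \<odot>\<^bsub>F (Suc (Suc q))\<^esub> s' (d (Suc q) y))
        = d (Suc q) (T (Suc (Suc q)) y) \<ominus>\<^bsub>F (Suc q)\<^esub> d (Suc q) (\<rho> \<odot>\<^bsub>F (Suc (Suc q))\<^esub> s' (d (Suc q) y))"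
        by (rule module_homs_minus[OF modF modF d_hom module_homsD(1)[OF T y]]) (use r sy in simp)
      also have "\<dots> = \<zero>\<^bsub>F (Suc q)\<^esub>"
        unfolding chain[OF y] module_homsD(3)[OF d_hom r sy] eq
        by (rule F1.diff_self) (use r Tdy in simp)
      finally show ?thesis .
    qed
    ultimately show ?case using s'(1) by blast
  qed
  then show "x \<in> carrier (F q) \<Longrightarrow> T q x \<in> mF q" by blast
qed

text \<open>Multiplication by \<open>x\<close> induces zero on \<open>k\<close>, so it is
  null-homotopic on the resolution. Each new map is a lift of x - h d, and the invariant
  \<open>P\<close> says that this has values in cycles.\<close>

lemma homotopy:
  assumes x: "x \<in> \<mm>"
  shows "\<exists>h. (\<forall>q. h q \<in> module_homs R (F q) (F (Suc q))) \<and>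
    (\<forall>y\<in>carrier (F 0). d 0 (h 0 y) = x \<odot>\<^bsub>F 0\<^esub> y) \<and>
    (\<forall>q. \<forall>y\<in>carrier (F (Suc q)). d (Suc q) (h (Suc q) y) = x \<odot>\<^bsub>F (Suc q)\<^esub> y \<ominus>\<^bsub>F (Suc q)\<^esub> h q (d q y))"
proof -
  have xR: "x \<in> carrier R" using x by simp
  define P where "P q h \<longleftrightarrow> h \<in> module_homs R (F q) (F (Suc q)) \<and>
    (\<forall>y\<in>carrier (F (Suc q)). d q (h (d q y)) = x \<odot>\<^bsub>F q\<^esub> d q y) \<and>
    (q = 0 \<longrightarrow> (\<forall>y\<in>carrier (F 0). d 0 (h y) = x \<odot>\<^bsub>F 0\<^esub> y))" for q h
  define Q where "Q q h h' \<longleftrightarrow>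
    (\<forall>y\<in>carrier (F (Suc q)). d (Suc q) (h' y) = x \<odot>\<^bsub>F (Suc q)\<^esub> y \<ominus>\<^bsub>F (Suc q)\<^esub> h (d q y))" for q h h'
  have mult: "(\<lambda>y. x \<odot>\<^bsub>F q\<^esub> y) \<in> module_homs R (F q) (F q)" for q
    by (rule homs_smult[OF modF _ xR]) (auto simp: module_homs_def)
  have "\<exists>f. \<forall>n. P n (f n) \<and> Q n (f n) (f (Suc n))"
  proof (rule dependent_nat_choice)
    interpret F0: module R "F 0" by (rule modF)
    have "\<exists>h\<in>module_homs R (F 0) (F (Suc 0)). \<forall>y\<in>carrier (F 0). d 0 (h y) = x \<odot>\<^bsub>F 0\<^esub> y"
    proof (rule lift_F[OF basis modF mult])
      fix y assume y: "y \<in> carrier (F 0)"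
      have "x \<odot>\<^bsub>F 0\<^esub> y \<in> mF 0" using ideal_mult_gen[OF modF m.is_ideal x y] by (simp add: mF_def)
      then show "\<partial> 0 (x \<odot>\<^bsub>F 0\<^esub> y) = \<zero>\<^bsub>W 0\<^esub>" using mF0_iff xR y by simp
    qed
    then show "\<exists>h. P 0 h" unfolding P_def using module_homsD(1)[OF d_hom] by blast
  next
    fix h q assume h: "P q h"
    then have hh: "h \<in> module_homs R (F q) (F (Suc q))"
      and hd: "\<And>y. y \<in> carrier (F (Suc q)) \<Longrightarrow> d q (h (d q y)) = x \<odot>\<^bsub>F q\<^esub> d q y" by (auto simp: P_def)
    interpret Fq: module R "F q" by (rule modF)
    interpret F1: module R "F (Suc q)" by (rule modF)
    have comp: "(\<lambda>y. h (d q y)) \<in> module_homs R (F (Suc q)) (F (Suc q))" by (rule module_homs_comp[OF d_hom hh])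
    have "\<exists>h'\<in>module_homs R (F (Suc q)) (F (Suc (Suc q))).
      \<forall>y\<in>carrier (F (Suc q)). d (Suc q) (h' y) = x \<odot>\<^bsub>F (Suc q)\<^esub> y \<ominus>\<^bsub>F (Suc q)\<^esub> h (d q y)"
    proof (rule lift_F[OF basis modF homs_diff[OF modF mult comp]])
      fix y assume y: "y \<in> carrier (F (Suc q))"
      have "d q (x \<odot>\<^bsub>F (Suc q)\<^esub> y \<ominus>\<^bsub>F (Suc q)\<^esub> h (d q y)) = d q (x \<odot>\<^bsub>F (Suc q)\<^esub> y) \<ominus>\<^bsub>F q\<^esub> d q (h (d q y))"
        by (rule module_homs_minus[OF modF modF d_hom]) (use xR y module_homsD(1)[OF comp y] in auto)
      also have "\<dots> = \<zero>\<^bsub>F q\<^esub>"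
        unfolding hd[OF y] module_homsD(3)[OF d_hom xR y]
        by (rule Fq.diff_self) (use xR module_homsD(1)[OF d_hom y] in simp)
      finally show "\<partial> (Suc q) (x \<odot>\<^bsub>F (Suc q)\<^esub> y \<ominus>\<^bsub>F (Suc q)\<^esub> h (d q y)) = \<zero>\<^bsub>W (Suc q)\<^esub>" by simp
    qed
    then obtain h' where h': "h' \<in> module_homs R (F (Suc q)) (F (Suc (Suc q)))"
      "\<And>y. y \<in> carrier (F (Suc q)) \<Longrightarrow> d (Suc q) (h' y) = x \<odot>\<^bsub>F (Suc q)\<^esub> y \<ominus>\<^bsub>F (Suc q)\<^esub> h (d q y)" by blast
    have "d (Suc q) (h' (d (Suc q) y)) = x \<odot>\<^bsub>F (Suc q)\<^esub> d (Suc q) y" if y: "y \<in> carrier (F (Suc (Suc q)))" for y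
    proof -
      have dy: "d (Suc q) y \<in> carrier (F (Suc q))" using module_homsD(1)[OF d_hom y] .
      show ?thesis
        unfolding h'(2)[OF dy] dd[OF y] module_homs_zero[OF modF modF hh]
        by (rule F1.diff_zero) (use xR dy in simp)
    qed
    then show "\<exists>h'. P (Suc q) h' \<and> Q q h h'" using h' unfolding P_def Q_def by blast
  qed
  then obtain h where h: "\<And>n. P n (h n)" "\<And>n. Q n (h n) (h (Suc n))" by blast
  then show ?thesis unfolding P_def Q_def by (intro exI[of _ h]) blast
qed

text \<open>A class in Ext^1(k, k) is given by a map to \<open>F 0\<close> that is a cocycle modulo
  \<open>\<mm>\<close>, and it lifts to a chain map of degree -1 that commutes with the
  differentials without signs. The lift can start because \<mm> \<open>F 0\<close> is the kernel of
  the augmentation.\<close>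

lemma chain_map_lift:
  assumes t0: "t0 \<in> module_homs R (F (Suc 0)) (F 0)"
    and t0d: "\<And>y. y \<in> carrier (F (Suc (Suc 0))) \<Longrightarrow> t0 (d (Suc 0) y) \<in> mF 0"
  shows "\<exists>\<theta>. \<theta> 0 = t0 \<and> (\<forall>q. \<theta> q \<in> module_homs R (F (Suc q)) (F q)) \<and>
    (\<forall>q. \<forall>y\<in>carrier (F (Suc (Suc q))). d q (\<theta> (Suc q) y) = \<theta> q (d (Suc q) y))"
proof -
  define P where "P q t \<longleftrightarrow> t \<in> module_homs R (F (Suc q)) (F q) \<and>
    (\<forall>y\<in>carrier (F (Suc (Suc q))). \<partial> q (t (d (Suc q) y)) = \<zero>\<^bsub>W q\<^esub>) \<and> (q = 0 \<longrightarrow> t = t0)" for q t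
  define Q where "Q q t t' \<longleftrightarrow>
    (\<forall>y\<in>carrier (F (Suc (Suc q))). d q (t' y) = t (d (Suc q) y))" for q t t'
  have "\<exists>f. \<forall>n. P n (f n) \<and> Q n (f n) (f (Suc n))"
  proof (rule dependent_nat_choice)
    show "\<exists>t. P 0 t" unfolding P_def
      using t0 t0d mF0_iff mF_mem(1) by (intro exI[of _ t0]) auto
  next
    fix t q assume t: "P q t"
    then have th: "t \<in> module_homs R (F (Suc q)) (F q)"
      and td: "\<And>y. y \<in> carrier (F (Suc (Suc q))) \<Longrightarrow> \<partial> q (t (d (Suc q) y)) = \<zero>\<^bsub>W q\<^esub>" by (auto simp: P_def)
    obtain t' where t': "t' \<in> module_homs R (F (Suc (Suc q))) (F (Suc q))"
      "\<And>y. y \<in> carrier (F (Suc (Suc q))) \<Longrightarrow> d q (t' y) = t (d (Suc q) y)"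
      using lift_F[OF basis modF module_homs_comp[OF d_hom th] td] by blast
    have "\<partial> (Suc q) (t' (d (Suc (Suc q)) y)) = \<zero>\<^bsub>W (Suc q)\<^esub>" if y: "y \<in> carrier (F (Suc (Suc (Suc q))))" for y
      using t'(2)[OF module_homsD(1)[OF d_hom y]] dd[OF y] module_homs_zero[OF modF modF th] by simp
    then show "\<exists>t'. P (Suc q) t' \<and> Q q t t'" using t' unfolding P_def Q_def by blast
  qed
  then obtain t where t: "\<And>n. P n (t n)" "\<And>n. Q n (t n) (t (Suc n))" by blast
  then show ?thesis unfolding P_def Q_def by (intro exI[of _ t]) blast
qed

end

section \<open>Operators on the minimal resolution of the residue field\<close>

context module
begin

lemma diff_diff_left:
  assumes "v \<in> carrier M" "w \<in> carrier M"
  shows "(v \<ominus>\<^bsub>M\<^esub> w) \<ominus>\<^bsub>M\<^esub> v = \<ominus>\<^bsub>M\<^esub> w"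
  using assms by (simp add: a_minus_def M.a_ac M.r_neg M.r_neg1 M.r_neg2)

lemma diff_diff_diff:
  assumes "v \<in> carrier M" "w \<in> carrier M" "x \<in> carrier M"
  shows "(v \<ominus>\<^bsub>M\<^esub> w) \<ominus>\<^bsub>M\<^esub> (v \<ominus>\<^bsub>M\<^esub> x) = \<ominus>\<^bsub>M\<^esub> (w \<ominus>\<^bsub>M\<^esub> x)"
  using assms by (simp add: a_minus_def M.minus_add M.a_ac M.r_neg M.r_neg1 M.r_neg2)

end

lemma finsum_ring_as_module [simp]: "finsum (ring_as_module R) = finsum R"
  by (simp add: finsum_def finprod_def fun_eq_iff)

lemma (in cring) finsum_in_ideal:
  assumes J: "ideal J R" and "finite T" "\<And>t. t \<in> T \<Longrightarrow> f t \<in> J"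
  shows "(\<Oplus>t\<in>T. f t) \<in> J"
proof -
  interpret A: module R "ring_as_module R" by (rule module_ring_as_module) (rule is_cring)
  have "submodule J R (ring_as_module R)"
    by (rule A.submodule_intro) (auto simp: ideal_closed[OF J])
  then show ?thesis using A.finsum_in_submodule[OF _ assms(2,3)] by simp
qed

lemma (in cring) genideal_list_comb:
  assumes xs: "set xs \<subseteq> carrier R" and c: "c \<in> Idl (set xs)"
  shows "\<exists>a. (\<forall>l<length xs. a l \<in> carrier R) \<and> c = (\<Oplus>l\<in>{..<length xs}. a l \<otimes> xs ! l)"
proof -
  let ?L = "{..<length xs}"
  have x: "xs ! l \<in> carrier R" if "l < length xs" for l using xs that by auto
  define J where "J = {c. \<exists>a. (\<forall>l<length xs. a l \<in> carrier R) \<and> c = (\<Oplus>l\<in>?L. a l \<otimes> xs ! l)}"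
  have "ideal J R"
  proof (rule ideal_intro)
    show "J \<subseteq> carrier R" using x by (auto simp: J_def intro!: finsum_closed)
    have "\<zero> = (\<Oplus>l\<in>?L. \<zero> \<otimes> xs ! l)"
      using finsum_zero[of ?L] finsum_cong'[of ?L ?L "\<lambda>_. \<zero>" "\<lambda>l. \<zero> \<otimes> xs ! l"] x by simp
    then show "\<zero> \<in> J" unfolding J_def by (intro CollectI exI[of _ "\<lambda>_. \<zero>"]) simp
    fix v assume "v \<in> J"
    then obtain a where a: "\<And>l. l < length xs \<Longrightarrow> a l \<in> carrier R" "v = (\<Oplus>l\<in>?L. a l \<otimes> xs ! l)"
      by (auto simp: J_def)
    { fix w assume "w \<in> J"
      then obtain b where b: "\<And>l. l < length xs \<Longrightarrow> b l \<in> carrier R" "w = (\<Oplus>l\<in>?L. b l \<otimes> xs ! l)"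
        by (auto simp: J_def)
      have "v \<oplus> w = (\<Oplus>l\<in>?L. a l \<otimes> xs ! l \<oplus> b l \<otimes> xs ! l)"
        unfolding a b by (rule finsum_addf[symmetric]) (use a b x in auto)
      also have "\<dots> = (\<Oplus>l\<in>?L. (a l \<oplus> b l) \<otimes> xs ! l)"
        by (rule finsum_cong') (use a b x in \<open>auto simp: l_distr\<close>)
      finally show "v \<oplus> w \<in> J" unfolding J_def using a b by (intro CollectI exI[of _ "\<lambda>l. a l \<oplus> b l"]) simp }
    fix r assume r: "r \<in> carrier R"
    have "r \<otimes> v = (\<Oplus>l\<in>?L. r \<otimes> (a l \<otimes> xs ! l))"
      unfolding a by (rule finsum_rdistr) (use a x r in auto)
    also have "\<dots> = (\<Oplus>l\<in>?L. (r \<otimes> a l) \<otimes> xs ! l)"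
      by (rule finsum_cong') (use a x r in \<open>auto simp: m_assoc\<close>)
    finally show "r \<otimes> v \<in> J" unfolding J_def using a r by (intro CollectI exI[of _ "\<lambda>l. r \<otimes> a l"]) simp
  qed
  moreover have "set xs \<subseteq> J"
  proof
    fix y assume "y \<in> set xs"
    then obtain i where i: "i < length xs" "y = xs ! i" by (auto simp: in_set_conv_nth)
    have "(\<Oplus>l\<in>?L. (if l = i then \<one> else \<zero>) \<otimes> xs ! l) = (\<Oplus>l\<in>?L. if i = l then xs ! l else \<zero>)"
      by (rule finsum_cong') (use x in auto)
    also have "\<dots> = xs ! i" by (rule add.finprod_singleton) (use i x in auto)
    finally show "y \<in> J" unfolding J_def i(2)
      by (intro CollectI exI[of _ "\<lambda>l. if l = i then \<one> else \<zero>"]) simp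
  qed
  ultimately have "Idl (set xs) \<subseteq> J" by (rule genideal_minimal)
  then show ?thesis using c by (auto simp: J_def)
qed

lemma (in noetherian_local) local_ring: "local_ring R" and max_ideal_eq: "max_ideal R = \<mm>"
proof -
  show "local_ring R" unfolding local_ring_def using is_cring maximal_m unique_m by blast
  then show "max_ideal R = \<mm>" unfolding max_ideal_def by (intro the_equality maximal_m unique_m)
qed

text \<open>With a unit as coefficient, \<open>xs ! j\<close> would be a combination of the other
  generators and could be dropped, against the minimality of their number.\<close>

lemma (in noetherian_local) minimal_gens_independent:
  assumes xs: "set xs \<subseteq> carrier R" "Idl (set xs) = \<mm>" "length xs = embedding_dim R"
    and a: "\<And>l. l < length xs \<Longrightarrow> a l \<in> carrier R" and z: "(\<Oplus>l\<in>{..<length xs}. a l \<otimes> xs ! l) = \<zero>"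
    and j: "j < length xs"
  shows "a j \<in> \<mm>"
proof (rule ccontr)
  assume "a j \<notin> \<mm>"
  then obtain c where c: "c \<in> carrier R" "c \<otimes> a j = \<one>" using unit_of_notin_m a j by blast
  have x: "xs ! l \<in> carrier R" if "l < length xs" for l using xs that by auto
  define ys where "ys = take j xs @ drop (Suc j) xs"
  have ysR: "set ys \<subseteq> carrier R" using xs(1) by (auto simp: ys_def dest: in_set_takeD in_set_dropD)
  have other: "xs ! l \<in> set ys" if "l < length xs" "l \<noteq> j" for l
  proof (cases "l < j")
    case True
    then have "xs ! l = take j xs ! l" "l < length (take j xs)" using j by auto
    then show ?thesis unfolding ys_def by (metis UnCI nth_mem set_append)
  next
    case False
    then have "xs ! l = drop (Suc j) xs ! (l - Suc j)" "l - Suc j < length (drop (Suc j) xs)" using that j by auto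
    then show ?thesis unfolding ys_def by (metis UnCI nth_mem set_append)
  qed
  note J = genideal_ideal[OF ysR]
  note jc = ideal_closed[OF J]
  have L: "{..<length xs} = insert j ({..<length xs} - {j})" using j by auto
  have "(\<Oplus>l\<in>{..<length xs}. a l \<otimes> xs ! l) = a j \<otimes> xs ! j \<oplus> (\<Oplus>l\<in>{..<length xs} - {j}. a l \<otimes> xs ! l)"
    by (subst L, rule finsum_insert) (use a x j in auto)
  moreover have "(\<Oplus>l\<in>{..<length xs} - {j}. a l \<otimes> xs ! l) \<in> Idl (set ys)"
  proof (rule finsum_in_ideal[OF J])
    fix l assume "l \<in> {..<length xs} - {j}"
    then have l: "l < length xs" "l \<noteq> j" by auto
    show "a l \<otimes> xs ! l \<in> Idl (set ys)"
      using other[OF l] genideal_self[OF ysR] by (intro jc(6) a[OF l(1)]) blast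
  qed simp
  ultimately have "a j \<otimes> xs ! j \<in> Idl (set ys)"
    using sum_mem_cancel[OF J, of "a j \<otimes> xs ! j"] a j x z jc(2) by simp
  then have "c \<otimes> (a j \<otimes> xs ! j) \<in> Idl (set ys)" using jc(6) c by blast
  then have "xs ! j \<in> Idl (set ys)" using c a j x m_assoc[of c "a j" "xs ! j"] by simp
  then have "set xs \<subseteq> Idl (set ys)"
    using other genideal_self[OF ysR] by (metis in_set_conv_nth subsetD subsetI)
  then have "\<mm> \<subseteq> Idl (set ys)" using genideal_minimal[OF J] xs(2) by blast
  moreover have "set ys \<subseteq> set xs" by (auto simp: ys_def dest: in_set_takeD in_set_dropD)
  then have "Idl (set ys) \<subseteq> \<mm>" using subset_Idl_subset[OF xs(1)] xs(2) by blast
  ultimately have "embedding_dim R \<le> length ys"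
    using embedding_dim_gens(2)[OF noetherian_ring_axioms local_ring ysR] max_ideal_eq by simp
  then show False using xs(3) j by (simp add: ys_def)
qed

context min_resolution
begin

lemma basis_hom:
  assumes M: "module R M" and w: "\<And>b. b \<in> bas q \<Longrightarrow> w b \<in> carrier M"
  shows "\<exists>f\<in>module_homs R (F q) M. \<forall>b\<in>bas q. f b = w b"
proof (intro bexI[OF _ dual_basis_hom[OF basis M w]] ballI)
  interpret M: module R M by (rule M)
  fix b assume b: "b \<in> bas q"
  have "(\<Oplus>\<^bsub>M\<^esub>b'\<in>bas q. crd q b' b \<odot>\<^bsub>M\<^esub> w b') = (\<Oplus>\<^bsub>M\<^esub>b'\<in>bas q. if b = b' then w b' else \<zero>\<^bsub>M\<^esub>)"
    by (rule M.finsum_cong') (use w crd_delta b in auto)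
  also have "\<dots> = w b" by (rule M.add.finprod_singleton[OF b bas(1)]) (use w in auto)
  finally show "(\<Oplus>\<^bsub>M\<^esub>b'\<in>bas q. crd q b' b \<odot>\<^bsub>M\<^esub> w b') = w b" .
qed

lemma hom_eq_on_basis:
  assumes M: "module R M" and f: "f \<in> module_homs R (F q) M" and g: "g \<in> module_homs R (F q) M"
    and eq: "\<And>b. b \<in> bas q \<Longrightarrow> f b = g b" and x: "x \<in> carrier (F q)"
  shows "f x = g x"
proof -
  interpret M: module R M by (rule M)
  have "f x = (\<Oplus>\<^bsub>M\<^esub>b\<in>bas q. crd q b x \<odot>\<^bsub>M\<^esub> f b)" by (rule dual_basis_expand[OF basis modF M f x])
  also have "\<dots> = (\<Oplus>\<^bsub>M\<^esub>b\<in>bas q. crd q b x \<odot>\<^bsub>M\<^esub> g b)"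
    by (rule M.finsum_cong') (use eq crd(1) x bas(2) module_homsD(1)[OF g] in auto)
  also have "\<dots> = g x" by (rule dual_basis_expand[OF basis modF M g x, symmetric])
  finally show ?thesis .
qed

text \<open>The commutator of a degree -1 map and a degree +1 map. In degree 0 the second term is
  absent because \<open>\<theta>\<close> has nothing below \<open>F 0\<close> to map to.\<close>

definition comm :: "(nat \<Rightarrow> 'm \<Rightarrow> 'm) \<Rightarrow> (nat \<Rightarrow> 'm \<Rightarrow> 'm) \<Rightarrow> nat \<Rightarrow> 'm \<Rightarrow> 'm" where
  "comm \<theta> h q v = (case q of 0 \<Rightarrow> \<theta> 0 (h 0 v) | Suc i \<Rightarrow> \<theta> (Suc i) (h (Suc i) v) \<ominus>\<^bsub>F (Suc i)\<^esub> h i (\<theta> i v))"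

text \<open>Since \<open>\<theta>\<close> commutes with \<open>d\<close> and d h + h d is
  multiplication by \<open>x\<close>, the terms with \<open>x\<close> cancel and the commutator
  anticommutes with \<open>d\<close>. Subtracting the scalar \<kappa> with alternating sign leaves a
  map of the same kind that starts in \<mm> \<open>F 0\<close>, and \<open>chain_map_mF\<close>
  applies with \<open>\<rho>\<close> equal to -1.\<close>

lemma comm_mF:
  assumes h: "\<And>q. h q \<in> module_homs R (F q) (F (Suc q))" and x: "x \<in> carrier R"
    and h0: "\<And>y. y \<in> carrier (F 0) \<Longrightarrow> d 0 (h 0 y) = x \<odot>\<^bsub>F 0\<^esub> y"
    and hS: "\<And>q y. y \<in> carrier (F (Suc q)) \<Longrightarrow>
      d (Suc q) (h (Suc q) y) = x \<odot>\<^bsub>F (Suc q)\<^esub> y \<ominus>\<^bsub>F (Suc q)\<^esub> h q (d q y)"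
    and t: "\<And>q. \<theta> q \<in> module_homs R (F (Suc q)) (F q)"
    and td: "\<And>q y. y \<in> carrier (F (Suc (Suc q))) \<Longrightarrow> d q (\<theta> (Suc q) y) = \<theta> q (d (Suc q) y)"
    and kap: "\<kappa> \<in> carrier R" and base: "\<theta> 0 (h 0 b0) \<ominus>\<^bsub>F 0\<^esub> \<kappa> \<odot>\<^bsub>F 0\<^esub> b0 \<in> mF 0"
    and v: "v \<in> carrier (F q)"
  shows "comm \<theta> h q v \<ominus>\<^bsub>F q\<^esub> ((\<ominus> \<one>) [^] q \<otimes> \<kappa>) \<odot>\<^bsub>F q\<^esub> v \<in> mF q"
proof -
  have comm_hom: "comm \<theta> h q \<in> module_homs R (F q) (F q)" for q
  proof (cases q)
    case 0
    have "comm \<theta> h 0 = (\<lambda>v. \<theta> 0 (h 0 v))" by (simp add: comm_def fun_eq_iff)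
    then show ?thesis unfolding 0 by (simp only: module_homs_comp[OF h t])
  next
    case (Suc i)
    have "comm \<theta> h (Suc i) = (\<lambda>v. \<theta> (Suc i) (h (Suc i) v) \<ominus>\<^bsub>F (Suc i)\<^esub> h i (\<theta> i v))"
      by (simp add: comm_def fun_eq_iff)
    then show ?thesis unfolding Suc
      by (simp only: homs_diff[OF modF module_homs_comp[OF h t] module_homs_comp[OF t h]])
  qed
  have sg: "(\<ominus> \<one>) [^] q \<in> carrier R" for q :: nat by simp
  have scal: "(\<lambda>v. ((\<ominus> \<one>) [^] q \<otimes> \<kappa>) \<odot>\<^bsub>F q\<^esub> v) \<in> module_homs R (F q) (F q)" for q
    by (rule homs_smult[OF modF]) (use kap in \<open>auto simp: module_homs_def\<close>)
  define T where "T q v = comm \<theta> h q v \<ominus>\<^bsub>F q\<^esub> ((\<ominus> \<one>) [^] q \<otimes> \<kappa>) \<odot>\<^bsub>F q\<^esub> v" for q v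
  have T: "T q \<in> module_homs R (F q) (F q)" for q
    using homs_diff[OF modF comm_hom scal] by (simp add: T_def[abs_def])
  have dcomm: "d q (comm \<theta> h (Suc q) y) = \<ominus>\<^bsub>F q\<^esub> comm \<theta> h q (d q y)" if y: "y \<in> carrier (F (Suc q))" for q y
  proof -
    interpret F: module R "F q" by (rule modF)
    have hy: "h (Suc q) y \<in> carrier (F (Suc (Suc q)))" using module_homsD(1)[OF h y] .
    have dy: "d q y \<in> carrier (F q)" using module_homsD(1)[OF d_hom y] .
    have ty: "\<theta> q y \<in> carrier (F q)" using module_homsD(1)[OF t y] .
    have hdy: "h q (d q y) \<in> carrier (F (Suc q))" using module_homsD(1)[OF h dy] .
    have "d q (comm \<theta> h (Suc q) y) = d q (\<theta> (Suc q) (h (Suc q) y)) \<ominus>\<^bsub>F q\<^esub> d q (h q (\<theta> q y))"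
      unfolding comm_def nat.case
      by (rule module_homs_minus[OF modF modF d_hom module_homsD(1)[OF t hy] module_homsD(1)[OF h ty]])
    also have "d q (\<theta> (Suc q) (h (Suc q) y)) = \<theta> q (x \<odot>\<^bsub>F (Suc q)\<^esub> y \<ominus>\<^bsub>F (Suc q)\<^esub> h q (d q y))"
      unfolding td[OF hy] hS[OF y] ..
    also have "\<dots> = \<theta> q (x \<odot>\<^bsub>F (Suc q)\<^esub> y) \<ominus>\<^bsub>F q\<^esub> \<theta> q (h q (d q y))"
      by (rule module_homs_minus[OF modF modF t _ hdy]) (use module.smult_closed[OF modF x y] in simp)
    also have "\<theta> q (x \<odot>\<^bsub>F (Suc q)\<^esub> y) = x \<odot>\<^bsub>F q\<^esub> \<theta> q y" by (rule module_homsD(3)[OF t x y])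
    finally have main: "d q (comm \<theta> h (Suc q) y) =
      (x \<odot>\<^bsub>F q\<^esub> \<theta> q y \<ominus>\<^bsub>F q\<^esub> \<theta> q (h q (d q y))) \<ominus>\<^bsub>F q\<^esub> d q (h q (\<theta> q y))" .
    have thd: "\<theta> q (h q (d q y)) \<in> carrier (F q)" using module_homsD(1)[OF t hdy] .
    have xty: "x \<odot>\<^bsub>F q\<^esub> \<theta> q y \<in> carrier (F q)" using x ty by simp
    show ?thesis
    proof (cases q)
      case 0
      have "d q (h q (\<theta> q y)) = x \<odot>\<^bsub>F q\<^esub> \<theta> q y" using h0 ty 0 by simp
      moreover have "comm \<theta> h q (d q y) = \<theta> q (h q (d q y))" by (simp add: comm_def 0)
      ultimately show ?thesis unfolding main using F.diff_diff_left[OF xty thd] by simp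
    next
      case (Suc i)
      have y': "y \<in> carrier (F (Suc (Suc i)))" using y Suc by simp
      have "d q (h q (\<theta> q y)) = x \<odot>\<^bsub>F q\<^esub> \<theta> q y \<ominus>\<^bsub>F q\<^esub> h i (\<theta> i (d q y))"
        using hS[of "\<theta> q y" i] ty td[OF y'] Suc by simp
      moreover have "h i (\<theta> i (d q y)) \<in> carrier (F q)"
        using module_homsD(1)[OF h module_homsD(1)[OF t, of "d q y" i]] dy Suc by simp
      moreover have "comm \<theta> h q (d q y) = \<theta> q (h q (d q y)) \<ominus>\<^bsub>F q\<^esub> h i (\<theta> i (d q y))"
        by (simp add: comm_def Suc)
      ultimately show ?thesis unfolding main
        using F.diff_diff_diff[OF xty thd] by simp
    qed
  qed
  have "T q v \<in> mF q"
  proof (rule chain_map_mF[of T "\<ominus> \<one>", OF T])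
    show "T 0 b0 \<in> mF 0" using base kap by (simp add: T_def comm_def)
    fix q y assume y: "y \<in> carrier (F (Suc q))"
    interpret F: module R "F q" by (rule modF)
    interpret F': module R "F (Suc q)" by (rule modF)
    have dy: "d q y \<in> carrier (F q)" using module_homsD(1)[OF d_hom y] .
    let ?s = "(\<ominus> \<one>) [^] q \<otimes> \<kappa>"
    have s: "?s \<in> carrier R" using kap by simp
    have "(\<ominus> \<one>) [^] Suc q \<otimes> \<kappa> = \<ominus> ?s"
      using kap sg[of q] by (simp add: l_minus r_minus)
    then have "T (Suc q) y = comm \<theta> h (Suc q) y \<ominus>\<^bsub>F (Suc q)\<^esub> (\<ominus> ?s) \<odot>\<^bsub>F (Suc q)\<^esub> y"
      by (simp add: T_def)
    then have "d q (T (Suc q) y) = d q (comm \<theta> h (Suc q) y) \<ominus>\<^bsub>F q\<^esub> d q ((\<ominus> ?s) \<odot>\<^bsub>F (Suc q)\<^esub> y)"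
      using module_homs_minus[OF modF modF d_hom module_homsD(1)[OF comm_hom y], of "(\<ominus> ?s) \<odot>\<^bsub>F (Suc q)\<^esub> y"] s y by simp
    also have "\<dots> = \<ominus>\<^bsub>F q\<^esub> comm \<theta> h q (d q y) \<ominus>\<^bsub>F q\<^esub> (\<ominus> ?s) \<odot>\<^bsub>F q\<^esub> d q y"
      using dcomm[OF y] module_homsD(3)[OF d_hom _ y, of "\<ominus> ?s"] s by simp
    also have "\<dots> = (\<ominus> \<one>) \<odot>\<^bsub>F q\<^esub> T q (d q y)"
    proof -
      have c: "comm \<theta> h q (d q y) \<in> carrier (F q)" using module_homsD(1)[OF comm_hom dy] .
      have sd: "?s \<odot>\<^bsub>F q\<^esub> d q y \<in> carrier (F q)" using s dy by simp
      have Tc: "T q (d q y) \<in> carrier (F q)" using module_homsD(1)[OF T dy] .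
      have "(\<ominus> \<one>) \<odot>\<^bsub>F q\<^esub> T q (d q y) = \<ominus>\<^bsub>F q\<^esub> T q (d q y)"
        using F.smult_l_minus[OF one_closed Tc] Tc by simp
      moreover have "(\<ominus> ?s) \<odot>\<^bsub>F q\<^esub> d q y = \<ominus>\<^bsub>F q\<^esub> (?s \<odot>\<^bsub>F q\<^esub> d q y)" by (rule F.smult_l_minus[OF s dy])
      ultimately show ?thesis using c sd by (simp add: T_def a_minus_def F.M.minus_add)
    qed
    finally show "d q (T (Suc q) y) = (\<ominus> \<one>) \<odot>\<^bsub>F q\<^esub> T q (d q y)" .
  qed (use v in simp_all)
  then show ?thesis by (simp add: T_def)
qed

text \<open>The \<open>h l\<close> are null-homotopies of the multiplications by the minimal generators of \<open>\<mm>\<close>. The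
  chain maps \<open>\<theta> j\<close> of degree \<open>-1\<close> represent the dual basis of \<open>Ext\<^sup>1(k, k)\<close>.\<close>

lemma operators:
  "\<exists>\<theta> h. (\<forall>j<embedding_dim R. \<forall>q. \<theta> j q \<in> module_homs R (F (Suc q)) (F q)) \<and>
    (\<forall>j<embedding_dim R. \<forall>q. \<forall>y\<in>carrier (F (Suc (Suc q))). d q (\<theta> j (Suc q) y) = \<theta> j q (d (Suc q) y)) \<and>
    (\<forall>l<embedding_dim R. \<forall>q. h l q \<in> module_homs R (F q) (F (Suc q))) \<and>
    (\<forall>j<embedding_dim R. \<forall>l<embedding_dim R. \<forall>q. \<forall>v\<in>carrier (F q).
       comm (\<theta> j) (h l) q v \<ominus>\<^bsub>F q\<^esub> ((\<ominus> \<one>) [^] q \<otimes> (if j = l then \<one> else \<zero>)) \<odot>\<^bsub>F q\<^esub> v \<in> mF q)"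
proof -
  interpret A: module R "ring_as_module R" by (rule module_ring_as_module) (rule is_cring)
  interpret F0: module R "F 0" by (rule modF)
  let ?r = "embedding_dim R"
  obtain xs where xs: "length xs = ?r" "set xs \<subseteq> carrier R" "Idl (set xs) = \<mm>"
    using embedding_dim_gens(1)[OF noetherian_ring_axioms local_ring] max_ideal_eq by auto
  have x: "xs ! l \<in> carrier R" "xs ! l \<in> \<mm>" if "l < ?r" for l
    using genideal_self[OF xs(2)] xs that by auto
  \<comment> \<open>The map \<open>d 0\<close> is written in the generators of \<open>\<mm>\<close>.
    The coefficient of the \<open>l\<close>-th generator, extended linearly from the basis of
    \<open>F 1\<close>, becomes the functional \<open>f l\<close>, which modulo \<open>\<mm>\<close>
    is a coordinate on \<mm>/\<mm>^2.\<close>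
  have "\<exists>a. (\<forall>l<?r. a l \<in> carrier R) \<and> crd0 (d 0 b) = (\<Oplus>l\<in>{..<?r}. a l \<otimes> xs ! l)" if "b \<in> bas (Suc 0)" for b
  proof -
    have "d 0 b \<in> mF 0" using d_mF bas(2)[OF that] by simp
    then have "crd0 (d 0 b) \<in> Idl (set xs)" using mF0_crd mF_mem(1) xs(3) by blast
    then show ?thesis using genideal_list_comb[OF xs(2)] xs(1) by simp
  qed
  then obtain \<alpha> where \<alpha>: "\<And>b l. b \<in> bas (Suc 0) \<Longrightarrow> l < ?r \<Longrightarrow> \<alpha> b l \<in> carrier R"
    "\<And>b. b \<in> bas (Suc 0) \<Longrightarrow> crd0 (d 0 b) = (\<Oplus>l\<in>{..<?r}. \<alpha> b l \<otimes> xs ! l)" by metis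
  have "\<forall>l. \<exists>f. l < ?r \<longrightarrow> f \<in> module_homs R (F (Suc 0)) (ring_as_module R) \<and> (\<forall>b\<in>bas (Suc 0). f b = \<alpha> b l)"
    using basis_hom[OF A.module_axioms, of "Suc 0" "\<lambda>b. \<alpha> b l" for l] \<alpha>(1) by simp blast
  then obtain f where f: "\<And>l. l < ?r \<Longrightarrow> f l \<in> module_homs R (F (Suc 0)) (ring_as_module R)"
    "\<And>l b. l < ?r \<Longrightarrow> b \<in> bas (Suc 0) \<Longrightarrow> f l b = \<alpha> b l" by metis
  have fR: "f l v \<in> carrier R" if "l < ?r" "v \<in> carrier (F (Suc 0))" for l v
    using module_homsD(1)[OF f(1)[OF that(1)] that(2)] by simp
  have comb: "crd0 (d 0 v) = (\<Oplus>l\<in>{..<?r}. f l v \<otimes> xs ! l)" if v: "v \<in> carrier (F (Suc 0))" for v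
  proof (rule hom_eq_on_basis[OF A.module_axioms _ _ _ v])
    show "(\<lambda>v. crd0 (d 0 v)) \<in> module_homs R (F (Suc 0)) (ring_as_module R)"
      by (rule module_homs_comp[OF d_hom crd0_hom])
    have "(\<lambda>v. \<Oplus>\<^bsub>ring_as_module R\<^esub>l\<in>{..<?r}. f l v \<otimes> xs ! l) \<in> module_homs R (F (Suc 0)) (ring_as_module R)"
    proof (rule homs_finsum[OF A.module_axioms])
      fix l assume "l \<in> {..<?r}"
      then have l: "l < ?r" by simp
      show "(\<lambda>v. f l v \<otimes> xs ! l) \<in> module_homs R (F (Suc 0)) (ring_as_module R)"
        using module_homsD[OF f(1)[OF l]] x(1)[OF l] by (intro module_homsI) (auto simp: l_distr m_assoc)
    qed simp
    then show "(\<lambda>v. \<Oplus>l\<in>{..<?r}. f l v \<otimes> xs ! l) \<in> module_homs R (F (Suc 0)) (ring_as_module R)" by simp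
    fix b assume b: "b \<in> bas (Suc 0)"
    show "crd0 (d 0 b) = (\<Oplus>l\<in>{..<?r}. f l b \<otimes> xs ! l)"
      unfolding \<alpha>(2)[OF b] by (rule finsum_cong') (use f(2) b \<alpha>(1) x in auto)
  qed
  have indep: "a j \<in> \<mm>" if "\<And>l. l < ?r \<Longrightarrow> a l \<in> carrier R" "(\<Oplus>l\<in>{..<?r}. a l \<otimes> xs ! l) = \<zero>" "j < ?r" for a j
    using minimal_gens_independent[OF xs(2,3,1), of a j] that xs(1) by simp
  have t0: "(\<lambda>v. f j v \<odot>\<^bsub>F 0\<^esub> b0) \<in> module_homs R (F (Suc 0)) (F 0)" if j: "j < ?r" for j
    using module_homsD[OF f(1)[OF j]] b0(1)
    by (intro module_homsI) (auto simp: F0.smult_l_distr F0.smult_assoc1)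
  have mFb: "a \<odot>\<^bsub>F 0\<^esub> b0 \<in> mF 0" if "a \<in> \<mm>" for a
    using ideal_mult_gen[OF modF m.is_ideal that b0(1)] by (simp add: mF_def)
  have zero: "crd0 \<zero>\<^bsub>F 0\<^esub> = \<zero>" using module_homs_zero[OF modF A.module_axioms crd0_hom] by simp
  \<comment> \<open>The values \<open>f l (d (Suc 0) y)\<close> are the coefficients of a relation
    among the generators, since d d = 0; minimality puts them into \<open>\<mm>\<close>.\<close>
  have t0d: "f j (d (Suc 0) y) \<odot>\<^bsub>F 0\<^esub> b0 \<in> mF 0" if j: "j < ?r" and y: "y \<in> carrier (F (Suc (Suc 0)))" for j y
  proof -
    have dy: "d (Suc 0) y \<in> carrier (F (Suc 0))" using module_homsD(1)[OF d_hom y] .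
    have "(\<Oplus>l\<in>{..<?r}. f l (d (Suc 0) y) \<otimes> xs ! l) = \<zero>" using comb[OF dy] dd[OF y] zero by simp
    then show ?thesis using indep[of "\<lambda>l. f l (d (Suc 0) y)" j] fR dy j by (intro mFb) blast
  qed
  define PT where "PT j \<theta> \<longleftrightarrow> \<theta> 0 = (\<lambda>v. f j v \<odot>\<^bsub>F 0\<^esub> b0) \<and> (\<forall>q. \<theta> q \<in> module_homs R (F (Suc q)) (F q)) \<and>
    (\<forall>q. \<forall>y\<in>carrier (F (Suc (Suc q))). d q (\<theta> (Suc q) y) = \<theta> q (d (Suc q) y))" for j \<theta>
  have "\<exists>\<theta>. PT j \<theta>" if "j < ?r" for j
    unfolding PT_def by (rule chain_map_lift[OF t0[OF that] t0d[OF that]])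
  then obtain \<theta> where PT: "\<And>j. j < ?r \<Longrightarrow> PT j (\<theta> j)" by metis
  have \<theta>: "\<theta> j 0 = (\<lambda>v. f j v \<odot>\<^bsub>F 0\<^esub> b0)" "\<theta> j q \<in> module_homs R (F (Suc q)) (F q)"
    "y \<in> carrier (F (Suc (Suc q))) \<Longrightarrow> d q (\<theta> j (Suc q) y) = \<theta> j q (d (Suc q) y)" if "j < ?r" for j q y
    using PT[OF that] by (simp_all add: PT_def)
  define PH where "PH l h \<longleftrightarrow> (\<forall>q. h q \<in> module_homs R (F q) (F (Suc q))) \<and>
    (\<forall>y\<in>carrier (F 0). d 0 (h 0 y) = xs ! l \<odot>\<^bsub>F 0\<^esub> y) \<and>
    (\<forall>q. \<forall>y\<in>carrier (F (Suc q)). d (Suc q) (h (Suc q) y) = xs ! l \<odot>\<^bsub>F (Suc q)\<^esub> y \<ominus>\<^bsub>F (Suc q)\<^esub> h q (d q y))" for l h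
  have "\<exists>h. PH l h" if "l < ?r" for l
    unfolding PH_def by (rule homotopy[OF x(2)[OF that]])
  then obtain h where PH: "\<And>l. l < ?r \<Longrightarrow> PH l (h l)" by metis
  have h: "h l q \<in> module_homs R (F q) (F (Suc q))"
    "y \<in> carrier (F 0) \<Longrightarrow> d 0 (h l 0 y) = xs ! l \<odot>\<^bsub>F 0\<^esub> y"
    "z \<in> carrier (F (Suc q)) \<Longrightarrow>
      d (Suc q) (h l (Suc q) z) = xs ! l \<odot>\<^bsub>F (Suc q)\<^esub> z \<ominus>\<^bsub>F (Suc q)\<^esub> h l q (d q z)" if "l < ?r" for l q y z
    using PH[OF that] by (simp_all add: PH_def)
  \<comment> \<open>\<open>h l\<close> lifts multiplication by \<open>xs ! l\<close>, so its
    coordinates at \<open>b0\<close> and the Kronecker symbols are two systems of coefficients for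
    the same generator. They agree modulo \<open>\<mm>\<close>.\<close>
  have base: "\<theta> j 0 (h l 0 b0) \<ominus>\<^bsub>F 0\<^esub> (if j = l then \<one> else \<zero>) \<odot>\<^bsub>F 0\<^esub> b0 \<in> mF 0" if j: "j < ?r" and l: "l < ?r" for j l
  proof -
    let ?v = "h l 0 b0" and ?\<delta> = "\<lambda>i. if i = l then \<one> else \<zero>"
    have v: "?v \<in> carrier (F (Suc 0))" using module_homsD(1)[OF h(1)[OF l] b0(1)] .
    have "xs ! l = (\<Oplus>i\<in>{..<?r}. f i ?v \<otimes> xs ! i)" using comb[OF v] h(2)[OF l b0(1)] b0(5) x(1)[OF l] by simp
    moreover have "xs ! l = (\<Oplus>i\<in>{..<?r}. ?\<delta> i \<otimes> xs ! i)"
    proof -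
      have "(\<Oplus>i\<in>{..<?r}. ?\<delta> i \<otimes> xs ! i) = (\<Oplus>i\<in>{..<?r}. if l = i then xs ! i else \<zero>)"
        by (rule finsum_cong') (use x in auto)
      also have "\<dots> = xs ! l" by (rule add.finprod_singleton) (use l x in auto)
      finally show ?thesis by simp
    qed
    moreover have "(\<Oplus>i\<in>{..<?r}. f i ?v \<otimes> xs ! i) =
      (\<Oplus>i\<in>{..<?r}. (f i ?v \<ominus> ?\<delta> i) \<otimes> xs ! i) \<oplus> (\<Oplus>i\<in>{..<?r}. ?\<delta> i \<otimes> xs ! i)"
    proof -
      have "(\<Oplus>i\<in>{..<?r}. (f i ?v \<ominus> ?\<delta> i) \<otimes> xs ! i) \<oplus> (\<Oplus>i\<in>{..<?r}. ?\<delta> i \<otimes> xs ! i)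
        = (\<Oplus>i\<in>{..<?r}. (f i ?v \<ominus> ?\<delta> i) \<otimes> xs ! i \<oplus> ?\<delta> i \<otimes> xs ! i)"
        by (rule finsum_addf[symmetric]) (use fR v x in auto)
      also have "\<dots> = (\<Oplus>i\<in>{..<?r}. f i ?v \<otimes> xs ! i)"
      proof (rule finsum_cong')
        fix i assume "i \<in> {..<?r}"
        then have "f i ?v \<in> carrier R" "xs ! i \<in> carrier R" "?\<delta> i \<in> carrier R" using fR v x by auto
        then show "(f i ?v \<ominus> ?\<delta> i) \<otimes> xs ! i \<oplus> ?\<delta> i \<otimes> xs ! i = f i ?v \<otimes> xs ! i" by algebra
      qed (use fR v x in auto)
      finally show ?thesis by simp
    qed
    moreover have "(\<Oplus>i\<in>{..<?r}. (f i ?v \<ominus> ?\<delta> i) \<otimes> xs ! i) \<in> carrier R"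
      by (rule finsum_closed) (use fR v x in auto)
    ultimately have z: "(\<Oplus>i\<in>{..<?r}. (f i ?v \<ominus> ?\<delta> i) \<otimes> xs ! i) \<oplus> xs ! l = xs ! l"
      and zR: "(\<Oplus>i\<in>{..<?r}. (f i ?v \<ominus> ?\<delta> i) \<otimes> xs ! i) \<in> carrier R" by argo+
    then have "(\<Oplus>i\<in>{..<?r}. (f i ?v \<ominus> ?\<delta> i) \<otimes> xs ! i) = \<zero>"
      using add.r_cancel_one[OF x(1)[OF l] zR] by simp
    then have "f j ?v \<ominus> ?\<delta> j \<in> \<mm>" using indep[of "\<lambda>i. f i ?v \<ominus> ?\<delta> i" j] fR v j by simp
    then have "(f j ?v \<ominus> ?\<delta> j) \<odot>\<^bsub>F 0\<^esub> b0 \<in> mF 0" by (rule mFb)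
    then show ?thesis using F0.smult_diff_l[of "f j ?v" "?\<delta> j" b0] fR[OF j v] b0(1) \<theta>(1)[OF j] by auto
  qed
  show ?thesis
  proof (rule exI[of _ \<theta>], rule exI[of _ h], intro conjI allI impI ballI)
    fix j l q v assume j: "j < ?r" and l: "l < ?r" and v: "v \<in> carrier (F q)"
    have \<kappa>: "(if j = l then \<one> else \<zero>) \<in> carrier R" by (cases "j = l") simp_all
    show "comm (\<theta> j) (h l) q v \<ominus>\<^bsub>F q\<^esub> ((\<ominus> \<one>) [^] q \<otimes> (if j = l then \<one> else \<zero>)) \<odot>\<^bsub>F q\<^esub> v \<in> mF q"
      by (rule comm_mF[OF h(1)[OF l] x(1)[OF l] h(2,3)[OF l] \<theta>(2,3)[OF j] \<kappa> base[OF j l] v])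
  qed (use \<theta> h in auto)
qed

end

section \<open>Nonvanishing of Ext into a summand of a syzygy\<close>

context min_resolution
begin

text \<open>Coboundaries take values in \<mm> \<open>M\<close> because the resolution is minimal, so
  such a cocycle has a nonzero class in Ext^q(k, M). The condition modulo \<open>\<mm>\<close> is
  the one that the operators pass on.\<close>

definition essential_cocycle :: "('a, 'n) module \<Rightarrow> nat \<Rightarrow> ('m \<Rightarrow> 'n) \<Rightarrow> bool" where
  "essential_cocycle M q \<psi> \<longleftrightarrow> \<psi> \<in> module_homs R (F q) M \<and>
     (\<forall>y\<in>carrier (F (Suc q)). \<psi> (d q y) = \<zero>\<^bsub>M\<^esub>) \<and>
     (\<exists>v\<in>carrier (F q). \<psi> v \<notin> ideal_mult M \<mm>)"

text \<open>The new cocycle is \<open>\<psi>\<close> composed with one of the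
  \<open>\<theta> j\<close>. If all these composites vanished modulo \<mm> \<open>M\<close>, the
  commutation relations would make \<open>\<psi>\<close> vanish there as well, provided that its
  degree is below the number of operators.\<close>

lemma essential_cocycle_Suc:
  fixes M :: "('a, 'n) module"
  assumes M: "module R M" and ess: "essential_cocycle M q \<psi>" and q: "q < embedding_dim R"
  shows "\<exists>\<psi>'. essential_cocycle M (Suc q) \<psi>'"
proof -
  let ?r = "embedding_dim R" and ?mM = "ideal_mult M \<mm>"
  interpret M: module R M by (rule M)
  note mM = M.submodule_mem[OF ideal_mult_submodule[OF M m.is_ideal]]
  have swap: "b \<in> ?mM" if "a \<in> ?mM" "b \<in> carrier M" "a \<ominus>\<^bsub>M\<^esub> b \<in> ?mM" for a b
  proof -
    have "a \<ominus>\<^bsub>M\<^esub> (a \<ominus>\<^bsub>M\<^esub> b) \<in> ?mM" by (rule mM(5)[OF that(1,3)])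
    then show ?thesis
      using mM(1)[OF that(1)] that(2) by (simp add: a_minus_def M.minus_add M.M.a_assoc[symmetric] M.M.r_neg)
  qed
  obtain \<theta> h where op:
    "(\<forall>j<?r. \<forall>q. \<theta> j q \<in> module_homs R (F (Suc q)) (F q)) \<and>
    (\<forall>j<?r. \<forall>q. \<forall>y\<in>carrier (F (Suc (Suc q))). d q (\<theta> j (Suc q) y) = \<theta> j q (d (Suc q) y)) \<and>
    (\<forall>l<?r. \<forall>q. h l q \<in> module_homs R (F q) (F (Suc q))) \<and>
    (\<forall>j<?r. \<forall>l<?r. \<forall>q. \<forall>v\<in>carrier (F q).
       comm (\<theta> j) (h l) q v \<ominus>\<^bsub>F q\<^esub> ((\<ominus> \<one>) [^] q \<otimes> (if j = l then \<one> else \<zero>)) \<odot>\<^bsub>F q\<^esub> v \<in> mF q)"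
    using operators by (elim exE) (rule that)
  note \<theta> = op[THEN conjunct1, rule_format] op[THEN conjunct2, THEN conjunct1, rule_format]
  note h = op[THEN conjunct2, THEN conjunct2, THEN conjunct1, rule_format]
  note comm = op[THEN conjunct2, THEN conjunct2, THEN conjunct2, rule_format]
  \<comment> \<open>Induction on the degree, with a hypothesis only on the operators of index at
    least \<open>t\<close>. The descent replaces \<open>\<psi>\<close> by its composite with
    \<open>h t\<close> and raises \<open>t\<close> by one, so every degree uses up one generator;
    this is the origin of the bound on \<open>q + t\<close>.\<close>
  have small: "\<forall>v\<in>carrier (F q). \<psi> v \<in> ?mM"
    if "\<psi> \<in> module_homs R (F q) M" "q + t < ?r"
      "\<And>j y. t \<le> j \<Longrightarrow> j < ?r \<Longrightarrow> y \<in> carrier (F (Suc q)) \<Longrightarrow> \<psi> (\<theta> j q y) \<in> ?mM" for q t \<psi>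
    using that
  proof (induction q arbitrary: t \<psi>)
    case 0
    note \<psi>D = module_homsD[OF 0(1)]
    have t: "t < ?r" using 0 by simp
    interpret F: module R "F 0" by (rule modF)
    show ?case
    proof
      fix v assume v: "v \<in> carrier (F 0)"
      have hv: "h t 0 v \<in> carrier (F (Suc 0))" using module_homsD(1)[OF h[OF t] v] .
      have thv: "\<theta> t 0 (h t 0 v) \<in> carrier (F 0)" using module_homsD(1)[OF \<theta>(1)[OF t] hv] .
      have "\<theta> t 0 (h t 0 v) \<ominus>\<^bsub>F 0\<^esub> v \<in> mF 0" using comm[OF t t v] v by (simp add: comm_def)
      then have "\<psi> (\<theta> t 0 (h t 0 v) \<ominus>\<^bsub>F 0\<^esub> v) \<in> ?mM" by (rule hom_mF[OF M 0(1)])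
      then have "\<psi> (\<theta> t 0 (h t 0 v)) \<ominus>\<^bsub>M\<^esub> \<psi> v \<in> ?mM" using module_homs_minus[OF modF M 0(1) thv v] by simp
      moreover have "\<psi> (\<theta> t 0 (h t 0 v)) \<in> ?mM" using 0(3)[of t] t hv by simp
      ultimately show "\<psi> v \<in> ?mM" using swap \<psi>D(1)[OF v] by blast
    qed
  next
    case (Suc q)
    note \<psi>D = module_homsD[OF Suc.prems(1)]
    have t: "t < ?r" using Suc.prems by simp
    interpret F: module R "F q" by (rule modF)
    interpret F': module R "F (Suc q)" by (rule modF)
    have comm': "\<psi> (\<theta> j (Suc q) (h t (Suc q) v)) \<ominus>\<^bsub>M\<^esub> \<psi> (h t q (\<theta> j q v)) \<ominus>\<^bsub>M\<^esub>
        ((\<ominus> \<one>) [^] Suc q \<otimes> (if j = t then \<one> else \<zero>)) \<odot>\<^bsub>M\<^esub> \<psi> v \<in> ?mM"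
      if j: "j < ?r" and v: "v \<in> carrier (F (Suc q))" for j v
    proof -
      let ?s = "(\<ominus> \<one>) [^] Suc q \<otimes> (if j = t then \<one> else \<zero>)"
      have s: "?s \<in> carrier R" by (cases "j = t") simp_all
      have c1: "\<theta> j (Suc q) (h t (Suc q) v) \<in> carrier (F (Suc q))"
        using module_homsD(1)[OF \<theta>(1)[OF j] module_homsD(1)[OF h[OF t] v]] .
      have c2: "h t q (\<theta> j q v) \<in> carrier (F (Suc q))"
        using module_homsD(1)[OF h[OF t] module_homsD(1)[OF \<theta>(1)[OF j] v]] .
      have "\<psi> (comm (\<theta> j) (h t) (Suc q) v \<ominus>\<^bsub>F (Suc q)\<^esub> ?s \<odot>\<^bsub>F (Suc q)\<^esub> v) \<in> ?mM"
        by (rule hom_mF[OF M Suc.prems(1) comm[OF j t v]])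
      also have "\<psi> (comm (\<theta> j) (h t) (Suc q) v \<ominus>\<^bsub>F (Suc q)\<^esub> ?s \<odot>\<^bsub>F (Suc q)\<^esub> v)
        = \<psi> (\<theta> j (Suc q) (h t (Suc q) v) \<ominus>\<^bsub>F (Suc q)\<^esub> h t q (\<theta> j q v)) \<ominus>\<^bsub>M\<^esub> \<psi> (?s \<odot>\<^bsub>F (Suc q)\<^esub> v)"
        unfolding comm_def nat.case
        by (rule module_homs_minus[OF modF M Suc.prems(1) F'.diff_closed[OF c1 c2] F'.smult_closed[OF s v]])
      also have "\<dots> = \<psi> (\<theta> j (Suc q) (h t (Suc q) v)) \<ominus>\<^bsub>M\<^esub> \<psi> (h t q (\<theta> j q v)) \<ominus>\<^bsub>M\<^esub> ?s \<odot>\<^bsub>M\<^esub> \<psi> v"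
        unfolding module_homs_minus[OF modF M Suc.prems(1) c1 c2] \<psi>D(3)[OF s v] ..
      finally show ?thesis .
    qed
    have th: "\<psi> (\<theta> j (Suc q) (h t (Suc q) v)) \<in> ?mM" "\<psi> (\<theta> j (Suc q) (h t (Suc q) v)) \<in> carrier M"
      "\<psi> (h t q (\<theta> j q v)) \<in> carrier M"
      if "t \<le> j" "j < ?r" "v \<in> carrier (F (Suc q))" for j v
    proof -
      show "\<psi> (\<theta> j (Suc q) (h t (Suc q) v)) \<in> ?mM"
        by (rule Suc.prems(3)[OF that(1,2) module_homsD(1)[OF h[OF t] that(3)]])
      then show "\<psi> (\<theta> j (Suc q) (h t (Suc q) v)) \<in> carrier M" by (rule mM(1))
      show "\<psi> (h t q (\<theta> j q v)) \<in> carrier M"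
        using \<psi>D(1)[OF module_homsD(1)[OF h[OF t] module_homsD(1)[OF \<theta>(1)[OF that(2)] that(3)]]] .
    qed
    \<comment> \<open>For \<open>j\<close> above \<open>t\<close> the commutator of
      \<open>\<theta> j\<close> with \<open>h t\<close> vanishes modulo \<open>\<mm>\<close>.
      Smallness of \<open>\<psi>\<close> after \<open>\<theta> j\<close> is therefore inherited by
      its composite with \<open>h t\<close>.\<close>
    have ind: "\<forall>w\<in>carrier (F q). \<psi> (h t q w) \<in> ?mM"
    proof (rule Suc.IH[of "\<lambda>w. \<psi> (h t q w)" "Suc t"])
      show "(\<lambda>w. \<psi> (h t q w)) \<in> module_homs R (F q) M" by (rule module_homs_comp[OF h[OF t] Suc.prems(1)])
      show "q + Suc t < ?r" using Suc.prems(2) by simp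
      fix j y assume j: "Suc t \<le> j" "j < ?r" and y: "y \<in> carrier (F (Suc q))"
      have tj: "t \<le> j" "j \<noteq> t" using j by auto
      note c = th[OF tj(1) j(2) y]
      have "\<psi> (\<theta> j (Suc q) (h t (Suc q) y)) \<ominus>\<^bsub>M\<^esub> \<psi> (h t q (\<theta> j q y)) \<in> ?mM"
        using comm'[OF j(2) y] tj(2) \<psi>D(1)[OF y] c(2,3) M.diff_zero[OF M.diff_closed[OF c(2,3)]] by simp
      then show "\<psi> (h t q (\<theta> j q y)) \<in> ?mM" by (rule swap[OF c(1,3)])
    qed
    show ?case
    proof
      fix v assume v: "v \<in> carrier (F (Suc q))"
      note c = th[OF order_refl t v]
      let ?s = "(\<ominus> \<one>) [^] Suc q"
      have s: "?s \<in> carrier R" by simp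
      have "\<psi> (h t q (\<theta> t q v)) \<in> ?mM" using ind module_homsD(1)[OF \<theta>(1)[OF t] v] by blast
      then have a: "\<psi> (\<theta> t (Suc q) (h t (Suc q) v)) \<ominus>\<^bsub>M\<^esub> \<psi> (h t q (\<theta> t q v)) \<in> ?mM" by (rule mM(5)[OF c(1)])
      \<comment> \<open>The remaining relation, for \<open>j = t\<close>: both terms of the
        commutator are small under \<open>\<psi>\<close>, hence so is \<open>\<psi>\<close> up to a
        sign, and the sign squares to 1.\<close>
      have "?s \<odot>\<^bsub>M\<^esub> \<psi> v \<in> ?mM"
        by (rule swap[OF a]) (use comm'[OF t v] \<psi>D(1)[OF v] in simp_all)
      then have "?s \<odot>\<^bsub>M\<^esub> (?s \<odot>\<^bsub>M\<^esub> \<psi> v) \<in> ?mM" by (rule mM(6)[OF s])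
      moreover have "?s \<otimes> ?s = \<one>"
      proof -
        have "?s \<otimes> ?s = ((\<ominus> \<one>) \<otimes> (\<ominus> \<one>)) [^] Suc q" by (rule nat_pow_distrib[symmetric]) simp_all
        also have "(\<ominus> \<one>) \<otimes> (\<ominus> \<one>) = \<one>" by (simp add: l_minus)
        finally show ?thesis by simp
      qed
      ultimately show "\<psi> v \<in> ?mM" using M.smult_assoc1[OF s s \<psi>D(1)[OF v]] \<psi>D(1)[OF v] by simp
    qed
  qed
  have \<psi>: "\<psi> \<in> module_homs R (F q) M" "\<And>y. y \<in> carrier (F (Suc q)) \<Longrightarrow> \<psi> (d q y) = \<zero>\<^bsub>M\<^esub>"
    "\<exists>v\<in>carrier (F q). \<psi> v \<notin> ?mM"
    using ess by (auto simp: essential_cocycle_def)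
  have "\<not> (\<forall>j y. j < ?r \<longrightarrow> y \<in> carrier (F (Suc q)) \<longrightarrow> \<psi> (\<theta> j q y) \<in> ?mM)"
    using small[OF \<psi>(1), of 0] q \<psi>(3) by auto
  then obtain j y where j: "j < ?r" "y \<in> carrier (F (Suc q))" "\<psi> (\<theta> j q y) \<notin> ?mM" by blast
  have "essential_cocycle M (Suc q) (\<lambda>y. \<psi> (\<theta> j q y))"
    unfolding essential_cocycle_def
  proof (intro conjI ballI)
    show "(\<lambda>y. \<psi> (\<theta> j q y)) \<in> module_homs R (F (Suc q)) M" by (rule module_homs_comp[OF \<theta>(1)[OF j(1)] \<psi>(1)])
    show "\<psi> (\<theta> j q (d (Suc q) z)) = \<zero>\<^bsub>M\<^esub>" if "z \<in> carrier (F (Suc (Suc q)))" for z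
      using \<theta>(2)[OF j(1) that] \<psi>(2)[OF module_homsD(1)[OF \<theta>(1)[OF j(1)] that]] by simp
    show "\<exists>v\<in>carrier (F (Suc q)). \<psi> (\<theta> j q v) \<notin> ?mM" using j(2,3) by blast
  qed
  then show ?thesis by blast
qed

lemma essential_cocycle_raise:
  assumes M: "module R M" and ess: "essential_cocycle M q \<psi>" and "q \<le> p" "p \<le> embedding_dim R"
  shows "\<exists>\<psi>'. essential_cocycle M p \<psi>'"
  using assms(3,4)
proof (induction p rule: dec_induct)
  case base
  then show ?case using ess by blast
next
  case (step p)
  then show ?case using essential_cocycle_Suc[OF M] by fastforce
qed

text \<open>\<open>M\<close> is generated by the images of a finite basis. If all values of
  \<open>\<psi>\<close> were in \<mm> \<open>M\<close>, Nakayama's lemma would make \<open>M\<close>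
  zero.\<close>

lemma essential_cocycle_onto:
  fixes M :: "('a, 'n) module"
  assumes M: "module R M" and \<psi>: "\<psi> \<in> module_homs R (F q) M"
    and cocycle: "\<And>y. y \<in> carrier (F (Suc q)) \<Longrightarrow> \<psi> (d q y) = \<zero>\<^bsub>M\<^esub>"
    and onto: "\<psi> ` carrier (F q) = carrier M" and nz: "carrier M \<noteq> {\<zero>\<^bsub>M\<^esub>}"
  shows "essential_cocycle M q \<psi>"
proof (rule ccontr)
  interpret M: module R M by (rule M)
  assume "\<not> ?thesis"
  then have "\<psi> ` carrier (F q) \<subseteq> ideal_mult M \<mm>"
    using \<psi> cocycle by (auto simp: essential_cocycle_def)
  then have all: "carrier M \<subseteq> ideal_mult M \<mm>" unfolding onto .
  define T where "T = \<psi> ` bas q"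
  have T: "finite T" "T \<subseteq> carrier M" using bas module_homsD(1)[OF \<psi>] by (auto simp: T_def)
  let ?S = "lspan M (carrier R) {\<zero>\<^bsub>M\<^esub>} T"
  have S: "submodule ?S R M" by (rule M.lspan_submodule[OF oneideal M.zero_submodule T(2)])
  have gen: "w \<in> ?S" if w: "w \<in> carrier M" for w
  proof -
    obtain x where x: "x \<in> carrier (F q)" "w = \<psi> x" using onto w by blast
    have "(\<Oplus>\<^bsub>M\<^esub>b\<in>bas q. crd q b x \<odot>\<^bsub>M\<^esub> \<psi> b) \<in> ?S"
    proof (rule M.finsum_in_submodule[OF S bas(1)])
      fix b assume "b \<in> bas q"
      then show "crd q b x \<odot>\<^bsub>M\<^esub> \<psi> b \<in> ?S"
        using crd(1) x(1) by (intro M.lspan_gen[OF oneideal M.zero_submodule T(2)]) (auto simp: T_def)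
    qed
    then show ?thesis using dual_basis_expand[OF basis modF M \<psi> x(1)] x(2) by simp
  qed
  let ?L = "lspan M \<mm> {\<zero>\<^bsub>M\<^esub>} T"
  have L: "submodule ?L R M" by (rule M.lspan_submodule[OF m.is_ideal M.zero_submodule T(2)])
  have "ideal_mult M \<mm> \<subseteq> ?L"
    by (rule ideal_mult_minimal[OF M m.is_ideal L]) (rule M.lspan_scale[OF m.is_ideal T(2) _ gen])
  then have "T \<subseteq> ?L" using all T(2) by blast
  then have "T \<subseteq> {\<zero>\<^bsub>M\<^esub>}" using nakayama[OF M M.zero_submodule T] by blast
  then have "?S \<subseteq> {\<zero>\<^bsub>M\<^esub>}" by (intro M.lspan_minimal[OF M.zero_submodule]) auto
  then show False using gen nz M.zero_closed by blast
qed

end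

locale resolution_pair = min_resolution R \<mm> k F e d u + injective_res R \<mm> N I h \<delta>
  for R :: "('a, 'c) ring_scheme" (structure) and \<mm> and k :: "('a, 'm) module" and F e d u
    and N :: "('a, 'n) module" and I :: "nat \<Rightarrow> ('a, 'e) module" and h \<delta>
begin

text \<open>This is the balancing of Ext: a cocycle in free degree i+1 with values in the
  \<open>j\<close>-th cosyzygy has its class in Ext^{i+j+1}(k, N). The induction trades one free
  degree for one injective degree. At \<open>i = 0\<close> the image of \<open>d 0\<close> contains
  \<mm> \<open>F 0\<close>, and the claim is an extension over the residue field.\<close>

lemma cocycle_extends:
  assumes "Ext_k_vanish (i + j)" "f \<in> module_homs R (F (Suc i)) (C j)"
    and "\<And>y. y \<in> carrier (F (Suc (Suc i))) \<Longrightarrow> f (d (Suc i) y) = \<zero>\<^bsub>I j\<^esub>"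
  shows "\<exists>g\<in>module_homs R (F i) (C j). \<forall>v\<in>carrier (F (Suc i)). f v = g (d i v)"
  using assms
proof (induction i arbitrary: j f)
  case 0
  interpret F0: module R "F 0" by (rule modF)
  let ?B = "d 0 ` carrier (F (Suc 0))"
  have B: "submodule ?B R (F 0)"
    by (rule submodule_image[OF modF modF d_hom module.carrier_is_submodule[OF modF]])
  have "f x = \<zero>\<^bsub>C j\<^esub>" if "x \<in> carrier (F (Suc 0))" "d 0 x = \<zero>\<^bsub>F 0\<^esub>" for x
    using exact[of x "Suc 0"] that 0(3) by auto
  then obtain f' where f': "f' \<in> module_homs R (restr (F 0) ?B) (C j)" "\<forall>x\<in>carrier (F (Suc 0)). f' (d 0 x) = f x"
    using factor_through_image[OF modF modF d_hom 0(2) modC] by blast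
  have "\<exists>g\<in>module_homs R (F 0) (C j). \<forall>x\<in>?B. g x = f' x"
  proof (rule extend_over_residue[OF _ modF B _ f'(1)])
    show "Ext_k_vanish j" using 0(1) by simp
    fix a z assume "a \<in> \<mm>" "z \<in> carrier (F 0)"
    then have "a \<odot>\<^bsub>F 0\<^esub> z \<in> mF 0" using ideal_mult_gen[OF modF m.is_ideal] by (simp add: mF_def)
    then show "a \<odot>\<^bsub>F 0\<^esub> z \<in> ?B" using mF0_image by fastforce
  qed
  then obtain g where g: "g \<in> module_homs R (F 0) (C j)" "\<And>x. x \<in> ?B \<Longrightarrow> g x = f' x" by blast
  have "f v = g (d 0 v)" if "v \<in> carrier (F (Suc 0))" for v
    using f'(2) g(2)[of "d 0 v"] that by simp
  then show ?case using g(1) by blast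
next
  case (Suc i)
  interpret Ij: module R "I j" by (rule modI)
  interpret I': module R "I (Suc j)" by (rule modI)
  let ?B = "d (Suc i) ` carrier (F (Suc (Suc i)))"
  have B: "submodule ?B R (F (Suc i))"
    by (rule submodule_image[OF modF modF d_hom module.carrier_is_submodule[OF modF]])
  have "f x = \<zero>\<^bsub>C j\<^esub>" if "x \<in> carrier (F (Suc (Suc i)))" "d (Suc i) x = \<zero>\<^bsub>F (Suc i)\<^esub>" for x
    using exact[of x "Suc (Suc i)"] that Suc.prems(3) by auto
  then obtain f' where f': "f' \<in> module_homs R (restr (F (Suc i)) ?B) (C j)"
    "\<And>x. x \<in> carrier (F (Suc (Suc i))) \<Longrightarrow> f' (d (Suc i) x) = f x"
    using factor_through_image[OF modF modF d_hom Suc.prems(2) modC] by blast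
  obtain g where g: "g \<in> module_homs R (F (Suc i)) (I j)" "\<And>x. x \<in> ?B \<Longrightarrow> g x = f' x"
    using injective_extend[OF injI modF B homCD(1)[OF f'(1)]] by blast
  note gD = module_homsD[OF g(1)]
  have gB: "g (d (Suc i) y) = f y" if "y \<in> carrier (F (Suc (Suc i)))" for y
    using g(2) f'(2) that by simp
  have dg: "(\<lambda>x. \<delta> j (g x)) \<in> module_homs R (F (Suc i)) (C (Suc j))"
    by (rule module_homs_comp[OF g(1) \<delta>_homC])
  have dgB: "\<delta> j (g (d (Suc i) y)) = \<zero>\<^bsub>I (Suc j)\<^esub>" if "y \<in> carrier (F (Suc (Suc i)))" for y
    using gB[OF that] cosyzD(2)[OF homCD(2)[OF Suc.prems(2) that]] by simp
  have van: "Ext_k_vanish (i + Suc j)" using Suc.prems(1) by simp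
  obtain l0 where l0: "l0 \<in> module_homs R (F i) (C (Suc j))"
    "\<And>v. v \<in> carrier (F (Suc i)) \<Longrightarrow> \<delta> j (g v) = l0 (d i v)"
    using Suc.IH[OF van dg dgB] by blast
  obtain l where l: "l \<in> module_homs R (F i) (I j)" "\<And>x. x \<in> carrier (F i) \<Longrightarrow> \<delta> j (l x) = l0 x"
    using lift_projective[OF basis modF l0(1)] by blast
  have ld: "(\<lambda>v. l (d i v)) \<in> module_homs R (F (Suc i)) (I j)" by (rule module_homs_comp[OF d_hom l(1)])
  have "(\<lambda>v. g v \<ominus>\<^bsub>I j\<^esub> l (d i v)) \<in> module_homs R (F (Suc i)) (C j)"
  proof (rule homCI[OF homs_diff[OF modI g(1) ld]])
    fix v assume v: "v \<in> carrier (F (Suc i))"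
    have "\<delta> j (g v \<ominus>\<^bsub>I j\<^esub> l (d i v)) = \<delta> j (g v) \<ominus>\<^bsub>I (Suc j)\<^esub> \<delta> j (l (d i v))"
      by (rule module_homs_minus[OF modI modI \<delta> gD(1)[OF v] module_homsD(1)[OF ld v]])
    also have "\<dots> = \<zero>\<^bsub>I (Suc j)\<^esub>"
      unfolding l0(2)[OF v] l(2)[OF module_homsD(1)[OF d_hom v]]
      by (rule I'.diff_self) (rule cosyzD(1)[OF homCD(2)[OF l0(1) module_homsD(1)[OF d_hom v]]])
    finally show "\<delta> j (g v \<ominus>\<^bsub>I j\<^esub> l (d i v)) = \<zero>\<^bsub>I (Suc j)\<^esub>" .
  qed
  moreover have "\<forall>v\<in>carrier (F (Suc (Suc i))). f v = g (d (Suc i) v) \<ominus>\<^bsub>I j\<^esub> l (d i (d (Suc i) v))"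
  proof
    fix v assume v: "v \<in> carrier (F (Suc (Suc i)))"
    show "f v = g (d (Suc i) v) \<ominus>\<^bsub>I j\<^esub> l (d i (d (Suc i) v))"
      unfolding gB[OF v] dd[OF v] module_homs_zero[OF modF modI l(1)]
      by (rule Ij.diff_zero[symmetric]) (rule cosyzD(1)[OF homCD(2)[OF Suc.prems(2) v]])
  qed
  ultimately show ?case by (intro bexI)
qed

text \<open>If the class vanished, \<open>\<psi>\<close> would factor through \<open>d i\<close>,
  and minimality would put its values into \<mm> \<open>N\<close>. The index is shifted because
  \<open>Ext_k_vanish i\<close> speaks of degree i+1.\<close>

lemma essential_cocycle_not_Ext_k_vanish:
  assumes "essential_cocycle N (Suc i) \<psi>"
  shows "\<not> Ext_k_vanish i"
proof
  assume van: "Ext_k_vanish i"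
  have \<psi>: "\<psi> \<in> module_homs R (F (Suc i)) N" "\<And>y. y \<in> carrier (F (Suc (Suc i))) \<Longrightarrow> \<psi> (d (Suc i) y) = \<zero>\<^bsub>N\<^esub>"
    "\<exists>v\<in>carrier (F (Suc i)). \<psi> v \<notin> ideal_mult N \<mm>"
    using assms by (auto simp: essential_cocycle_def)
  have hC: "h \<in> module_homs R N (C 0)" by (rule module_homs_corestr[OF h(1)]) (use h(3) in auto)
  have van0: "Ext_k_vanish (i + 0)" using van by simp
  have hz: "h (\<psi> (d (Suc i) y)) = \<zero>\<^bsub>I 0\<^esub>" if "y \<in> carrier (F (Suc (Suc i)))" for y
    unfolding \<psi>(2)[OF that] by (rule module_homs_zero[OF modN modI h(1)])
  obtain g where g: "g \<in> module_homs R (F i) (C 0)" "\<And>v. v \<in> carrier (F (Suc i)) \<Longrightarrow> h (\<psi> v) = g (d i v)"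
    using cocycle_extends[OF van0 module_homs_comp[OF \<psi>(1) hC] hz] by blast
  have "\<exists>g'\<in>module_homs R (F i) N. \<forall>x\<in>carrier (F i). h (g' x) = g x"
    by (rule dual_basis_lift[OF basis modF modN modC hC g(1)]) (use homCD(2)[OF g(1)] h(3) in auto)
  then obtain g' where g': "g' \<in> module_homs R (F i) N" "\<And>x. x \<in> carrier (F i) \<Longrightarrow> h (g' x) = g x" by blast
  have "\<psi> v \<in> ideal_mult N \<mm>" if v: "v \<in> carrier (F (Suc i))" for v
  proof -
    have dv: "d i v \<in> carrier (F i)" using module_homsD(1)[OF d_hom v] .
    have "h (\<psi> v) = h (g' (d i v))" using g(2)[OF v] g'(2)[OF dv] by simp
    then have "\<psi> v = g' (d i v)"
      using h(2) module_homsD(1)[OF \<psi>(1) v] module_homsD(1)[OF g'(1) dv] by (auto simp: inj_on_def)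
    then show ?thesis using hom_mF[OF modN g'(1) d_mF[OF v]] by simp
  qed
  then show False using \<psi>(3) by blast
qed

end

section \<open>Modules of homomorphisms\<close>

text \<open>Homomorphisms are made extensional, so that those which agree on
  \<open>carrier M\<close> are equal; otherwise the group laws would only hold up to values outside
  the carrier.\<close>

definition hom_module ::
    "('a, 'c) ring_scheme \<Rightarrow> ('a, 'm) module \<Rightarrow> ('a, 'n) module \<Rightarrow> ('a, 'm \<Rightarrow> 'n) module" where
  "hom_module R M N =
     \<lparr>carrier = module_homs R M N \<inter> extensional (carrier M), monoid.mult = undefined, one = undefined,
      ring.zero = (\<lambda>x\<in>carrier M. \<zero>\<^bsub>N\<^esub>),
      ring.add = (\<lambda>f g. \<lambda>x\<in>carrier M. f x \<oplus>\<^bsub>N\<^esub> g x),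
      module.smult = (\<lambda>a f. \<lambda>x\<in>carrier M. a \<odot>\<^bsub>N\<^esub> f x)\<rparr>"

lemma hom_module_simps [simp]:
  "carrier (hom_module R M N) = module_homs R M N \<inter> extensional (carrier M)"
  "\<zero>\<^bsub>hom_module R M N\<^esub> = (\<lambda>x\<in>carrier M. \<zero>\<^bsub>N\<^esub>)"
  "f \<oplus>\<^bsub>hom_module R M N\<^esub> g = (\<lambda>x\<in>carrier M. f x \<oplus>\<^bsub>N\<^esub> g x)"
  "a \<odot>\<^bsub>hom_module R M N\<^esub> f = (\<lambda>x\<in>carrier M. a \<odot>\<^bsub>N\<^esub> f x)"
  by (simp_all add: hom_module_def)

lemma restrict_hom:
  assumes "module R M" "f \<in> module_homs R M N"
  shows "restrict f (carrier M) \<in> carrier (hom_module R M N)"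
  using module_homs_cong[OF assms(2,1), of "restrict f (carrier M)"] by simp

lemma module_hom_module:
  assumes M: "module R M" and N: "module R N"
  shows "module R (hom_module R M N)"
proof -
  interpret N: module R N by (rule N)
  let ?H = "hom_module R M N"
  have val: "f x \<in> carrier N" if "f \<in> carrier ?H" "x \<in> carrier M" for f x
    using that module_homsD(1)[of f R M N x] by simp
  have ext: "f = g" if "f \<in> carrier ?H" "g \<in> carrier ?H" "\<And>x. x \<in> carrier M \<Longrightarrow> f x = g x" for f g
    by (rule extensionalityI[of f "carrier M"]) (use that in auto)
  have add: "f \<oplus>\<^bsub>?H\<^esub> g \<in> carrier ?H" if "f \<in> carrier ?H" "g \<in> carrier ?H" for f g
    using restrict_hom[OF M homs_add[OF N, of f M g]] that by simp
  have smult: "a \<odot>\<^bsub>?H\<^esub> f \<in> carrier ?H" if "a \<in> carrier R" "f \<in> carrier ?H" for a f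
    using restrict_hom[OF M homs_smult[OF N, of f M a]] that by simp
  have zero: "\<zero>\<^bsub>?H\<^esub> \<in> carrier ?H" using restrict_hom[OF M homs_zero[OF N]] by simp
  have "abelian_group ?H"
  proof (rule abelian_groupI)
    fix f g h assume "f \<in> carrier ?H" "g \<in> carrier ?H" "h \<in> carrier ?H"
    then show "f \<oplus>\<^bsub>?H\<^esub> g \<oplus>\<^bsub>?H\<^esub> h = f \<oplus>\<^bsub>?H\<^esub> (g \<oplus>\<^bsub>?H\<^esub> h)"
      by (intro ext add) (auto simp: val N.M.a_assoc)
  next
    fix f g assume "f \<in> carrier ?H" "g \<in> carrier ?H"
    then show "f \<oplus>\<^bsub>?H\<^esub> g = g \<oplus>\<^bsub>?H\<^esub> f" by (intro ext add) (auto simp: val N.M.a_comm)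
  next
    fix f assume f: "f \<in> carrier ?H"
    then show "\<zero>\<^bsub>?H\<^esub> \<oplus>\<^bsub>?H\<^esub> f = f" by (intro ext add zero) (auto simp: val)
    have neg: "restrict (\<lambda>x. \<ominus>\<^bsub>N\<^esub> f x) (carrier M) \<in> carrier ?H"
      using restrict_hom[OF M homs_neg[OF N, of f M]] f by simp
    show "\<exists>g\<in>carrier ?H. g \<oplus>\<^bsub>?H\<^esub> f = \<zero>\<^bsub>?H\<^esub>"
      by (rule bexI[OF _ neg], rule ext[OF add[OF neg f] zero]) (use f in \<open>auto simp: val N.M.l_neg\<close>)
  qed (use add zero in auto)
  then show ?thesis
  proof (intro moduleI N.is_cring)
    fix a b f assume *: "a \<in> carrier R" "b \<in> carrier R" "f \<in> carrier ?H"
    then show "(a \<oplus>\<^bsub>R\<^esub> b) \<odot>\<^bsub>?H\<^esub> f = a \<odot>\<^bsub>?H\<^esub> f \<oplus>\<^bsub>?H\<^esub> b \<odot>\<^bsub>?H\<^esub> f"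
      by (intro ext add smult) (auto simp: val N.smult_l_distr)
    show "a \<otimes>\<^bsub>R\<^esub> b \<odot>\<^bsub>?H\<^esub> f = a \<odot>\<^bsub>?H\<^esub> (b \<odot>\<^bsub>?H\<^esub> f)"
      using * by (intro ext smult) (auto simp: val N.smult_assoc1)
  next
    fix a f g assume "a \<in> carrier R" "f \<in> carrier ?H" "g \<in> carrier ?H"
    then show "a \<odot>\<^bsub>?H\<^esub> (f \<oplus>\<^bsub>?H\<^esub> g) = a \<odot>\<^bsub>?H\<^esub> f \<oplus>\<^bsub>?H\<^esub> a \<odot>\<^bsub>?H\<^esub> g"
      by (intro ext add smult) (auto simp: val N.smult_r_distr)
  next
    fix f assume "f \<in> carrier ?H"
    then show "\<one>\<^bsub>R\<^esub> \<odot>\<^bsub>?H\<^esub> f = f" by (intro ext smult) (auto simp: val)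
  qed (use smult in auto)
qed

lemma hom_module_eval:
  assumes "x \<in> carrier M"
  shows "(\<lambda>f. f x) \<in> module_homs R (hom_module R M N) N"
  by (rule module_homsI) (use assms module_homsD(1)[of _ R M N] in auto)

lemma hom_module_ext:
  assumes "f \<in> carrier (hom_module R M N)" "g \<in> carrier (hom_module R M N)"
    and "\<And>x. x \<in> carrier M \<Longrightarrow> f x = g x"
  shows "f = g"
  by (rule extensionalityI[of f "carrier M"]) (use assms in auto)

lemma hom_module_pullback:
  assumes M: "module R M" and M': "module R M'" and N: "module R N" and q: "q \<in> module_homs R M M'"
  shows "(\<lambda>f. \<lambda>x\<in>carrier M. f (q x)) \<in> module_homs R (hom_module R M' N) (hom_module R M N)"
proof (rule module_homsI)
  interpret M: module R M by (rule M)
  note qc = module_homsD(1)[OF q]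
  fix f assume f: "f \<in> carrier (hom_module R M' N)"
  have comp: "(\<lambda>x\<in>carrier M. f (q x)) \<in> carrier (hom_module R M N)" if "f \<in> carrier (hom_module R M' N)" for f
    using restrict_hom[OF M module_homs_comp[OF q, of f N]] that by simp
  show "(\<lambda>x\<in>carrier M. f (q x)) \<in> carrier (hom_module R M N)" by (rule comp[OF f])
  show "(\<lambda>x\<in>carrier M. (f \<oplus>\<^bsub>hom_module R M' N\<^esub> g) (q x)) =
    (\<lambda>x\<in>carrier M. f (q x)) \<oplus>\<^bsub>hom_module R M N\<^esub> (\<lambda>x\<in>carrier M. g (q x))" for g
    using qc by (auto simp: fun_eq_iff)
  show "(\<lambda>x\<in>carrier M. (a \<odot>\<^bsub>hom_module R M' N\<^esub> f) (q x)) = a \<odot>\<^bsub>hom_module R M N\<^esub> (\<lambda>x\<in>carrier M. f (q x))" for a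
    using qc by (auto simp: fun_eq_iff)
qed

text \<open>The roles are exchanged: the old coordinates generate the dual, and evaluations at the
  old generators are its coordinates.\<close>

lemma dual_basis_dual:
  assumes P: "dual_basis R P T p \<pi>" and mP: "module R P"
  shows "dual_basis R (hom_module R P (ring_as_module R)) T (\<lambda>t. restrict (\<pi> t) (carrier P)) (\<lambda>t f. f (p t))"
proof -
  interpret P: module R P by (rule mP)
  interpret A: module R "ring_as_module R" by (rule module_ring_as_module) (rule P.is_cring)
  let ?A = "ring_as_module R"
  let ?H = "hom_module R P ?A"
  have H: "module R ?H" by (rule module_hom_module[OF mP A.module_axioms])
  interpret H: module R ?H by (rule H)
  have T: "finite T" and \<pi>: "\<And>t. t \<in> T \<Longrightarrow> \<pi> t \<in> module_homs R P ?A" using P by (auto simp: dual_basis_def)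
  note c = dual_basis_coord[OF P]
  have pH: "restrict (\<pi> t) (carrier P) \<in> carrier ?H" if "t \<in> T" for t by (rule restrict_hom[OF mP \<pi>[OF that]])
  have "f = (\<Oplus>\<^bsub>?H\<^esub>t\<in>T. f (p t) \<odot>\<^bsub>?H\<^esub> restrict (\<pi> t) (carrier P))" if f: "f \<in> carrier ?H" for f
  proof -
    have fh: "f \<in> module_homs R P ?A" using f by simp
    have fp: "f (p t) \<in> carrier R" if "t \<in> T" for t using module_homsD(1)[OF fh c(4)[OF that]] by simp
    have sm: "f (p t) \<odot>\<^bsub>?H\<^esub> restrict (\<pi> t) (carrier P) \<in> carrier ?H" if "t \<in> T" for t
      by (rule H.smult_closed[OF fp[OF that] pH[OF that]])
    show ?thesis
    proof (rule hom_module_ext[OF f])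
      show "(\<Oplus>\<^bsub>?H\<^esub>t\<in>T. f (p t) \<odot>\<^bsub>?H\<^esub> restrict (\<pi> t) (carrier P)) \<in> carrier ?H"
        by (rule H.finsum_closed) (use sm in blast)
      fix x assume x: "x \<in> carrier P"
      have "(\<Oplus>\<^bsub>?H\<^esub>t\<in>T. f (p t) \<odot>\<^bsub>?H\<^esub> restrict (\<pi> t) (carrier P)) x
        = (\<Oplus>\<^bsub>?A\<^esub>t\<in>T. (f (p t) \<odot>\<^bsub>?H\<^esub> restrict (\<pi> t) (carrier P)) x)"
        by (rule module_homs_finsum_apply[OF H A.module_axioms hom_module_eval[OF x] T sm])
      also have "\<dots> = (\<Oplus>\<^bsub>?A\<^esub>t\<in>T. \<pi> t x \<odot>\<^bsub>?A\<^esub> f (p t))"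
        by (rule A.finsum_cong') (use fp c(1) x in \<open>auto simp: P.m_comm\<close>)
      also have "\<dots> = f x" by (rule dual_basis_expand[OF P mP A.module_axioms fh x, symmetric])
      finally show "f x = (\<Oplus>\<^bsub>?H\<^esub>t\<in>T. f (p t) \<odot>\<^bsub>?H\<^esub> restrict (\<pi> t) (carrier P)) x" by simp
    qed
  qed
  then show ?thesis
    unfolding dual_basis_def by (intro conjI ballI T Pi_I pH hom_module_eval c(4))
qed

section \<open>From finite injective dimension to a regular sequence\<close>

text \<open>Take the largest \<open>s\<close> with Ext^{s+1}(k, N) nonzero; it exists because of
  \<open>D\<close>, and the essential cocycle shows that s+1 is at least the embedding dimension.
  Homotopies for the elements of \<open>\<mm>\<close> dualise, so the dual complex falls under
  \<open>cochain_exact_below_top\<close> and is exact in degrees 0 to s.\<close>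

lemma (in resolution_pair) dual_exact:
  assumes fin: "\<And>j. j > D \<Longrightarrow> carrier (I j) = {\<zero>\<^bsub>I j\<^esub>}"
    and ess: "essential_cocycle N p \<psi>" and r: "0 < embedding_dim R"
  shows "f \<in> module_homs R (F 0) (ring_as_module R) \<Longrightarrow>
      (\<And>y. y \<in> carrier (F (Suc 0)) \<Longrightarrow> f (d 0 y) = \<zero>) \<Longrightarrow> v \<in> carrier (F 0) \<Longrightarrow> f v = \<zero>"
    and "Suc q < embedding_dim R \<Longrightarrow> f \<in> module_homs R (F (Suc q)) (ring_as_module R) \<Longrightarrow>
      (\<And>y. y \<in> carrier (F (Suc (Suc q))) \<Longrightarrow> f (d (Suc q) y) = \<zero>) \<Longrightarrow>
      \<exists>g\<in>module_homs R (F q) (ring_as_module R). \<forall>v\<in>carrier (F (Suc q)). f v = g (d q v)"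
proof -
  let ?A = "ring_as_module R" and ?r = "embedding_dim R"
  interpret A: module R ?A by (rule module_ring_as_module) (rule is_cring)
  \<comment> \<open>A cocycle below the embedding dimension is raised to that degree, any other is
    kept. As the embedding dimension is positive, the degree is a successor in both cases.\<close>
  have "\<exists>i \<psi>'. essential_cocycle N (Suc i) \<psi>' \<and> ?r \<le> Suc i"
  proof (cases "p < ?r")
    case True
    then obtain i where "?r = Suc i" using r by (cases ?r) auto
    then show ?thesis using essential_cocycle_raise[OF modN ess, of "?r"] True by auto
  next
    case False
    then obtain i where "p = Suc i" using r by (cases p) auto
    then show ?thesis using ess False by auto
  qed
  then obtain i where i: "\<not> Ext_k_vanish i" "?r \<le> Suc i" using essential_cocycle_not_Ext_k_vanish by blast
  have bound: "j \<le> D" if "\<not> Ext_k_vanish j" for j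
  proof (rule ccontr)
    assume "\<not> j \<le> D"
    then have "cosyz (Suc j) \<subseteq> {\<zero>\<^bsub>I (Suc j)\<^esub>}" using fin[of "Suc j"] cosyzD(1) by auto
    then have "Ext_k_vanish j"
      unfolding Ext_k_vanish_def
      using module_homs_zero[OF modI modI \<delta>[of j]] module.smult_r_null[OF modI[of j]] module.submodule_mem(2)[OF modI module.carrier_is_submodule[OF modI[of j]]]
      by (intro ballI impI bexI[of _ "\<zero>\<^bsub>I j\<^esub>"]) auto
    then show False using that by simp
  qed
  define S where "S = {j. \<not> Ext_k_vanish j}"
  have S: "finite S" "i \<in> S" using bound i(1) finite_subset[of S "{..D}"] by (auto simp: S_def)
  define s where "s = Max S"
  have "s \<in> S" unfolding s_def by (rule Max_in) (use S in auto)
  moreover have le: "j \<le> s" if "j \<in> S" for j unfolding s_def by (rule Max_ge[OF S(1) that])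
  ultimately have s: "\<not> Ext_k_vanish s" "\<And>j. j > s \<Longrightarrow> Ext_k_vanish j" "i \<le> s"
    using S(2) by (auto simp: S_def not_le[symmetric])
  define G where "G q = hom_module R (F q) ?A" for q
  define dG where "dG q f = (\<lambda>x\<in>carrier (F (Suc q)). f (d q x))" for q and f :: "'m \<Rightarrow> 'a"
  have G: "module R (G q)" for q unfolding G_def by (rule module_hom_module[OF modF A.module_axioms])
  have dG: "dG q \<in> module_homs R (G q) (G (Suc q))" for q
    unfolding G_def dG_def[abs_def] by (rule hom_module_pullback[OF modF modF A.module_axioms d_hom])
  have mem: "f \<in> module_ker (G q) (G (Suc q)) (dG q) \<longleftrightarrow>
    f \<in> carrier (G q) \<and> (\<forall>y\<in>carrier (F (Suc q)). f (d q y) = \<zero>)" for f q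
    by (auto simp: module_ker_def dG_def G_def fun_eq_iff restrict_def)
  have fR: "f x \<in> carrier R" "f (x \<oplus>\<^bsub>F q\<^esub> y) = f x \<oplus> f y" "f (x \<ominus>\<^bsub>F q\<^esub> y) = f x \<ominus> f y"
    "a \<in> carrier R \<Longrightarrow> f (a \<odot>\<^bsub>F q\<^esub> x) = a \<otimes> f x"
    if f: "f \<in> carrier (G q)" and xy: "x \<in> carrier (F q)" "y \<in> carrier (F q)" for f x y q a
  proof -
    have fh: "f \<in> module_homs R (F q) ?A" using f by (simp add: G_def)
    show "f x \<in> carrier R" "f (x \<oplus>\<^bsub>F q\<^esub> y) = f x \<oplus> f y" "a \<in> carrier R \<Longrightarrow> f (a \<odot>\<^bsub>F q\<^esub> x) = a \<otimes> f x"
      using module_homsD[OF fh] xy by auto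
    have "f (x \<ominus>\<^bsub>F q\<^esub> y) = f x \<ominus>\<^bsub>?A\<^esub> f y" by (rule module_homs_minus[OF modF A.module_axioms fh xy])
    then show "f (x \<ominus>\<^bsub>F q\<^esub> y) = f x \<ominus> f y"
      by (simp add: a_minus_def a_inv_def m_inv_def)
  qed
  have dGdG: "dG (Suc q) (dG q f) = \<zero>\<^bsub>G (Suc (Suc q))\<^esub>" if "f \<in> carrier (G q)" for q f
  proof -
    have "f \<zero>\<^bsub>F q\<^esub> = \<zero>" using module_homs_zero[OF modF A.module_axioms] that by (simp add: G_def)
    then show ?thesis using dd module_homsD(1)[OF d_hom] by (auto simp: dG_def G_def fun_eq_iff)
  qed
  have basisG: "\<exists>T p \<pi>. dual_basis R (G q) (T :: 'm set) p \<pi>" for q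
    unfolding G_def using dual_basis_dual[OF basis modF] by blast
  have kill0: "a \<odot>\<^bsub>G 0\<^esub> f = \<zero>\<^bsub>G 0\<^esub>" if a: "a \<in> \<mm>" and f: "f \<in> module_ker (G 0) (G 1) (dG 0)" for a f
  proof -
    obtain h where h: "h \<in> module_homs R (F 0) (F (Suc 0))" "\<And>y. y \<in> carrier (F 0) \<Longrightarrow> d 0 (h y) = a \<odot>\<^bsub>F 0\<^esub> y"
      using homotopy[OF a] by blast
    have f': "f \<in> carrier (G 0)" "\<And>y. y \<in> carrier (F (Suc 0)) \<Longrightarrow> f (d 0 y) = \<zero>" using f mem[of f 0] by auto
    have "a \<otimes> f x = \<zero>" if x: "x \<in> carrier (F 0)" for x
      using fR(4)[OF f'(1) x x, of a] f'(2)[OF module_homsD(1)[OF h(1) x]] h(2)[OF x] a by simp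
    then show ?thesis by (auto simp: G_def fun_eq_iff)
  qed
  \<comment> \<open>The transposed homotopy: \<open>f\<close> vanishes on d h x = a x - h d x, so
    \<open>f\<close> composed with \<open>h q\<close> is a cochain whose coboundary is a f.\<close>
  have kill: "a \<odot>\<^bsub>G (Suc q)\<^esub> f \<in> dG q ` carrier (G q)"
    if a: "a \<in> \<mm>" and f: "f \<in> module_ker (G (Suc q)) (G (Suc (Suc q))) (dG (Suc q))" for a f q
  proof -
    obtain h where h: "\<And>q. h q \<in> module_homs R (F q) (F (Suc q))"
      "\<And>y. y \<in> carrier (F (Suc q)) \<Longrightarrow> d (Suc q) (h (Suc q) y) = a \<odot>\<^bsub>F (Suc q)\<^esub> y \<ominus>\<^bsub>F (Suc q)\<^esub> h q (d q y)"
      using homotopy[OF a] by blast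
    have f': "f \<in> carrier (G (Suc q))" "\<And>y. y \<in> carrier (F (Suc (Suc q))) \<Longrightarrow> f (d (Suc q) y) = \<zero>"
      using f mem[of f "Suc q"] by auto
    have fh: "f \<in> module_homs R (F (Suc q)) ?A" using f'(1) by (simp add: G_def)
    let ?g = "restrict (\<lambda>x. f (h q x)) (carrier (F q))"
    have g: "?g \<in> carrier (G q)"
      unfolding G_def by (rule restrict_hom[OF modF module_homs_comp[OF h(1) fh]])
    have "a \<otimes> f x = f (h q (d q x))" if x: "x \<in> carrier (F (Suc q))" for x
    proof -
      interpret F: module R "F (Suc q)" by (rule modF)
      have aR: "a \<in> carrier R" using a by simp
      have hdx: "h q (d q x) \<in> carrier (F (Suc q))" using module_homsD(1)[OF h(1) module_homsD(1)[OF d_hom x]] .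
      have ax: "a \<odot>\<^bsub>F (Suc q)\<^esub> x \<in> carrier (F (Suc q))" using aR x by simp
      have "f (a \<odot>\<^bsub>F (Suc q)\<^esub> x) \<ominus> f (h q (d q x)) = \<zero>"
        using fR(3)[OF f'(1) ax hdx] f'(2)[OF module_homsD(1)[OF h(1) x]] h(2)[OF x] by simp
      then have "f (a \<odot>\<^bsub>F (Suc q)\<^esub> x) = f (h q (d q x))"
        using fR(1)[OF f'(1) ax ax] fR(1)[OF f'(1) hdx hdx] by simp
      then show ?thesis using fR(4)[OF f'(1) x x aR] by simp
    qed
    then have "a \<odot>\<^bsub>G (Suc q)\<^esub> f = dG q ?g"
      using module_homsD(1)[OF d_hom] by (auto simp: G_def dG_def fun_eq_iff)
    then show ?thesis using g by blast
  qed
  have ex0: "module_ker (G 0) (G 1) (dG 0) = {\<zero>\<^bsub>G 0\<^esub>}"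
    by (rule cochain_exact_below_top(1)[OF G dG dGdG basisG kill0 kill fin s(1,2)])
  have exS: "module_ker (G (Suc q)) (G (Suc (Suc q))) (dG (Suc q)) = dG q ` carrier (G q)" if "q < s" for q
    by (rule cochain_exact_below_top(2)[OF G dG dGdG basisG kill0 kill fin s(1,2) that])
  show "f v = \<zero>" if f: "f \<in> module_homs R (F 0) ?A" "\<And>y. y \<in> carrier (F (Suc 0)) \<Longrightarrow> f (d 0 y) = \<zero>"
    and v: "v \<in> carrier (F 0)" for f v
  proof -
    have "restrict f (carrier (F 0)) \<in> module_ker (G 0) (G 1) (dG 0)"
      using mem[of "restrict f (carrier (F 0))" 0] restrict_hom[OF modF f(1)] f(2) module_homsD(1)[OF d_hom]
      by (simp add: G_def)
    then have "restrict f (carrier (F 0)) = (\<lambda>x\<in>carrier (F 0). \<zero>)" unfolding ex0 by (simp add: G_def)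
    then show ?thesis using v by (metis restrict_apply')
  qed
  show "\<exists>g\<in>module_homs R (F q) ?A. \<forall>v\<in>carrier (F (Suc q)). f v = g (d q v)"
    if q: "Suc q < ?r" and f: "f \<in> module_homs R (F (Suc q)) ?A"
      "\<And>y. y \<in> carrier (F (Suc (Suc q))) \<Longrightarrow> f (d (Suc q) y) = \<zero>" for q f
  proof -
    have "restrict f (carrier (F (Suc q))) \<in> module_ker (G (Suc q)) (G (Suc (Suc q))) (dG (Suc q))"
      using mem[of "restrict f (carrier (F (Suc q)))" "Suc q"] restrict_hom[OF modF f(1)] f(2) module_homsD(1)[OF d_hom]
      by (simp add: G_def)
    then obtain g where g: "g \<in> carrier (G q)" "restrict f (carrier (F (Suc q))) = dG q g"
      using exS[of q] q i(2) s(3) by auto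
    then have "f v = g (d q v)" if "v \<in> carrier (F (Suc q))" for v
      using that unfolding dG_def by (metis restrict_apply')
    then show ?thesis using g(1) by (auto simp: G_def)
  qed
qed

lemma regular_seq_snoc:
  assumes "cring R" "regular_seq R xs" "y \<in> carrier R"
    and "\<And>a. a \<in> carrier R \<Longrightarrow> y \<otimes>\<^bsub>R\<^esub> a \<in> Idl\<^bsub>R\<^esub> (set xs) \<Longrightarrow> a \<in> Idl\<^bsub>R\<^esub> (set xs)"
  shows "regular_seq R (xs @ [y])"
  using assms unfolding regular_seq_def by (auto simp: nth_append less_Suc_eq)

section \<open>From vanishing of Ext(k, R) to a regular sequence\<close>

context min_resolution
begin

text \<open>\<open>Ext\<^sup>q(k, R/J) = 0\<close>; homomorphisms from \<open>F q\<close> to \<open>R/J\<close> are represented by their lifts to \<open>R\<close>.\<close>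

definition Ext_quot_vanish :: "'a set \<Rightarrow> nat \<Rightarrow> bool" where
  "Ext_quot_vanish J q \<longleftrightarrow> (\<forall>f\<in>module_homs R (F q) (ring_as_module R).
     (\<forall>y\<in>carrier (F (Suc q)). f (d q y) \<in> J) \<longrightarrow>
     (case q of 0 \<Rightarrow> \<forall>v\<in>carrier (F 0). f v \<in> J
      | Suc i \<Rightarrow> \<exists>g\<in>module_homs R (F i) (ring_as_module R). \<forall>v\<in>carrier (F (Suc i)). f v \<ominus> g (d i v) \<in> J))"

lemma modA: "module R (ring_as_module R)"
  by (rule module_ring_as_module) (rule is_cring)

lemma functional:
  assumes f: "f \<in> module_homs R (F q) (ring_as_module R)"
  shows "x \<in> carrier (F q) \<Longrightarrow> f x \<in> carrier R"
    "x \<in> carrier (F q) \<Longrightarrow> y \<in> carrier (F q) \<Longrightarrow> f (x \<oplus>\<^bsub>F q\<^esub> y) = f x \<oplus> f y"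
    "a \<in> carrier R \<Longrightarrow> x \<in> carrier (F q) \<Longrightarrow> f (a \<odot>\<^bsub>F q\<^esub> x) = a \<otimes> f x"
    "f \<zero>\<^bsub>F q\<^esub> = \<zero>"
  using module_homsD[OF f] module_homs_zero[OF modF modA f] by auto

lemma functionalI:
  assumes "\<And>x. x \<in> carrier (F q) \<Longrightarrow> f x \<in> carrier R"
    "\<And>x y. x \<in> carrier (F q) \<Longrightarrow> y \<in> carrier (F q) \<Longrightarrow> f (x \<oplus>\<^bsub>F q\<^esub> y) = f x \<oplus> f y"
    "\<And>a x. a \<in> carrier R \<Longrightarrow> x \<in> carrier (F q) \<Longrightarrow> f (a \<odot>\<^bsub>F q\<^esub> x) = a \<otimes> f x"
  shows "f \<in> module_homs R (F q) (ring_as_module R)"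
  by (rule module_homsI) (use assms in auto)

lemma functional_in_ideal:
  assumes f: "f \<in> module_homs R (F q) (ring_as_module R)" and J: "ideal J R"
    and b: "\<And>b. b \<in> bas q \<Longrightarrow> f b \<in> J" and x: "x \<in> carrier (F q)"
  shows "f x \<in> J"
proof -
  have "f x = (\<Oplus>b\<in>bas q. crd q b x \<otimes> f b)"
    using dual_basis_expand[OF basis modF modA f x] by simp
  also have "\<dots> \<in> J"
    by (rule finsum_in_ideal[OF J bas(1)]) (rule ideal_closed(6)[OF J b crd(1)[OF _ x]])
  finally show ?thesis .
qed

lemma functional_comb:
  assumes f: "f \<in> module_homs R (F q) (ring_as_module R)" and g: "g \<in> module_homs R (F q) (ring_as_module R)"
    and y: "y \<in> carrier R"
  shows "(\<lambda>x. f x \<ominus> g x \<otimes> y) \<in> module_homs R (F q) (ring_as_module R)"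
proof (rule functionalI)
  note F = functional[OF f] and G = functional[OF g]
  interpret F: module R "F q" by (rule modF)
  fix x assume x: "x \<in> carrier (F q)"
  show "f x \<ominus> g x \<otimes> y \<in> carrier R" using F G x y by simp
  show "f (x \<oplus>\<^bsub>F q\<^esub> z) \<ominus> g (x \<oplus>\<^bsub>F q\<^esub> z) \<otimes> y = (f x \<ominus> g x \<otimes> y) \<oplus> (f z \<ominus> g z \<otimes> y)" if z: "z \<in> carrier (F q)" for z
  proof -
    have "f x \<in> carrier R" "f z \<in> carrier R" "g x \<in> carrier R" "g z \<in> carrier R" using F G x z by auto
    then show ?thesis unfolding F(2)[OF x z] G(2)[OF x z] using y by algebra
  qed
  show "f (a \<odot>\<^bsub>F q\<^esub> x) \<ominus> g (a \<odot>\<^bsub>F q\<^esub> x) \<otimes> y = a \<otimes> (f x \<ominus> g x \<otimes> y)" if a: "a \<in> carrier R" for a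
  proof -
    have "f x \<in> carrier R" "g x \<in> carrier R" using F G x by auto
    then show ?thesis unfolding F(3)[OF a x] G(3)[OF a x] using y a by algebra
  qed
qed

text \<open>The long exact sequence of multiplication by \<open>y\<close> on R/J. A cocycle
  \<open>f\<close> modulo the larger ideal has f d = g1 y modulo \<open>J\<close>; cancelling
  \<open>y\<close> makes \<open>g1\<close> a cocycle, so it is g2 d modulo \<open>J\<close>, and f -
  g2 y is a cocycle modulo \<open>J\<close> itself.\<close>

lemma Ext_quot_vanish_step:
  assumes J: "ideal J R" and y: "y \<in> carrier R"
    and nzd: "\<And>a. a \<in> carrier R \<Longrightarrow> y \<otimes> a \<in> J \<Longrightarrow> a \<in> J"
    and van: "Ext_quot_vanish J q" "Ext_quot_vanish J (Suc q)"
  shows "Ext_quot_vanish (add_gen R J y) q"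
  unfolding Ext_quot_vanish_def
proof (intro ballI impI)
  note j = ideal_closed[OF J]
  note Jy = add_gen[OF J y] and jy = ideal_closed[OF add_gen(1)[OF J y]]
  fix f assume f: "f \<in> module_homs R (F q) (ring_as_module R)"
    and fd: "\<forall>v\<in>carrier (F (Suc q)). f (d q v) \<in> add_gen R J y"
  note fF = functional[OF f]
  have dc: "d p v \<in> carrier (F p)" if "v \<in> carrier (F (Suc p))" for p v using module_homsD(1)[OF d_hom that] .
  have "\<forall>b\<in>bas (Suc q). \<exists>c\<in>carrier R. \<exists>w\<in>J. f (d q b) = w \<oplus> c \<otimes> y"
  proof
    fix b assume "b \<in> bas (Suc q)"
    then have "f (d q b) \<in> add_gen R J y" using fd bas(2) by blast
    then show "\<exists>c\<in>carrier R. \<exists>w\<in>J. f (d q b) = w \<oplus> c \<otimes> y" unfolding add_gen_def by blast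
  qed
  then obtain c where c: "\<And>b. b \<in> bas (Suc q) \<Longrightarrow> c b \<in> carrier R"
    "\<And>b. b \<in> bas (Suc q) \<Longrightarrow> \<exists>w\<in>J. f (d q b) = w \<oplus> c b \<otimes> y" by metis
  obtain g1 where g1: "g1 \<in> module_homs R (F (Suc q)) (ring_as_module R)" "\<And>b. b \<in> bas (Suc q) \<Longrightarrow> g1 b = c b"
    using basis_hom[OF modA, of "Suc q" c] c(1) by auto
  note g1F = functional[OF g1(1)]
  have fdh: "(\<lambda>v. f (d q v)) \<in> module_homs R (F (Suc q)) (ring_as_module R)" by (rule module_homs_comp[OF d_hom f])
  have diff: "f (d q v) \<ominus> g1 v \<otimes> y \<in> J" if v: "v \<in> carrier (F (Suc q))" for v
  proof (rule functional_in_ideal[OF functional_comb[OF fdh g1(1) y] J _ v])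
    fix b assume b: "b \<in> bas (Suc q)"
    obtain w where w: "w \<in> J" "f (d q b) = w \<oplus> c b \<otimes> y" using c(2)[OF b] by blast
    have "w \<in> carrier R" using j(1) w(1) .
    then have "(w \<oplus> c b \<otimes> y) \<ominus> c b \<otimes> y = w" using c(1)[OF b] y by algebra
    then show "f (d q b) \<ominus> g1 b \<otimes> y \<in> J" using w g1(2)[OF b] by simp
  qed
  have "g1 (d (Suc q) v) \<in> J" if v: "v \<in> carrier (F (Suc (Suc q)))" for v
  proof (rule nzd)
    have gR: "g1 (d (Suc q) v) \<in> carrier R" using g1F(1)[OF dc[OF v]] .
    then show "g1 (d (Suc q) v) \<in> carrier R" .
    have "\<zero> \<ominus> g1 (d (Suc q) v) \<otimes> y \<in> J" using diff[OF dc[OF v]] dd[OF v] fF(4) by simp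
    then have "\<ominus> (\<zero> \<ominus> g1 (d (Suc q) v) \<otimes> y) \<in> J" by (rule j(4))
    moreover have "\<ominus> (\<zero> \<ominus> g1 (d (Suc q) v) \<otimes> y) = y \<otimes> g1 (d (Suc q) v)" using gR y by algebra
    ultimately show "y \<otimes> g1 (d (Suc q) v) \<in> J" by simp
  qed
  then obtain g2 where g2: "g2 \<in> module_homs R (F q) (ring_as_module R)"
    "\<And>v. v \<in> carrier (F (Suc q)) \<Longrightarrow> g1 v \<ominus> g2 (d q v) \<in> J"
    using van(2) g1(1) unfolding Ext_quot_vanish_def by auto
  note g2F = functional[OF g2(1)]
  have "f (d q v) \<ominus> g2 (d q v) \<otimes> y \<in> J" if v: "v \<in> carrier (F (Suc q))" for v
  proof -
    have carr: "f (d q v) \<in> carrier R" "g1 v \<in> carrier R" "g2 (d q v) \<in> carrier R"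
      using fF(1)[OF dc[OF v]] g1F(1)[OF v] g2F(1)[OF dc[OF v]] .
    have "f (d q v) \<ominus> g2 (d q v) \<otimes> y = (f (d q v) \<ominus> g1 v \<otimes> y) \<oplus> (g1 v \<ominus> g2 (d q v)) \<otimes> y"
      using carr y by algebra
    also have "\<dots> \<in> J" by (intro j(3,7) diff g2(2) v y)
    finally show ?thesis .
  qed
  then have van': "case q of 0 \<Rightarrow> \<forall>v\<in>carrier (F 0). f v \<ominus> g2 v \<otimes> y \<in> J
      | Suc i \<Rightarrow> \<exists>g\<in>module_homs R (F i) (ring_as_module R). \<forall>v\<in>carrier (F (Suc i)). (f v \<ominus> g2 v \<otimes> y) \<ominus> g (d i v) \<in> J"
    using van(1)[unfolded Ext_quot_vanish_def, rule_format, OF functional_comb[OF f g2(1) y]] by blast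
  have g2y: "g2 v \<otimes> y \<in> add_gen R J y" if "v \<in> carrier (F q)" for v
    using jy(6)[OF Jy(3) g2F(1)[OF that]] .
  show "case q of 0 \<Rightarrow> \<forall>v\<in>carrier (F 0). f v \<in> add_gen R J y
      | Suc i \<Rightarrow> \<exists>g\<in>module_homs R (F i) (ring_as_module R). \<forall>v\<in>carrier (F (Suc i)). f v \<ominus> g (d i v) \<in> add_gen R J y"
  proof (cases q)
    case 0
    have "f v \<in> add_gen R J y" if v: "v \<in> carrier (F q)" for v
      using diff_mem_cancel[OF Jy(1) fF(1)[OF v] g2y[OF v]] van' 0 v Jy(2) by auto
    then show ?thesis using 0 by simp
  next
    case (Suc i)
    obtain g where g: "g \<in> module_homs R (F i) (ring_as_module R)"
      "\<And>v. v \<in> carrier (F q) \<Longrightarrow> (f v \<ominus> g2 v \<otimes> y) \<ominus> g (d i v) \<in> J" using van' Suc by auto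
    have "f v \<ominus> g (d i v) \<in> add_gen R J y" if v: "v \<in> carrier (F q)" for v
    proof -
      have gR: "g (d i v) \<in> carrier R" using functional(1)[OF g(1)] dc[of v i] v Suc by simp
      have carr: "f v \<in> carrier R" "g2 v \<in> carrier R" using fF(1)[OF v] g2F(1)[OF v] .
      have "f v \<ominus> g (d i v) = ((f v \<ominus> g2 v \<otimes> y) \<ominus> g (d i v)) \<oplus> g2 v \<otimes> y"
        using carr gR y by algebra
      also have "\<dots> \<in> add_gen R J y" using jy(3)[OF _ g2y[OF v]] g(2)[OF v] Jy(2) by blast
      finally show ?thesis .
    qed
    then show ?thesis using g(1) Suc by auto
  qed
qed

text \<open>Vanishing of Hom(k, R/J) provides a nonzerodivisor on R/J in \<open>\<mm>\<close>, and
  passing to the next quotient costs one degree of vanishing. So \<open>r\<close> degrees yield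
  \<open>r\<close> entries.\<close>

lemma regular_seq_of_Ext_vanish:
  assumes "\<And>q. q < r \<Longrightarrow> Ext_quot_vanish {\<zero>} q"
  shows "\<exists>xs. length xs = r \<and> regular_seq R xs \<and> set xs \<subseteq> \<mm>"
proof -
  have "\<exists>xs. length xs = j \<and> regular_seq R xs \<and> set xs \<subseteq> \<mm> \<and> (\<forall>q<r - j. Ext_quot_vanish (Idl (set xs)) q)"
    if "j \<le> r" for j
    using that
  proof (induction j)
    case 0
    have "Idl {} = {\<zero>}"
      using genideal_minimal[OF zeroideal, of "{}"] ideal_closed(2)[OF genideal_ideal[of "{}"]] by auto
    then show ?case using assms by (intro exI[of _ "[]"]) (simp add: regular_seq_def)
  next
    case (Suc j)
    then obtain xs where xs: "length xs = j" "regular_seq R xs" "set xs \<subseteq> \<mm>"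
      and van: "\<And>q. q < r - j \<Longrightarrow> Ext_quot_vanish (Idl (set xs)) q" by auto
    have xR: "set xs \<subseteq> carrier R" using xs(3) ideal_closed(1)[OF m.is_ideal] by blast
    note J = genideal_ideal[OF xR]
    have "\<exists>y\<in>\<mm>. \<forall>a\<in>carrier R. y \<otimes> a \<in> Idl (set xs) \<longrightarrow> a \<in> Idl (set xs)"
    proof (rule exists_nonzerodivisor[OF J m.is_ideal])
      fix c assume c: "c \<in> carrier R" "\<And>a. a \<in> \<mm> \<Longrightarrow> a \<otimes> c \<in> Idl (set xs)"
      note cr = functional[OF crd0_hom]
      \<comment> \<open>If \<open>\<mm>\<close> carries \<open>c\<close> into \<open>J\<close>, this
        functional is a cocycle modulo \<open>J\<close> in degree 0, because \<open>d 0\<close> has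
        coordinates in \<open>\<mm>\<close>. Its value at \<open>b0\<close> is
        \<open>c\<close>.\<close>
      have f: "(\<lambda>v. crd0 v \<otimes> c) \<in> module_homs R (F 0) (ring_as_module R)"
        by (rule functionalI) (use cr c(1) in \<open>auto simp: l_distr m_assoc\<close>)
      have "crd0 (d 0 y) \<otimes> c \<in> Idl (set xs)" if "y \<in> carrier (F (Suc 0))" for y
        using c(2) mF0_crd d_mF[OF that] mF_mem(1) by blast
      moreover have "Ext_quot_vanish (Idl (set xs)) 0" using van[of 0] Suc.prems by simp
      ultimately have "\<forall>v\<in>carrier (F 0). crd0 v \<otimes> c \<in> Idl (set xs)"
        using f unfolding Ext_quot_vanish_def by auto
      then show "c \<in> Idl (set xs)" using b0(1,2) c(1) by force
    qed
    then obtain y where y: "y \<in> \<mm>" "\<And>a. a \<in> carrier R \<Longrightarrow> y \<otimes> a \<in> Idl (set xs) \<Longrightarrow> a \<in> Idl (set xs)" by blast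
    have yR: "y \<in> carrier R" using y(1) ideal_closed(1)[OF m.is_ideal] by blast
    have eq: "Idl (set (xs @ [y])) = add_gen R (Idl (set xs)) y" using genideal_insert[OF xR yR] by simp
    show ?case
    proof (intro exI[of _ "xs @ [y]"] conjI allI impI)
      show "regular_seq R (xs @ [y])" by (rule regular_seq_snoc[OF is_cring xs(2) yR y(2)])
      show "Ext_quot_vanish (Idl (set (xs @ [y]))) q" if "q < r - Suc j" for q
        unfolding eq by (rule Ext_quot_vanish_step[OF J yR y(2)]) (use van that in auto)
    qed (use xs y in auto)
  qed
  from this[of r] show ?thesis by auto
qed

end

lemma (in resolution_pair) regular_of_finite_injective_dimension:
  assumes fin: "\<And>j. j > D \<Longrightarrow> carrier (I j) = {\<zero>\<^bsub>I j\<^esub>}" and ess: "essential_cocycle N p \<psi>"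
  shows "regular_local_ring R"
proof -
  let ?r = "embedding_dim R"
  have "\<exists>xs. length xs = ?r \<and> regular_seq R xs \<and> set xs \<subseteq> \<mm>"
  proof (rule regular_seq_of_Ext_vanish)
    fix q assume q: "q < ?r"
    then have r: "0 < ?r" by simp
    note ex = dual_exact[where D = D, OF _ ess r]
    show "Ext_quot_vanish {\<zero>} q"
      unfolding Ext_quot_vanish_def
    proof (intro ballI impI)
      fix f assume f: "f \<in> module_homs R (F q) (ring_as_module R)" "\<forall>y\<in>carrier (F (Suc q)). f (d q y) \<in> {\<zero>}"
      show "case q of 0 \<Rightarrow> \<forall>v\<in>carrier (F 0). f v \<in> {\<zero>}
        | Suc i \<Rightarrow> \<exists>g\<in>module_homs R (F i) (ring_as_module R). \<forall>v\<in>carrier (F (Suc i)). f v \<ominus> g (d i v) \<in> {\<zero>}"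
      proof (cases q)
        case 0
        have "f v = \<zero>" if "v \<in> carrier (F 0)" for v
          by (rule ex(1)[OF _ _ _ that]) (use f 0 fin in auto)
        then show ?thesis using 0 by simp
      next
        case (Suc i)
        have "\<exists>g\<in>module_homs R (F i) (ring_as_module R). \<forall>v\<in>carrier (F (Suc i)). f v = g (d i v)"
          by (rule ex(2)) (use f q Suc fin in auto)
        then obtain g where g: "g \<in> module_homs R (F i) (ring_as_module R)" "\<forall>v\<in>carrier (F (Suc i)). f v = g (d i v)"
          by blast
        have "f v \<ominus> g (d i v) = \<zero>" if v: "v \<in> carrier (F (Suc i))" for v
          using g(2) v functional(1)[OF g(1) module_homsD(1)[OF d_hom v]] by (simp add: a_minus_def r_neg)
        then show ?thesis using g(1) Suc by auto
      qed
    qed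
  qed
  then obtain xs where xs: "length xs = ?r" "regular_seq R xs" "set xs \<subseteq> \<mm>" by blast
  then show ?thesis
    using prime_chain_of_regular_seq[OF xs(2) m_prime xs(3)]
      regular_local_ring_iff_prime_chain[OF noetherian_ring_axioms local_ring] by auto
qed

lemma direct_sum_projection:
  assumes M: "module R M" and Ns: "submodule N R M" and Cs: "submodule C R M" and NC: "N \<inter> C \<subseteq> {\<zero>\<^bsub>M\<^esub>}"
  shows "\<exists>p\<in>module_homs R (restr M (N <+>\<^bsub>M\<^esub> C)) (restr M N). (\<forall>x\<in>N. p x = x) \<and> (\<forall>x\<in>C. p x = \<zero>\<^bsub>M\<^esub>)"
proof -
  interpret M: module R M by (rule M)
  note n = M.submodule_mem[OF Ns] and c = M.submodule_mem[OF Cs]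
  have dec: "\<exists>y\<in>N. \<exists>z\<in>C. x = y \<oplus>\<^bsub>M\<^esub> z" if "x \<in> N <+>\<^bsub>M\<^esub> C" for x
    using that unfolding set_add_def' by auto
  define p where "p x = (SOME y. y \<in> N \<and> (\<exists>z\<in>C. x = y \<oplus>\<^bsub>M\<^esub> z))" for x
  have p: "p (y \<oplus>\<^bsub>M\<^esub> z) = y" if yz: "y \<in> N" "z \<in> C" for y z
  proof -
    let ?P = "\<lambda>y'. y' \<in> N \<and> (\<exists>z'\<in>C. y \<oplus>\<^bsub>M\<^esub> z = y' \<oplus>\<^bsub>M\<^esub> z')"
    have "?P (p (y \<oplus>\<^bsub>M\<^esub> z))" unfolding p_def by (rule someI[of ?P y]) (use yz in blast)
    then obtain z' where y': "p (y \<oplus>\<^bsub>M\<^esub> z) \<in> N" "z' \<in> C" "y \<oplus>\<^bsub>M\<^esub> z = p (y \<oplus>\<^bsub>M\<^esub> z) \<oplus>\<^bsub>M\<^esub> z'" by blast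
    define y' where "y' = p (y \<oplus>\<^bsub>M\<^esub> z)"
    have carr: "y \<in> carrier M" "z \<in> carrier M" "y' \<in> carrier M" "z' \<in> carrier M"
      using yz y' n(1) c(1) by (auto simp: y'_def)
    have eq: "y \<oplus>\<^bsub>M\<^esub> z = y' \<oplus>\<^bsub>M\<^esub> z'" using y'(3) by (simp add: y'_def)
    have "y \<ominus>\<^bsub>M\<^esub> y' = (y \<oplus>\<^bsub>M\<^esub> z) \<ominus>\<^bsub>M\<^esub> (y' \<oplus>\<^bsub>M\<^esub> z)"
      using carr by (simp add: a_minus_def M.minus_add M.M.a_ac M.M.r_neg M.M.r_neg1 M.M.r_neg2)
    also have "\<dots> = z' \<ominus>\<^bsub>M\<^esub> z"
    proof -
      have "(y \<oplus>\<^bsub>M\<^esub> z) \<ominus>\<^bsub>M\<^esub> (y' \<oplus>\<^bsub>M\<^esub> z) = z' \<oplus>\<^bsub>M\<^esub> (y' \<oplus>\<^bsub>M\<^esub> (\<ominus>\<^bsub>M\<^esub> y' \<oplus>\<^bsub>M\<^esub> \<ominus>\<^bsub>M\<^esub> z))"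
        unfolding eq using carr by (simp add: a_minus_def M.minus_add M.M.a_ac)
      then show ?thesis using carr by (simp add: a_minus_def M.M.r_neg2)
    qed
    finally have "y \<ominus>\<^bsub>M\<^esub> y' \<in> N \<inter> C"
      using n(5)[OF yz(1), of y'] c(5)[OF y'(2) yz(2)] y'(1) by (simp add: y'_def)
    then show ?thesis using NC M.diff_eq_zero[OF carr(1,3)] by (auto simp: y'_def)
  qed
  have "p \<in> module_homs R (restr M (N <+>\<^bsub>M\<^esub> C)) (restr M N)"
  proof (rule module_homsI)
    fix x assume "x \<in> carrier (restr M (N <+>\<^bsub>M\<^esub> C))"
    then have "x \<in> N <+>\<^bsub>M\<^esub> C" by simp
    then obtain y z where x: "y \<in> N" "z \<in> C" "x = y \<oplus>\<^bsub>M\<^esub> z" using dec by blast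
    show "p x \<in> carrier (restr M N)" using p[OF x(1,2)] x by simp
    show "p (x \<oplus>\<^bsub>restr M (N <+>\<^bsub>M\<^esub> C)\<^esub> x') = p x \<oplus>\<^bsub>restr M N\<^esub> p x'"
      if "x' \<in> carrier (restr M (N <+>\<^bsub>M\<^esub> C))" for x'
    proof -
      have "x' \<in> N <+>\<^bsub>M\<^esub> C" using \<open>x' \<in> carrier (restr M (N <+>\<^bsub>M\<^esub> C))\<close> by simp
      then obtain y' z' where x': "y' \<in> N" "z' \<in> C" "x' = y' \<oplus>\<^bsub>M\<^esub> z'" using dec by blast
      have "x \<oplus>\<^bsub>M\<^esub> x' = (y \<oplus>\<^bsub>M\<^esub> y') \<oplus>\<^bsub>M\<^esub> (z \<oplus>\<^bsub>M\<^esub> z')"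
        unfolding x(3) x'(3) using x x' n(1) c(1) by (simp add: M.M.a_ac)
      then show ?thesis using p[OF n(3)[OF x(1) x'(1)] c(3)[OF x(2) x'(2)]] p[OF x(1,2)] p[OF x'(1,2)] x(3) x'(3) by simp
    qed
    show "p (a \<odot>\<^bsub>restr M (N <+>\<^bsub>M\<^esub> C)\<^esub> x) = a \<odot>\<^bsub>restr M N\<^esub> p x" if a: "a \<in> carrier R" for a
    proof -
      have "a \<odot>\<^bsub>M\<^esub> x = a \<odot>\<^bsub>M\<^esub> y \<oplus>\<^bsub>M\<^esub> a \<odot>\<^bsub>M\<^esub> z"
        unfolding x(3) using x a n(1) c(1) by (simp add: M.smult_r_distr)
      then show ?thesis using p[OF n(6)[OF a x(1)] c(6)[OF a x(2)]] p[OF x(1,2)] x(3) by simp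
    qed
  qed
  moreover have "p x = x" if "x \<in> N" for x using p[OF that c(2)] n(1)[OF that] by simp
  moreover have "p x = \<zero>\<^bsub>M\<^esub>" if "x \<in> C" for x using p[OF n(2) that] c(1)[OF that] by simp
  ultimately show ?thesis by blast
qed

lemma direct_summand_projection:
  assumes M: "module R M" and N: "direct_summand R M N"
  shows "submodule N R M \<and> (\<exists>p\<in>module_homs R M (restr M N). \<forall>x\<in>N. p x = x)"
proof -
  obtain C where *: "submodule N R M" "submodule C R M" "N \<inter> C = {\<zero>\<^bsub>M\<^esub>}" "N <+>\<^bsub>M\<^esub> C = carrier M"
    using N by (auto simp: direct_summand_def)
  then show ?thesis using direct_sum_projection[OF M *(1,2)] by auto
qed

lemma (in min_resolution) regular_of_summand:
  assumes N: "direct_summand R (syzygy k F d n) N" and nz: "N \<noteq> {\<zero>\<^bsub>syzygy k F d n\<^esub>}"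
    and fin: "inj_dim R ((syzygy k F d n)\<lparr>carrier := N\<rparr>) < \<infinity>"
  shows "regular_local_ring R"
proof -
  let ?S = "syzygy k F d n"
  have S: "module R ?S" "\<partial> n \<in> module_homs R (F n) ?S" "\<partial> n ` carrier (F n) = carrier ?S" "\<zero>\<^bsub>?S\<^esub> = \<zero>\<^bsub>W n\<^esub>"
  proof -
    have im: "submodule (d i ` carrier (F (Suc i))) R (F i)" for i
      by (rule submodule_image[OF modF modF d_hom module.carrier_is_submodule[OF modF]])
    show "module R ?S" using modk module_restr[OF modF im] by (cases n) auto
    show "\<partial> n \<in> module_homs R (F n) ?S"
      using bdry_hom[of 0] module_homs_corestr[OF d_hom] by (cases n) auto
    show "\<partial> n ` carrier (F n) = carrier ?S" using e_onto by (cases n) auto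
    show "\<zero>\<^bsub>?S\<^esub> = \<zero>\<^bsub>W n\<^esub>" by (cases n) auto
  qed
  obtain p where Ns: "submodule N R ?S" and p: "p \<in> module_homs R ?S (restr ?S N)" "\<And>x. x \<in> N \<Longrightarrow> p x = x"
    using direct_summand_projection[OF S(1) N] by blast
  have modN: "module R (restr ?S N)" by (rule module_restr[OF S(1) Ns])
  have p0: "p \<zero>\<^bsub>?S\<^esub> = \<zero>\<^bsub>?S\<^esub>" using module_homs_zero[OF S(1) modN p(1)] by simp
  have ess: "essential_cocycle (restr ?S N) n (\<lambda>x. p (\<partial> n x))"
  proof (rule essential_cocycle_onto[OF modN module_homs_comp[OF S(2) p(1)]])
    show "p (\<partial> n (d n y)) = \<zero>\<^bsub>restr ?S N\<^esub>" if "y \<in> carrier (F (Suc n))" for y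
      using bdry_d[OF that] S(4) p0 by simp
    have "(\<lambda>x. p (\<partial> n x)) ` carrier (F n) = p ` carrier ?S" using S(3) by (simp add: image_image[symmetric])
    also have "\<dots> = N"
    proof
      show "p ` carrier ?S \<subseteq> N" using module_homsD(1)[OF p(1)] by auto
      show "N \<subseteq> p ` carrier ?S" using p(2) module.submodule_mem(1)[OF S(1) Ns] by (metis image_eqI subsetI)
    qed
    finally show "(\<lambda>x. p (\<partial> n x)) ` carrier (F n) = carrier (restr ?S N)" by simp
    show "carrier (restr ?S N) \<noteq> {\<zero>\<^bsub>restr ?S N\<^esub>}" using nz by simp
  qed
  \<comment> \<open>The infimum of the empty set is \<infinity>, so finite injective dimension
    provides a resolution that ends.\<close>
  obtain D and I :: "nat \<Rightarrow> ('a, ('a, 'm) inj_carrier) module" and h \<delta> where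
    res: "injective_resolution R (restr ?S N) I h \<delta>" and D: "\<And>j. j > D \<Longrightarrow> carrier (I j) = {\<zero>\<^bsub>I j\<^esub>}"
  proof -
    have "{enat n | n. \<exists>(I :: nat \<Rightarrow> ('a, ('a, 'm) inj_carrier) module) h d.
            injective_resolution R (restr ?S N) I h d \<and> (\<forall>j>n. carrier (I j) = {\<zero>\<^bsub>I j\<^esub>})} \<noteq> {}"
      (is "?E \<noteq> {}")
    proof
      assume E: "?E = {}"
      have "inj_dim R (restr ?S N) = Inf {}" unfolding inj_dim_def by (simp only: E)
      then show False using fin by (simp add: top_enat_def)
    qed
    then show ?thesis using that by blast
  qed
  interpret resolution_pair R \<mm> k F e d u "restr ?S N" I h \<delta>
    by unfold_locales (rule res)
  show ?thesis by (rule regular_of_finite_injective_dimension[OF D ess])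
qed

section \<open>Finiteness of the resolution over a regular local ring\<close>

context min_resolution
begin

text \<open>J times \<open>F q\<close>, described by coordinates so that a nonzerodivisor modulo
  \<open>J\<close> can be cancelled coordinatewise.\<close>

definition idF :: "'a set \<Rightarrow> nat \<Rightarrow> 'm set" where
  "idF J q = {x \<in> carrier (F q). \<forall>b\<in>bas q. crd q b x \<in> J}"

lemma idF_submodule:
  assumes J: "ideal J R"
  shows "submodule (idF J q) R (F q)"
proof (rule module.submodule_intro[OF modF])
  interpret F: module R "F q" by (rule modF)
  note j = ideal_closed[OF J] and c = functional[OF crd_hom]
  show "idF J q \<subseteq> carrier (F q)" by (auto simp: idF_def)
  show "\<zero>\<^bsub>F q\<^esub> \<in> idF J q" using c(4) j(2) by (auto simp: idF_def)
  show "x \<oplus>\<^bsub>F q\<^esub> y \<in> idF J q" if "x \<in> idF J q" "y \<in> idF J q" for x y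
    using that c(2) j(3) by (auto simp: idF_def)
  show "a \<odot>\<^bsub>F q\<^esub> x \<in> idF J q" if "a \<in> carrier R" "x \<in> idF J q" for a x
    using that c(3) j(6) by (auto simp: idF_def)
qed

lemma hom_idF:
  assumes J: "ideal J R" and f: "f \<in> module_homs R (F q) (F p)" and x: "x \<in> idF J q"
  shows "f x \<in> idF J p"
proof -
  have xF: "x \<in> carrier (F q)" using x by (simp add: idF_def)
  have "crd p b (f x) \<in> J" if b: "b \<in> bas p" for b
  proof -
    have fb: "(\<lambda>v. crd p b (f v)) \<in> module_homs R (F q) (ring_as_module R)"
      by (rule module_homs_comp[OF f crd_hom[OF b]])
    have "crd p b (f x) = (\<Oplus>b'\<in>bas q. crd q b' x \<otimes> crd p b (f b'))"
      using dual_basis_expand[OF basis modF modA fb xF] by simp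
    also have "\<dots> \<in> J"
      by (rule finsum_in_ideal[OF J bas(1)])
        (use x functional(1)[OF fb bas(2)] in \<open>auto simp: idF_def intro: ideal_closed(7)[OF J]\<close>)
    finally show ?thesis .
  qed
  then show ?thesis using module_homsD(1)[OF f xF] by (simp add: idF_def)
qed

lemma idF_nzd:
  assumes J: "ideal J R" and y: "y \<in> carrier R"
    and nzd: "\<And>a. a \<in> carrier R \<Longrightarrow> y \<otimes> a \<in> J \<Longrightarrow> a \<in> J"
    and x: "x \<in> carrier (F q)" "y \<odot>\<^bsub>F q\<^esub> x \<in> idF J q"
  shows "x \<in> idF J q"
  using x nzd functional(1,3)[OF crd_hom] y by (auto simp: idF_def)

lemma idF_add_gen:
  assumes J: "ideal J R" and y: "y \<in> carrier R" and x: "x \<in> idF (add_gen R J y) q"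
  shows "\<exists>w\<in>idF J q. \<exists>z\<in>carrier (F q). x = w \<oplus>\<^bsub>F q\<^esub> y \<odot>\<^bsub>F q\<^esub> z"
proof -
  interpret F: module R "F q" by (rule modF)
  have xF: "x \<in> carrier (F q)" using x by (simp add: idF_def)
  have "\<forall>b\<in>bas q. \<exists>c\<in>carrier R. \<exists>w\<in>J. crd q b x = w \<oplus> c \<otimes> y"
    using x by (auto simp: idF_def add_gen_def) blast
  then obtain c where c: "\<And>b. b \<in> bas q \<Longrightarrow> c b \<in> carrier R"
    "\<And>b. b \<in> bas q \<Longrightarrow> \<exists>w\<in>J. crd q b x = w \<oplus> c b \<otimes> y" by metis
  define z where "z = (\<Oplus>\<^bsub>F q\<^esub>b\<in>bas q. c b \<odot>\<^bsub>F q\<^esub> b)"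
  have zF: "z \<in> carrier (F q)" unfolding z_def by (rule F.finsum_closed) (use c(1) bas(2) in auto)
  have crz: "crd q b z = c b" if b: "b \<in> bas q" for b
  proof -
    note cr = functional[OF crd_hom[OF b]]
    have "crd q b z = (\<Oplus>\<^bsub>ring_as_module R\<^esub>b'\<in>bas q. crd q b (c b' \<odot>\<^bsub>F q\<^esub> b'))"
      unfolding z_def by (rule module_homs_finsum_apply[OF modF modA crd_hom[OF b] bas(1)]) (use c(1) bas(2) in auto)
    also have "\<dots> = (\<Oplus>b'\<in>bas q. if b = b' then c b' else \<zero>)"
      unfolding finsum_ring_as_module
      by (rule finsum_cong') (use c(1) cr(3) bas(2) crd_delta b in auto)
    also have "\<dots> = c b" by (rule add.finprod_singleton[OF b bas(1)]) (use c(1) in auto)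
    finally show ?thesis .
  qed
  have yz: "y \<odot>\<^bsub>F q\<^esub> z \<in> carrier (F q)" using y zF by simp
  have "x \<ominus>\<^bsub>F q\<^esub> y \<odot>\<^bsub>F q\<^esub> z \<in> idF J q"
    unfolding idF_def
  proof (intro CollectI conjI ballI)
    show "x \<ominus>\<^bsub>F q\<^esub> y \<odot>\<^bsub>F q\<^esub> z \<in> carrier (F q)" using xF yz by simp
    fix b assume b: "b \<in> bas q"
    note cr = functional[OF crd_hom[OF b]]
    obtain w where w: "w \<in> J" "crd q b x = w \<oplus> c b \<otimes> y" using c(2)[OF b] by blast
    have nyz: "\<ominus>\<^bsub>F q\<^esub> (y \<odot>\<^bsub>F q\<^esub> z) = (\<ominus> y) \<odot>\<^bsub>F q\<^esub> z" using F.smult_l_minus[OF y zF] by simp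
    have "crd q b (x \<ominus>\<^bsub>F q\<^esub> y \<odot>\<^bsub>F q\<^esub> z) = (w \<oplus> c b \<otimes> y) \<oplus> (\<ominus> y) \<otimes> c b"
      unfolding a_minus_def nyz using cr(2)[OF xF, of "(\<ominus> y) \<odot>\<^bsub>F q\<^esub> z"] cr(3)[of "\<ominus> y" z] y zF w(2) crz[OF b] by simp
    also have "\<dots> = w"
    proof -
      have "w \<in> carrier R" using ideal_closed(1)[OF J w(1)] .
      then show ?thesis using y c(1)[OF b] by algebra
    qed
    finally show "crd q b (x \<ominus>\<^bsub>F q\<^esub> y \<odot>\<^bsub>F q\<^esub> z) \<in> J" using w(1) by simp
  qed
  moreover have "x = (x \<ominus>\<^bsub>F q\<^esub> y \<odot>\<^bsub>F q\<^esub> z) \<oplus>\<^bsub>F q\<^esub> y \<odot>\<^bsub>F q\<^esub> z"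
    using F.diff_add_cancel[OF xF yz] by simp
  ultimately show ?thesis using zF by blast
qed

text \<open>\<open>Tor\<^sub>i(k, R/(x\<^sub>1, \<dots>, x\<^sub>j)) = 0\<close> for \<open>i > j\<close> and a regular sequence \<open>x\<^sub>1, \<dots>, x\<^sub>n\<close>.\<close>

lemma Tor_regular_seq:
  assumes xs: "regular_seq R xs" and j: "j \<le> length xs" "j \<le> i" and z: "z \<in> carrier (F (Suc i))"
    and dz: "d i z \<in> idF (Idl (set (take j xs))) i"
  shows "\<exists>y\<in>carrier (F (Suc (Suc i))). z \<ominus>\<^bsub>F (Suc i)\<^esub> d (Suc i) y \<in> idF (Idl (set (take j xs))) (Suc i)"
  using j z dz
proof (induction j arbitrary: i z)
  case 0
  interpret F: module R "F (Suc i)" by (rule modF)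
  have "Idl {} = {\<zero>}"
    using genideal_minimal[OF zeroideal, of "{}"] ideal_closed(2)[OF genideal_ideal[of "{}"]] by auto
  then have J0: "Idl (set (take 0 xs)) = {\<zero>}" by simp
  interpret F': module R "F i" by (rule modF)
  have dzF: "d i z \<in> carrier (F i)" using module_homsD(1)[OF d_hom 0(3)] .
  have "(\<Oplus>\<^bsub>F i\<^esub>b\<in>bas i. crd i b (d i z) \<odot>\<^bsub>F i\<^esub> b) = (\<Oplus>\<^bsub>F i\<^esub>b\<in>bas i. \<zero>\<^bsub>F i\<^esub>)"
    by (rule F'.finsum_cong') (use 0(4) bas(2) J0 in \<open>auto simp: idF_def\<close>)
  then have "d i z = \<zero>\<^bsub>F i\<^esub>" using expand[OF dzF] by simp
  then obtain y where y: "y \<in> carrier (F (Suc (Suc i)))" "z = d (Suc i) y" using exact[of z "Suc i"] 0(3) by auto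
  then have "z \<ominus>\<^bsub>F (Suc i)\<^esub> d (Suc i) y = \<zero>\<^bsub>F (Suc i)\<^esub>" using F.diff_self[OF 0(3)] by simp
  then show ?case using y(1) module.submodule_mem(2)[OF modF idF_submodule[OF zeroideal]] J0 by (intro bexI[of _ y]) auto
next
  case (Suc j)
  have xR: "set xs \<subseteq> carrier R" using xs by (simp add: regular_seq_def)
  then have tR: "set (take j xs) \<subseteq> carrier R" using set_take_subset by fastforce
  let ?J = "Idl (set (take j xs))" and ?x = "xs ! j"
  have x: "?x \<in> carrier R" using xR Suc.prems(1) by auto
  note J = genideal_ideal[OF tR]
  have eq: "Idl (set (take (Suc j) xs)) = add_gen R ?J ?x"
    using genideal_insert[OF tR x] Suc.prems(1) by (simp add: take_Suc_conv_app_nth)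
  note Jx = add_gen[OF J x]
  have nzd: "a \<in> ?J" if "a \<in> carrier R" "?x \<otimes> a \<in> ?J" for a
    using xs that Suc.prems(1) unfolding regular_seq_def by auto
  obtain i' where i: "i = Suc i'" using Suc.prems(2) by (cases i) auto
  interpret F0: module R "F i'" by (rule modF)
  interpret F1: module R "F i" by (rule modF)
  interpret F2: module R "F (Suc i)" by (rule modF)
  note s0 = F0.submodule_mem[OF idF_submodule[OF J]] and s1 = F1.submodule_mem[OF idF_submodule[OF J]]
    and s2 = F2.submodule_mem[OF idF_submodule[OF Jx(1)]]
  obtain w y where wy: "w \<in> idF ?J i" "y \<in> carrier (F i)" "d i z = w \<oplus>\<^bsub>F i\<^esub> ?x \<odot>\<^bsub>F i\<^esub> y"
    using idF_add_gen[OF J x Suc.prems(4)[unfolded eq]] by blast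
  have wF: "w \<in> carrier (F i)" using s1(1)[OF wy(1)] .
  have xy: "?x \<odot>\<^bsub>F i\<^esub> y \<in> carrier (F i)" using x wy(2) by simp
  have dhom: "d i' \<in> module_homs R (F i) (F i')" using d_hom[of i'] i by simp
  note D = module_homsD[OF dhom]
  \<comment> \<open>Another differential applied to w + x y gives zero, so x d y vanishes modulo the
    smaller ideal, and x cancels. The induction one degree lower then makes \<open>y\<close> a
    boundary modulo that ideal.\<close>
  have "?x \<odot>\<^bsub>F i'\<^esub> d i' y \<oplus>\<^bsub>F i'\<^esub> d i' w = d i' (d i z)"
    unfolding wy(3) D(2)[OF wF xy] D(3)[OF x wy(2)] using D(1)[OF wF] x D(1)[OF wy(2)] by (simp add: F0.M.a_comm)
  also have "\<dots> = \<zero>\<^bsub>F i'\<^esub>" using dd[of z i'] Suc.prems(3) i by simp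
  finally have "?x \<odot>\<^bsub>F i'\<^esub> d i' y \<oplus>\<^bsub>F i'\<^esub> d i' w \<in> idF ?J i'" using s0(2) by simp
  then have "?x \<odot>\<^bsub>F i'\<^esub> d i' y \<in> idF ?J i'"
    using F0.diff_submodule_cancel[OF idF_submodule[OF J], of "?x \<odot>\<^bsub>F i'\<^esub> d i' y" "d i' w"] hom_idF[OF J dhom wy(1)]
      x D(1)[OF wy(2)] by simp
  then have "d i' y \<in> idF ?J i'"
    by (intro idF_nzd[OF J x _ D(1)[OF wy(2)]]) (rule nzd)
  then obtain y' where y': "y' \<in> carrier (F (Suc i))" "y \<ominus>\<^bsub>F i\<^esub> d i y' \<in> idF ?J i"
    using Suc.IH[of i' y] Suc.prems(1,2) wy(2) i by auto
  have dy': "d i y' \<in> carrier (F i)" using module_homsD(1)[OF d_hom y'(1)] .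
  have xy': "?x \<odot>\<^bsub>F (Suc i)\<^esub> y' \<in> carrier (F (Suc i))" using x y'(1) by simp
  \<comment> \<open>Corrected by x y', the element \<open>z\<close> becomes a cycle modulo the
    smaller ideal, to which the induction applies in the original degree. The correction is a
    multiple of x and so vanishes modulo the larger ideal.\<close>
  have "d i (z \<ominus>\<^bsub>F (Suc i)\<^esub> ?x \<odot>\<^bsub>F (Suc i)\<^esub> y') = d i z \<ominus>\<^bsub>F i\<^esub> ?x \<odot>\<^bsub>F i\<^esub> d i y'"
    using module_homs_minus[OF modF modF d_hom Suc.prems(3) xy'] module_homsD(3)[OF d_hom x y'(1)] by simp
  also have "\<dots> = w \<oplus>\<^bsub>F i\<^esub> ?x \<odot>\<^bsub>F i\<^esub> (y \<ominus>\<^bsub>F i\<^esub> d i y')"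
    unfolding wy(3) F1.smult_diff_r[OF x wy(2) dy'] using wF xy x dy' by (simp add: a_minus_def F1.M.a_assoc)
  also have "\<dots> \<in> idF ?J i" by (intro s1(3,6) wy(1) y'(2) x)
  finally obtain y2 where y2: "y2 \<in> carrier (F (Suc (Suc i)))"
    "(z \<ominus>\<^bsub>F (Suc i)\<^esub> ?x \<odot>\<^bsub>F (Suc i)\<^esub> y') \<ominus>\<^bsub>F (Suc i)\<^esub> d (Suc i) y2 \<in> idF ?J (Suc i)"
    using Suc.IH[of i "z \<ominus>\<^bsub>F (Suc i)\<^esub> ?x \<odot>\<^bsub>F (Suc i)\<^esub> y'"] Suc.prems(1-3) xy' by auto
  have dy2: "d (Suc i) y2 \<in> carrier (F (Suc i))" using module_homsD(1)[OF d_hom y2(1)] .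
  have "z \<ominus>\<^bsub>F (Suc i)\<^esub> d (Suc i) y2 =
    ((z \<ominus>\<^bsub>F (Suc i)\<^esub> ?x \<odot>\<^bsub>F (Suc i)\<^esub> y') \<ominus>\<^bsub>F (Suc i)\<^esub> d (Suc i) y2) \<oplus>\<^bsub>F (Suc i)\<^esub> ?x \<odot>\<^bsub>F (Suc i)\<^esub> y'"
  proof -
    have "(z \<ominus>\<^bsub>F (Suc i)\<^esub> ?x \<odot>\<^bsub>F (Suc i)\<^esub> y') \<ominus>\<^bsub>F (Suc i)\<^esub> d (Suc i) y2 =
      (z \<ominus>\<^bsub>F (Suc i)\<^esub> d (Suc i) y2) \<ominus>\<^bsub>F (Suc i)\<^esub> ?x \<odot>\<^bsub>F (Suc i)\<^esub> y'"
      using Suc.prems(3) xy' dy2 by (simp add: a_minus_def F2.M.a_ac)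
    then show ?thesis
      using F2.diff_add_cancel[OF F2.diff_closed[OF Suc.prems(3) dy2] xy'] by simp
  qed
  also have "\<dots> \<in> idF (add_gen R ?J ?x) (Suc i)"
  proof (rule s2(3))
    show "(z \<ominus>\<^bsub>F (Suc i)\<^esub> ?x \<odot>\<^bsub>F (Suc i)\<^esub> y') \<ominus>\<^bsub>F (Suc i)\<^esub> d (Suc i) y2 \<in> idF (add_gen R ?J ?x) (Suc i)"
      using y2(2) Jx(2) by (auto simp: idF_def)
    show "?x \<odot>\<^bsub>F (Suc i)\<^esub> y' \<in> idF (add_gen R ?J ?x) (Suc i)"
      using xy' functional(1,3)[OF crd_hom] y'(1) x ideal_closed(7)[OF Jx(1) Jx(3)] by (auto simp: idF_def)
  qed
  finally show ?case using y2(1) eq by auto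
qed

text \<open>Modulo \<open>\<mm>\<close> all differentials vanish, so every \<open>z\<close> is a
  cycle; the vanishing of Tor makes it a boundary and hence zero modulo \<open>\<mm>\<close>. A
  basis element cannot be zero there, as its own coordinate is 1.\<close>

lemma resolution_finite:
  assumes xs: "regular_seq R xs" "Idl (set xs) = \<mm>" and i: "length xs < i"
  shows "carrier (F i) = {\<zero>\<^bsub>F i\<^esub>}"
proof -
  obtain i' where i': "i = Suc i'" "length xs \<le> i'" using i by (cases i) auto
  interpret F: module R "F i" by (rule modF)
  have m: "x \<in> idF \<mm> q \<longleftrightarrow> x \<in> mF q" for x q using mF_iff[of x q] mF_mem(1) by (auto simp: idF_def)
  have all: "z \<in> mF i" if z: "z \<in> carrier (F i)" for z
  proof -
    have "d i' z \<in> idF (Idl (set (take (length xs) xs))) i'" using d_mF[of z i'] z i'(1) m xs(2) by simp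
    then obtain y where y: "y \<in> carrier (F (Suc i))" "z \<ominus>\<^bsub>F i\<^esub> d i y \<in> mF i"
      using Tor_regular_seq[OF xs(1) order_refl i'(2), of z] z i'(1) m xs(2) by auto
    have "z = (z \<ominus>\<^bsub>F i\<^esub> d i y) \<oplus>\<^bsub>F i\<^esub> d i y"
      using F.diff_add_cancel[OF z module_homsD(1)[OF d_hom y(1)]] by simp
    then show ?thesis using mF_mem(3)[OF y(2) d_mF[OF y(1)]] by simp
  qed
  have "bas i = {}"
  proof (rule ccontr)
    assume "bas i \<noteq> {}"
    then obtain b where b: "b \<in> bas i" by blast
    then have "crd i b b \<in> \<mm>" using all[OF bas(2)[OF b]] mF_iff[OF bas(2)[OF b]] by blast
    then show False using crd_delta[OF b b] one_notin_m by simp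
  qed
  then have "x = \<zero>\<^bsub>F i\<^esub>" if "x \<in> carrier (F i)" for x using expand[OF that] by simp
  then show ?thesis by auto
qed

end

section \<open>Injective modules\<close>

text \<open>An injective homomorphism is an isomorphism onto its image, so inclusions of submodules
  are enough as test maps.\<close>

lemma injective_moduleI:
  fixes E :: "('a, 'e) module"
  assumes E: "module R E"
    and ext: "\<And>(N :: ('a, 'a) module) U f. module R N \<Longrightarrow> submodule U R N \<Longrightarrow>
      f \<in> module_homs R (restr N U) E \<Longrightarrow> \<exists>g\<in>module_homs R N E. \<forall>x\<in>U. g x = f x"
  shows "injective_module R E"
  unfolding injective_module_def
proof (intro conjI E allI impI ballI)
  fix N' N :: "('a, 'a) module" and i f
  assume N': "module R N'" and N: "module R N" and i: "i \<in> module_homs R N' N"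
    and f: "f \<in> module_homs R N' E" and inj: "inj_on i (carrier N')"
  interpret N': module R N' by fact
  have "f x = \<zero>\<^bsub>E\<^esub>" if "x \<in> carrier N'" "i x = \<zero>\<^bsub>N\<^esub>" for x
  proof -
    have "x = \<zero>\<^bsub>N'\<^esub>" using inj that module_homs_zero[OF N' N i] by (auto simp: inj_on_def)
    then show ?thesis using module_homs_zero[OF N' E f] by simp
  qed
  then obtain h where h: "h \<in> module_homs R (restr N (i ` carrier N')) E" "\<And>x. x \<in> carrier N' \<Longrightarrow> h (i x) = f x"
    using factor_through_image[OF N' N i f E] by blast
  show "\<exists>g\<in>module_homs R N E. \<forall>x\<in>carrier N'. g (i x) = f x"
    using ext[OF N submodule_image[OF N' N i N'.carrier_is_submodule] h(1)] h(2) by fastforce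
qed

lemma injective_retract:
  assumes E: "injective_module R E" and H: "module R H" and p: "p \<in> module_homs R E H"
    and i: "i \<in> module_homs R H E" and pi: "\<And>x. x \<in> carrier H \<Longrightarrow> p (i x) = x"
  shows "injective_module R H"
proof (rule injective_moduleI[OF H])
  fix N :: "('a, 'a) module" and U f
  assume N: "module R N" and U: "submodule U R N" and f: "f \<in> module_homs R (restr N U) H"
  obtain g where g: "g \<in> module_homs R N E" "\<And>x. x \<in> U \<Longrightarrow> g x = i (f x)"
    using injective_extend[OF E N U module_homs_comp[OF f i]] by blast
  show "\<exists>g\<in>module_homs R N H. \<forall>x\<in>U. g x = f x"
    using g(2) pi module_homsD(1)[OF f] by (intro bexI[OF _ module_homs_comp[OF g(1) p]]) simp
qed

text \<open>Only the finitely many values at the \<open>p t\<close> matter: each map that takes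
  \<open>x\<close> to \<open>f x (p t)\<close> extends by injectivity of \<open>E\<close>, and the
  dual basis puts the extensions together.\<close>

lemma injective_hom_module:
  assumes P: "dual_basis R P T p \<pi>" "module R P" and E: "injective_module R E"
  shows "injective_module R (hom_module R P E)"
proof (rule injective_moduleI)
  have mE: "module R E" using E by (simp add: injective_module_def)
  interpret E: module R E by (rule mE)
  show mH: "module R (hom_module R P E)" by (rule module_hom_module[OF P(2) mE])
  fix N :: "('a, 'a) module" and U f
  assume N: "module R N" and U: "submodule U R N" and f: "f \<in> module_homs R (restr N U) (hom_module R P E)"
  interpret N: module R N by (rule N)
  have "\<forall>t\<in>T. \<exists>g\<in>module_homs R N E. \<forall>x\<in>U. g x = f x (p t)"
    using injective_extend[OF E N U module_homs_comp[OF f hom_module_eval[OF dual_basis_coord(4)[OF P(1)]]]] by blast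
  then obtain g where g: "\<And>t. t \<in> T \<Longrightarrow> g t \<in> module_homs R N E" "\<And>t x. t \<in> T \<Longrightarrow> x \<in> U \<Longrightarrow> g t x = f x (p t)"
    by metis
  note c = dual_basis_coord[OF P(1)]
  have T: "finite T" using P(1) by (simp add: dual_basis_def)
  define G where "G x = (\<lambda>v\<in>carrier P. \<Oplus>\<^bsub>E\<^esub>t\<in>T. \<pi> t v \<odot>\<^bsub>E\<^esub> g t x)" for x
  have Gc: "G x \<in> carrier (hom_module R P E)" if x: "x \<in> carrier N" for x
    unfolding G_def
    by (rule restrict_hom[OF P(2) dual_basis_hom[OF P(1) mE]]) (use module_homsD(1)[OF g(1) x] in blast)
  have Gv: "(\<lambda>x. \<Oplus>\<^bsub>E\<^esub>t\<in>T. \<pi> t v \<odot>\<^bsub>E\<^esub> g t x) \<in> module_homs R N E" if v: "v \<in> carrier P" for v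
    by (rule homs_finsum[OF mE T homs_smult[OF mE g(1)]]) (use c(1) v in auto)
  have "G \<in> module_homs R N (hom_module R P E)"
    by (rule module_homsI) (use Gc module_homsD[OF Gv] in \<open>auto simp: G_def fun_eq_iff\<close>)
  moreover have "G x = f x" if x: "x \<in> U" for x
  proof (rule hom_module_ext[OF Gc])
    show "x \<in> carrier N" using N.submodule_mem(1)[OF U x] .
    have fx: "f x \<in> carrier (hom_module R P E)" using module_homsD(1)[OF f] x by simp
    then show "f x \<in> carrier (hom_module R P E)" .
    have fh: "f x \<in> module_homs R P E" using fx by simp
    show "G x v = f x v" if v: "v \<in> carrier P" for v
    proof -
      have "G x v = (\<Oplus>\<^bsub>E\<^esub>t\<in>T. \<pi> t v \<odot>\<^bsub>E\<^esub> f x (p t))"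
        unfolding G_def using v x by (auto intro!: E.finsum_cong' simp: g(2) c(1) c(4) module_homsD(1)[OF fh])
      also have "\<dots> = f x v" by (rule dual_basis_expand[OF P mE fh v, symmetric])
      finally show ?thesis .
    qed
  qed
  ultimately show "\<exists>g\<in>module_homs R N (hom_module R P E). \<forall>x\<in>U. g x = f x" by blast
qed

section \<open>Coinduced modules\<close>

definition restrict_scalars :: "('s \<Rightarrow> 'a) \<Rightarrow> ('a, 'm) module \<Rightarrow> ('s, 'm) module" where
  "restrict_scalars \<phi> M = \<lparr>carrier = carrier M, monoid.mult = undefined, one = undefined,
     ring.zero = \<zero>\<^bsub>M\<^esub>, ring.add = ring.add M, module.smult = (\<lambda>s x. \<phi> s \<odot>\<^bsub>M\<^esub> x)\<rparr>"

lemma restrict_scalars_simps [simp]: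
  "carrier (restrict_scalars \<phi> M) = carrier M"
  "\<zero>\<^bsub>restrict_scalars \<phi> M\<^esub> = \<zero>\<^bsub>M\<^esub>"
  "x \<oplus>\<^bsub>restrict_scalars \<phi> M\<^esub> y = x \<oplus>\<^bsub>M\<^esub> y"
  "s \<odot>\<^bsub>restrict_scalars \<phi> M\<^esub> x = \<phi> s \<odot>\<^bsub>M\<^esub> x"
  by (simp_all add: restrict_scalars_def)

lemma abelian_group_cong:
  assumes G: "abelian_group G"
    and eq: "carrier H = carrier G" "\<zero>\<^bsub>H\<^esub> = \<zero>\<^bsub>G\<^esub>" "\<And>x y. x \<oplus>\<^bsub>H\<^esub> y = x \<oplus>\<^bsub>G\<^esub> y"
  shows "abelian_group H"
proof -
  interpret G: abelian_group G by (rule G)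
  show ?thesis
  proof (rule abelian_groupI; unfold eq)
    show "\<exists>y\<in>carrier G. y \<oplus>\<^bsub>G\<^esub> x = \<zero>\<^bsub>G\<^esub>" if "x \<in> carrier G" for x
      using G.l_neg[OF that] that by (intro bexI[of _ "\<ominus>\<^bsub>G\<^esub> x"]) auto
  qed (auto simp: G.a_ac)
qed

lemma module_restrict_scalars:
  assumes S: "cring S" and M: "module R M" and \<phi>: "\<phi> \<in> ring_hom S R"
  shows "module S (restrict_scalars \<phi> M)"
proof -
  interpret M: module R M by (rule M)
  note h = ring_hom_closed[OF \<phi>] ring_hom_add[OF \<phi>] ring_hom_mult[OF \<phi>] ring_hom_one[OF \<phi>]
  have "abelian_group (restrict_scalars \<phi> M)"
    by (rule abelian_group_cong[OF M.abelian_group_axioms]) simp_all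
  then show ?thesis
    by (intro module.intro module_axioms.intro S)
      (auto simp: h M.smult_l_distr M.smult_r_distr M.smult_assoc1)
qed

lemma submodule_restrict_scalars:
  assumes S: "cring S" and M: "module R M" and \<phi>: "\<phi> \<in> ring_hom S R" and U: "submodule U R M"
  shows "submodule U S (restrict_scalars \<phi> M)"
proof -
  interpret M: module R M by (rule M)
  interpret Z: module S "restrict_scalars \<phi> M" by (rule module_restrict_scalars[OF S M \<phi>])
  note u = M.submodule_mem[OF U]
  show ?thesis by (rule Z.submodule_intro) (use u ring_hom_closed[OF \<phi>] in auto)
qed

text \<open>The \<open>R\<close>-module \<open>Hom\<^sub>S(R, D)\<close>, where \<open>R\<close> is an \<open>S\<close>-algebra by \<open>\<phi>\<close>.\<close>

definition coinduced ::
    "('s, 'd) ring_scheme \<Rightarrow> ('a, 'c) ring_scheme \<Rightarrow> ('s \<Rightarrow> 'a) \<Rightarrow> ('s, 'n) module \<Rightarrow> ('a, 'a \<Rightarrow> 'n) module" where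
  "coinduced S R \<phi> D =
     (let H = hom_module S (restrict_scalars \<phi> (ring_as_module R)) D in
      \<lparr>carrier = carrier H, monoid.mult = undefined, one = undefined, ring.zero = \<zero>\<^bsub>H\<^esub>, ring.add = ring.add H,
       module.smult = (\<lambda>a f. \<lambda>b\<in>carrier R. f (b \<otimes>\<^bsub>R\<^esub> a))\<rparr>)"

context
  fixes S :: "('s, 'd) ring_scheme" and R :: "('a, 'c) ring_scheme" (structure) and \<phi> and D :: "('s, 'n) module"
  assumes S: "cring S" and R: "cring R" and \<phi>: "\<phi> \<in> ring_hom S R" and D: "module S D"
begin

interpretation R: cring R by (rule R)
interpretation D: module S D by (rule D)

lemma coinduced_carrier:
  "f \<in> carrier (coinduced S R \<phi> D) \<longleftrightarrow> f \<in> extensional (carrier R) \<and>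
    (\<forall>a\<in>carrier R. f a \<in> carrier D) \<and> (\<forall>a\<in>carrier R. \<forall>b\<in>carrier R. f (a \<oplus> b) = f a \<oplus>\<^bsub>D\<^esub> f b) \<and>
    (\<forall>s\<in>carrier S. \<forall>a\<in>carrier R. f (\<phi> s \<otimes> a) = s \<odot>\<^bsub>D\<^esub> f a)"
  by (auto simp: coinduced_def Let_def module_homs_def)

lemma coinducedD:
  assumes "f \<in> carrier (coinduced S R \<phi> D)" "a \<in> carrier R"
  shows "f a \<in> carrier D" "b \<in> carrier R \<Longrightarrow> f (a \<oplus> b) = f a \<oplus>\<^bsub>D\<^esub> f b"
    "s \<in> carrier S \<Longrightarrow> f (\<phi> s \<otimes> a) = s \<odot>\<^bsub>D\<^esub> f a"
  using assms by (auto simp: coinduced_carrier)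

lemma coinduced_simps:
  "\<zero>\<^bsub>coinduced S R \<phi> D\<^esub> = (\<lambda>a\<in>carrier R. \<zero>\<^bsub>D\<^esub>)"
  "f \<oplus>\<^bsub>coinduced S R \<phi> D\<^esub> g = (\<lambda>a\<in>carrier R. f a \<oplus>\<^bsub>D\<^esub> g a)"
  "a \<odot>\<^bsub>coinduced S R \<phi> D\<^esub> f = (\<lambda>b\<in>carrier R. f (b \<otimes> a))"
  by (auto simp: coinduced_def Let_def)

lemma coinduced_ext:
  assumes "f \<in> carrier (coinduced S R \<phi> D)" "g \<in> carrier (coinduced S R \<phi> D)"
    and "\<And>x. x \<in> carrier R \<Longrightarrow> f x = g x"
  shows "f = g"
  by (rule extensionalityI[of f "carrier R"]) (use assms in \<open>auto simp: coinduced_carrier\<close>)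

lemma coinduced_smult_closed:
  assumes a: "a \<in> carrier R" and f: "f \<in> carrier (coinduced S R \<phi> D)"
  shows "a \<odot>\<^bsub>coinduced S R \<phi> D\<^esub> f \<in> carrier (coinduced S R \<phi> D)"
  using coinducedD[OF f] a ring_hom_closed[OF \<phi>]
  by (auto simp: coinduced_carrier coinduced_simps R.l_distr R.m_assoc)

lemma module_coinduced: "module R (coinduced S R \<phi> D)"
proof -
  let ?E = "coinduced S R \<phi> D"
  let ?H = "hom_module S (restrict_scalars \<phi> (ring_as_module R)) D"
  have "module S ?H"
    by (rule module_hom_module[OF module_restrict_scalars[OF S module_ring_as_module[OF R] \<phi>] D])
  then have "abelian_group ?H" by (rule module.axioms)
  then have ab: "abelian_group ?E"
    by (rule abelian_group_cong) (simp_all add: coinduced_def Let_def)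
  then interpret E: abelian_group ?E .
  note c = coinducedD and sm = coinduced_smult_closed
  show ?thesis
  proof (intro module.intro module_axioms.intro R ab sm)
    fix a b f assume a: "a \<in> carrier R" and b: "b \<in> carrier R" and f: "f \<in> carrier ?E"
    show "(a \<oplus> b) \<odot>\<^bsub>?E\<^esub> f = a \<odot>\<^bsub>?E\<^esub> f \<oplus>\<^bsub>?E\<^esub> b \<odot>\<^bsub>?E\<^esub> f"
      using a b c[OF f] by (auto simp: coinduced_simps fun_eq_iff R.r_distr)
    show "(a \<otimes> b) \<odot>\<^bsub>?E\<^esub> f = a \<odot>\<^bsub>?E\<^esub> (b \<odot>\<^bsub>?E\<^esub> f)"
      using a b by (auto simp: coinduced_simps fun_eq_iff R.m_assoc)
  next
    fix a f g assume a: "a \<in> carrier R" and fg: "f \<in> carrier ?E" "g \<in> carrier ?E"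
    show "a \<odot>\<^bsub>?E\<^esub> (f \<oplus>\<^bsub>?E\<^esub> g) = a \<odot>\<^bsub>?E\<^esub> f \<oplus>\<^bsub>?E\<^esub> a \<odot>\<^bsub>?E\<^esub> g"
      using a by (auto simp: coinduced_simps fun_eq_iff)
  next
    fix f assume f: "f \<in> carrier ?E"
    show "\<one> \<odot>\<^bsub>?E\<^esub> f = f"
      by (rule coinduced_ext[OF sm[OF R.one_closed f] f]) (simp add: coinduced_simps)
  qed
qed

text \<open>Evaluation at 1 turns maps into Hom_S(R, D) that are linear over \<open>R\<close> into
  maps to \<open>D\<close> that are linear over \<open>S\<close>. The latter extend, and a -> l (a
  x) leads back.\<close>

lemma injective_coinduced:
  assumes inj: "injective_module S D"
  shows "injective_module R (coinduced S R \<phi> D)"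
proof (rule injective_moduleI[OF module_coinduced])
  let ?E = "coinduced S R \<phi> D"
  fix N :: "('a, 'a) module" and U f
  assume N: "module R N" and U: "submodule U R N" and f: "f \<in> module_homs R (restr N U) ?E"
  interpret N: module R N by (rule N)
  note u = N.submodule_mem[OF U] and fD = module_homsD[OF f, simplified] and h = ring_hom_closed[OF \<phi>]
  have "(\<lambda>x. f x \<one>) \<in> module_homs S (restr (restrict_scalars \<phi> N) U) D"
    by (rule module_homsI)
      (use fD h coinducedD(1)[OF fD(1)] coinducedD(3)[OF fD(1) R.one_closed] in \<open>simp_all add: coinduced_simps\<close>)
  then obtain l where l: "l \<in> module_homs S (restrict_scalars \<phi> N) D" "\<And>x. x \<in> U \<Longrightarrow> l x = f x \<one>"
    using injective_extend[OF inj module_restrict_scalars[OF S N \<phi>] submodule_restrict_scalars[OF S N \<phi> U]] by blast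
  note lD = module_homsD[OF l(1), simplified]
  define g where "g x = (\<lambda>a\<in>carrier R. l (a \<odot>\<^bsub>N\<^esub> x))" for x
  have gc: "g x \<in> carrier ?E" if "x \<in> carrier N" for x
    using lD h that by (auto simp: coinduced_carrier g_def N.smult_l_distr N.smult_assoc1)
  have "g \<in> module_homs R N ?E"
    by (rule module_homsI) (use gc lD in \<open>auto simp: coinduced_simps fun_eq_iff g_def N.smult_r_distr N.smult_assoc1\<close>)
  moreover have "g x = f x" if x: "x \<in> U" for x
  proof (rule coinduced_ext[OF gc[OF u(1)[OF x]] fD(1)[OF x]])
    fix a assume a: "a \<in> carrier R"
    show "g x a = f x a" using l(2)[OF u(6)[OF a x]] fD(3)[OF a x] a by (simp add: g_def coinduced_simps)
  qed
  ultimately show "\<exists>g\<in>module_homs R N ?E. \<forall>x\<in>U. g x = f x" by blast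
qed

end

section \<open>The injective hull of the residue field\<close>

lemma int_embedding_hom:
  fixes R (structure)
  assumes "ring R"
  shows "(\<lambda>n::int. add_pow R n \<one>) \<in> ring_hom \<Z> R"
proof -
  interpret ring R by fact
  show ?thesis
  proof (rule ring_hom_memI)
    fix n m :: int
    show "add_pow R (n \<otimes>\<^bsub>\<Z>\<^esub> m) \<one> = add_pow R n \<one> \<otimes> add_pow R m \<one>"
      using add_pow_ldistr_int[of \<one> "add_pow R m \<one>" n] add.int_pow_pow[of \<one> n m] by (simp add: mult.commute)
    show "add_pow R (n \<oplus>\<^bsub>\<Z>\<^esub> m) \<one> = add_pow R n \<one> \<oplus> add_pow R m \<one>"
      using add.int_pow_mult[of \<one> n m] by simp
  qed auto
qed

text \<open>The quotient \<open>\<rat>/\<int>\<close>, by representatives in \<open>[0, 1)\<close>.\<close>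

definition rat_mod_int :: "(int, rat) module" where
  "rat_mod_int = \<lparr>carrier = {x. 0 \<le> x \<and> x < 1}, monoid.mult = undefined, one = undefined,
     ring.zero = 0, ring.add = (\<lambda>x y. frac (x + y)), module.smult = (\<lambda>n x. frac (of_int n * x))\<rparr>"

lemma rat_mod_int_simps [simp]:
  "carrier rat_mod_int = {x. 0 \<le> x \<and> x < 1}"
  "\<zero>\<^bsub>rat_mod_int\<^esub> = 0"
  "x \<oplus>\<^bsub>rat_mod_int\<^esub> y = frac (x + y)"
  "n \<odot>\<^bsub>rat_mod_int\<^esub> x = frac (of_int n * x)"
  by (simp_all add: rat_mod_int_def)

lemma frac_eq_iff: "frac x = frac y \<longleftrightarrow> x - y \<in> \<int>"
  using frac_diff_eq[of x y] frac_diff_zero[of x y] by fastforce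

lemma frac_mult_frac: "frac (of_int n * frac x) = frac (of_int n * x)"
  unfolding frac_eq_iff by (simp add: frac_def algebra_simps)

lemma module_rat_mod_int: "module \<Z> rat_mod_int"
proof (intro module.intro module_axioms.intro int_is_cring)
  show "abelian_group rat_mod_int"
  proof (rule abelian_groupI)
    fix x y z :: rat
    show "x \<oplus>\<^bsub>rat_mod_int\<^esub> y \<oplus>\<^bsub>rat_mod_int\<^esub> z = x \<oplus>\<^bsub>rat_mod_int\<^esub> (y \<oplus>\<^bsub>rat_mod_int\<^esub> z)"
      by (simp add: add.assoc)
    show "\<exists>y\<in>carrier rat_mod_int. y \<oplus>\<^bsub>rat_mod_int\<^esub> x = \<zero>\<^bsub>rat_mod_int\<^esub>"
      by (intro bexI[of _ "frac (- x)"]) (auto simp: frac_lt_1)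
  qed (auto simp: frac_lt_1 add.commute frac_eq)
qed (auto simp: frac_lt_1 frac_mult_frac frac_eq algebra_simps)

lemma int_multiples:
  assumes zero: "(0::int) \<in> S" and diff: "\<And>a b. a \<in> S \<Longrightarrow> b \<in> S \<Longrightarrow> a - b \<in> S"
    and mult: "\<And>a b. b \<in> S \<Longrightarrow> a * b \<in> S"
  shows "\<exists>m. S = {n. m dvd n}"
proof (cases "S = {0}")
  case True
  then show ?thesis by (intro exI[of _ 0]) auto
next
  case False
  then obtain s where s: "s \<in> S" "s \<noteq> 0" using zero by blast
  then have "\<bar>s\<bar> \<in> S" using mult[of s "-1"] by (simp add: abs_if)
  then have ex: "0 < nat \<bar>s\<bar> \<and> int (nat \<bar>s\<bar>) \<in> S" using s by simp
  define m where "m = (LEAST m. 0 < m \<and> int m \<in> S)"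
  have m: "0 < m" "int m \<in> S" using LeastI[of "\<lambda>m. 0 < m \<and> int m \<in> S", OF ex] by (auto simp: m_def)
  have "int m dvd n" if n: "n \<in> S" for n
  proof -
    have "n mod int m = n - n div int m * int m" by (simp add: minus_div_mult_eq_mod)
    then have r: "n mod int m \<in> S" using diff[OF n mult[OF m(2), of "n div int m"]] by simp
    have "\<not> 0 < n mod int m"
    proof
      assume p: "0 < n mod int m"
      then have "0 < nat (n mod int m) \<and> int (nat (n mod int m)) \<in> S" using r by simp
      then have "m \<le> nat (n mod int m)" using Least_le[of "\<lambda>m. 0 < m \<and> int m \<in> S"] unfolding m_def by blast
      then show False using m(1) pos_mod_bound[of "int m" n] p by linarith
    qed
    moreover have "0 \<le> n mod int m" using m(1) by simp
    ultimately have "n mod int m = 0" by linarith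
    then show ?thesis by (simp add: dvd_eq_mod_eq_0)
  qed
  then show ?thesis using mult[OF m(2)] by (intro exI[of _ "int m"]) (auto simp: dvd_def mult.commute)
qed

lemma int_annihilator:
  assumes N: "module \<Z> N" and Y: "submodule Y \<Z> N" and z: "z \<in> carrier N"
  shows "\<exists>m. \<forall>n. n \<odot>\<^bsub>N\<^esub> z \<in> Y \<longleftrightarrow> m dvd n"
proof -
  interpret N: module \<Z> N by fact
  note y = N.submodule_mem[OF Y]
  have "\<exists>m. {n. n \<odot>\<^bsub>N\<^esub> z \<in> Y} = {n. m dvd n}"
  proof (rule int_multiples)
    show "0 \<in> {n. n \<odot>\<^bsub>N\<^esub> z \<in> Y}" using N.smult_l_null[OF z] y(2) by simp
    have mult: "a * b \<in> {n. n \<odot>\<^bsub>N\<^esub> z \<in> Y}" if "b \<in> {n. n \<odot>\<^bsub>N\<^esub> z \<in> Y}" for a b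
      using that y(6)[of a] N.smult_assoc1[of a b z] z by simp
    then show "a * b \<in> {n. n \<odot>\<^bsub>N\<^esub> z \<in> Y}" if "b \<in> {n. n \<odot>\<^bsub>N\<^esub> z \<in> Y}" for a b using that .
    have "(a + (-1) * b) \<in> {n. n \<odot>\<^bsub>N\<^esub> z \<in> Y}" if "a \<in> {n. n \<odot>\<^bsub>N\<^esub> z \<in> Y}" "b \<in> {n. n \<odot>\<^bsub>N\<^esub> z \<in> Y}" for a b
      using that y(3) mult[OF that(2), of "-1"] N.smult_l_distr[of a "(-1) * b" z] z by simp
    then show "a - b \<in> {n. n \<odot>\<^bsub>N\<^esub> z \<in> Y}" if "a \<in> {n. n \<odot>\<^bsub>N\<^esub> z \<in> Y}" "b \<in> {n. n \<odot>\<^bsub>N\<^esub> z \<in> Y}" for a b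
      using that by simp
  qed
  then show ?thesis by blast
qed

lemma injective_rat_mod_int: "injective_module \<Z> rat_mod_int"
proof (rule injective_moduleI[OF module_rat_mod_int])
  fix N :: "(int, int) module" and U f
  assume N: "module \<Z> N" and U: "submodule U \<Z> N" and f: "f \<in> module_homs \<Z> (restr N U) rat_mod_int"
  show "\<exists>g\<in>module_homs \<Z> N rat_mod_int. \<forall>x\<in>U. g x = f x"
  proof (rule extension_by_steps[OF N module_rat_mod_int U f])
    fix Y g z assume Y: "submodule Y \<Z> N" and g: "g \<in> module_homs \<Z> (restr N Y) rat_mod_int" and z: "z \<in> carrier N"
    interpret N: module \<Z> N by fact
    obtain m where m: "\<And>n. n \<odot>\<^bsub>N\<^esub> z \<in> Y \<longleftrightarrow> m dvd n" using int_annihilator[OF N Y z] by blast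
    have mz: "m \<odot>\<^bsub>N\<^esub> z \<in> Y" by (simp add: m)
    \<comment> \<open>Divisibility of Q/Z. For \<open>m = 0\<close> the quotient is 0 by convention,
      and then only the scalar 0 takes \<open>z\<close> into \<open>Y\<close>.\<close>
    define w where "w = frac (g (m \<odot>\<^bsub>N\<^esub> z) / of_int m)"
    show "\<exists>w\<in>carrier rat_mod_int. \<forall>a\<in>carrier \<Z>. a \<odot>\<^bsub>N\<^esub> z \<in> Y \<longrightarrow> g (a \<odot>\<^bsub>N\<^esub> z) = a \<odot>\<^bsub>rat_mod_int\<^esub> w"
    proof (intro bexI[of _ w] ballI impI)
      show "w \<in> carrier rat_mod_int" by (simp add: w_def frac_lt_1)
      fix a assume "a \<odot>\<^bsub>N\<^esub> z \<in> Y"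
      then obtain q where q: "a = q * m" using m by (auto simp: dvd_def mult.commute)
      have "g (a \<odot>\<^bsub>N\<^esub> z) = g (q \<odot>\<^bsub>N\<^esub> (m \<odot>\<^bsub>N\<^esub> z))" using N.smult_assoc1[of q m z] z q by simp
      also have "\<dots> = frac (of_int q * g (m \<odot>\<^bsub>N\<^esub> z))" using module_homsD(3)[OF g, of q "m \<odot>\<^bsub>N\<^esub> z"] mz by simp
      also have "\<dots> = frac (of_int a * (g (m \<odot>\<^bsub>N\<^esub> z) / of_int m))"
      proof (cases "m = 0")
        case True
        have "g \<zero>\<^bsub>N\<^esub> = 0" using module_homs_zero[OF module_restr[OF N Y] module_rat_mod_int g] by simp
        then show ?thesis using True N.smult_l_null[OF z] by simp
      qed (simp add: q)
      finally show "g (a \<odot>\<^bsub>N\<^esub> z) = a \<odot>\<^bsub>rat_mod_int\<^esub> w" by (simp add: w_def frac_mult_frac)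
    qed
  qed
qed

text \<open>The property is elementwise, so it passes to unions of chains.\<close>

lemma (in module) maximal_submodule:
  assumes S: "submodule S R M" "\<And>x. x \<in> S \<Longrightarrow> P x"
  obtains H where "submodule H R M" "S \<subseteq> H" "\<forall>x\<in>H. P x"
    "\<forall>H'. submodule H' R M \<longrightarrow> H \<subseteq> H' \<longrightarrow> (\<forall>x\<in>H'. P x) \<longrightarrow> H' = H"
proof -
  let ?\<H> = "{H. submodule H R M \<and> S \<subseteq> H \<and> (\<forall>x\<in>H. P x)}"
  have "\<exists>H\<in>?\<H>. \<forall>H'\<in>?\<H>. H \<subseteq> H' \<longrightarrow> H' = H"
  proof (rule subset_Zorn_nonempty)
    show "?\<H> \<noteq> {}" using S by blast
    fix C assume C: "C \<noteq> {}" "subset.chain ?\<H> C"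
    then have sub: "\<And>H. H \<in> C \<Longrightarrow> H \<in> ?\<H>" and
      tot: "\<And>G H. G \<in> C \<Longrightarrow> H \<in> C \<Longrightarrow> G \<subseteq> H \<or> H \<subseteq> G"
      by (auto simp: subset_chain_def)
    have "submodule (\<Union>C) R M"
    proof (rule submodule_intro)
      show "\<Union>C \<subseteq> carrier M" using sub submodule_mem(1) by blast
      show "\<zero>\<^bsub>M\<^esub> \<in> \<Union>C" using sub submodule_mem(2) C(1) by blast
      show "a \<oplus>\<^bsub>M\<^esub> b \<in> \<Union>C" if ab: "a \<in> \<Union>C" "b \<in> \<Union>C" for a b
      proof -
        obtain H where "H \<in> C" "a \<in> H" "b \<in> H" using ab tot by blast
        then show ?thesis using sub submodule_mem(3)[of H a b] by blast
      qed
      show "r \<odot>\<^bsub>M\<^esub> b \<in> \<Union>C" if "r \<in> carrier R" "b \<in> \<Union>C" for r b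
        using that sub submodule_mem(6)[of _ r b] by blast
    qed
    then show "\<Union>C \<in> ?\<H>" using sub C(1) by blast
  qed
  then obtain H where "H \<in> ?\<H>" "\<forall>H'\<in>?\<H>. H \<subseteq> H' \<longrightarrow> H' = H" by blast
  then show ?thesis by (intro that[of H]) auto
qed

lemma (in module) submodule_set_add:
  assumes "submodule H R M" "submodule C R M"
  shows "submodule (H <+>\<^bsub>M\<^esub> C) R M" "H \<subseteq> H <+>\<^bsub>M\<^esub> C" "C \<subseteq> H <+>\<^bsub>M\<^esub> C"
proof -
  note h = submodule_mem[OF assms(1)] and c = submodule_mem[OF assms(2)]
  have I: "x \<oplus>\<^bsub>M\<^esub> y \<in> H <+>\<^bsub>M\<^esub> C" if "x \<in> H" "y \<in> C" for x y using that by (auto simp: set_add_def')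
  have E: "\<exists>y\<in>H. \<exists>z\<in>C. x = y \<oplus>\<^bsub>M\<^esub> z" if "x \<in> H <+>\<^bsub>M\<^esub> C" for x using that by (auto simp: set_add_def')
  show "submodule (H <+>\<^bsub>M\<^esub> C) R M"
  proof (rule submodule_intro)
    show "H <+>\<^bsub>M\<^esub> C \<subseteq> carrier M" using E h c by fastforce
    show "\<zero>\<^bsub>M\<^esub> \<in> H <+>\<^bsub>M\<^esub> C" using I[OF h(2) c(2)] by simp
    show "a \<oplus>\<^bsub>M\<^esub> b \<in> H <+>\<^bsub>M\<^esub> C" if ab: "a \<in> H <+>\<^bsub>M\<^esub> C" "b \<in> H <+>\<^bsub>M\<^esub> C" for a b
    proof -
      obtain x y x' y' where *: "x \<in> H" "y \<in> C" "x' \<in> H" "y' \<in> C" "a = x \<oplus>\<^bsub>M\<^esub> y" "b = x' \<oplus>\<^bsub>M\<^esub> y'"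
        using E[OF ab(1)] E[OF ab(2)] by blast
      have "a \<oplus>\<^bsub>M\<^esub> b = (x \<oplus>\<^bsub>M\<^esub> x') \<oplus>\<^bsub>M\<^esub> (y \<oplus>\<^bsub>M\<^esub> y')"
        using * h(1) c(1) by (simp add: M.a_ac)
      then show ?thesis using I[OF h(3)[OF *(1,3)] c(3)[OF *(2,4)]] by simp
    qed
    show "r \<odot>\<^bsub>M\<^esub> b \<in> H <+>\<^bsub>M\<^esub> C" if r: "r \<in> carrier R" "b \<in> H <+>\<^bsub>M\<^esub> C" for r b
    proof -
      obtain x y where *: "x \<in> H" "y \<in> C" "b = x \<oplus>\<^bsub>M\<^esub> y" using E[OF r(2)] by blast
      then show ?thesis using I[OF h(6)[OF r(1) *(1)] c(6)[OF r(1) *(2)]] r(1) h(1) c(1) by (simp add: smult_r_distr)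
    qed
  qed
  show "H \<subseteq> H <+>\<^bsub>M\<^esub> C" using I[OF _ c(2)] h(1) by fastforce
  show "C \<subseteq> H <+>\<^bsub>M\<^esub> C" using I[OF h(2)] c(1) by fastforce
qed

definition essential_extension ::
    "('a, 'c) ring_scheme \<Rightarrow> ('a, 'm) module \<Rightarrow> 'm set \<Rightarrow> 'm set \<Rightarrow> bool" where
  "essential_extension R M S H \<longleftrightarrow>
     (\<forall>x\<in>H. x \<noteq> \<zero>\<^bsub>M\<^esub> \<longrightarrow> (\<exists>a\<in>carrier R. a \<odot>\<^bsub>M\<^esub> x \<in> S \<and> a \<odot>\<^bsub>M\<^esub> x \<noteq> \<zero>\<^bsub>M\<^esub>))"

text \<open>A maximal essential extension \<open>H\<close> of \<open>S\<close> inside an injective module is a direct summand: with \<open>C\<close>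
  maximal among the submodules that meet \<open>H\<close> in zero, the projection \<open>H \<oplus> C \<rightarrow> H\<close> extends to \<open>g\<close>, whose
  image is again essential over \<open>S\<close>.\<close>

lemma injective_hull:
  assumes E: "injective_module R E" and S: "submodule S R E"
  shows "\<exists>H. submodule H R E \<and> S \<subseteq> H \<and> essential_extension R E S H \<and> injective_module R (restr E H)"
proof -
  have mE: "module R E" using E by (simp add: injective_module_def)
  interpret E: module R E by (rule mE)
  note s = E.submodule_mem[OF S]
  define ess where "ess x \<longleftrightarrow> (x \<noteq> \<zero>\<^bsub>E\<^esub> \<longrightarrow> (\<exists>a\<in>carrier R. a \<odot>\<^bsub>E\<^esub> x \<in> S \<and> a \<odot>\<^bsub>E\<^esub> x \<noteq> \<zero>\<^bsub>E\<^esub>))" for x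
  have ess0: "ess x" if "x \<in> S" for x using that s(1) unfolding ess_def by (intro impI bexI[of _ "\<one>\<^bsub>R\<^esub>"]) auto
  obtain H where H: "submodule H R E" "S \<subseteq> H" "\<forall>x\<in>H. ess x"
    and Hmax: "\<forall>H'. submodule H' R E \<longrightarrow> H \<subseteq> H' \<longrightarrow> (\<forall>x\<in>H'. ess x) \<longrightarrow> H' = H"
    by (rule E.maximal_submodule[where P = ess, OF S ess0])
  note h = E.submodule_mem[OF H(1)]
  have C0: "x \<in> H \<longrightarrow> x = \<zero>\<^bsub>E\<^esub>" if "x \<in> {\<zero>\<^bsub>E\<^esub>}" for x using that by simp
  obtain C where C: "submodule C R E" "\<forall>x\<in>C. x \<in> H \<longrightarrow> x = \<zero>\<^bsub>E\<^esub>"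
    and Cmax: "\<forall>C'. submodule C' R E \<longrightarrow> C \<subseteq> C' \<longrightarrow> (\<forall>x\<in>C'. x \<in> H \<longrightarrow> x = \<zero>\<^bsub>E\<^esub>) \<longrightarrow> C' = C"
    by (rule E.maximal_submodule[where P = "\<lambda>x. x \<in> H \<longrightarrow> x = \<zero>\<^bsub>E\<^esub>", OF E.zero_submodule C0])
  note sum = E.submodule_set_add[OF H(1) C(1)]
  have "H \<inter> C \<subseteq> {\<zero>\<^bsub>E\<^esub>}" using C(2) by blast
  then obtain p where p: "p \<in> module_homs R (restr E (H <+>\<^bsub>E\<^esub> C)) (restr E H)"
    "\<And>x. x \<in> H \<Longrightarrow> p x = x" "\<And>x. x \<in> C \<Longrightarrow> p x = \<zero>\<^bsub>E\<^esub>"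
    using direct_sum_projection[OF mE H(1) C(1)] by blast
  obtain g where g: "g \<in> module_homs R E E" "\<And>x. x \<in> H <+>\<^bsub>E\<^esub> C \<Longrightarrow> g x = p x"
    using injective_extend[OF E mE sum(1) module_homs_corestrD[OF p(1)]] h(1) by blast
  note gD = module_homsD[OF g(1)]
  have gH: "g x = x" if "x \<in> H" for x using g(2)[of x] p(2)[OF that] sum(2) that by auto
  have gC: "g x = \<zero>\<^bsub>E\<^esub>" if "x \<in> C" for x using g(2)[of x] p(3)[OF that] sum(3) that by auto
  \<comment> \<open>\<open>g\<close> is the identity on \<open>H\<close>, so its kernel meets
    \<open>H\<close> only in zero. It contains \<open>C\<close>, and maximality of \<open>C\<close>
    makes them equal.\<close>
  have ker: "x \<in> C" if x: "x \<in> carrier E" "g x = \<zero>\<^bsub>E\<^esub>" for x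
  proof -
    have "module_ker E E g = C"
      by (rule Cmax[rule_format, OF submodule_ker[OF mE mE g(1)]])
        (use gC gH E.submodule_mem(1)[OF C(1)] in \<open>auto simp: module_ker_def\<close>)
    then show ?thesis using x by (auto simp: module_ker_def)
  qed
  have "g ` carrier E = H"
  proof (rule Hmax[rule_format])
    show sg: "submodule (g ` carrier E) R E" by (rule submodule_image[OF mE mE g(1) E.carrier_is_submodule])
    show "H \<subseteq> g ` carrier E" using gH h(1) by (metis image_eqI subsetI)
    fix y assume "y \<in> g ` carrier E"
    then obtain x where x: "x \<in> carrier E" "y = g x" by blast
    show "ess y"
      unfolding ess_def
    proof
      assume "y \<noteq> \<zero>\<^bsub>E\<^esub>"
      then have xC: "x \<notin> C" using gC x by blast
      \<comment> \<open>By maximality of \<open>C\<close>, adding \<open>x\<close> produces a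
        nonzero element v = c + r x of \<open>H\<close>. Applying \<open>g\<close> fixes
        \<open>v\<close> and kills \<open>c\<close>, so \<open>v\<close> is a multiple of
        \<open>y\<close>, and it has a nonzero multiple in \<open>S\<close>.\<close>
      define C' where "C' = C <+>\<^bsub>E\<^esub> {r \<odot>\<^bsub>E\<^esub> x | r. r \<in> carrier R}"
      have sx: "submodule {r \<odot>\<^bsub>E\<^esub> x | r. r \<in> carrier R} R E"
      proof (rule E.submodule_intro)
        show "\<zero>\<^bsub>E\<^esub> \<in> {r \<odot>\<^bsub>E\<^esub> x | r. r \<in> carrier R}" using E.smult_l_null[OF x(1)] by (metis (mono_tags, lifting) E.R.zero_closed mem_Collect_eq)
        show "a \<oplus>\<^bsub>E\<^esub> b \<in> {r \<odot>\<^bsub>E\<^esub> x | r. r \<in> carrier R}"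
          if ab: "a \<in> {r \<odot>\<^bsub>E\<^esub> x | r. r \<in> carrier R}" "b \<in> {r \<odot>\<^bsub>E\<^esub> x | r. r \<in> carrier R}" for a b
        proof -
          obtain r r' where "r \<in> carrier R" "r' \<in> carrier R" "a = r \<odot>\<^bsub>E\<^esub> x" "b = r' \<odot>\<^bsub>E\<^esub> x" using ab by blast
          then show ?thesis using E.smult_l_distr[of r r' x] x(1) by (auto intro!: exI[of _ "r \<oplus>\<^bsub>R\<^esub> r'"])
        qed
        show "s \<odot>\<^bsub>E\<^esub> b \<in> {r \<odot>\<^bsub>E\<^esub> x | r. r \<in> carrier R}"
          if ab: "s \<in> carrier R" "b \<in> {r \<odot>\<^bsub>E\<^esub> x | r. r \<in> carrier R}" for s b
        proof -
          obtain r where "r \<in> carrier R" "b = r \<odot>\<^bsub>E\<^esub> x" using ab by blast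
          then show ?thesis using E.smult_assoc1[of s r x] x(1) ab(1) by (auto intro!: exI[of _ "s \<otimes>\<^bsub>R\<^esub> r"])
        qed
      qed (use x in auto)
      note sum' = E.submodule_set_add[OF C(1) sx]
      have "x \<in> {r \<odot>\<^bsub>E\<^esub> x | r. r \<in> carrier R}" using E.smult_one[OF x(1)] by (metis (mono_tags, lifting) E.R.one_closed mem_Collect_eq)
      then have "x \<in> C'" using sum'(3) by (auto simp: C'_def)
      then obtain v where v: "v \<in> C'" "v \<in> H" "v \<noteq> \<zero>\<^bsub>E\<^esub>"
        using Cmax[THEN spec, of C'] sum' xC unfolding C'_def by blast
      then obtain c r where cr: "c \<in> C" "r \<in> carrier R" "v = c \<oplus>\<^bsub>E\<^esub> r \<odot>\<^bsub>E\<^esub> x"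
        unfolding C'_def set_add_def' by auto
      have cE: "c \<in> carrier E" using E.submodule_mem(1)[OF C(1) cr(1)] .
      have "v = g v" using gH[OF v(2)] by simp
      also have "\<dots> = r \<odot>\<^bsub>E\<^esub> y" unfolding cr(3) using gD cE cr x gC[OF cr(1)] by simp
      finally have vy: "v = r \<odot>\<^bsub>E\<^esub> y" .
      obtain b where b: "b \<in> carrier R" "b \<odot>\<^bsub>E\<^esub> v \<in> S" "b \<odot>\<^bsub>E\<^esub> v \<noteq> \<zero>\<^bsub>E\<^esub>" using H(3)[rule_format, OF v(2)] v(3) unfolding ess_def by blast
      have "b \<odot>\<^bsub>E\<^esub> v = (b \<otimes>\<^bsub>R\<^esub> r) \<odot>\<^bsub>E\<^esub> y" unfolding vy using b(1) cr(2) x gD(1) by (simp add: E.smult_assoc1)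
      then show "\<exists>a\<in>carrier R. a \<odot>\<^bsub>E\<^esub> y \<in> S \<and> a \<odot>\<^bsub>E\<^esub> y \<noteq> \<zero>\<^bsub>E\<^esub>"
        using b cr(2) by (intro bexI[of _ "b \<otimes>\<^bsub>R\<^esub> r"]) auto
    qed
  qed
  then have gH': "g \<in> module_homs R E (restr E H)" by (intro module_homs_corestr[OF g(1)]) auto
  have id: "(\<lambda>x. x) \<in> module_homs R (restr E H) E" by (rule module_homsI) (use h in auto)
  have "injective_module R (restr E H)"
    by (rule injective_retract[OF E module_restr[OF mE H(1)] gH' id]) (simp add: gH)
  moreover have "essential_extension R E S H" using H(3) unfolding essential_extension_def ess_def by blast
  ultimately show ?thesis using H(1,2) by blast
qed

text \<open>A character of R/\<mm>, seen on \<open>R\<close>: zero on \<open>\<mm>\<close>, a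
  suitable nonzero value at 1, and the rest by injectivity of Q/Z. As it vanishes on the ideal
  \<open>\<mm>\<close>, the coinduced action of \<open>\<mm>\<close> kills it.\<close>

lemma (in noetherian_local) residue_character:
  "\<exists>(E :: ('a, 'a \<Rightarrow> rat) module) \<chi>. injective_module R E \<and> \<chi> \<in> carrier E \<and> \<chi> \<noteq> \<zero>\<^bsub>E\<^esub> \<and>
    (\<forall>a\<in>\<mm>. a \<odot>\<^bsub>E\<^esub> \<chi> = \<zero>\<^bsub>E\<^esub>)"
proof -
  let ?A = "ring_as_module R"
  let ?\<phi> = "\<lambda>n::int. add_pow R n \<one>"
  let ?Z = "restrict_scalars ?\<phi> ?A"
  let ?E = "coinduced \<Z> R ?\<phi> rat_mod_int"
  have \<phi>: "?\<phi> \<in> ring_hom \<Z> R" by (rule int_embedding_hom) (rule ring_axioms)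
  have mA: "module R ?A" by (rule module_ring_as_module) (rule is_cring)
  interpret A: module R ?A by (rule mA)
  have mZ: "module \<Z> ?Z" by (rule module_restrict_scalars[OF int_is_cring mA \<phi>])
  have "submodule \<mm> R ?A" by (rule A.submodule_intro) (use ideal_closed[OF m.is_ideal] in auto)
  then have mm: "submodule \<mm> \<Z> ?Z" by (rule submodule_restrict_scalars[OF int_is_cring mA \<phi>])
  \<comment> \<open>\<open>p\<close> generates the kernel of the map from the integers to the
    residue field, so up to sign it is the residue characteristic.\<close>
  obtain p where p: "\<And>n. ?\<phi> n \<in> \<mm> \<longleftrightarrow> p dvd n"
    using int_annihilator[OF mZ mm, of \<one>] by auto
  have p1: "\<not> p dvd 1" using p[of 1] one_notin_m by simp
  \<comment> \<open>An element of Q/Z of order |p|; in residue characteristic 0 every nonzero value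
    is allowed, and 1/2 is taken.\<close>
  define c where "c = (if p = 0 then 1 / 2 else 1 / of_int \<bar>p\<bar> :: rat)"
  have c: "0 < c" "c < 1"
  proof -
    have "1 < (of_int \<bar>p\<bar> :: rat)" if "p \<noteq> 0"
    proof -
      have "\<bar>p\<bar> > 1" using that p1 by (cases "\<bar>p\<bar> = 1") auto
      then show ?thesis by (simp only: of_int_1_less_iff)
    qed
    then show "0 < c" "c < 1" by (auto simp: c_def)
  qed
  have ck: "frac (of_int n * c) = 0" if n: "p dvd n" for n
  proof (cases "p = 0")
    case False
    obtain q where q: "n = p * q" using n by (auto simp: dvd_def)
    have "of_int n * c = of_int (sgn p * q)" using False by (auto simp: q c_def abs_if)
    then show ?thesis by simp
  qed (use n in auto)
  have "\<exists>Y f. submodule Y \<Z> ?Z \<and> \<mm> \<subseteq> Y \<and> \<one> \<in> Y \<and> f \<in> module_homs \<Z> (restr ?Z Y) rat_mod_int \<and> f \<one> = c \<and>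
    (\<forall>b\<in>\<mm>. f b = \<zero>\<^bsub>rat_mod_int\<^esub>)"
    by (rule extend_by_element[OF mZ module_rat_mod_int mm]) (use c p ck in auto)
  then obtain Y f where Y: "submodule Y \<Z> ?Z" "\<mm> \<subseteq> Y" "\<one> \<in> Y"
    and f: "f \<in> module_homs \<Z> (restr ?Z Y) rat_mod_int" "f \<one> = c" "\<And>b. b \<in> \<mm> \<Longrightarrow> f b = 0" by auto
  obtain g where g: "g \<in> module_homs \<Z> ?Z rat_mod_int" "\<And>x. x \<in> Y \<Longrightarrow> g x = f x"
    using injective_extend[OF injective_rat_mod_int mZ Y(1) f(1)] by blast
  let ?\<chi> = "restrict g (carrier R)"
  have "?\<chi> \<in> carrier ?E" using restrict_hom[OF mZ g(1)] by (simp add: coinduced_def Let_def)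
  moreover have "?\<chi> \<noteq> \<zero>\<^bsub>?E\<^esub>"
  proof
    assume "?\<chi> = \<zero>\<^bsub>?E\<^esub>"
    then have "?\<chi> \<one> = 0" by (simp add: coinduced_def Let_def)
    then show False using g(2)[OF Y(3)] f(2) c by simp
  qed
  moreover have "a \<odot>\<^bsub>?E\<^esub> ?\<chi> = \<zero>\<^bsub>?E\<^esub>" if a: "a \<in> \<mm>" for a
  proof -
    have "g (b \<otimes> a) = 0" if b: "b \<in> carrier R" for b
    proof -
      have "b \<otimes> a \<in> \<mm>" using m.I_l_closed[OF a b] .
      then show ?thesis using g(2)[of "b \<otimes> a"] f(3)[of "b \<otimes> a"] Y(2) by auto
    qed
    then show ?thesis using a ideal_closed(1)[OF m.is_ideal] by (auto simp: coinduced_def Let_def fun_eq_iff)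
  qed
  moreover have "injective_module R ?E"
    by (rule injective_coinduced[OF int_is_cring is_cring \<phi> module_rat_mod_int injective_rat_mod_int])
  ultimately show ?thesis by blast
qed

text \<open>The multiples of \<chi> form a copy of the residue field, over which the hull is
  essential. A nonzero element killed by \<open>\<mm>\<close> has a nonzero multiple in this copy
  only by a unit, so it lies in the copy itself.\<close>

lemma (in noetherian_local) residue_injective_hull:
  obtains E :: "('a, 'a \<Rightarrow> rat) module" and \<chi> where "injective_module R E" "\<chi> \<in> carrier E"
    "\<forall>a\<in>carrier R. a \<odot>\<^bsub>E\<^esub> \<chi> = \<zero>\<^bsub>E\<^esub> \<longleftrightarrow> a \<in> \<mm>"
    "\<forall>x\<in>carrier E. (\<forall>a\<in>\<mm>. a \<odot>\<^bsub>E\<^esub> x = \<zero>\<^bsub>E\<^esub>) \<longrightarrow> (\<exists>a\<in>carrier R. x = a \<odot>\<^bsub>E\<^esub> \<chi>)"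
proof -
  obtain E :: "('a, 'a \<Rightarrow> rat) module" and \<chi> where E: "injective_module R E"
    and \<chi>: "\<chi> \<in> carrier E" "\<chi> \<noteq> \<zero>\<^bsub>E\<^esub>" "\<And>a. a \<in> \<mm> \<Longrightarrow> a \<odot>\<^bsub>E\<^esub> \<chi> = \<zero>\<^bsub>E\<^esub>"
    using residue_character by blast
  have mE: "module R E" using E by (simp add: injective_module_def)
  interpret E: module R E by (rule mE)
  define S where "S = (\<lambda>a. a \<odot>\<^bsub>E\<^esub> \<chi>) ` carrier R"
  have mA: "module R (ring_as_module R)" by (rule module_ring_as_module) (rule is_cring)
  have "(\<lambda>a. a \<odot>\<^bsub>E\<^esub> \<chi>) \<in> module_homs R (ring_as_module R) E"
    by (rule module_homsI) (use \<chi>(1) in \<open>auto simp: E.smult_l_distr E.smult_assoc1\<close>)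
  from submodule_image[OF mA mE this module.carrier_is_submodule[OF mA]]
  have S: "submodule S R E" by (simp add: S_def)
  obtain H where H: "submodule H R E" "S \<subseteq> H" "essential_extension R E S H" "injective_module R (restr E H)"
    using injective_hull[OF E S] by blast
  note h = E.submodule_mem(1)[OF H(1)]
  have ann: "a \<odot>\<^bsub>E\<^esub> \<chi> = \<zero>\<^bsub>E\<^esub> \<longleftrightarrow> a \<in> \<mm>" if a: "a \<in> carrier R" for a
    using module_saturated[OF mE E.zero_submodule, of a \<chi>] \<chi> a by auto
  have "\<chi> \<in> H" using H(2) \<chi>(1) by (force simp: S_def intro: image_eqI[of _ _ \<one>])
  moreover have "\<exists>a\<in>carrier R. x = a \<odot>\<^bsub>E\<^esub> \<chi>" if x: "x \<in> H" "\<And>a. a \<in> \<mm> \<Longrightarrow> a \<odot>\<^bsub>E\<^esub> x = \<zero>\<^bsub>E\<^esub>" for x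
  proof (cases "x = \<zero>\<^bsub>E\<^esub>")
    case True
    then show ?thesis using \<chi>(1) by (intro bexI[of _ \<zero>]) auto
  next
    case False
    then obtain a where a: "a \<in> carrier R" "a \<odot>\<^bsub>E\<^esub> x \<in> S" "a \<odot>\<^bsub>E\<^esub> x \<noteq> \<zero>\<^bsub>E\<^esub>"
      using H(3) x(1) unfolding essential_extension_def by blast
    have "x \<in> S" using module_saturated[OF mE S, of a x] a x(2)[of a] h[OF x(1)] by auto
    then show ?thesis by (auto simp: S_def)
  qed
  ultimately show ?thesis using H(4) ann by (intro that[of "restr E H" \<chi>]) auto
qed

section \<open>An injective resolution of the residue field\<close>

text \<open>Hom(-, E) is exact and takes free modules of finite rank to injective ones. The kernel
  at the start is Hom(k, E), the socle of \<open>E\<close>, which \<chi> generates and thereby makes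
  a copy of \<open>k\<close>.\<close>

lemma (in min_resolution) dual_injective_resolution:
  fixes E :: "('a, 'n) module"
  assumes E: "injective_module R E" and \<chi>: "\<chi> \<in> carrier E"
    and ann: "\<forall>a\<in>carrier R. a \<odot>\<^bsub>E\<^esub> \<chi> = \<zero>\<^bsub>E\<^esub> \<longleftrightarrow> a \<in> \<mm>"
    and socle: "\<forall>x\<in>carrier E. (\<forall>a\<in>\<mm>. a \<odot>\<^bsub>E\<^esub> x = \<zero>\<^bsub>E\<^esub>) \<longrightarrow> (\<exists>a\<in>carrier R. x = a \<odot>\<^bsub>E\<^esub> \<chi>)"
  shows "\<exists>h. injective_resolution R k (\<lambda>j. hom_module R (F j) E) h (\<lambda>j f. \<lambda>x\<in>carrier (F (Suc j)). f (d j x))"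
proof -
  let ?A = "ring_as_module R"
  define I where "I j = hom_module R (F j) E" for j
  define \<delta> where "\<delta> j f = (\<lambda>x\<in>carrier (F (Suc j)). f (d j x))" for j and f :: "'m \<Rightarrow> 'n"
  have mE: "module R E" using E by (simp add: injective_module_def)
  interpret E: module R E by (rule mE)
  interpret k: module R k by (rule modk)
  interpret F0: module R "F 0" by (rule modF)
  have mA: "module R ?A" by (rule module_ring_as_module) (rule is_cring)
  have u_hom: "(\<lambda>a. a \<odot>\<^bsub>k\<^esub> u) \<in> module_homs R ?A k"
    by (rule module_homsI) (use u(1) in \<open>auto simp: k.smult_l_distr k.smult_assoc1\<close>)
  have \<chi>_hom: "(\<lambda>a. a \<odot>\<^bsub>E\<^esub> \<chi>) \<in> module_homs R ?A E"
    by (rule module_homsI) (use \<chi> in \<open>auto simp: E.smult_l_distr E.smult_assoc1\<close>)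
  have im: "(\<lambda>a. a \<odot>\<^bsub>k\<^esub> u) ` carrier ?A = carrier k" using u(1,3) by auto
  have "\<exists>\<iota>\<in>module_homs R (restr k ((\<lambda>a. a \<odot>\<^bsub>k\<^esub> u) ` carrier ?A)) E. \<forall>a\<in>carrier ?A. \<iota> (a \<odot>\<^bsub>k\<^esub> u) = a \<odot>\<^bsub>E\<^esub> \<chi>"
    by (rule factor_through_image[OF mA modk u_hom \<chi>_hom mE]) (use u(2) ann in auto)
  then obtain \<iota> where \<iota>: "\<iota> \<in> module_homs R k E" "\<And>a. a \<in> carrier R \<Longrightarrow> \<iota> (a \<odot>\<^bsub>k\<^esub> u) = a \<odot>\<^bsub>E\<^esub> \<chi>"
    unfolding im by auto
  note \<iota>D = module_homsD[OF \<iota>(1)]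
  have \<iota>m: "a \<odot>\<^bsub>E\<^esub> \<iota> y = \<zero>\<^bsub>E\<^esub>" if "a \<in> \<mm>" "y \<in> carrier k" for a y
    using \<iota>D(3)[of a y] k_killed[OF that] module_homs_zero[OF modk mE \<iota>(1)] that by simp
  \<comment> \<open>A homomorphism on \<open>F 0\<close> that kills \<mm> \<open>F 0\<close> amounts
    to a socle element, its value at \<open>b0\<close>; here that value is
    \<open>\<iota> y\<close>.\<close>
  define h where "h y = (\<lambda>v\<in>carrier (F 0). crd0 v \<odot>\<^bsub>E\<^esub> \<iota> y)" for y
  note c0 = functional[OF crd0_hom]
  have hc: "h y \<in> carrier (I 0)" if y: "y \<in> carrier k" for y
  proof -
    have "(\<lambda>v. crd0 v \<odot>\<^bsub>E\<^esub> \<iota> y) \<in> module_homs R (F 0) E"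
      by (rule module_homsI) (use c0 \<iota>D(1)[OF y] in \<open>auto simp: E.smult_l_distr E.smult_assoc1\<close>)
    then show ?thesis unfolding h_def I_def by (rule restrict_hom[OF modF])
  qed
  have hh: "h \<in> module_homs R k (I 0)"
  proof (rule module_homsI[OF hc])
    show "h (y \<oplus>\<^bsub>k\<^esub> y') = h y \<oplus>\<^bsub>I 0\<^esub> h y'" if "y \<in> carrier k" "y' \<in> carrier k" for y y'
      using that c0 \<iota>D by (auto simp: h_def I_def fun_eq_iff E.smult_r_distr)
    show "h (a \<odot>\<^bsub>k\<^esub> y) = a \<odot>\<^bsub>I 0\<^esub> h y" if a: "a \<in> carrier R" and y: "y \<in> carrier k" for a y
    proof (rule hom_module_ext[OF hc[unfolded I_def]])
      have m0: "module R (hom_module R (F 0) E)" by (rule module_hom_module[OF modF mE])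
      show "a \<odot>\<^bsub>I 0\<^esub> h y \<in> carrier (hom_module R (F 0) E)"
        unfolding I_def by (rule module.smult_closed[OF m0 a hc[OF y, unfolded I_def]])
      show "h (a \<odot>\<^bsub>k\<^esub> y) v = (a \<odot>\<^bsub>I 0\<^esub> h y) v" if v: "v \<in> carrier (F 0)" for v
        using v a y c0(1)[OF v] \<iota>D E.smult_assoc1[of "crd0 v" a "\<iota> y"] E.smult_assoc1[of a "crd0 v" "\<iota> y"]
        by (simp add: h_def I_def m_comm)
    qed (use a y in simp)
  qed
  have \<delta>h: "\<delta> j \<in> module_homs R (I j) (I (Suc j))" for j
    unfolding I_def \<delta>_def[abs_def] by (rule hom_module_pullback[OF modF modF mE d_hom])
  have ker: "f \<in> module_ker (I j) (I (Suc j)) (\<delta> j) \<longleftrightarrow>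
    f \<in> carrier (I j) \<and> (\<forall>y\<in>carrier (F (Suc j)). f (d j y) = \<zero>\<^bsub>E\<^esub>)" for f j
    by (auto simp: module_ker_def \<delta>_def I_def fun_eq_iff restrict_def)
  have inj: "inj_on h (carrier k)"
  proof (rule inj_onI)
    fix y y' assume y: "y \<in> carrier k" "y' \<in> carrier k" "h y = h y'"
    obtain a a' where a: "a \<in> carrier R" "a' \<in> carrier R" "y = a \<odot>\<^bsub>k\<^esub> u" "y' = a' \<odot>\<^bsub>k\<^esub> u" using u(3) y by metis
    have "\<iota> y = \<iota> y'" using y(3)[THEN fun_cong, of b0] b0(1,2) \<iota>D(1) y by (simp add: h_def)
    then have "(a \<ominus> a') \<odot>\<^bsub>E\<^esub> \<chi> = \<zero>\<^bsub>E\<^esub>"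
      using a \<chi> by (simp add: \<iota>(2) E.smult_diff_l E.diff_self)
    then have "(a \<ominus> a') \<odot>\<^bsub>k\<^esub> u = \<zero>\<^bsub>k\<^esub>" using ann u(2) a by simp
    then show "y = y'" using a u(1) k.diff_eq_zero[of y y'] y by (simp add: k.smult_diff_l)
  qed
  have h_ker: "h ` carrier k = module_ker (I 0) (I 1) (\<delta> 0)"
  proof
    show "h ` carrier k \<subseteq> module_ker (I 0) (I 1) (\<delta> 0)"
    proof clarify
      fix y assume y: "y \<in> carrier k"
      have "h y (d 0 x) = \<zero>\<^bsub>E\<^esub>" if x: "x \<in> carrier (F (Suc 0))" for x
        using \<iota>m[of "crd0 (d 0 x)" y] mF0_crd d_mF[OF x] module_homsD(1)[OF d_hom x] y by (simp add: h_def)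
      then show "h y \<in> module_ker (I 0) (I 1) (\<delta> 0)" using ker[of "h y" 0] hc[OF y] by simp
    qed
    show "module_ker (I 0) (I 1) (\<delta> 0) \<subseteq> h ` carrier k"
    proof
      fix f assume "f \<in> module_ker (I 0) (I 1) (\<delta> 0)"
      then have f: "f \<in> carrier (I 0)" "\<And>y. y \<in> carrier (F (Suc 0)) \<Longrightarrow> f (d 0 y) = \<zero>\<^bsub>E\<^esub>" using ker[of f 0] by auto
      have fh: "f \<in> module_homs R (F 0) E" using f(1) by (simp add: I_def)
      note fD = module_homsD[OF fh]
      \<comment> \<open>Multiples of \<open>b0\<close> by elements of \<open>\<mm>\<close> are
        boundaries, where \<open>f\<close> vanishes; so the value at \<open>b0\<close> is in the
        socle.\<close>
      have "a \<odot>\<^bsub>E\<^esub> f b0 = \<zero>\<^bsub>E\<^esub>" if a: "a \<in> \<mm>" for a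
      proof -
        have aR: "a \<in> carrier R" using a by simp
        have "a \<odot>\<^bsub>F 0\<^esub> b0 \<in> mF 0" using mF0_crd[of "a \<odot>\<^bsub>F 0\<^esub> b0"] b0(1) b0(5)[OF aR] aR a by simp
        then obtain y where "y \<in> carrier (F 1)" "a \<odot>\<^bsub>F 0\<^esub> b0 = d 0 y" using mF0_image by blast
        then show ?thesis using fD(3)[OF aR b0(1)] f(2)[of y] by simp
      qed
      then obtain a where a: "a \<in> carrier R" "f b0 = a \<odot>\<^bsub>E\<^esub> \<chi>" using socle fD(1)[OF b0(1)] by blast
      have au: "a \<odot>\<^bsub>k\<^esub> u \<in> carrier k" using a(1) u(1) by simp
      have "f = h (a \<odot>\<^bsub>k\<^esub> u)"
      proof (rule hom_module_ext[OF f(1)[unfolded I_def] hc[OF au, unfolded I_def]])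
        fix v assume v: "v \<in> carrier (F 0)"
        have "f v = f (crd0 v \<odot>\<^bsub>F 0\<^esub> b0)" using b0(3)[OF v] by simp
        also have "\<dots> = crd0 v \<odot>\<^bsub>E\<^esub> \<iota> (a \<odot>\<^bsub>k\<^esub> u)" using fD(3)[OF b0(4)[OF v] b0(1)] a \<iota>(2) by simp
        finally show "f v = h (a \<odot>\<^bsub>k\<^esub> u) v" using v by (simp add: h_def)
      qed
      then show "f \<in> h ` carrier k" using au by blast
    qed
  qed
  have ex: "\<delta> j ` carrier (I j) = module_ker (I (Suc j)) (I (Suc (Suc j))) (\<delta> (Suc j))" for j
  proof
    show "\<delta> j ` carrier (I j) \<subseteq> module_ker (I (Suc j)) (I (Suc (Suc j))) (\<delta> (Suc j))"
    proof clarify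
      fix f assume f: "f \<in> carrier (I j)"
      then have "f \<zero>\<^bsub>F j\<^esub> = \<zero>\<^bsub>E\<^esub>" using module_homs_zero[OF modF mE, of f j] by (simp add: I_def)
      then have "\<delta> j f (d (Suc j) y) = \<zero>\<^bsub>E\<^esub>" if "y \<in> carrier (F (Suc (Suc j)))" for y
        using dd[OF that] module_homsD(1)[OF d_hom that] by (simp add: \<delta>_def)
      then show "\<delta> j f \<in> module_ker (I (Suc j)) (I (Suc (Suc j))) (\<delta> (Suc j))"
        using ker module_homsD(1)[OF \<delta>h f] by blast
    qed
    show "module_ker (I (Suc j)) (I (Suc (Suc j))) (\<delta> (Suc j)) \<subseteq> \<delta> j ` carrier (I j)"
    proof
      fix f assume "f \<in> module_ker (I (Suc j)) (I (Suc (Suc j))) (\<delta> (Suc j))"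
      then have f: "f \<in> carrier (I (Suc j))"
        "\<And>y. y \<in> carrier (F (Suc (Suc j))) \<Longrightarrow> f (d (Suc j) y) = \<zero>\<^bsub>E\<^esub>" using ker by auto
      have fh: "f \<in> module_homs R (F (Suc j)) E" using f(1) by (simp add: I_def)
      have "f x = \<zero>\<^bsub>E\<^esub>" if "x \<in> carrier (F (Suc j))" "d j x = \<zero>\<^bsub>F j\<^esub>" for x
        using exact[of x "Suc j"] that f(2) by (auto simp: W_def)
      then obtain g where g: "g \<in> module_homs R (restr (F j) (d j ` carrier (F (Suc j)))) E"
        "\<And>x. x \<in> carrier (F (Suc j)) \<Longrightarrow> g (d j x) = f x"
        using factor_through_image[OF modF modF d_hom fh mE] by blast
      obtain G where G: "G \<in> module_homs R (F j) E" "\<And>y. y \<in> d j ` carrier (F (Suc j)) \<Longrightarrow> G y = g y"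
        using injective_extend[OF E modF
          submodule_image[OF modF modF d_hom module.carrier_is_submodule[OF modF]] g(1)] by blast
      have Gc: "restrict G (carrier (F j)) \<in> carrier (I j)" unfolding I_def by (rule restrict_hom[OF modF G(1)])
      have "f = \<delta> j (restrict G (carrier (F j)))"
      proof (rule hom_module_ext[OF f(1)[unfolded I_def] module_homsD(1)[OF \<delta>h Gc, unfolded I_def]])
        fix v assume v: "v \<in> carrier (F (Suc j))"
        then show "f v = \<delta> j (restrict G (carrier (F j))) v"
          using g(2)[OF v] G(2)[of "d j v"] module_homsD(1)[OF d_hom v] by (simp add: \<delta>_def)
      qed
      then show "f \<in> \<delta> j ` carrier (I j)" using Gc by blast
    qed
  qed
  have "injective_module R (I j)" for j unfolding I_def by (rule injective_hom_module[OF basis modF E])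
  then have "injective_resolution R k I h \<delta>"
    unfolding injective_resolution_def using modk hh \<delta>h inj h_ker ex by blast
  then show ?thesis unfolding I_def[abs_def] \<delta>_def[abs_def] by blast
qed

section \<open>Change of element type and the injective dimension of the residue field\<close>

definition transport_module :: "('e \<Rightarrow> 't) \<Rightarrow> ('a, 'e) module \<Rightarrow> ('a, 't) module" where
  "transport_module c M = \<lparr>carrier = c ` carrier M, monoid.mult = undefined, one = undefined,
     ring.zero = c \<zero>\<^bsub>M\<^esub>, ring.add = (\<lambda>x y. c (inv_into UNIV c x \<oplus>\<^bsub>M\<^esub> inv_into UNIV c y)),
     module.smult = (\<lambda>a x. c (a \<odot>\<^bsub>M\<^esub> inv_into UNIV c x))\<rparr>"

lemma transport_module_simps [simp]:
  "carrier (transport_module c M) = c ` carrier M"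
  "\<zero>\<^bsub>transport_module c M\<^esub> = c \<zero>\<^bsub>M\<^esub>"
  "x \<oplus>\<^bsub>transport_module c M\<^esub> y = c (inv_into UNIV c x \<oplus>\<^bsub>M\<^esub> inv_into UNIV c y)"
  "a \<odot>\<^bsub>transport_module c M\<^esub> x = c (a \<odot>\<^bsub>M\<^esub> inv_into UNIV c x)"
  by (simp_all add: transport_module_def)

lemma transport_homs:
  assumes c: "inj c"
  shows "c \<in> module_homs R M (transport_module c M)" "inv_into UNIV c \<in> module_homs R (transport_module c M) M"
  using c by (auto intro!: module_homsI)

lemma module_transport:
  assumes c: "inj c" and M: "module R M"
  shows "module R (transport_module c M)"
proof -
  interpret M: module R M by (rule M)
  have ab: "abelian_group (transport_module c M)"
  proof (rule abelian_groupI)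
    fix x assume "x \<in> carrier (transport_module c M)"
    then obtain v where v: "v \<in> carrier M" "x = c v" by auto
    then show "\<exists>y\<in>carrier (transport_module c M). y \<oplus>\<^bsub>transport_module c M\<^esub> x = \<zero>\<^bsub>transport_module c M\<^esub>"
      using c M.M.l_neg[of v] by (intro bexI[of _ "c (\<ominus>\<^bsub>M\<^esub> v)"]) auto
  qed (use c in \<open>auto simp: M.M.a_ac\<close>)
  show ?thesis
    by (intro module.intro module_axioms.intro M.is_cring ab)
      (use c in \<open>auto simp: M.smult_l_distr M.smult_r_distr M.smult_assoc1\<close>)
qed

text \<open>\<open>inj_dim\<close> looks for resolutions over one particular element type, and
  conjugation by an injection moves a resolution there; \<open>inv_into UNIV c\<close> undoes
  \<open>c\<close> on its range.\<close>

lemma injective_resolution_transport: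
  assumes c: "inj c" and res: "injective_resolution R M I h \<delta>"
  shows "injective_resolution R M (\<lambda>j. transport_module c (I j)) (\<lambda>x. c (h x)) (\<lambda>j x. c (\<delta> j (inv_into UNIV c x)))"
proof -
  have inj: "\<And>j. injective_module R (I j)" and hom: "h \<in> module_homs R M (I 0)"
    "\<And>j. \<delta> j \<in> module_homs R (I j) (I (Suc j))" and exact: "h ` carrier M = module_ker (I 0) (I 1) (\<delta> 0)"
    "\<And>j. \<delta> j ` carrier (I j) = module_ker (I (Suc j)) (I (Suc (Suc j))) (\<delta> (Suc j))"
    using res by (auto simp: injective_resolution_def)
  have "injective_module R (transport_module c (I j))" for j
    by (rule injective_retract[OF inj module_transport[OF c] transport_homs[OF c]])
      (use inj c in \<open>auto simp: injective_module_def\<close>)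
  moreover have "(\<lambda>x. c (\<delta> j (inv_into UNIV c x))) \<in> module_homs R (transport_module c (I j)) (transport_module c (I (Suc j)))" for j
    by (rule module_homs_comp[OF module_homs_comp[OF transport_homs(2)[OF c] hom(2)] transport_homs(1)[OF c]])
  moreover have ker: "module_ker (transport_module c (I i)) (transport_module c (I j)) (\<lambda>x. c (f (inv_into UNIV c x)))
      = c ` module_ker (I i) (I j) f" for i j f
    using c by (auto simp: module_ker_def inj_eq)
  moreover have "(\<lambda>x. c (h x)) ` carrier M = c ` (h ` carrier M)" by (simp add: image_image)
  moreover have "(\<lambda>x. c (\<delta> j (inv_into UNIV c x))) ` carrier (transport_module c (I j)) = c ` (\<delta> j ` carrier (I j))" for j
    using c by (simp add: image_image)
  moreover have "inj_on (\<lambda>x. c (h x)) (carrier M)"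
    using res c by (auto simp: injective_resolution_def inj_on_def)
  moreover have "(\<lambda>x. c (h x)) \<in> module_homs R M (transport_module c (I 0))"
    by (rule module_homs_comp[OF hom(1) transport_homs(1)[OF c]])
  ultimately show ?thesis using res exact by (simp add: injective_resolution_def)
qed

lemma (in min_resolution) residue_field_inj_dim:
  assumes reg: "regular_local_ring R"
  shows "inj_dim R k < \<infinity>"
proof -
  have loc: "noetherian_ring R" "local_ring R" using reg by (auto simp: regular_local_ring_def)
  obtain xs where xs: "length xs = embedding_dim R" "set xs \<subseteq> carrier R" "Idl (set xs) = \<mm>"
    using embedding_dim_gens(1)[OF loc] m_eq by auto
  obtain P where "prime_chain R P (embedding_dim R)" using reg regular_local_ring_iff_prime_chain[OF loc] by blast
  then have seq: "regular_seq R xs" using regular_seq_of_prime_chain[of P xs] xs by simp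
  obtain E :: "('a, 'a \<Rightarrow> rat) module" and \<chi> where E: "injective_module R E" "\<chi> \<in> carrier E"
    "\<forall>a\<in>carrier R. a \<odot>\<^bsub>E\<^esub> \<chi> = \<zero>\<^bsub>E\<^esub> \<longleftrightarrow> a \<in> \<mm>"
    "\<forall>x\<in>carrier E. (\<forall>a\<in>\<mm>. a \<odot>\<^bsub>E\<^esub> x = \<zero>\<^bsub>E\<^esub>) \<longrightarrow> (\<exists>a\<in>carrier R. x = a \<odot>\<^bsub>E\<^esub> \<chi>)"
    by (rule residue_injective_hull)
  obtain h where res: "injective_resolution R k (\<lambda>j. hom_module R (F j) E) h (\<lambda>j f. \<lambda>x\<in>carrier (F (Suc j)). f (d j x))"
    using dual_injective_resolution[OF E] by blast
  \<comment> \<open>The graph of the function, with its rational values numbered. Countability of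
    the rationals is what makes this fit into \<open>inj_carrier\<close>.\<close>
  define code :: "('m \<Rightarrow> 'a \<Rightarrow> rat) \<Rightarrow> ('a, 'm) inj_carrier"
    where "code f = {(a, v, to_nat (f v a)) | a v. True}" for f
  have code: "inj code"
  proof (rule injI, rule ext, rule ext)
    fix f g :: "'m \<Rightarrow> 'a \<Rightarrow> rat" and v a assume eq: "code f = code g"
    have "(a, v, to_nat (f v a)) \<in> code f" by (auto simp: code_def)
    then have "(a, v, to_nat (f v a)) \<in> code g" unfolding eq .
    then show "f v a = g v a" by (auto simp: code_def)
  qed
  let ?I = "\<lambda>j. transport_module code (hom_module R (F j) E)"
  have "carrier (?I j) = {\<zero>\<^bsub>?I j\<^esub>}" if j: "j > embedding_dim R" for j
  proof -
    have Fj: "carrier (F j) = {\<zero>\<^bsub>F j\<^esub>}" using resolution_finite[OF seq xs(3)] xs(1) j by simp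
    have mE: "module R E" using E(1) by (simp add: injective_module_def)
    have "carrier (hom_module R (F j) E) = {\<zero>\<^bsub>hom_module R (F j) E\<^esub>}"
    proof
      show "carrier (hom_module R (F j) E) \<subseteq> {\<zero>\<^bsub>hom_module R (F j) E\<^esub>}"
      proof
        fix f assume f: "f \<in> carrier (hom_module R (F j) E)"
        have H: "module R (hom_module R (F j) E)" by (rule module_hom_module[OF modF mE])
        have fh: "f \<in> module_homs R (F j) E" using f by simp
        interpret H: module R "hom_module R (F j) E" by (rule H)
        have "f = \<zero>\<^bsub>hom_module R (F j) E\<^esub>"
          by (rule hom_module_ext[OF f H.M.zero_closed]) (use Fj module_homs_zero[OF modF mE fh] in simp)
        then show "f \<in> {\<zero>\<^bsub>hom_module R (F j) E\<^esub>}" by simp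
      qed
    next
      interpret H: module R "hom_module R (F j) E" by (rule module_hom_module[OF modF mE])
      show "{\<zero>\<^bsub>hom_module R (F j) E\<^esub>} \<subseteq> carrier (hom_module R (F j) E)" using H.M.zero_closed by blast
    qed
    then show ?thesis by (simp only: transport_module_simps image_insert image_empty)
  qed
  then have "enat (embedding_dim R) \<in> {enat n | n. \<exists>(I :: nat \<Rightarrow> ('a, ('a, 'm) inj_carrier) module) h d.
            injective_resolution R k I h d \<and> (\<forall>j>n. carrier (I j) = {\<zero>\<^bsub>I j\<^esub>})}"
    using injective_resolution_transport[OF code res] by blast
  then have "inj_dim R k \<le> enat (embedding_dim R)" unfolding inj_dim_def by (rule Inf_lower)
  also have "\<dots> < \<infinity>" by simp
  finally show ?thesis .
qed

theorem theorem1p4p11: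
  fixes A :: "('a, 'c) ring_scheme"
    and k :: "('a, 'm) module"
    and F :: "nat \<Rightarrow> ('a, 'm) module"
    and e :: "'m \<Rightarrow> 'm"
    and d :: "nat \<Rightarrow> 'm \<Rightarrow> 'm"
  assumes noetherian: "noetherian_ring A"
    and local: "local_ring A"
    and residue_field: "module_isomorphic A k (residue_field_module A)"
    and resolution: "minimal_free_resolution A k F e d"
  shows "regular_local_ring A \<longleftrightarrow>
    (\<exists>n N. direct_summand A (syzygy k F d n) N \<and>
           N \<noteq> {\<zero>\<^bsub>syzygy k F d n\<^esub>} \<and>
           inj_dim A ((syzygy k F d n)\<lparr>carrier := N\<rparr>) < \<infinity>)"
proof -
  have mk: "module A k" using resolution by (simp add: minimal_free_resolution_def)
  interpret k: module A k by (rule mk)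
  obtain u where u: "u \<in> carrier k" "\<And>a. a \<in> carrier A \<Longrightarrow> a \<odot>\<^bsub>k\<^esub> u = \<zero>\<^bsub>k\<^esub> \<longleftrightarrow> a \<in> max_ideal A"
    "\<And>y. y \<in> carrier k \<Longrightarrow> \<exists>a\<in>carrier A. y = a \<odot>\<^bsub>k\<^esub> u"
    using residue_field_generator[OF noetherian local mk residue_field] by blast
  interpret noetherian_local A "max_ideal A" by (rule noetherian_local_max_ideal[OF noetherian local])
  interpret min_resolution A "max_ideal A" k F e d u
    by unfold_locales (use resolution u in auto)
  show ?thesis
  proof
    assume reg: "regular_local_ring A"
    have "u \<noteq> \<zero>\<^bsub>k\<^esub>" using u(2)[OF k.R.one_closed] u(1) one_notin_m by auto
    then have "carrier k \<noteq> {\<zero>\<^bsub>k\<^esub>}" using u(1) by blast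
    moreover have "direct_summand A (syzygy k F d 0) (carrier k)"
      unfolding direct_summand_def
      using k.carrier_is_submodule k.zero_submodule
      by (auto intro!: exI[of _ "{\<zero>\<^bsub>k\<^esub>}"] simp: set_add_def')
    ultimately show "\<exists>n N. direct_summand A (syzygy k F d n) N \<and> N \<noteq> {\<zero>\<^bsub>syzygy k F d n\<^esub>} \<and>
      inj_dim A ((syzygy k F d n)\<lparr>carrier := N\<rparr>) < \<infinity>"
      using residue_field_inj_dim[OF reg] by (intro exI[of _ 0] exI[of _ "carrier k"]) auto
  next
    assume "\<exists>n N. direct_summand A (syzygy k F d n) N \<and> N \<noteq> {\<zero>\<^bsub>syzygy k F d n\<^esub>} \<and>
      inj_dim A ((syzygy k F d n)\<lparr>carrier := N\<rparr>) < \<infinity>"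
    then show "regular_local_ring A" using regular_of_summand by blast
  qed
qed

end
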